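(* Let $T>0$, $\varepsilon>0$. Let $f,g\in L^2(0,T;L^2(\mathcal E))$, $h\in H^1(0,T;\mathbb R^{n_D})$, $r\in H^1(0,T;\mathbb R^{n_N})$, and $p(0),m(0)\in L^2(\mathcal E)$. Then there exists a unique mild solution $(p,m,\lambda)$ of the system $(H_\varepsilon)$ (see context) with $$p\in C([0,T],L^2(\mathcal E))\cap H^1(0,T;H^{-1}(\bar{\mathcal E})),\qquad m\in C([0,T],L^2(\mathcal E)).$$ The Lagrange multiplier $\lambda$ exists in a distributional sense with a regular primitive in $C([0,T],\mathbb R^{n_D})$, and $\dot p+\mathcal B^*\lambda\in L^2(0,T;[H^1(\bar{\mathcal E})]^* )$.
   Context: Network: $\mathcal G=(\mathcal V,\mathcal E)$ is a finite connected directed graph whose edges are identified with bounded intervals of positive length. $\mathcal V$ is the disjoint union of $\mathcal V_D$ (boundary vertices where the potential is prescribed) and $\mathcal V_N$ (all other vertices); $n_D=|\mathcal V_D|\ge1$, $n_N=|\mathcal V_N|$, and vectors in $\mathbb R^{n_D},\mathbb R^{n_N}$ are indexed by these vertices. Spaces: $L^2(\mathcal E)$ = functions edgewise in $L^2(e)$, with inner product $(\cdot,\cdot)=\sum_e(\cdot,\cdot)_{L^2(e)}$ and norm $\|\cdot\|$. $H^1(\bar{\mathcal E})$ = functions edgewise in $H^1(e)$ that are globally continuous on the network (usual $H^1$ norm); $H^1_0(\bar{\mathcal E})$ = those vanishing at $\mathcal V_D$; $H^{-1}(\bar{\mathcal E})=[H^1_0(\bar{\mathcal E})]^*$. $L^2(\mathcal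 E)$ is identified with its dual and embedded in $H^{-1}(\bar{\mathcal E})$ and $[H^1(\bar{\mathcal E})]^*$. Coefficients: measurable, time-independent $a,d$ on $\mathcal E$ with $0\le a\le\overline a$ and $0<\underline d\le d\le\overline d<\infty$ a.e. Operators: $\mathcal K:H^1(\bar{\mathcal E})\to[L^2(\mathcal E)]^*$, $\langle\mathcal Kq,m\rangle=(\partial_xq,m)$ (edgewise derivative); $\mathcal B:H^1(\bar{\mathcal E})\to\mathbb R^{n_D}$ and $\mathcal C:H^1(\bar{\mathcal E})\to\mathbb R^{n_N}$ are point evaluation at $\mathcal V_D$ and $\mathcal V_N$; $\mathcal B^-:\mathbb R^{n_D}\to H^1(\bar{\mathcal E})$ is a fixed linear right inverse of $\mathcal B$. System $(H_\varepsilon)$: $\dot p+ap-\mathcal K^*m+\mathcal B^*\lambda=g-\mathcal C^*r$ in $[H^1(\bar{\mathcal E})]^*$; $\varepsilon\dot m+\mathcal Kp+dm=f$ in $[L^2(\mathcal E)]^*$; $\mathcal Bp=h$ in $\mathbb R^{n_D}$, with initial values $p(0),m(0)$. Mild solution of $(H_\varepsilon)$: let $(\bar p,\bar m,\bar\lambda)\in H^1(0,T;H^1_0(\bar{\mathcal E}))\times H^1(0,T;L^2(\mathcal E))\times H^1(0,T;\mathbb R^{n_D})$ be the unique solution of $a\bar p-\mathcal K^*\bar m+\mathcal B^*\bar\lambda=-\mathcal C^*r$ in $[H^1(\bar{\mathcal E})]^*$, $\mathcal K\bar p+d\bar m=0$ in $[L^2(\mathcal E)]^*$, $\mathcal B\bar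 p=0$. Put $\tilde p=p-\bar p-\mathcal B^-h$, $\tilde m=m-\bar m$. Then $(p,m)$ is a mild solution if $x=[\varepsilon^{-1/2}\tilde p,\tilde m]^T$ is the mild solution (variation of constants with the $C_0$-semigroup) in $L^2(\mathcal E)\times L^2(\mathcal E)$ of $\dot x=\varepsilon^{-1/2}\mathcal Ax+F$, $x(0)=[\varepsilon^{-1/2}(p(0)-\bar p(0)-\mathcal B^-h(0)),\,m(0)-\bar m(0)]^T$, where $F=[\varepsilon^{-1/2}(g-\dot{\bar p}-a\mathcal B^-h-\mathcal B^-\dot h),\ \varepsilon^{-1}(f-\mathcal K\mathcal B^-h)-\dot{\bar m}]^T$ and $\mathcal A=\begin{bmatrix}-\sqrt\varepsilon\,a&\mathcal K^*\\-\mathcal K&-d/\sqrt\varepsilon\end{bmatrix}$ has domain $H^1_0(\bar{\mathcal E})\times\{m\in L^2(\mathcal E):\exists m_*\in L^2(\mathcal E)\text{ with }(m_*,q)=\langle\mathcal K^*m,q\rangle\ \forall q\in H^1_0(\bar{\mathcal E})\}$. The multiplier $\lambda$ is the ($\mathbb R^{n_D}$-valued) distribution for which the first equation of $(H_\varepsilon)$ holds in the sense of distributions on $(0,T)$ with values in $[H^1(\bar{\mathcal E})]^*$. *)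

theory Defs
  imports "HOL-Analysis.Analysis"
begin

section \<open>The Hilbert space of square integrable functions on the real line\<close>

definition sq_integrable :: "'a measure \<Rightarrow> ('a \<Rightarrow> 'b::{banach, second_countable_topology}) \<Rightarrow> bool"
  where "sq_integrable M f \<longleftrightarrow> f \<in> borel_measurable M \<and> integrable M (\<lambda>x. (norm (f x))\<^sup>2)"

lemma sq_integrable_mult:
  fixes f g :: "'a \<Rightarrow> real"
  assumes "sq_integrable M f" "sq_integrable M g"
  shows "integrable M (\<lambda>x. f x * g x)"
proof (rule Bochner_Integration.integrable_bound)
  show "integrable M (\<lambda>x. (norm (f x))\<^sup>2 + (norm (g x))\<^sup>2)"
    using assms unfolding sq_integrable_def by auto
  show "(\<lambda>x. f x * g x) \<in> borel_measurable M"
    using assms unfolding sq_integrable_def by auto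
  have "\<bar>a * b\<bar> \<le> \<bar>a\<^sup>2 + b\<^sup>2\<bar>" for a b :: real
  proof -
    have "2 * (\<bar>a\<bar> * \<bar>b\<bar>) \<le> a\<^sup>2 + b\<^sup>2"
      using sum_squares_bound[of "\<bar>a\<bar>" "\<bar>b\<bar>"] by (simp add: mult.assoc)
    moreover have "0 \<le> \<bar>a\<bar> * \<bar>b\<bar>" by simp
    moreover have "\<bar>a * b\<bar> = \<bar>a\<bar> * \<bar>b\<bar>" by (rule abs_mult)
    ultimately show ?thesis by linarith
  qed
  then show "AE x in M. norm (f x * g x) \<le> norm ((norm (f x))\<^sup>2 + (norm (g x))\<^sup>2)"
    by auto
qed

lemma sq_integrable_real:
  fixes f :: "'a \<Rightarrow> real"
  shows "sq_integrable M f \<longleftrightarrow> f \<in> borel_measurable M \<and> integrable M (\<lambda>x. f x * f x)"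
  by (simp add: sq_integrable_def power2_eq_square)

lemma sq_integrable_zero: "sq_integrable M (\<lambda>x. 0 :: real)"
  by (simp add: sq_integrable_real)

lemma sq_integrable_add:
  fixes f g :: "'a \<Rightarrow> real"
  assumes "sq_integrable M f" "sq_integrable M g"
  shows "sq_integrable M (\<lambda>x. f x + g x)"
proof -
  have "integrable M (\<lambda>x. f x * f x + (g x * g x + (f x * g x + f x * g x)))"
    using assms sq_integrable_mult[OF assms] by (auto simp: sq_integrable_real)
  then have "integrable M (\<lambda>x. (f x + g x) * (f x + g x))"
    by (simp only: distrib_left distrib_right mult.commute add_ac)
  then show ?thesis
    using assms by (auto simp: sq_integrable_real)
qed

lemma sq_integrable_scale:
  fixes f :: "'a \<Rightarrow> real"
  assumes "sq_integrable M f"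
  shows "sq_integrable M (\<lambda>x. c * f x)"
proof -
  have "integrable M (\<lambda>x. (c * c) * (f x * f x))"
    using assms by (auto simp: sq_integrable_real)
  then show ?thesis
    using assms by (auto simp: sq_integrable_real algebra_simps)
qed

lemma sq_integrable_minus:
  fixes f :: "'a \<Rightarrow> real"
  assumes "sq_integrable M f"
  shows "sq_integrable M (\<lambda>x. - f x)"
  using sq_integrable_scale[OF assms, of "-1"] by simp

lemma sq_integrable_diff:
  fixes f g :: "'a \<Rightarrow> real"
  assumes "sq_integrable M f" "sq_integrable M g"
  shows "sq_integrable M (\<lambda>x. f x - g x)"
  using sq_integrable_add[OF assms(1) sq_integrable_minus[OF assms(2)]] by simp

text \<open>The type \<open>l2\<close> is \<open>L\<^sup>2(\<real>)\<close>, i.e. square integrable functions modulo equality almost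
  everywhere. The class instances \<^class>\<open>banach\<close> and \<^class>\<open>second_countable_topology\<close> make the Bochner
  integral of the library available for functions with values in \<open>l2\<close>.\<close>

quotient_type l2 = "real \<Rightarrow> real" / partial:
  "\<lambda>f g. sq_integrable lebesgue f \<and> sq_integrable lebesgue g \<and> (AE x in lebesgue. f x = g x)"
proof (rule part_equivpI)
  show "\<exists>f::real \<Rightarrow> real. sq_integrable lebesgue f \<and> sq_integrable lebesgue f \<and> (AE x in lebesgue. f x = f x)"
    using sq_integrable_zero by auto
  show "symp (\<lambda>f g :: real \<Rightarrow> real. sq_integrable lebesgue f \<and> sq_integrable lebesgue g \<and> (AE x in lebesgue. f x = g x))"
    by (auto simp: symp_def eq_commute)
  show "transp (\<lambda>f g :: real \<Rightarrow> real. sq_integrable lebesgue f \<and> sq_integrable lebesgue g \<and> (AE x in lebesgue. f x = g x))"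
    unfolding transp_def by (auto elim: AE_mp)
qed

instantiation l2 :: real_inner
begin

lift_definition zero_l2 :: l2 is "\<lambda>x. 0"
  by (simp add: sq_integrable_zero)

lift_definition plus_l2 :: "l2 \<Rightarrow> l2 \<Rightarrow> l2" is "\<lambda>f g x. f x + g x"
  by (auto simp: sq_integrable_add)

lift_definition minus_l2 :: "l2 \<Rightarrow> l2 \<Rightarrow> l2" is "\<lambda>f g x. f x - g x"
  by (auto simp: sq_integrable_diff)

lift_definition uminus_l2 :: "l2 \<Rightarrow> l2" is "\<lambda>f x. - f x"
  by (auto simp: sq_integrable_minus)

lift_definition scaleR_l2 :: "real \<Rightarrow> l2 \<Rightarrow> l2" is "\<lambda>c f x. c * f x"
  by (auto simp: sq_integrable_scale)

lift_definition inner_l2 :: "l2 \<Rightarrow> l2 \<Rightarrow> real" is "\<lambda>f g. LINT x|lebesgue. f x * g x"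
proof -
  fix f f' g g' :: "real \<Rightarrow> real"
  assume *: "sq_integrable lebesgue f \<and> sq_integrable lebesgue f' \<and> (AE x in lebesgue. f x = f' x)"
    "sq_integrable lebesgue g \<and> sq_integrable lebesgue g' \<and> (AE x in lebesgue. g x = g' x)"
  then have "AE x in lebesgue. f x * g x = f' x * g' x"
    by auto
  with * show "(LINT x|lebesgue. f x * g x) = (LINT x|lebesgue. f' x * g' x)"
    by (intro integral_cong_AE) (auto simp: sq_integrable_def)
qed

definition norm_l2 :: "l2 \<Rightarrow> real" where "norm_l2 x = sqrt (inner x x)"
definition dist_l2 :: "l2 \<Rightarrow> l2 \<Rightarrow> real" where "dist_l2 x y = norm (x - y)"
definition sgn_l2 :: "l2 \<Rightarrow> l2" where "sgn_l2 x = scaleR (inverse (norm x)) x"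
definition uniformity_l2 :: "(l2 \<times> l2) filter"
  where "uniformity_l2 = (INF e\<in>{0<..}. principal {(x, y). dist x y < e})"
definition open_l2 :: "l2 set \<Rightarrow> bool"
  where "open_l2 U \<longleftrightarrow> (\<forall>x\<in>U. \<forall>\<^sub>F (x', y) in uniformity. x' = x \<longrightarrow> y \<in> U)"

instance
proof
  fix x y z :: l2 and a b :: real
  show "x + y + z = x + (y + z)" by transfer (simp add: add.assoc sq_integrable_add)
  show "x + y = y + x" by transfer (simp add: add.commute sq_integrable_add)
  show "0 + x = x" by transfer simp
  show "- x + x = 0" by transfer (simp add: sq_integrable_zero)
  show "x - y = x + - y" by transfer (simp add: sq_integrable_diff)
  show "a *\<^sub>R (x + y) = a *\<^sub>R x + a *\<^sub>R y"
    by transfer (simp add: distrib_left sq_integrable_add sq_integrable_scale)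
  show "(a + b) *\<^sub>R x = a *\<^sub>R x + b *\<^sub>R x"
    by transfer (simp add: distrib_right sq_integrable_add sq_integrable_scale)
  show "a *\<^sub>R b *\<^sub>R x = (a * b) *\<^sub>R x"
    by transfer (simp add: mult.assoc sq_integrable_scale)
  show "1 *\<^sub>R x = x" by transfer simp
  show "dist x y = norm (x - y)" by (rule dist_l2_def)
  show "sgn x = scaleR (inverse (norm x)) x" by (rule sgn_l2_def)
  show "(uniformity :: (l2 \<times> l2) filter) = (INF e\<in>{0<..}. principal {(x, y). dist x y < e})"
    by (rule uniformity_l2_def)
  show "open U \<longleftrightarrow> (\<forall>x\<in>U. \<forall>\<^sub>F (x', y) in uniformity. x' = x \<longrightarrow> y \<in> U)" for U :: "l2 set"
    by (rule open_l2_def)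
  show "inner x y = inner y x" by transfer (simp add: mult.commute)
  show "inner (x + y) z = inner x z + inner y z"
    by transfer (simp add: distrib_right sq_integrable_mult)
  show "inner (a *\<^sub>R x) y = a * inner x y"
    by transfer (simp add: mult.assoc)
  show "0 \<le> inner x x" by transfer simp
  show "inner x x = 0 \<longleftrightarrow> x = 0"
  proof transfer
    fix f :: "real \<Rightarrow> real"
    assume f: "sq_integrable lebesgue f \<and> sq_integrable lebesgue f \<and> (AE x in lebesgue. f x = f x)"
    then have "integrable lebesgue (\<lambda>x. f x * f x)" by (simp add: sq_integrable_real)
    from integral_nonneg_eq_0_iff_AE[OF this] f
    show "((LINT x|lebesgue. f x * f x) = 0) =
       (sq_integrable lebesgue f \<and> sq_integrable lebesgue (\<lambda>x. 0 :: real) \<and> (AE x in lebesgue. f x = 0))"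
      by (simp add: sq_integrable_zero)
  qed
  show "norm x = sqrt (inner x x)" by (rule norm_l2_def)
qed

end

lemma norm_l2_sq: "sq_integrable lebesgue f \<Longrightarrow> (norm (abs_l2 f))\<^sup>2 = (LINT x|lebesgue. (f x)\<^sup>2)"
  using inner_l2.abs_eq[of f f] by (simp only: power2_norm_eq_inner) (simp add: power2_eq_square)

lemma abs_l2_diff: "sq_integrable lebesgue f \<Longrightarrow> sq_integrable lebesgue g \<Longrightarrow>
   abs_l2 f - abs_l2 g = abs_l2 (\<lambda>x. f x - g x)"
  by (simp add: minus_l2.abs_eq)

lemma l2_cases: obtains f where "sq_integrable lebesgue f" "x = abs_l2 f"
  by (induction x rule: l2.abs_induct) auto


instance l2 :: banach
proof
  fix X :: "nat \<Rightarrow> l2"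
  assume "Cauchy X"
  have "\<forall>n. \<exists>f. sq_integrable lebesgue f \<and> X n = abs_l2 f"
    using l2_cases by metis
  then obtain f where f: "\<And>n. sq_integrable lebesgue (f n)" "\<And>n. X n = abs_l2 (f n)"
    by metis
  have "\<forall>k. \<exists>N. \<forall>m\<ge>N. \<forall>n\<ge>N. norm (X m - X n) < (1/2)^k"
    using \<open>Cauchy X\<close> by (simp add: Cauchy_def dist_norm)
  then obtain N where N: "\<And>k m n. m \<ge> N k \<Longrightarrow> n \<ge> N k \<Longrightarrow> norm (X m - X n) < (1/2)^k"
    by metis
  define r where "r k = k + (\<Sum>i\<le>k. N i)" for k
  have r_ge: "r j \<ge> N k" if "k \<le> j" for j k
  proof -
    have "N k \<le> (\<Sum>i\<le>j. N i)" using that by (intro member_le_sum) auto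
    then show ?thesis by (simp add: r_def)
  qed
  have r_mono: "strict_mono r" by (auto simp: strict_mono_Suc_iff r_def)
  define g where "g k = f (r k)" for k
  have g: "sq_integrable lebesgue (g k)" for k by (simp add: g_def f)
  then have [measurable]: "g k \<in> borel_measurable lebesgue" for k
    by (simp add: sq_integrable_def)
  have int_g: "integrable lebesgue (\<lambda>x. (g j x - g k x)\<^sup>2)" for j k
    using sq_integrable_diff[OF g g] by (simp add: sq_integrable_def)
  have nn_g: "(\<integral>\<^sup>+x. ennreal ((g j x - g k x)\<^sup>2) \<partial>lebesgue) \<le> ennreal ((1/4)^k)" if "k \<le> j" for j k
  proof -
    have "(\<integral>\<^sup>+x. ennreal ((g j x - g k x)\<^sup>2) \<partial>lebesgue) = ennreal (LINT x|lebesgue. (g j x - g k x)\<^sup>2)"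
      by (intro nn_integral_eq_integral int_g) auto
    also have "(LINT x|lebesgue. (g j x - g k x)\<^sup>2) = (norm (X (r j) - X (r k)))\<^sup>2"
      by (simp add: f(2) abs_l2_diff f(1) norm_l2_sq sq_integrable_diff g_def)
    also have "\<dots> \<le> ((1/2)^k)\<^sup>2"
      using N[of k "r j" "r k"] r_ge[OF that] r_ge[of k k] by (intro power_mono) auto
    also have "((1/2)^k)\<^sup>2 = (1/4 :: real)^k"
      by (simp add: power2_eq_square power_mult_distrib[symmetric])
    finally show ?thesis by (simp add: ennreal_leI)
  qed
  have "(\<integral>\<^sup>+x. (\<Sum>k. ennreal (2^k * (g (Suc k) x - g k x)\<^sup>2)) \<partial>lebesgue)
      = (\<Sum>k. \<integral>\<^sup>+x. ennreal (2^k * (g (Suc k) x - g k x)\<^sup>2) \<partial>lebesgue)"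
    by (intro nn_integral_suminf) auto
  also have "\<dots> \<le> (\<Sum>k. ennreal ((1/2)^k))"
  proof (intro suminf_le summableI)
    fix k
    have "(\<integral>\<^sup>+x. ennreal (2^k * (g (Suc k) x - g k x)\<^sup>2) \<partial>lebesgue)
        = ennreal (2^k) * (\<integral>\<^sup>+x. ennreal ((g (Suc k) x - g k x)\<^sup>2) \<partial>lebesgue)"
      by (simp add: ennreal_mult nn_integral_cmult)
    also have "\<dots> \<le> ennreal (2^k) * ennreal ((1/4)^k)"
      by (intro mult_left_mono nn_g) auto
    also have "\<dots> = ennreal ((1/2)^k)"
      by (simp add: ennreal_mult[symmetric] power_mult_distrib[symmetric])
    finally show "(\<integral>\<^sup>+x. ennreal (2^k * (g (Suc k) x - g k x)\<^sup>2) \<partial>lebesgue) \<le> ennreal ((1/2)^k)" .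
  qed
  also have "\<dots> = ennreal (\<Sum>k. (1/2)^k)"
    by (intro suminf_ennreal2 summable_geometric) auto
  finally have "(\<integral>\<^sup>+x. (\<Sum>k. ennreal (2^k * (g (Suc k) x - g k x)\<^sup>2)) \<partial>lebesgue) \<noteq> \<infinity>"
    by (auto simp: top_unique)
  then have "AE x in lebesgue. (\<Sum>k. ennreal (2^k * (g (Suc k) x - g k x)\<^sup>2)) \<noteq> \<infinity>"
    by (intro nn_integral_PInf_AE) auto
  then have conv: "AE x in lebesgue. convergent (\<lambda>k. g k x)"
  proof (eventually_elim)
    case (elim x)
    have "summable (\<lambda>k. 2^k * (g (Suc k) x - g k x)\<^sup>2)"
      using elim by (intro summable_suminf_not_top) auto
    then have "Bseq (\<lambda>k. 2^k * (g (Suc k) x - g k x)\<^sup>2)"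
      by (intro convergent_imp_Bseq) (auto dest!: summable_LIMSEQ_zero simp: convergent_def)
    then obtain C where C: "C > 0" "\<And>k. norm (2^k * (g (Suc k) x - g k x)\<^sup>2) \<le> C"
      by (auto simp: Bseq_def)
    have "summable (\<lambda>k. g (Suc k) x - g k x)"
    proof (rule summable_comparison_test')
      show "summable (\<lambda>k. sqrt C * (sqrt (1/2))^k)"
        by (intro summable_mult summable_geometric) (simp add: real_sqrt_divide)
      fix k :: nat
      have "(g (Suc k) x - g k x)\<^sup>2 \<le> C * (1/2)^k"
        using C(2)[of k] by (simp add: field_simps power_divide)
      then have "sqrt ((g (Suc k) x - g k x)\<^sup>2) \<le> sqrt (C * (1/2)^k)"
        by (rule real_sqrt_le_mono)
      then show "norm (g (Suc k) x - g k x) \<le> sqrt C * (sqrt (1/2))^k"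
        by (simp only: real_sqrt_abs real_sqrt_mult real_sqrt_power[symmetric] real_norm_def)
    qed
    moreover have "(\<Sum>i<n. g (Suc i) x - g i x) = g n x - g 0 x" for n
      by (rule sum_lessThan_telescope[where f = "\<lambda>n. g n x"])
    ultimately have "convergent (\<lambda>n. g n x - g 0 x)"
      by (simp only: summable_iff_convergent)
    then show ?case
      by (simp add: convergent_diff_const_right_iff)
  qed
  define F where "F x = lim (\<lambda>k. g k x)" for x
  have F_meas [measurable]: "F \<in> borel_measurable lebesgue"
    unfolding F_def by measurable
  have F_lim: "AE x in lebesgue. (\<lambda>k. g k x) \<longlonglongrightarrow> F x"
    using conv by eventually_elim (simp add: F_def convergent_LIMSEQ_iff)
  have nn_F: "(\<integral>\<^sup>+x. ennreal ((F x - g k x)\<^sup>2) \<partial>lebesgue) \<le> ennreal ((1/4)^k)" for k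
  proof -
    have "(\<integral>\<^sup>+x. ennreal ((F x - g k x)\<^sup>2) \<partial>lebesgue)
        = (\<integral>\<^sup>+x. liminf (\<lambda>j. ennreal ((g j x - g k x)\<^sup>2)) \<partial>lebesgue)"
      using F_lim
    proof (intro nn_integral_cong_AE, eventually_elim)
      case (elim x)
      then have "(\<lambda>j. ennreal ((g j x - g k x)\<^sup>2)) \<longlonglongrightarrow> ennreal ((F x - g k x)\<^sup>2)"
        by (intro tendsto_intros)
      from lim_imp_Liminf[OF sequentially_bot this] show ?case by simp
    qed
    also have "\<dots> \<le> liminf (\<lambda>j. \<integral>\<^sup>+x. ennreal ((g j x - g k x)\<^sup>2) \<partial>lebesgue)"
      by (intro nn_integral_liminf) auto
    also have "\<dots> \<le> liminf (\<lambda>j. ennreal ((1/4)^k))"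
      by (intro Liminf_mono eventually_sequentiallyI[of k] nn_g)
    also have "\<dots> = ennreal ((1/4)^k)"
      by (simp add: Liminf_const)
    finally show ?thesis .
  qed
  have Fg: "sq_integrable lebesgue (\<lambda>x. F x - g k x)" for k
    unfolding sq_integrable_def
    using nn_F[of k] by (auto intro!: integrableI_bounded le_less_trans[OF nn_F] simp: top.not_eq_extremum)
  have F: "sq_integrable lebesgue F"
    using sq_integrable_add[OF Fg[of 0] g[of 0]] by simp
  have le: "norm (X (r k) - abs_l2 F) \<le> (1/2)^k" for k
  proof -
    have "ennreal ((norm (abs_l2 F - X (r k)))\<^sup>2) = ennreal (LINT x|lebesgue. (F x - g k x)\<^sup>2)"
      by (simp add: f abs_l2_diff F norm_l2_sq sq_integrable_diff g_def)
    also have "\<dots> = (\<integral>\<^sup>+x. ennreal ((F x - g k x)\<^sup>2) \<partial>lebesgue)"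
      using Fg[of k] by (intro nn_integral_eq_integral[symmetric]) (auto simp: sq_integrable_def)
    also have "\<dots> \<le> ennreal ((1/4)^k)" by (rule nn_F)
    finally have "(norm (abs_l2 F - X (r k)))\<^sup>2 \<le> (1/4)^k"
      by (simp add: ennreal_le_iff)
    also have "(1/4 :: real)^k = ((1/2)^k)\<^sup>2"
      by (simp add: power2_eq_square power_mult_distrib[symmetric])
    finally show ?thesis
      by (simp add: norm_minus_commute power2_le_iff_abs_le)
  qed
  have "(\<lambda>k. X (r k) - abs_l2 F) \<longlonglongrightarrow> 0"
    by (rule Lim_null_comparison[OF _ LIMSEQ_realpow_zero[of "1/2"]]) (auto simp: le)
  then have "(X \<circ> r) \<longlonglongrightarrow> abs_l2 F"
    by (simp add: LIM_zero_iff o_def)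
  then have "X \<longlonglongrightarrow> abs_l2 F"
    using \<open>Cauchy X\<close> r_mono Cauchy_converges_subseq by blast
  then show "convergent X" by (auto simp: convergent_def)
qed


lemma countable_subbasis_if_dense:
  fixes D :: "'a::metric_space set"
  assumes "countable D" "closure D = UNIV"
  shows "\<exists>B :: 'a set set. countable B \<and> open = generate_topology B"
proof (intro exI conjI)
  define B where "B = (\<lambda>(d, n). ball d (1 / real (Suc n))) ` (D \<times> (UNIV :: nat set))"
  show "countable B" unfolding B_def using assms(1) by auto
  have "topological_basis B"
  proof (rule topological_basisI)
    show "open U" if "U \<in> B" for U using that by (auto simp: B_def)
    fix U and x :: 'a assume "open U" "x \<in> U"
    then obtain e where e: "e > 0" "ball x e \<subseteq> U" by (auto simp: open_contains_ball)
    obtain n where n: "1 / real (Suc n) < e / 2"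
      using nat_approx_posE[of "e/2"] e by auto
    obtain d where d: "d \<in> D" "dist d x < 1 / real (Suc n)"
      using assms(2) closure_approachable[of x D] by (metis UNIV_I of_nat_0_less_iff zero_less_Suc zero_less_divide_1_iff)
    have "ball d (1 / real (Suc n)) \<subseteq> ball x e"
    proof
      fix y assume "y \<in> ball d (1 / real (Suc n))"
      then have "dist x y < e"
        using d n dist_triangle[of x y d] by (simp add: dist_commute)
      then show "y \<in> ball x e" by simp
    qed
    then show "\<exists>V\<in>B. x \<in> V \<and> V \<subseteq> U"
      using d e by (intro bexI[of _ "ball d (1 / real (Suc n))"]) (auto simp: B_def)
  qed
  then show "open = generate_topology B"
    by (rule topological_basis_imp_subbasis)
qed

abbreviation ind_l2 :: "real set \<Rightarrow> l2"
  where "ind_l2 A \<equiv> abs_l2 (indicator A)"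

lemma sq_integrable_indicator:
  assumes "A \<in> lmeasurable"
  shows "sq_integrable lebesgue (indicator A :: real \<Rightarrow> real)"
  using assms by (auto simp: sq_integrable_real indicator_inter_arith[symmetric] fmeasurable_def)

lemma ind_l2_approx:
  fixes B :: "real set set"
  assumes B: "topological_basis B" "countable B" and A: "A \<in> lmeasurable"
  shows "ind_l2 A \<in> closure {ind_l2 (\<Union>F) |F. finite F \<and> F \<subseteq> B \<and> \<Union>F \<in> lmeasurable}"
  unfolding closure_approachable
proof (intro allI impI)
  fix e :: real assume "e > 0"
  define \<delta> where "\<delta> = e\<^sup>2 / 2"
  have "\<delta> > 0" using \<open>e > 0\<close> by (simp add: \<delta>_def)
  obtain T where T: "open T" "A \<subseteq> T" "T - A \<in> lmeasurable" "emeasure lebesgue (T - A) < ennreal \<delta>"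
    using sets_lebesgue_outer_open[of A \<delta>] A \<open>\<delta> > 0\<close> by auto
  have Tm: "T \<in> lmeasurable"
    using fmeasurable.Un[OF A T(3)] T(2) by (metis Diff_partition)
  obtain B' where B': "B' \<subseteq> B" "\<Union>B' = T"
    using B(1) \<open>open T\<close> by (auto simp: topological_basis_def)
  have "\<exists>F. finite F \<and> F \<subseteq> B' \<and> measure lebesgue (T - \<Union>F) < \<delta>"
  proof (cases "B' = {}")
    case True
    then show ?thesis using B' \<open>\<delta> > 0\<close> by (intro exI[of _ "{}"]) auto
  next
    case False
    define U where "U n = \<Union> (from_nat_into B' ` {..<n})" for n
    have cB': "countable B'" using B B' countable_subset by blast
    have rng: "range (from_nat_into B') = B'"
      using False cB' by (simp add: range_from_nat_into)
    have op: "open X" if "X \<in> B'" for X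
      using B(1) B' that topological_basis_open by blast
    have nth: "from_nat_into B' i \<in> B'" for i using rng by blast
    have Un: "U n \<in> sets lebesgue" "U n \<subseteq> T" for n
      using op[OF nth] nth B'(2) by (auto simp: U_def)
    have "(\<Union>n. U n) = \<Union> (range (from_nat_into B'))" by (auto simp: U_def)
    then have UT: "(\<Union>n. U n) = T" by (simp only: rng B')
    have "(\<lambda>n. measure lebesgue (U n)) \<longlonglongrightarrow> measure lebesgue (\<Union>n. U n)"
    proof (rule Lim_measure_incseq)
      show "range U \<subseteq> sets lebesgue" using Un by auto
      show "incseq U" unfolding U_def by (intro monoI Union_mono image_mono) auto
      show "emeasure lebesgue (\<Union>n. U n) \<noteq> \<infinity>"
        unfolding UT infinity_ennreal_def using fmeasurableD2[OF Tm] .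
    qed
    then have "(\<lambda>n. measure lebesgue (U n)) \<longlonglongrightarrow> measure lebesgue T"
      by (simp only: UT)
    from order_tendstoD(1)[OF this, of "measure lebesgue T - \<delta>"]
    have "\<forall>\<^sub>F n in sequentially. measure lebesgue T - \<delta> < measure lebesgue (U n)"
      using \<open>\<delta> > 0\<close> by simp
    then obtain n where n: "measure lebesgue T - \<delta> < measure lebesgue (U n)"
      using eventually_happens'[OF sequentially_bot] by blast
    have "measure lebesgue (T - U n) = measure lebesgue T - measure lebesgue (U n)"
      by (rule measure_Diff[OF _ fmeasurableD[OF Tm] Un]) (use fmeasurableD2[OF Tm] in simp)
    then have "measure lebesgue (T - \<Union> (from_nat_into B' ` {..<n})) < \<delta>"
      using n by (simp only: U_def)
    moreover have "from_nat_into B' ` {..<n} \<subseteq> B'" using nth by blast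
    ultimately show ?thesis by blast
  qed
  then obtain F where F: "finite F" "F \<subseteq> B'" "measure lebesgue (T - \<Union>F) < \<delta>" by auto
  have "open (\<Union>F)"
    using F(2) B' B(1) topological_basis_open by (intro open_Union) blast
  then have Fs: "\<Union>F \<in> sets lebesgue" by simp
  have FT: "\<Union>F \<subseteq> T" using F(2) B'(2) by auto
  have Fm: "\<Union>F \<in> lmeasurable"
    using fmeasurableI2[OF Tm FT Fs] .
  have TFm: "T - \<Union>F \<in> lmeasurable"
    using Tm Fs by (rule fmeasurable_Diff)
  have TA: "measure lebesgue (T - A) < \<delta>"
    using T(4) \<open>\<delta> > 0\<close> unfolding emeasure_eq_measure2[OF T(3)] by (simp only: ennreal_less_iff measure_nonneg)
  have "(norm (ind_l2 (\<Union>F) - ind_l2 A))\<^sup>2 = (LINT x|lebesgue. (indicator (\<Union>F) x - indicator A x)\<^sup>2)"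
    by (simp add: abs_l2_diff sq_integrable_indicator A Fm norm_l2_sq sq_integrable_diff)
  also have "\<dots> \<le> (LINT x|lebesgue. indicat_real (T - A) x + indicat_real (T - \<Union>F) x)"
  proof (rule integral_mono)
    show "integrable lebesgue (\<lambda>x. (indicat_real (\<Union>F) x - indicator A x)\<^sup>2)"
      using sq_integrable_diff[OF sq_integrable_indicator[OF Fm] sq_integrable_indicator[OF A]]
      by (simp add: sq_integrable_def)
    show "integrable lebesgue (\<lambda>x. indicat_real (T - A) x + indicat_real (T - \<Union>F) x)"
      using T(3) TFm unfolding lmeasurable_iff_integrable by (rule Bochner_Integration.integrable_add)
    show "(indicat_real (\<Union>F) x - indicator A x)\<^sup>2 \<le> indicat_real (T - A) x + indicat_real (T - \<Union>F) x" for x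
      using FT T(2) by (auto simp: indicator_def)
  qed
  also have "\<dots> = measure lebesgue (T - A) + measure lebesgue (T - \<Union>F)"
    using T(3) TFm unfolding lmeasurable_iff_integrable by (subst Bochner_Integration.integral_add) auto
  also have "\<dots> < e\<^sup>2" using TA F(3) by (simp add: \<delta>_def)
  finally have "norm (ind_l2 (\<Union>F) - ind_l2 A) < e"
    using \<open>e > 0\<close> power_less_imp_less_base[of _ 2 e] by simp
  then show "\<exists>y\<in>{ind_l2 (\<Union>F) |F. finite F \<and> F \<subseteq> B \<and> \<Union>F \<in> lmeasurable}. dist y (ind_l2 A) < e"
    using F B' Fm by (auto simp: dist_norm)
qed

lemma dense_l2:
  assumes add: "\<And>x y :: l2. x \<in> S \<Longrightarrow> y \<in> S \<Longrightarrow> x + y \<in> S"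
    and ind: "\<And>c A. A \<in> lmeasurable \<Longrightarrow> c *\<^sub>R ind_l2 A \<in> S"
    and "closed S"
  shows "S = UNIV"
proof -
  have "x \<in> S" for x
  proof -
    obtain f where f: "sq_integrable lebesgue f" "x = abs_l2 f" by (rule l2_cases)
    then have [measurable]: "f \<in> borel_measurable lebesgue" by (simp add: sq_integrable_def)
    obtain s where s: "\<And>i. simple_function lebesgue (s i)" "\<And>x. (\<lambda>i. s i x) \<longlonglongrightarrow> f x"
      "\<And>i x. norm (s i x) \<le> 2 * norm (f x)"
      using borel_measurable_implies_sequence_metric[of f lebesgue 0] by auto
    have sm [measurable]: "s i \<in> borel_measurable lebesgue" for i
      using s(1) by (rule borel_measurable_simple_function)
    have s_le: "(s i x)\<^sup>2 \<le> 4 * (f x)\<^sup>2" for i x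
      using power_mono[OF s(3)[of i x], of 2] by (simp add: power_mult_distrib)
    have f2: "integrable lebesgue (\<lambda>x. (f x)\<^sup>2)" using f by (simp add: sq_integrable_def)
    have sq: "sq_integrable lebesgue (s i)" for i
      unfolding sq_integrable_def
    proof
      show "integrable lebesgue (\<lambda>x. (norm (s i x))\<^sup>2)"
        by (rule Bochner_Integration.integrable_bound[of _ "\<lambda>x. 4 * (f x)\<^sup>2"]) (use f2 s_le in auto)
    qed simp
    have S0: "0 \<in> S" using ind[of "{}" 0] by simp
    have "abs_l2 (s i) \<in> S" for i
    proof -
      have fin: "finite (range (s i))" using s(1)[of i] by (simp add: simple_function_def)
      have meas: "s i -` {y} \<in> lmeasurable" if "y \<noteq> 0" for y
      proof -
        have "s i -` {y} \<in> sets lebesgue" using s(1)[of i] simple_functionD(2)[of lebesgue "s i" "{y}"] by simp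
        moreover have "integrable lebesgue (indicat_real (s i -` {y}))"
        proof (rule Bochner_Integration.integrable_bound)
          show "integrable lebesgue (\<lambda>x. (1 / y\<^sup>2) * (s i x)\<^sup>2)"
            using sq[of i] by (intro integrable_mult_right) (simp add: sq_integrable_def)
          show "indicat_real (s i -` {y}) \<in> borel_measurable lebesgue" using calculation by simp
          show "AE x in lebesgue. norm (indicat_real (s i -` {y}) x) \<le> norm (1 / y\<^sup>2 * (s i x)\<^sup>2)"
            using that by (auto simp: indicator_def)
        qed
        ultimately show ?thesis by (simp only: lmeasurable_iff_integrable)
      qed
      have sum: "sq_integrable lebesgue (\<lambda>x. \<Sum>y\<in>Y. y * indicator (s i -` {y}) x) \<and>
         abs_l2 (\<lambda>x. \<Sum>y\<in>Y. y * indicator (s i -` {y}) x) \<in> S" if "finite Y" "0 \<notin> Y" for Y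
        using that
      proof (induction Y)
        case empty
        then show ?case using S0 by (simp add: sq_integrable_zero zero_l2.abs_eq[symmetric])
      next
        case (insert y Y)
        have m: "s i -` {y} \<in> lmeasurable" using insert.prems meas by auto
        have sq1: "sq_integrable lebesgue (\<lambda>x. y * indicator (s i -` {y}) x)"
          using sq_integrable_scale[OF sq_integrable_indicator[OF m]] by simp
        from insert have sqY: "sq_integrable lebesgue (\<lambda>x. \<Sum>y\<in>Y. y * indicator (s i -` {y}) x)"
          and Y: "abs_l2 (\<lambda>x. \<Sum>y\<in>Y. y * indicator (s i -` {y}) x) \<in> S" by blast+
        have split: "(\<lambda>x. \<Sum>y\<in>insert y Y. y * indicator (s i -` {y}) x) =
          (\<lambda>x. y * indicator (s i -` {y}) x + (\<Sum>y\<in>Y. y * indicator (s i -` {y}) x))"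
          by (rule ext, rule sum.insert) (use insert in auto)
        have "y *\<^sub>R ind_l2 (s i -` {y}) = abs_l2 (\<lambda>x. y * indicator (s i -` {y}) x)"
          by (rule scaleR_l2.abs_eq) (simp add: sq_integrable_indicator m)
        moreover have "abs_l2 (\<lambda>x. y * indicator (s i -` {y}) x) + abs_l2 (\<lambda>x. \<Sum>y\<in>Y. y * indicator (s i -` {y}) x) =
          abs_l2 (\<lambda>x. y * indicator (s i -` {y}) x + (\<Sum>y\<in>Y. y * indicator (s i -` {y}) x))"
          by (rule plus_l2.abs_eq) (use sq1 sqY in auto)
        ultimately show ?case
          unfolding split using add[OF ind[OF m, of y] Y] sq_integrable_add[OF sq1 sqY] by simp
      qed
      have "(\<lambda>x. \<Sum>y\<in>range (s i) - {0}. y * indicator (s i -` {y}) x) = s i"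
      proof
        fix x
        have "(\<Sum>y\<in>range (s i) - {0}. y * indicator (s i -` {y}) x)
          = (\<Sum>y\<in>range (s i) - {0}. if s i x = y then y else 0)"
          by (intro sum.cong) (auto simp: indicator_def)
        also have "\<dots> = s i x" using fin by (simp add: sum.delta')
        finally show "(\<Sum>y\<in>range (s i) - {0}. y * indicator (s i -` {y}) x) = s i x" .
      qed
      with sum[of "range (s i) - {0}"] fin show ?thesis by simp
    qed
    moreover have "(\<lambda>i. abs_l2 (s i)) \<longlonglongrightarrow> abs_l2 f"
    proof -
      have "(\<lambda>i. LINT x|lebesgue. (s i x - f x)\<^sup>2) \<longlonglongrightarrow> integral\<^sup>L lebesgue (\<lambda>x::real. 0::real)"
      proof (rule integral_dominated_convergence)
        show "integrable lebesgue (\<lambda>x. 10 * (f x)\<^sup>2)" using f2 by simp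
        show "AE x in lebesgue. (\<lambda>i. (s i x - f x)\<^sup>2) \<longlonglongrightarrow> 0"
        proof (rule AE_I2)
          fix x
          have "(\<lambda>i. (s i x - f x)\<^sup>2) \<longlonglongrightarrow> (f x - f x)\<^sup>2"
            by (intro tendsto_intros s(2))
          then show "(\<lambda>i. (s i x - f x)\<^sup>2) \<longlonglongrightarrow> 0" by simp
        qed
        show "AE x in lebesgue. norm ((s i x - f x)\<^sup>2) \<le> 10 * (f x)\<^sup>2" for i
        proof (rule AE_I2)
          fix x
          have "0 \<le> (s i x + f x)\<^sup>2" by simp
          then have "(s i x - f x)\<^sup>2 \<le> 2 * (s i x)\<^sup>2 + 2 * (f x)\<^sup>2"
            by (simp add: power2_eq_square algebra_simps)
          then show "norm ((s i x - f x)\<^sup>2) \<le> 10 * (f x)\<^sup>2"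
            using s_le[of i x] by simp
        qed
      qed auto
      then have "(\<lambda>i. (norm (abs_l2 (s i) - abs_l2 f))\<^sup>2) \<longlonglongrightarrow> 0"
        by (simp add: abs_l2_diff sq f norm_l2_sq sq_integrable_diff)
      then have "(\<lambda>i. sqrt ((norm (abs_l2 (s i) - abs_l2 f))\<^sup>2)) \<longlonglongrightarrow> sqrt 0"
        by (rule tendsto_real_sqrt)
      then have "(\<lambda>i. abs_l2 (s i) - abs_l2 f) \<longlonglongrightarrow> 0"
        by (simp add: tendsto_norm_zero_iff)
      then show ?thesis by (rule LIM_zero_cancel)
    qed
    ultimately show "x \<in> S"
      unfolding f(2) using \<open>closed S\<close> by (metis closed_sequential_limits)
  qed
  then show ?thesis by auto
qed

instance l2 :: second_countable_topology
proof
  obtain B :: "real set set" where B: "countable B" "topological_basis B"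
    using ex_countable_basis by auto
  define D0 where "D0 = {ind_l2 (\<Union>F) |F. finite F \<and> F \<subseteq> B \<and> \<Union>F \<in> lmeasurable}"
  have "countable {F. finite F \<and> F \<subseteq> B}"
    using B(1) by (rule countable_Collect_finite_subset)
  moreover have "D0 \<subseteq> (\<lambda>F. ind_l2 (\<Union>F)) ` {F. finite F \<and> F \<subseteq> B}"
    by (auto simp: D0_def)
  ultimately have D0: "countable D0"
    by (meson countable_image countable_subset)
  define val where "val xs = sum_list (map (\<lambda>(q, u). real_of_rat q *\<^sub>R u) xs)" for xs :: "(rat \<times> l2) list"
  define D where "D = val ` lists (UNIV \<times> D0)"
  have "countable D" using D0 by (auto simp: D_def)
  moreover have "closure D = UNIV"
  proof (rule dense_l2)
    fix x y assume "x \<in> closure D" "y \<in> closure D"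
    then obtain X Y where XY: "\<And>n. X n \<in> D" "X \<longlonglongrightarrow> x" "\<And>n. Y n \<in> D" "Y \<longlonglongrightarrow> y"
      by (metis closure_sequential)
    have "X n + Y n \<in> D" for n
    proof -
      obtain xs ys where "X n = val xs" "Y n = val ys" "xs \<in> lists (UNIV \<times> D0)" "ys \<in> lists (UNIV \<times> D0)"
        using XY(1)[of n] XY(3)[of n] by (auto simp: D_def)
      then have "X n + Y n = val (xs @ ys)" "xs @ ys \<in> lists (UNIV \<times> D0)" by (auto simp: val_def)
      then show ?thesis by (auto simp: D_def)
    qed
    moreover have "(\<lambda>n. X n + Y n) \<longlonglongrightarrow> x + y" by (intro tendsto_intros XY)
    ultimately show "x + y \<in> closure D"
      unfolding closure_sequential by (intro exI[of _ "\<lambda>n. X n + Y n"]) auto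
  next
    fix c :: real and A :: "real set" assume "A \<in> lmeasurable"
    from ind_l2_approx[OF B(2,1) this] obtain U where U: "\<And>n. U n \<in> D0" "U \<longlonglongrightarrow> ind_l2 A"
      unfolding closure_sequential D0_def by blast
    have "c \<in> closure \<rat>" by (metis Rats_closure_real UNIV_I)
    then obtain q where q: "\<And>n. q n \<in> \<rat>" "q \<longlonglongrightarrow> c" by (metis closure_sequential)
    have "q n *\<^sub>R U n \<in> D" for n
    proof -
      obtain p where p: "q n = real_of_rat p" using q(1)[of n] by (auto elim: Rats_cases)
      then have "q n *\<^sub>R U n = val [(p, U n)]" by (simp add: val_def)
      then show ?thesis using U(1) by (auto simp: D_def)
    qed
    moreover have "(\<lambda>n. q n *\<^sub>R U n) \<longlonglongrightarrow> c *\<^sub>R ind_l2 A" by (intro tendsto_intros U q)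
    ultimately show "c *\<^sub>R ind_l2 A \<in> closure D"
      unfolding closure_sequential by (intro exI[of _ "\<lambda>n. q n *\<^sub>R U n"]) auto
  qed simp
  ultimately show "\<exists>B :: l2 set set. countable B \<and> open = generate_topology B"
    by (rule countable_subbasis_if_dense)
qed

instance vec :: ("{metric_space, second_countable_topology}", finite) second_countable_topology
proof
  obtain D :: "'a set" where D: "countable D" "\<And>U. open U \<Longrightarrow> U \<noteq> {} \<Longrightarrow> \<exists>d\<in>D. d \<in> U"
    by (rule countable_dense_setE) blast
  define E where "E = {v :: 'a ^ 'b. \<forall>i. v $ i \<in> D}"
  have "countable (PiE (UNIV :: 'b set) (\<lambda>_. D))"
    using D(1) by (intro countable_PiE) auto
  moreover have "E \<subseteq> vec_lambda ` PiE UNIV (\<lambda>_. D)"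
  proof
    fix v assume "v \<in> E"
    then show "v \<in> vec_lambda ` PiE UNIV (\<lambda>_. D)"
      by (intro image_eqI[of _ _ "vec_nth v"]) (auto simp: E_def)
  qed
  ultimately have "countable E" by (meson countable_image countable_subset)
  moreover have "closure E = UNIV"
  proof -
    have "x \<in> closure E" for x
      unfolding closure_approachable
    proof (intro allI impI)
      fix e :: real assume "e > 0"
      define \<delta> where "\<delta> = e / (real CARD('b) + 1)"
      have "\<delta> > 0" using \<open>e > 0\<close> by (simp add: \<delta>_def add_nonneg_pos)
      have "\<exists>d\<in>D. d \<in> ball (x $ i) \<delta>" for i
        using \<open>\<delta> > 0\<close> by (intro D(2)) auto
      then obtain d where d: "\<And>i. d i \<in> D" "\<And>i. dist (x $ i) (d i) < \<delta>"
        by (simp add: Bex_def) metis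
      have "dist (vec_lambda d) x \<le> (\<Sum>i\<in>UNIV. dist (d i) (x $ i))"
        unfolding dist_vec_def using L2_set_le_sum[of UNIV "\<lambda>i. dist (d i) (x $ i)"] by simp
      also have "\<dots> \<le> (\<Sum>i\<in>(UNIV :: 'b set). \<delta>)"
        using d(2) by (intro sum_mono) (simp add: dist_commute less_imp_le)
      also have "\<dots> < e"
        using \<open>e > 0\<close> by (simp add: \<delta>_def field_simps)
      finally show "\<exists>y\<in>E. dist y x < e"
        using d(1) by (intro bexI[of _ "vec_lambda d"]) (auto simp: E_def)
    qed
    then show ?thesis by auto
  qed
  ultimately show "\<exists>B :: ('a ^ 'b) set set. countable B \<and> open = generate_topology B"
    by (rule countable_subbasis_if_dense)
qed


lemma sq_integrable_rep_l2: "sq_integrable lebesgue (rep_l2 p)"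
  using Quotient3_rep_reflp[OF Quotient3_l2] by blast

lemma abs_rep_l2: "abs_l2 (rep_l2 p) = p"
  by (rule Quotient3_abs_rep[OF Quotient3_l2])

lemma rep_abs_l2:
  assumes "sq_integrable lebesgue f"
  shows "AE x in lebesgue. rep_l2 (abs_l2 f) x = f x"
  using rep_abs_rsp_left[OF Quotient3_l2, of f f] assms by auto


section \<open>Distributions and Bochner--Sobolev spaces in time\<close>

definition test_function :: "real \<Rightarrow> real \<Rightarrow> (real \<Rightarrow> real) \<Rightarrow> bool"
  where "test_function a b \<phi> \<longleftrightarrow>
    (\<forall>k. (deriv ^^ k) \<phi> differentiable_on UNIV) \<and>
    (\<exists>c d. a < c \<and> d < b \<and> (\<forall>x. \<phi> x \<noteq> 0 \<longrightarrow> x \<in> {c..d}))"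

text \<open>Meaningful only for \<open>u\<close> and \<open>v\<close> integrable over the interval (the integral of a
  non-integrable function is 0).\<close>

definition weak_derivative ::
    "real \<Rightarrow> real \<Rightarrow> (real \<Rightarrow> 'x::{banach, second_countable_topology}) \<Rightarrow> (real \<Rightarrow> 'x) \<Rightarrow> bool"
  where "weak_derivative a b u v \<longleftrightarrow> (\<forall>\<phi>. test_function a b \<phi> \<longrightarrow>
    (LINT t|lebesgue_on {a..b}. deriv \<phi> t *\<^sub>R u t) = - (LINT t|lebesgue_on {a..b}. \<phi> t *\<^sub>R v t))"

text \<open>For a closed subspace \<open>X\<close> of a separable Banach space, \<open>L2_time T X\<close>, \<open>H1_time T X\<close> and
  \<open>C_time T X\<close> are the spaces \<open>L\<^sup>2(0,T;X)\<close>, \<open>H\<^sup>1(0,T;X)\<close> and \<open>C([0,T],X)\<close>. Elements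
  of \<open>H\<^sup>1(0,T;X)\<close> are taken in their continuous representative, which is thereby
  defined at every \<open>t \<in> [0,T]\<close>; \<open>time_deriv\<close> picks a representative of the weak derivative.\<close>

definition L2_time :: "real \<Rightarrow> 'x::{banach, second_countable_topology} set \<Rightarrow> (real \<Rightarrow> 'x) set"
  where "L2_time T X =
    {u. sq_integrable (lebesgue_on {0..T}) u \<and> (AE t in lebesgue_on {0..T}. u t \<in> X)}"

definition C_time :: "real \<Rightarrow> 'x::topological_space set \<Rightarrow> (real \<Rightarrow> 'x) set"
  where "C_time T X = {u. continuous_on {0..T} u \<and> u ` {0..T} \<subseteq> X}"

definition H1_time :: "real \<Rightarrow> 'x::{banach, second_countable_topology} set \<Rightarrow> (real \<Rightarrow> 'x) set"
  where "H1_time T X = {u \<in> C_time T X. \<exists>v\<in>L2_time T X. weak_derivative 0 T u v}"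

definition time_deriv ::
    "real \<Rightarrow> (real \<Rightarrow> 'x::{banach, second_countable_topology}) \<Rightarrow> real \<Rightarrow> 'x"
  where "time_deriv T u = (SOME v. v \<in> L2_time T UNIV \<and> weak_derivative 0 T u v)"

text \<open>Distributions on \<open>(0,T)\<close> with values in a subspace \<open>X\<close> of a normed space: linear maps on the
  test functions, continuous in the sense that they have finite order on each compact
  subinterval. Values at functions that are not test functions are irrelevant.\<close>

definition distribution :: "real \<Rightarrow> 'x::real_normed_vector set \<Rightarrow> ((real \<Rightarrow> real) \<Rightarrow> 'x) \<Rightarrow> bool"
  where "distribution T X \<Lambda> \<longleftrightarrow>
    (\<forall>\<phi>. test_function 0 T \<phi> \<longrightarrow> \<Lambda> \<phi> \<in> X) \<and>
    (\<forall>\<phi> \<psi>. test_function 0 T \<phi> \<longrightarrow> test_function 0 T \<psi> \<longrightarrow> \<Lambda> (\<lambda>t. \<phi> t + \<psi> t) = \<Lambda> \<phi> + \<Lambda> \<psi>) \<and>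
    (\<forall>c \<phi>. test_function 0 T \<phi> \<longrightarrow> \<Lambda> (\<lambda>t. c * \<phi> t) = c *\<^sub>R \<Lambda> \<phi>) \<and>
    (\<forall>c d. 0 < c \<longrightarrow> d < T \<longrightarrow> (\<exists>C k. \<forall>\<phi>. test_function 0 T \<phi> \<longrightarrow>
       (\<forall>t. \<phi> t \<noteq> 0 \<longrightarrow> t \<in> {c..d}) \<longrightarrow>
       norm (\<Lambda> \<phi>) \<le> C * (\<Sum>j\<le>k. SUP t. \<bar>(deriv ^^ j) \<phi> t\<bar>)))"


section \<open>Strongly continuous semigroups on a closed subspace\<close>

definition c0_semigroup :: "'x::real_normed_vector set \<Rightarrow> (real \<Rightarrow> 'x \<Rightarrow> 'x) \<Rightarrow> bool"
  where "c0_semigroup X S \<longleftrightarrow>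
    (\<forall>t\<ge>0. \<forall>x\<in>X. S t x \<in> X) \<and>
    (\<forall>t\<ge>0. \<forall>x\<in>X. \<forall>y\<in>X. S t (x + y) = S t x + S t y) \<and>
    (\<forall>t\<ge>0. \<forall>x\<in>X. \<forall>c. S t (c *\<^sub>R x) = c *\<^sub>R S t x) \<and>
    (\<forall>t\<ge>0. \<exists>C. \<forall>x\<in>X. norm (S t x) \<le> C * norm x) \<and>
    (\<forall>x\<in>X. S 0 x = x) \<and>
    (\<forall>s\<ge>0. \<forall>t\<ge>0. \<forall>x\<in>X. S (s + t) x = S s (S t x)) \<and>
    (\<forall>x\<in>X. ((\<lambda>t. S t x) \<longlongrightarrow> x) (at_right 0))"

definition generated_by ::
    "'x::real_normed_vector set \<Rightarrow> (real \<Rightarrow> 'x \<Rightarrow> 'x) \<Rightarrow> 'x set \<Rightarrow> ('x \<Rightarrow> 'x) \<Rightarrow> bool"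
  where "generated_by X S D A \<longleftrightarrow>
    D = {x \<in> X. \<exists>y\<in>X. ((\<lambda>t. (1 / t) *\<^sub>R (S t x - x)) \<longlongrightarrow> y) (at_right 0)} \<and>
    (\<forall>x\<in>D. ((\<lambda>t. (1 / t) *\<^sub>R (S t x - x)) \<longlongrightarrow> A x) (at_right 0))"

definition semigroup_mild_solution ::
    "real \<Rightarrow> 'x::{banach, second_countable_topology} set \<Rightarrow> 'x set \<Rightarrow> ('x \<Rightarrow> 'x) \<Rightarrow>
     (real \<Rightarrow> 'x) \<Rightarrow> 'x \<Rightarrow> (real \<Rightarrow> 'x) \<Rightarrow> bool"
  where "semigroup_mild_solution T X D A F x0 x \<longleftrightarrow>
    (\<exists>S. c0_semigroup X S \<and> generated_by X S D A \<and>
      (\<forall>t\<in>{0..T}. integrable (lebesgue_on {0..t}) (\<lambda>s. S (t - s) (F s)) \<and>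
         x t = S t x0 + (LINT s|lebesgue_on {0..t}. S (t - s) (F s))))"


section \<open>Networks and their function spaces\<close>

text \<open>All elements of the (finite) types \<open>'v\<close> and \<open>'e\<close> are vertices and edges; the edge \<open>e\<close> is
  the interval \<open>[0, edge_length G e]\<close>, oriented from its source to its target. Parallel edges
  and loops are admitted. \<open>boundary G\<close> is \<open>\<V>\<^sub>D\<close> and its complement is \<open>\<V>\<^sub>N\<close>.\<close>

record ('v, 'e) network =
  source :: "'e \<Rightarrow> 'v"
  target :: "'e \<Rightarrow> 'v"
  edge_length :: "'e \<Rightarrow> real"
  boundary :: "'v set"

definition adjacency :: "('v, 'e) network \<Rightarrow> ('v \<times> 'v) set"
  where "adjacency G = {(source G e, target G e) |e. True}"

definition is_network :: "('v::finite, 'e::finite) network \<Rightarrow> bool"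
  where "is_network G \<longleftrightarrow>
    (\<forall>e. 0 < edge_length G e) \<and>
    boundary G \<noteq> {} \<and>
    (\<forall>u v. (u, v) \<in> (adjacency G \<union> (adjacency G)\<inverse>)\<^sup>*)"

text \<open>\<open>\<real>\<close>-vectors indexed by \<open>\<V>\<^sub>D\<close> or \<open>\<V>\<^sub>N\<close> are extended by zero to all vertices.\<close>

definition RD :: "('v::finite, 'e) network \<Rightarrow> (real ^ 'v) set"
  where "RD G = {y. \<forall>v. v \<notin> boundary G \<longrightarrow> y $ v = 0}"

definition RN :: "('v::finite, 'e) network \<Rightarrow> (real ^ 'v) set"
  where "RN G = {y. \<forall>v. v \<in> boundary G \<longrightarrow> y $ v = 0}"

type_synonym 'e l2e = "l2 ^ 'e"

text \<open>\<open>L\<^sup>2(\<E>)\<close>: families of elements of \<open>L\<^sup>2(\<real>)\<close> that vanish outside the respective edge; the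
  inner product of \<^typ>\<open>'e l2e\<close> is the sum of the edgewise ones.\<close>

definition L2E :: "('v, 'e::finite) network \<Rightarrow> ('e l2e) set"
  where "L2E G = {p. \<forall>e. AE x in lebesgue. x \<notin> {0..edge_length G e} \<longrightarrow> rep_l2 (p $ e) x = 0}"

definition mult :: "('v, 'e::finite) network \<Rightarrow> ('e \<Rightarrow> real \<Rightarrow> real) \<Rightarrow> 'e l2e \<Rightarrow> 'e l2e"
  where "mult G c p =
    (\<chi> e. abs_l2 (\<lambda>x. if x \<in> {0..edge_length G e} then c e x * rep_l2 (p $ e) x else 0))"

definition is_edge_deriv :: "('v, 'e::finite) network \<Rightarrow> 'e l2e \<Rightarrow> 'e l2e \<Rightarrow> bool"
  where "is_edge_deriv G q q' \<longleftrightarrow> q' \<in> L2E G \<and>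
    (\<forall>e. weak_derivative 0 (edge_length G e) (rep_l2 (q $ e)) (rep_l2 (q' $ e)))"

definition is_trace :: "('v::finite, 'e::finite) network \<Rightarrow> 'e l2e \<Rightarrow> real ^ 'v \<Rightarrow> bool"
  where "is_trace G q y \<longleftrightarrow> (\<exists>qc. \<forall>e.
    continuous_on {0..edge_length G e} (qc e) \<and>
    (AE x in lebesgue_on {0..edge_length G e}. qc e x = rep_l2 (q $ e) x) \<and>
    qc e 0 = y $ source G e \<and> qc e (edge_length G e) = y $ target G e)"

definition H1 :: "('v::finite, 'e::finite) network \<Rightarrow> ('e l2e) set"
  where "H1 G = {q \<in> L2E G. (\<exists>q'. is_edge_deriv G q q') \<and> (\<exists>y. is_trace G q y)}"

definition vertex_trace :: "('v::finite, 'e::finite) network \<Rightarrow> 'e l2e \<Rightarrow> real ^ 'v"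
  where "vertex_trace G q = (THE y. is_trace G q y)"

definition H10 :: "('v::finite, 'e::finite) network \<Rightarrow> ('e l2e) set"
  where "H10 G = {q \<in> H1 G. \<forall>v\<in>boundary G. vertex_trace G q $ v = 0}"

text \<open>The operator \<open>\<K>\<close>, with \<open>[L\<^sup>2(\<E>)]\<^sup>*\<close> identified with \<open>L\<^sup>2(\<E>)\<close>.\<close>

definition op_K :: "('v, 'e::finite) network \<Rightarrow> 'e l2e \<Rightarrow> 'e l2e"
  where "op_K G q = (THE q'. is_edge_deriv G q q')"

definition op_B :: "('v::finite, 'e::finite) network \<Rightarrow> 'e l2e \<Rightarrow> real ^ 'v"
  where "op_B G q = (\<chi> v. if v \<in> boundary G then vertex_trace G q $ v else 0)"

definition op_C :: "('v::finite, 'e::finite) network \<Rightarrow> 'e l2e \<Rightarrow> real ^ 'v"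
  where "op_C G q = (\<chi> v. if v \<in> boundary G then 0 else vertex_trace G q $ v)"

definition is_right_inverse :: "('v::finite, 'e::finite) network \<Rightarrow> (real ^ 'v \<Rightarrow> 'e l2e) \<Rightarrow> bool"
  where "is_right_inverse G Bm \<longleftrightarrow>
    (\<forall>y\<in>RD G. Bm y \<in> H1 G \<and> op_B G (Bm y) = y) \<and>
    (\<forall>y\<in>RD G. \<forall>z\<in>RD G. Bm (y + z) = Bm y + Bm z) \<and>
    (\<forall>c. \<forall>y\<in>RD G. Bm (c *\<^sub>R y) = c *\<^sub>R Bm y)"

definition h1_norm :: "('v, 'e::finite) network \<Rightarrow> 'e l2e \<Rightarrow> real"
  where "h1_norm G q = sqrt ((norm q)\<^sup>2 + (norm (op_K G q))\<^sup>2)"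

text \<open>\<open>H\<^sup>1(0,T;V)\<close> for \<open>V = H\<^sup>1(\<E>)\<close> or \<open>V = H\<^sup>1\<^sub>0(\<E>)\<close>. Since \<^const>\<open>h1_norm\<close> is the norm of
  \<open>(q, \<K>q)\<close> in \<open>L\<^sup>2(\<E>) \<times> L\<^sup>2(\<E>)\<close>, the space \<open>V\<close> is the graph of \<open>\<K>\<close> on \<open>V\<close>, a closed subspace
  of a type of class \<^class>\<open>banach\<close>.\<close>

definition H1_time_H1 ::
    "('v, 'e::finite) network \<Rightarrow> real \<Rightarrow> ('e l2e) set \<Rightarrow> (real \<Rightarrow> 'e l2e) set"
  where "H1_time_H1 G T V = {u. (\<lambda>t. (u t, op_K G (u t))) \<in> H1_time T ((\<lambda>q. (q, op_K G q)) ` V)}"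


section \<open>Dual spaces\<close>

text \<open>Elements of \<open>[H\<^sup>1(\<E>)]\<^sup>*\<close> and \<open>H\<^sup>-\<^sup>1(\<E>)\<close> are functions on \<^typ>\<open>'e l2e\<close> of which only the
  restriction to \<open>V = H\<^sup>1(\<E>)\<close> or \<open>V = H\<^sup>1\<^sub>0(\<E>)\<close> matters; accordingly, equality in \<open>V\<^sup>*\<close> is equality
  on \<open>V\<close>.\<close>

type_synonym 'e functional = "'e l2e \<Rightarrow> real"

definition dual :: "('v, 'e::finite) network \<Rightarrow> ('e l2e) set \<Rightarrow> 'e functional set"
  where "dual G V = {w.
    (\<forall>q\<in>V. \<forall>q'\<in>V. w (q + q') = w q + w q') \<and>
    (\<forall>c. \<forall>q\<in>V. w (c *\<^sub>R q) = c * w q) \<and>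
    (\<exists>C. \<forall>q\<in>V. \<bar>w q\<bar> \<le> C * h1_norm G q)}"

definition dual_norm :: "('v, 'e::finite) network \<Rightarrow> ('e l2e) set \<Rightarrow> 'e functional \<Rightarrow> real"
  where "dual_norm G V w = (SUP q\<in>{q \<in> V. h1_norm G q \<le> 1}. \<bar>w q\<bar>)"

definition emb :: "'e::finite l2e \<Rightarrow> 'e functional"
  where "emb p = (\<lambda>q. inner p q)"

definition K_adj :: "('v, 'e::finite) network \<Rightarrow> 'e l2e \<Rightarrow> 'e functional"
  where "K_adj G m = (\<lambda>q. inner (op_K G q) m)"

definition B_adj :: "('v::finite, 'e::finite) network \<Rightarrow> real ^ 'v \<Rightarrow> 'e functional"
  where "B_adj G y = (\<lambda>q. inner y (op_B G q))"

definition C_adj :: "('v::finite, 'e::finite) network \<Rightarrow> real ^ 'v \<Rightarrow> 'e functional"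
  where "C_adj G y = (\<lambda>q. inner y (op_C G q))"

text \<open>\<open>L\<^sup>2(0,T;V\<^sup>*)\<close>, with strong measurability spelled out as almost everywhere approximability
  by simple functions because \<open>V\<^sup>*\<close> is not a type.\<close>

definition L2_time_dual ::
    "('v, 'e::finite) network \<Rightarrow> real \<Rightarrow> ('e l2e) set \<Rightarrow> (real \<Rightarrow> 'e functional) set"
  where "L2_time_dual G T V = {w.
    (AE t in lebesgue_on {0..T}. w t \<in> dual G V) \<and>
    (\<exists>s. (\<forall>n. simple_function (lebesgue_on {0..T}) (s n) \<and> (\<forall>t\<in>{0..T}. s n t \<in> dual G V)) \<and>
      (AE t in lebesgue_on {0..T}. (\<lambda>n. dual_norm G V (\<lambda>q. s n t q - w t q)) \<longlonglongrightarrow> 0)) \<and>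
    integrable (lebesgue_on {0..T}) (\<lambda>t. (dual_norm G V (w t))\<^sup>2)}"

text \<open>\<open>V\<^sup>*\<close>-valued distributions on \<open>(0,T)\<close>. Evaluation at \<open>q \<in> V\<close> commutes with the Bochner
  integral, hence the distribution induced by a \<open>V\<^sup>*\<close>-valued function \<open>w\<close> is given by
  integrating \<open>\<langle>w(t), q\<rangle>\<close>.\<close>

type_synonym 'e dual_distribution = "(real \<Rightarrow> real) \<Rightarrow> 'e functional"

definition regular :: "real \<Rightarrow> (real \<Rightarrow> 'e functional) \<Rightarrow> 'e::finite dual_distribution"
  where "regular T w = (\<lambda>\<phi> q. LINT t|lebesgue_on {0..T}. \<phi> t * w t q)"

definition dist_deriv :: "'e::finite dual_distribution \<Rightarrow> 'e dual_distribution"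
  where "dist_deriv \<Lambda> = (\<lambda>\<phi> q. - \<Lambda> (deriv \<phi>) q)"

definition dist_eq ::
    "real \<Rightarrow> ('e l2e) set \<Rightarrow> 'e::finite dual_distribution \<Rightarrow> 'e dual_distribution \<Rightarrow> bool"
  where "dist_eq T V \<Lambda> \<Lambda>' \<longleftrightarrow> (\<forall>\<phi>. test_function 0 T \<phi> \<longrightarrow> (\<forall>q\<in>V. \<Lambda> \<phi> q = \<Lambda>' \<phi> q))"

definition H1_time_dual ::
    "('v, 'e::finite) network \<Rightarrow> real \<Rightarrow> ('e l2e) set \<Rightarrow> (real \<Rightarrow> 'e functional) set"
  where "H1_time_dual G T V = {u \<in> L2_time_dual G T V.
    \<exists>w\<in>L2_time_dual G T V. dist_eq T V (dist_deriv (regular T u)) (regular T w)}"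


section \<open>The hyperbolic system and its mild solutions\<close>

definition dom_A :: "('v::finite, 'e::finite) network \<Rightarrow> ('e l2e \<times> 'e l2e) set"
  where "dom_A G = H10 G \<times> {m \<in> L2E G. \<exists>m'\<in>L2E G. \<forall>q\<in>H10 G. inner m' q = K_adj G m q}"

text \<open>The \<open>L\<^sup>2\<close>-representative of \<open>\<K>\<^sup>* m\<close>, restricted to \<open>H\<^sup>1\<^sub>0(\<E>)\<close>.\<close>

definition K_adj_L2 :: "('v::finite, 'e::finite) network \<Rightarrow> 'e l2e \<Rightarrow> 'e l2e"
  where "K_adj_L2 G m = (THE m'. m' \<in> L2E G \<and> (\<forall>q\<in>H10 G. inner m' q = K_adj G m q))"

definition op_A ::
    "('v::finite, 'e::finite) network \<Rightarrow> ('e \<Rightarrow> real \<Rightarrow> real) \<Rightarrow> ('e \<Rightarrow> real \<Rightarrow> real) \<Rightarrow> real \<Rightarrow>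
     'e l2e \<times> 'e l2e \<Rightarrow> 'e l2e \<times> 'e l2e"
  where "op_A G a d \<epsilon> = (\<lambda>(p, m).
    (- (sqrt \<epsilon> *\<^sub>R mult G a p) + K_adj_L2 G m,
     - op_K G p - (1 / sqrt \<epsilon>) *\<^sub>R mult G d m))"

definition corrector ::
    "('v::finite, 'e::finite) network \<Rightarrow> ('e \<Rightarrow> real \<Rightarrow> real) \<Rightarrow> ('e \<Rightarrow> real \<Rightarrow> real) \<Rightarrow> real \<Rightarrow>
     (real \<Rightarrow> real ^ 'v) \<Rightarrow>
     (real \<Rightarrow> 'e l2e) \<Rightarrow> (real \<Rightarrow> 'e l2e) \<Rightarrow> (real \<Rightarrow> real ^ 'v) \<Rightarrow> bool"
  where "corrector G a d T r pb mb lb \<longleftrightarrow>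
    pb \<in> H1_time_H1 G T (H10 G) \<and> mb \<in> H1_time T (L2E G) \<and> lb \<in> H1_time T (RD G) \<and>
    (\<forall>t\<in>{0..T}.
      (\<forall>q\<in>H1 G. emb (mult G a (pb t)) q - K_adj G (mb t) q + B_adj G (lb t) q = - C_adj G (r t) q) \<and>
      op_K G (pb t) + mult G d (mb t) = 0 \<and>
      op_B G (pb t) = 0)"

definition mild_solution_pm ::
    "('v::finite, 'e::finite) network \<Rightarrow> ('e \<Rightarrow> real \<Rightarrow> real) \<Rightarrow> ('e \<Rightarrow> real \<Rightarrow> real) \<Rightarrow> real \<Rightarrow> real \<Rightarrow>
     (real ^ 'v \<Rightarrow> 'e l2e) \<Rightarrow>
     (real \<Rightarrow> 'e l2e) \<Rightarrow> (real \<Rightarrow> 'e l2e) \<Rightarrow> (real \<Rightarrow> real ^ 'v) \<Rightarrow> (real \<Rightarrow> real ^ 'v) \<Rightarrow>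
     'e l2e \<Rightarrow> 'e l2e \<Rightarrow> (real \<Rightarrow> 'e l2e) \<Rightarrow> (real \<Rightarrow> 'e l2e) \<Rightarrow> bool"
  where "mild_solution_pm G a d \<epsilon> T Bm f g h r p0 m0 p m \<longleftrightarrow>
    (\<exists>pb mb lb. corrector G a d T r pb mb lb \<and>
      semigroup_mild_solution T (L2E G \<times> L2E G)
        (dom_A G) (\<lambda>x. (1 / sqrt \<epsilon>) *\<^sub>R op_A G a d \<epsilon> x)
        (\<lambda>t. ((1 / sqrt \<epsilon>) *\<^sub>R (g t - time_deriv T pb t - mult G a (Bm (h t)) - Bm (time_deriv T h t)),
               (1 / \<epsilon>) *\<^sub>R (f t - op_K G (Bm (h t))) - time_deriv T mb t))
        ((1 / sqrt \<epsilon>) *\<^sub>R (p0 - pb 0 - Bm (h 0)), m0 - mb 0)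
        (\<lambda>t. ((1 / sqrt \<epsilon>) *\<^sub>R (p t - pb t - Bm (h t)), m t - mb t)))"

definition mild_solution ::
    "('v::finite, 'e::finite) network \<Rightarrow> ('e \<Rightarrow> real \<Rightarrow> real) \<Rightarrow> ('e \<Rightarrow> real \<Rightarrow> real) \<Rightarrow> real \<Rightarrow> real \<Rightarrow>
     (real ^ 'v \<Rightarrow> 'e l2e) \<Rightarrow>
     (real \<Rightarrow> 'e l2e) \<Rightarrow> (real \<Rightarrow> 'e l2e) \<Rightarrow> (real \<Rightarrow> real ^ 'v) \<Rightarrow> (real \<Rightarrow> real ^ 'v) \<Rightarrow>
     'e l2e \<Rightarrow> 'e l2e \<Rightarrow>
     (real \<Rightarrow> 'e l2e) \<Rightarrow> (real \<Rightarrow> 'e l2e) \<Rightarrow> ((real \<Rightarrow> real) \<Rightarrow> real ^ 'v) \<Rightarrow> bool"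
  where "mild_solution G a d \<epsilon> T Bm f g h r p0 m0 p m lam \<longleftrightarrow>
    mild_solution_pm G a d \<epsilon> T Bm f g h r p0 m0 p m \<and>
    distribution T (RD G) lam \<and>
    dist_eq T (H1 G)
      (\<lambda>\<phi> q. dist_deriv (regular T (\<lambda>t. emb (p t))) \<phi> q
         + regular T (\<lambda>t q. emb (mult G a (p t)) q - K_adj G (m t) q) \<phi> q
         + B_adj G (lam \<phi>) q)
      (regular T (\<lambda>t q. emb (g t) q - C_adj G (r t) q))"

end

theory Submission imports Defs begin

text \<open>The generator is the sum of the skew-adjoint operator with entries \<open>\<K>\<^sup>*\<close> and \<open>-\<K>\<close> and a
  bounded dissipative diagonal operator. Eliminating \<open>m\<close> turns its resolvent equation into a
  coercive symmetric problem in \<open>H\<^sup>1\<^sub>0\<close>, so it generates a contraction semigroup on \<open>L\<^sup>2 \<times> L\<^sup>2\<close>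
  (Yosida approximation); the corrector \<open>(p, m, \<lambda>)\<close> solves a problem of the same kind and depends
  linearly and boundedly on \<open>r(t)\<close>. Dissipativity makes the semigroup unique, hence also the mild
  solution. By Fubini's theorem a mild solution is a weak solution against test functions in
  \<open>H\<^sup>1\<^sub>0\<close>, on which \<open>\<C>\<close> may still act but \<open>\<B>\<close> vanishes. The defect of the first equation is
  therefore a functional on \<open>H\<^sup>1\<close> that vanishes on \<open>H\<^sup>1\<^sub>0\<close>, that is, it is of the form
  \<open>\<B>\<^sup>*\<lambda>\<close>; testing with liftings of the boundary unit vectors gives \<open>\<lambda>\<close> as the time derivative
  of a continuous function.\<close>

section \<open>Symmetric coercive forms on a Hilbert space\<close>

text \<open>A mild solution is defined through some C0-semigroup with the given generator and some
  corrector. Uniqueness must therefore cover arbitrary C0-semigroups, for which continuity of orbits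
  away from 0 has to be derived; this is where uniform boundedness enters. The function spaces are
  closed subsets of a type. Composing the generator with the orthogonal projection extends it by
  zero to the orthogonal complement; the extension is maximal dissipative on the whole type. The
  corrector exists because the functional \<open>C_adj G r\<close> does not vanish on
  \<open>H10 G\<close> and is in general not given by an L2 function, so it cannot be part of the
  inhomogeneity of the semigroup equation. \<open>Bm\<close> is linear on \<open>RD G\<close> only
  and arbitrary elsewhere; almost everywhere it may be exchanged for the bounded linear
  \<open>lift\<close>. One Fubini argument for the Duhamel integral serves twice: for the weak form
  of the equation and, with the identity semigroup on the real line, for weak derivatives of
  primitives, on which the description of H1 by edge data rests.\<close>

lemma symmetric_form_square_add:
  assumes "bounded_bilinear b" and sym: "\<And>x y. b x y = b y x"
  shows "b (x + t *\<^sub>R y) (x + t *\<^sub>R y) = b x x + 2 * t * b x y + t\<^sup>2 * (b y y :: real)"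
proof -
  interpret bounded_bilinear b by fact
  show ?thesis
    by (simp add: add_left add_right scaleR_left scaleR_right sym[of y x] power2_eq_square algebra_simps)
qed

text \<open>The first order condition at a minimizer. The value at t = -k/(c+1) is negative unless k
  = 0; the added 1 avoids a division by zero for c = 0.\<close>

lemma linear_le_quadratic_imp_zero:
  fixes k c :: real
  assumes "\<And>t. 0 \<le> 2 * t * k + t\<^sup>2 * c"
  shows "k = 0"
proof -
  have "0 \<le> c"
    using assms[of 1] assms[of "-1"] by simp
  have "0 \<le> 2 * (- k / (c + 1)) * k + (- k / (c + 1))\<^sup>2 * c"
    by (rule assms)
  also have "\<dots> = - (k\<^sup>2 * (c + 2) / (c + 1)\<^sup>2)"
    using \<open>0 \<le> c\<close> by (simp add: power2_eq_square divide_simps) algebra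
  finally have "k\<^sup>2 * (c + 2) / (c + 1)\<^sup>2 \<le> 0" by simp
  then have "k\<^sup>2 * (c + 2) \<le> 0"
    using \<open>0 \<le> c\<close> by (simp add: divide_le_0_iff zero_less_power2 not_le)
  then show ?thesis
    using \<open>0 \<le> c\<close> by (smt (verit) mult_pos_pos zero_less_power2)
qed

text \<open>The solution is the minimizer of \<open>b v v - 2 F v\<close>; minimizing sequences are Cauchy by the
  parallelogram identity.\<close>

theorem lax_milgram_symmetric:
  fixes V :: "'a::banach set" and b :: "'a \<Rightarrow> 'a \<Rightarrow> real"
  assumes V: "subspace V" "closed V"
    and b: "bounded_bilinear b" and sym: "\<And>x y. b x y = b y x"
    and c: "0 < c" "\<And>x. x \<in> V \<Longrightarrow> c * (norm x)\<^sup>2 \<le> b x x"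
    and F: "bounded_linear F"
  shows "\<exists>u\<in>V. \<forall>v\<in>V. b u v = F v"
proof -
  interpret b: bounded_bilinear b by fact
  interpret F: bounded_linear F by fact
  define J where "J v = b v v - 2 * F v" for v
  obtain K where K: "\<And>x. \<bar>F x\<bar> \<le> norm x * K" "0 < K"
    using F.pos_bounded by auto
  \<comment> \<open>Completing the square in c |v| - K bounds the energy from below.\<close>
  have lower: "- (K\<^sup>2 / c) \<le> J v" if "v \<in> V" for v
  proof -
    have "0 \<le> (c * norm v - K)\<^sup>2" by simp
    then have "c * (2 * norm v * K) \<le> c * (c * (norm v)\<^sup>2) + K\<^sup>2"
      by (simp add: power2_eq_square algebra_simps)
    then have "2 * norm v * K \<le> c * (norm v)\<^sup>2 + K\<^sup>2 / c"
      using c(1) by (simp add: field_simps power2_eq_square)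
    then show ?thesis
      using c(2)[OF that] K(1)[of v] unfolding J_def by linarith
  qed
  define \<mu> where "\<mu> = Inf (J ` V)"
  have bdd: "bdd_below (J ` V)" using lower by (intro bdd_belowI2)
  have V0: "0 \<in> V" using V(1) by (rule subspace_0)
  have \<mu>_le: "\<mu> \<le> J v" if "v \<in> V" for v
    unfolding \<mu>_def using bdd that by (intro cInf_lower) auto
  have "\<exists>v\<in>V. J v < \<mu> + 1 / real (Suc n)" for n
  proof -
    have "\<exists>y\<in>J ` V. y < \<mu> + 1 / real (Suc n)"
      using V0 bdd by (subst cInf_less_iff[symmetric]) (auto simp: \<mu>_def)
    then show ?thesis by auto
  qed
  then obtain v where v: "\<And>n. v n \<in> V" "\<And>n. J (v n) < \<mu> + 1 / real (Suc n)"
    by metis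
  have par: "c * (norm (x - y))\<^sup>2 \<le> 2 * (J x - \<mu>) + 2 * (J y - \<mu>)" if "x \<in> V" "y \<in> V" for x y
  proof -
    have z: "(1/2) *\<^sub>R (x + y) \<in> V" and xy: "x - y \<in> V"
      using that V(1) by (auto intro: subspace_add subspace_diff subspace_scale)
    have "b (x - y) (x - y) = 2 * J x + 2 * J y - 4 * J ((1/2) *\<^sub>R (x + y))"
      by (simp add: J_def b.add_left b.add_right b.diff_left b.diff_right b.scaleR_left b.scaleR_right
          F.add F.scaleR sym[of y x] field_simps)
    then show ?thesis
      using c(2)[OF xy] \<mu>_le[OF z] by simp
  qed
  have "Cauchy v"
  proof (rule metric_CauchyI)
    fix e :: real assume "0 < e"
    \<comment> \<open>The estimate \<open>par\<close> adds up four such excesses over the infimum,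
      hence the factor 1/4.\<close>
    obtain N where N: "1 / real (Suc N) < c * e\<^sup>2 / 4"
      using nat_approx_posE[of "c * e\<^sup>2 / 4"] \<open>0 < e\<close> c(1) by auto
    have small: "J (v n) - \<mu> < c * e\<^sup>2 / 4" if "n \<ge> N" for n
    proof -
      have "1 / real (Suc n) \<le> 1 / real (Suc N)" using that by (simp add: field_simps)
      then show ?thesis using v(2)[of n] N by simp
    qed
    have "dist (v m) (v n) < e" if "m \<ge> N" "n \<ge> N" for m n
    proof -
      define \<delta> where "\<delta> = c * e\<^sup>2 / 4"
      have "c * (norm (v m - v n))\<^sup>2 < 4 * \<delta>"
        using par[OF v(1) v(1), of m n] small[OF that(1)] small[OF that(2)] unfolding \<delta>_def[symmetric] by simp
      then have "c * (norm (v m - v n))\<^sup>2 < c * e\<^sup>2" by (simp add: \<delta>_def)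
      then have "(norm (v m - v n))\<^sup>2 < e\<^sup>2" using c(1) by simp
      then show ?thesis
        using \<open>0 < e\<close> by (simp add: dist_norm power_less_imp_less_base)
    qed
    then show "\<exists>M. \<forall>m\<ge>M. \<forall>n\<ge>M. dist (v m) (v n) < e" by blast
  qed
  then obtain u where u: "v \<longlonglongrightarrow> u" using Cauchy_convergent convergent_def by blast
  have uV: "u \<in> V" using V(2) v(1) u by (metis closed_sequentially)
  have "(\<lambda>n. J (v n)) \<longlonglongrightarrow> J u"
    unfolding J_def by (intro tendsto_intros b.tendsto F.tendsto u)
  moreover have "(\<lambda>n. \<mu> + 1 / real (Suc n)) \<longlonglongrightarrow> \<mu> + 0"
    by (intro tendsto_intros LIMSEQ_Suc lim_1_over_n)
  ultimately have Ju: "J u \<le> \<mu> + 0"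
    by (rule LIMSEQ_le) (use v(2) less_imp_le in blast)
  show ?thesis
  proof (intro bexI ballI)
    fix w assume w: "w \<in> V"
    have "0 \<le> 2 * t * (b u w - F w) + t\<^sup>2 * b w w" for t
    proof -
      have "u + t *\<^sub>R w \<in> V" using uV w V(1) by (intro subspace_add subspace_scale)
      from \<mu>_le[OF this] have "0 \<le> J (u + t *\<^sub>R w) - J u" using Ju by simp
      also have "\<dots> = 2 * t * (b u w - F w) + t\<^sup>2 * b w w"
        unfolding J_def symmetric_form_square_add[OF b sym] by (simp add: F.add F.scaleR algebra_simps)
      finally show ?thesis .
    qed
    from linear_le_quadratic_imp_zero[OF this] show "b u w = F w" by simp
  qed (rule uV)
qed

lemma orthogonal_projection:
  fixes V :: "'a::{real_inner, banach} set"
  assumes "subspace V" "closed V"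
  shows "\<exists>u\<in>V. \<forall>v\<in>V. inner (x - u) v = 0"
  using lax_milgram_symmetric[OF assms bounded_bilinear_inner inner_commute, of 1 "inner x"]
  by (simp add: power2_norm_eq_inner bounded_linear_inner_right inner_diff_left) metis

section \<open>The Banach algebra of bounded operators\<close>

text \<open>A copy of the bounded operators with composition as multiplication, so that the
  exponential series of a Banach algebra applies. The class \<open>perfect_space\<close> of the
  instances below excludes the zero space, on which 0 = 1 would hold.\<close>

typedef (overloaded) 'a bop = "UNIV :: ('a::real_normed_vector \<Rightarrow>\<^sub>L 'a) set" ..

setup_lifting type_definition_bop

instantiation bop :: ("{banach, perfect_space}") real_normed_algebra_1
begin

lift_definition zero_bop :: "'a bop" is 0 .
lift_definition one_bop :: "'a bop" is id_blinfun .
lift_definition plus_bop :: "'a bop \<Rightarrow> 'a bop \<Rightarrow> 'a bop" is "(+)" .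
lift_definition minus_bop :: "'a bop \<Rightarrow> 'a bop \<Rightarrow> 'a bop" is "(-)" .
lift_definition uminus_bop :: "'a bop \<Rightarrow> 'a bop" is uminus .
lift_definition scaleR_bop :: "real \<Rightarrow> 'a bop \<Rightarrow> 'a bop" is scaleR .
lift_definition times_bop :: "'a bop \<Rightarrow> 'a bop \<Rightarrow> 'a bop" is blinfun_compose .
lift_definition norm_bop :: "'a bop \<Rightarrow> real" is norm .
definition dist_bop :: "'a bop \<Rightarrow> 'a bop \<Rightarrow> real" where "dist_bop x y = norm (x - y)"
definition sgn_bop :: "'a bop \<Rightarrow> 'a bop" where "sgn_bop x = scaleR (inverse (norm x)) x"
definition uniformity_bop :: "('a bop \<times> 'a bop) filter"
  where "uniformity_bop = (INF e\<in>{0<..}. principal {(x, y). dist x y < e})"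
definition open_bop :: "'a bop set \<Rightarrow> bool"
  where "open_bop U \<longleftrightarrow> (\<forall>x\<in>U. \<forall>\<^sub>F (x', y) in uniformity. x' = x \<longrightarrow> y \<in> U)"

instance
proof
  fix a b c :: "'a bop" and r s :: real
  show "a + b + c = a + (b + c)" by transfer (rule add.assoc)
  show "a + b = b + a" by transfer (rule add.commute)
  show "0 + a = a" by transfer simp
  show "- a + a = 0" by transfer simp
  show "a - b = a + - b" by transfer simp
  show "r *\<^sub>R (a + b) = r *\<^sub>R a + r *\<^sub>R b" by transfer (rule scaleR_add_right)
  show "(r + s) *\<^sub>R a = r *\<^sub>R a + s *\<^sub>R a" by transfer (rule scaleR_add_left)
  show "r *\<^sub>R s *\<^sub>R a = (r * s) *\<^sub>R a" by transfer simp
  show "1 *\<^sub>R a = a" by transfer simp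
  show "dist a b = norm (a - b)" by (rule dist_bop_def)
  show "sgn a = scaleR (inverse (norm a)) a" by (rule sgn_bop_def)
  show "(uniformity :: ('a bop \<times> 'a bop) filter) = (INF e\<in>{0<..}. principal {(x, y). dist x y < e})"
    by (rule uniformity_bop_def)
  show "open U \<longleftrightarrow> (\<forall>x\<in>U. \<forall>\<^sub>F (x', y) in uniformity. x' = x \<longrightarrow> y \<in> U)" for U :: "'a bop set"
    by (rule open_bop_def)
  show "(norm a = 0) = (a = 0)" by transfer simp
  show "norm (a + b) \<le> norm a + norm b" by transfer (rule norm_triangle_ineq)
  show "norm (r *\<^sub>R a) = \<bar>r\<bar> * norm a" by transfer simp
  show "a * b * c = a * (b * c)" by transfer (auto intro: blinfun_eqI)
  show "(a + b) * c = a * c + b * c"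
    by transfer (auto intro!: blinfun_eqI simp: blinfun.bilinear_simps)
  show "a * (b + c) = a * b + a * c"
    by transfer (auto intro!: blinfun_eqI simp: blinfun.bilinear_simps)
  show "r *\<^sub>R a * b = r *\<^sub>R (a * b)"
    by transfer (auto intro!: blinfun_eqI simp: blinfun.bilinear_simps)
  show "a * r *\<^sub>R b = r *\<^sub>R (a * b)"
    by transfer (auto intro!: blinfun_eqI simp: blinfun.bilinear_simps)
  show "1 * a = a" by transfer (auto intro: blinfun_eqI)
  show "a * 1 = a" by transfer (auto intro: blinfun_eqI)
  show "(0 :: 'a bop) \<noteq> 1"
  proof transfer
    have "norm (id_blinfun :: 'a \<Rightarrow>\<^sub>L 'a) = 1" by (rule norm_blinfun_id)
    then show "(0 :: 'a \<Rightarrow>\<^sub>L 'a) \<noteq> id_blinfun" by (metis norm_zero zero_neq_one)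
  qed
  show "norm (a * b) \<le> norm a * norm b" by transfer (rule norm_blinfun_compose)
  show "norm (1 :: 'a bop) = 1" by transfer simp
qed

end

instance bop :: ("{banach, perfect_space}") banach
proof
  fix X :: "nat \<Rightarrow> 'a bop"
  have norm_diff: "norm (Rep_bop x - Rep_bop y) = norm (x - y)" for x y :: "'a bop"
    by (simp add: norm_bop.rep_eq minus_bop.rep_eq)
  assume "Cauchy X"
  then have "Cauchy (\<lambda>n. Rep_bop (X n))"
    by (simp add: Cauchy_def dist_norm norm_diff)
  then obtain L where L: "(\<lambda>n. Rep_bop (X n)) \<longlonglongrightarrow> L"
    using Cauchy_convergent convergent_def by blast
  have "norm (X n - Abs_bop L) = norm (Rep_bop (X n) - L)" for n
    by (metis norm_diff Abs_bop_inverse UNIV_I)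
  then have "X \<longlonglongrightarrow> Abs_bop L"
    using L by (simp add: LIMSEQ_iff)
  then show "convergent X" by (auto simp: convergent_def)
qed

lift_definition app :: "'a::real_normed_vector bop \<Rightarrow> 'a \<Rightarrow> 'a" is blinfun_apply .
lift_definition bop :: "('a::real_normed_vector \<Rightarrow> 'a) \<Rightarrow> 'a bop" is Blinfun .

lemma app_bop: "bounded_linear f \<Longrightarrow> app (bop f) = f"
  by transfer (rule bounded_linear_Blinfun_apply)

lemma bounded_bilinear_app: "bounded_bilinear (app :: 'a::{banach, perfect_space} bop \<Rightarrow> 'a \<Rightarrow> 'a)"
proof
  fix a b :: "'a bop" and x y :: 'a and r :: real
  show "app (a + b) x = app a x + app b x" by transfer (simp add: blinfun.add_left)
  show "app a (x + y) = app a x + app a y" by transfer (simp add: blinfun.add_right)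
  show "app (r *\<^sub>R a) x = r *\<^sub>R app a x" by transfer (simp add: blinfun.scaleR_left)
  show "app a (r *\<^sub>R x) = r *\<^sub>R app a x" by transfer (simp add: blinfun.scaleR_right)
  have "norm (app a x) \<le> norm a * norm x * 1" for a :: "'a bop" and x
    by transfer (simp add: norm_blinfun)
  then show "\<exists>K. \<forall>a x. norm (app (a :: 'a bop) x) \<le> norm a * norm x * K" by blast
qed

interpretation app: bounded_bilinear app by (rule bounded_bilinear_app)

lemma app_one [simp]: "app 1 x = x"
  by transfer simp

lemma app_times: "app (a * b) x = app a (app b x)"
  by transfer simp

lemma norm_app: "norm (app a x) \<le> norm a * norm x"
  by transfer (rule norm_blinfun)

lemma norm_bop_le: "bounded_linear f \<Longrightarrow> 0 \<le> K \<Longrightarrow> (\<And>x. norm (f x) \<le> K * norm x) \<Longrightarrow> norm (bop f) \<le> K"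
  by transfer (simp add: norm_blinfun_bound bounded_linear_Blinfun_apply)

lemma bop_eqI: "(\<And>x. app a x = app b x) \<Longrightarrow> a = b"
  by transfer (rule blinfun_eqI)

lemma exp_commute:
  fixes x y :: "'a::{real_normed_algebra_1, banach}"
  assumes "x * y = y * x"
  shows "exp x * y = y * exp x"
  by (simp add: exp_def suminf_mult[symmetric] summable_exp_generic suminf_mult2 power_commuting_commutes[OF assms])

text \<open>The scalar part commutes with C, so the exponential splits into exp(tC), of norm at most
  exp t, and the number exp(-t).\<close>

lemma norm_exp_contraction:
  fixes C :: "'a::{banach, perfect_space} bop"
  assumes "norm C \<le> 1" "0 \<le> t"
  shows "norm (exp (t *\<^sub>R (C - 1))) \<le> 1"
proof -
  have "t *\<^sub>R (C - 1) = t *\<^sub>R C + of_real (- t)"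
    by (simp add: of_real_def scaleR_diff_right)
  then have "exp (t *\<^sub>R (C - 1)) = exp (t *\<^sub>R C) * exp (of_real (- t))"
    using exp_add_commuting[of "t *\<^sub>R C" "of_real (- t)"] by (simp add: of_real_def)
  also have "norm \<dots> \<le> exp (norm (t *\<^sub>R C)) * norm (exp (of_real (- t)) :: 'a bop)"
    by (intro order.trans[OF norm_mult_ineq] mult_right_mono norm_exp) simp
  also have "\<dots> = exp (norm (t *\<^sub>R C)) * exp (- t)"
    by (simp only: exp_of_real norm_of_real abs_exp_cancel)
  also have "\<dots> \<le> exp t * exp (- t)"
    using assms by (intro mult_right_mono) (auto intro: mult_left_le)
  also have "\<dots> = 1" by (simp add: exp_minus_inverse)
  finally show ?thesis .
qed

section \<open>The semigroup generated by a maximal dissipative operator\<close>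

lemma closed_subspace_closure:
  fixes V :: "'a::real_normed_vector set"
  assumes "subspace V"
  shows "subspace (closure V)"
proof (rule subspaceI)
  show "0 \<in> closure V" using subspace_0[OF assms] closure_subset by blast
  fix x y assume "x \<in> closure V" "y \<in> closure V"
  then obtain X Y where XY: "\<And>n. X n \<in> V" "X \<longlonglongrightarrow> x" "\<And>n. Y n \<in> V" "Y \<longlonglongrightarrow> y"
    by (metis closure_sequential)
  then have "\<forall>n. X n + Y n \<in> V" "(\<lambda>n. X n + Y n) \<longlonglongrightarrow> x + y"
    using subspace_add[OF assms] by (auto intro: tendsto_add)
  then show "x + y \<in> closure V"
    unfolding closure_sequential by (intro exI[of _ "\<lambda>n. X n + Y n"]) simp
next
  fix c :: real and x assume "x \<in> closure V"
  then obtain X where X: "\<And>n. X n \<in> V" "X \<longlonglongrightarrow> x" by (metis closure_sequential)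
  then have "\<forall>n. c *\<^sub>R X n \<in> V" "(\<lambda>n. c *\<^sub>R X n) \<longlonglongrightarrow> c *\<^sub>R x"
    using subspace_scale[OF assms] by (auto intro: tendsto_intros)
  then show "c *\<^sub>R x \<in> closure V"
    unfolding closure_sequential by (intro exI[of _ "\<lambda>n. c *\<^sub>R X n"]) simp
qed

lemma inner_self_le_zero: "inner x x \<le> 0 \<Longrightarrow> x = 0"
  by (metis inner_ge_zero inner_eq_zero_iff order_antisym)

text \<open>The setting of the Lumer-Phillips theorem on a Hilbert space. Density of the domain is
  derived from the range condition in \<open>closure_D\<close>.\<close>

locale maximal_dissipative =
  fixes D :: "'a::{real_inner, banach, perfect_space} set" and A :: "'a \<Rightarrow> 'a"
  assumes subspace_D: "subspace D"
    and A_add: "x \<in> D \<Longrightarrow> y \<in> D \<Longrightarrow> A (x + y) = A x + A y"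
    and A_scale: "x \<in> D \<Longrightarrow> A (c *\<^sub>R x) = c *\<^sub>R A x"
    and dissipative: "x \<in> D \<Longrightarrow> inner (A x) x \<le> 0"
    and range_condition: "0 < l \<Longrightarrow> \<exists>x\<in>D. l *\<^sub>R x - A x = y"
begin

section \<open>Resolvents and density of the domain\<close>

lemma A_diff: "x \<in> D \<Longrightarrow> y \<in> D \<Longrightarrow> A (x - y) = A x - A y"
  using A_add[of x "- y"] A_scale[of y "- 1"] subspace_neg[OF subspace_D, of y] by simp

text \<open>Pairing l x - A x with x leaves at least l |x|^2 by dissipativity; Cauchy-Schwarz does
  the rest.\<close>

lemma norm_le_resolvent_eq:
  assumes "x \<in> D" "0 < l"
  shows "l * norm x \<le> norm (l *\<^sub>R x - A x)"
proof (cases "x = 0")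
  case False
  have "l * norm x * norm x \<le> inner (l *\<^sub>R x - A x) x"
    using dissipative[OF assms(1)] by (simp add: inner_diff_left power2_norm_eq_inner[symmetric] power2_eq_square)
  also have "\<dots> \<le> norm (l *\<^sub>R x - A x) * norm x" by (rule norm_cauchy_schwarz)
  finally show ?thesis using False by simp
qed (use A_scale[of x 0] assms in simp)

text \<open>The resolvent (l - A)^(-1); \<open>res\<close> and \<open>res_unique\<close> show that
  for l > 0 the choice is forced.\<close>

definition res :: "real \<Rightarrow> 'a \<Rightarrow> 'a"
  where "res l y = (SOME x. x \<in> D \<and> l *\<^sub>R x - A x = y)"

lemma res:
  assumes "0 < l"
  shows res_in: "res l y \<in> D" and res_eq: "l *\<^sub>R res l y - A (res l y) = y"
  unfolding res_def using someI_ex[of "\<lambda>x. x \<in> D \<and> l *\<^sub>R x - A x = y"] range_condition[OF assms, of y] by auto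

lemma res_unique:
  assumes "0 < l" "x \<in> D" "l *\<^sub>R x - A x = y"
  shows "res l y = x"
proof -
  have d: "res l y - x \<in> D" using assms res_in subspace_diff[OF subspace_D] by blast
  have "l *\<^sub>R (res l y - x) - A (res l y - x) = (l *\<^sub>R res l y - A (res l y)) - (l *\<^sub>R x - A x)"
    using assms(2) res_in[OF assms(1)] by (simp add: A_diff scaleR_diff_right)
  also have "\<dots> = y - y" by (simp only: assms(3) res_eq[OF assms(1)])
  finally show ?thesis using norm_le_resolvent_eq[OF d assms(1)] assms(1)
    by (simp add: mult_le_0_iff)
qed

lemma A_res: "0 < l \<Longrightarrow> A (res l y) = l *\<^sub>R res l y - y"
  using res_eq[of l y] by (simp add: algebra_simps)

lemma res_A:
  assumes "0 < l" "x \<in> D"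
  shows "res l (A x) = A (res l x)"
proof -
  have "l *\<^sub>R res l x - x \<in> D"
    using assms res_in by (intro subspace_diff[OF subspace_D] subspace_scale[OF subspace_D])
  moreover have "l *\<^sub>R (l *\<^sub>R res l x - x) - A (l *\<^sub>R res l x - x) = A x"
    using assms res_in[OF assms(1)] subspace_scale[OF subspace_D]
    by (simp add: A_diff A_scale A_res scaleR_diff_right)
  ultimately have "res l (A x) = l *\<^sub>R res l x - x"
    using assms(1) by (intro res_unique)
  then show ?thesis using assms by (simp add: A_res)
qed

lemma norm_res: "0 < l \<Longrightarrow> norm (l *\<^sub>R res l y) \<le> norm y"
  using norm_le_resolvent_eq[OF res_in[of l y], of l] by (simp add: res_eq)

lemma bounded_linear_res:
  assumes "0 < l"
  shows "bounded_linear (res l)"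
proof
  fix x y :: 'a and c :: real
  show "res l (x + y) = res l x + res l y"
    using assms res_in[OF assms] subspace_add[OF subspace_D]
    by (intro res_unique) (auto simp: A_add A_res scaleR_add_right)
  show "res l (c *\<^sub>R x) = c *\<^sub>R res l x"
    using assms res_in[OF assms] subspace_scale[OF subspace_D]
    by (intro res_unique) (auto simp: A_scale A_res scaleR_diff_right)
  have "norm (res l x) \<le> norm x * (1 / l)" for x
    using norm_res[OF assms, of x] assms by (simp add: field_simps)
  then show "\<exists>K. \<forall>x. norm (res l x) \<le> norm x * K" by blast
qed

text \<open>The resolvent identity, used once as it stands and once with l and m exchanged,
  expresses the same difference of resolvents by either product; the factor l - m cancels.\<close>

lemma res_commute:
  assumes "0 < l" "0 < m"
  shows "res l (res m x) = res m (res l x)"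
proof (cases "l = m")
  case False
  have *: "res m y = res l y + (l - m) *\<^sub>R res l (res m y)" if "0 < l" "0 < m" for l m y
  proof -
    interpret bounded_linear "res l" by (rule bounded_linear_res[OF that(1)])
    have "res l (y + (l - m) *\<^sub>R res m y) = res m y"
      using that res_in by (intro res_unique) (auto simp: A_res algebra_simps)
    then show ?thesis by (simp add: add scale)
  qed
  have "res m x - res l x = (l - m) *\<^sub>R res l (res m x)"
    using *[OF assms, of x] by (metis add_diff_cancel_left')
  moreover have "res l x - res m x = (m - l) *\<^sub>R res m (res l x)"
    using *[OF assms(2,1), of x] by (metis add_diff_cancel_left')
  ultimately have "(l - m) *\<^sub>R res l (res m x) = (l - m) *\<^sub>R res m (res l x)"
    by (metis minus_diff_eq scaleR_minus_left)
  then show ?thesis using False by simp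
qed simp

text \<open>Let z be the component of y orthogonal to the closure and x its resolvent at 1. As x
  lies in D, pairing x - A x = z with x gives 0, while dissipativity bounds the pairing below by
  |x|^2. Hence x and z vanish.\<close>

lemma closure_D: "closure D = UNIV"
proof -
  have "y \<in> closure D" for y
  proof -
    obtain p where p: "p \<in> closure D" "\<And>v. v \<in> closure D \<Longrightarrow> inner (y - p) v = 0"
      using orthogonal_projection[OF closed_subspace_closure[OF subspace_D] closed_closure] by blast
    define x where "x = res 1 (y - p)"
    have x: "x \<in> D" "x - A x = y - p" using res[of 1 "y - p"] by (auto simp: x_def)
    then have "inner (x - A x) x = 0" using p(2)[of x] closure_subset by auto
    then have "inner x x \<le> 0" using dissipative[OF x(1)] by (simp add: inner_diff_left)
    then have "x = 0" by (rule inner_self_le_zero)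
    then have "y = p" using x A_scale[of 0 0] by simp
    then show ?thesis using p by simp
  qed
  then show ?thesis by auto
qed

lemma approx_D:
  assumes "0 < e"
  obtains d where "d \<in> D" "norm (x - d) < e"
  using closure_D closure_approachable[of x D] assms by (auto simp: dist_norm norm_minus_commute)

section \<open>Yosida approximation\<close>

definition yl :: "nat \<Rightarrow> real" where "yl n = real (Suc n)"
definition yC :: "nat \<Rightarrow> 'a bop" where "yC n = bop (\<lambda>x. yl n *\<^sub>R res (yl n) x)"
text \<open>With l = n + 1 this is the Yosida approximation l A (l - A)^(-1), because A (l - A)^(-1)
  = l (l - A)^(-1) - 1. The part \<open>yC\<close> is a contraction, which is what makes
  \<open>yE\<close> contractive.\<close>

definition yA :: "nat \<Rightarrow> 'a bop" where "yA n = yl n *\<^sub>R (yC n - 1)"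
definition yE :: "nat \<Rightarrow> real \<Rightarrow> 'a bop" where "yE n t = exp (t *\<^sub>R yA n)"

lemma yl_pos [simp]: "0 < yl n" by (simp add: yl_def)

lemma bounded_linear_yC: "bounded_linear (\<lambda>x. yl n *\<^sub>R res (yl n) x)"
  by (rule bounded_linear_compose[OF bounded_linear_scaleR_right bounded_linear_res]) simp

lemma app_yC: "app (yC n) x = yl n *\<^sub>R res (yl n) x"
  unfolding yC_def by (simp add: app_bop bounded_linear_yC)

lemma norm_app_yC: "norm (app (yC n) x) \<le> norm x"
  unfolding app_yC by (rule norm_res) simp

text \<open>At a point d of the domain the error is the resolvent of A d, of norm at most |A d| / l.
  Contractivity of \<open>yC\<close> extends the convergence to the closure of the domain.\<close>

lemma app_yC_tendsto: "(\<lambda>n. app (yC n) x) \<longlonglongrightarrow> x"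
proof (rule LIMSEQ_I)
  fix e :: real assume "0 < e"
  obtain d where d: "d \<in> D" "norm (x - d) < e / 3" using approx_D[of "e/3"] \<open>0 < e\<close> by auto
  have "(\<lambda>n. norm (A d) * (1 / real (Suc n))) \<longlonglongrightarrow> norm (A d) * 0"
    by (intro tendsto_intros LIMSEQ_Suc lim_1_over_n)
  then have "\<forall>\<^sub>F n in sequentially. norm (A d) * (1 / real (Suc n)) < e / 3"
    using \<open>0 < e\<close> by (intro order_tendstoD(2)) auto
  then obtain N where N: "\<And>n. n \<ge> N \<Longrightarrow> norm (A d) * (1 / real (Suc n)) < e / 3"
    unfolding eventually_sequentially by blast
  have "norm (app (yC n) x - x) < e" if "n \<ge> N" for n
  proof -
    have "app (yC n) d - d = res (yl n) (A d)"
      using d by (simp add: app_yC A_res res_A)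
    also have "norm \<dots> \<le> norm (A d) * (1 / real (Suc n))"
    proof -
      have "yl n * norm (res (yl n) (A d)) \<le> norm (A d)"
        using norm_res[of "yl n" "A d"] by (simp add: abs_of_pos)
      then show ?thesis by (simp add: yl_def field_simps)
    qed
    finally have 1: "norm (app (yC n) d - d) < e / 3" using N[OF that] by (rule le_less_trans)
    have "norm (app (yC n) (x - d)) < e / 3"
      using norm_app_yC[of n "x - d"] d by simp
    moreover have "app (yC n) x - x = app (yC n) (x - d) + (app (yC n) d - d) - (x - d)"
      by (simp add: app.diff_right)
    ultimately show ?thesis
      using 1 d norm_triangle_ineq4[of "app (yC n) (x - d) + (app (yC n) d - d)" "x - d"]
        norm_triangle_ineq[of "app (yC n) (x - d)" "app (yC n) d - d"] by simp
  qed
  then show "\<exists>N. \<forall>n\<ge>N. norm (app (yC n) x - x) < e" by blast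
qed

lemma app_yA: "x \<in> D \<Longrightarrow> app (yA n) x = app (yC n) (A x)"
  by (simp add: yA_def app.scaleR_left app.diff_left app_yC res_A A_res)

lemma yA_commute: "yA n * yA m = yA m * yA n"
proof -
  have "yC n * yC m = yC m * yC n"
    by (rule bop_eqI) (simp add: app_times app_yC linear_cmul[OF bounded_linear.linear[OF bounded_linear_res]]
        res_commute[of "yl n" "yl m"] mult.commute)
  then show ?thesis by (simp add: yA_def algebra_simps)
qed

lemma norm_yE: "0 \<le> t \<Longrightarrow> norm (yE n t) \<le> 1"
  unfolding yE_def yA_def scaleR_scaleR
  by (intro norm_exp_contraction)
    (use bounded_linear_yC norm_res in \<open>auto simp: yC_def less_imp_le intro!: norm_bop_le\<close>)

lemma norm_app_yE: "0 \<le> t \<Longrightarrow> norm (app (yE n t) x) \<le> norm x"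
  using norm_app[of "yE n t" x] norm_yE[of t n] mult_right_mono[OF norm_yE[of t n] norm_ge_zero[of x]] by simp

lemma yE_deriv: "((\<lambda>t. app (yE n t) x) has_vector_derivative app (yE n t) (app (yA n) x)) (at t within T)"
  unfolding yE_def
  using bounded_linear.has_vector_derivative[OF app.bounded_linear_left exp_scaleR_has_vector_derivative_right]
  by (simp add: app_times)

text \<open>Interpolating between the two exponentials gives a curve whose derivative is a
  contraction applied to the difference of the generators at x. Commutation of the approximations is
  essential here.\<close>

lemma yE_diff:
  assumes "0 \<le> t"
  shows "norm (app (yE n t) x - app (yE m t) x) \<le> t * norm (app (yA n) x - app (yA m) x)"
proof -
  define B where "B = yA n - yA m"
  define f where "f s = app (exp (t *\<^sub>R yA m) * exp (s *\<^sub>R B)) x" for s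
  have comm: "(s *\<^sub>R yA n) * (s' *\<^sub>R yA m) = (s' *\<^sub>R yA m) * (s *\<^sub>R yA n)" for s s'
    by (simp add: yA_commute)
  \<comment> \<open>The left form has a single factor to differentiate in s; the right form is a
    product of contractions as long as 0 \<le> s \<le> t.\<close>
  have eq: "exp (t *\<^sub>R yA m) * exp (s *\<^sub>R B) = yE n s * yE m (t - s)" for s
  proof -
    have "exp (t *\<^sub>R yA m) * exp (s *\<^sub>R B) = exp (t *\<^sub>R yA m + s *\<^sub>R B)"
      by (rule exp_add_commuting[symmetric]) (simp add: B_def algebra_simps yA_commute)
    also have "t *\<^sub>R yA m + s *\<^sub>R B = s *\<^sub>R yA n + (t - s) *\<^sub>R yA m"
      by (simp add: B_def algebra_simps)
    also have "exp \<dots> = yE n s * yE m (t - s)"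
      unfolding yE_def by (rule exp_add_commuting[OF comm])
    finally show ?thesis .
  qed
  have "(f has_vector_derivative app (exp (t *\<^sub>R yA m) * (exp (s *\<^sub>R B) * B)) x) (at s within {0..t})" for s
    unfolding f_def
    by (intro bounded_linear.has_vector_derivative[OF app.bounded_linear_left]
        bounded_linear.has_vector_derivative[OF bounded_linear_mult_right] exp_scaleR_has_vector_derivative_right)
  then have der: "(f has_derivative (\<lambda>h. h *\<^sub>R app (yE n s * yE m (t - s)) (app B x))) (at s within {0..t})" for s
    unfolding has_vector_derivative_def by (simp add: mult.assoc[symmetric] eq app_times[of _ B])
  have "norm (f t - f 0) \<le> norm (app B x) * norm (t - 0)"
  proof (rule differentiable_bound[OF convex_real_interval(5) der])
    fix s assume s: "s \<in> {0..t}"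
    have "norm (app (yE n s * yE m (t - s)) (app B x)) \<le> norm (app B x)"
      using s by (auto simp: app_times intro!: order.trans[OF norm_app_yE])
    then show "onorm (\<lambda>h. h *\<^sub>R app (yE n s * yE m (t - s)) (app B x)) \<le> norm (app B x)"
      by (intro onorm_le) (simp add: mult.commute mult_left_mono)
  qed (use assms in auto)
  moreover have "f t = app (yE n t) x" "f 0 = app (yE m t) x"
    unfolding f_def eq by (simp_all add: yE_def)
  ultimately show ?thesis using assms by (simp add: B_def app.diff_left mult.commute)
qed

section \<open>The limit semigroup\<close>

definition sg :: "real \<Rightarrow> 'a \<Rightarrow> 'a" where "sg t x = lim (\<lambda>n. app (yE n t) x)"

lemma yA_tendsto: "x \<in> D \<Longrightarrow> (\<lambda>n. app (yA n) x) \<longlonglongrightarrow> A x"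
  by (simp add: app_yA app_yC_tendsto)

lemma yE_tendsto:
  assumes "0 \<le> t"
  shows "(\<lambda>n. app (yE n t) x) \<longlonglongrightarrow> sg t x"
proof -
  have "Cauchy (\<lambda>n. app (yE n t) x)"
  proof (rule metric_CauchyI)
    fix e :: real assume "0 < e"
    obtain d where d: "d \<in> D" "norm (x - d) < e / 3" using approx_D[of "e/3"] \<open>0 < e\<close> by auto
    have "Cauchy (\<lambda>n. app (yA n) d)" using yA_tendsto[OF d(1)] by (rule LIMSEQ_imp_Cauchy)
    \<comment> \<open>The divisor uses t + 1 because t may be 0.\<close>
    moreover have "0 < e / (3 * (t + 1))" using \<open>0 < e\<close> assms by simp
    ultimately obtain N where N: "\<And>m n. m \<ge> N \<Longrightarrow> n \<ge> N \<Longrightarrow> norm (app (yA m) d - app (yA n) d) < e / (3 * (t + 1))"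
      unfolding Cauchy_def dist_norm by metis
    have "dist (app (yE m t) x) (app (yE n t) x) < e" if mn: "m \<ge> N" "n \<ge> N" for m n
    proof -
      have "norm (app (yE m t) d - app (yE n t) d) \<le> t * norm (app (yA m) d - app (yA n) d)"
        by (rule yE_diff[OF assms])
      also have "\<dots> \<le> (t + 1) * norm (app (yA m) d - app (yA n) d)" by (rule mult_right_mono) auto
      also have "\<dots> < (t + 1) * (e / (3 * (t + 1)))"
        using assms by (intro mult_strict_left_mono N mn) auto
      also have "\<dots> = e / 3" using assms by (simp add: field_simps)
      finally have 1: "norm (app (yE m t) d - app (yE n t) d) < e / 3" .
      have "app (yE m t) x - app (yE n t) x =
        app (yE m t) (x - d) + (app (yE m t) d - app (yE n t) d) - app (yE n t) (x - d)"
        by (simp add: app.diff_right)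
      also have "norm \<dots> \<le> norm (app (yE m t) (x - d)) + norm (app (yE m t) d - app (yE n t) d)
          + norm (app (yE n t) (x - d))"
        by (intro order.trans[OF norm_triangle_ineq4] add_mono norm_triangle_ineq) simp
      also have "\<dots> < e"
        using 1 d(2) norm_app_yE[OF assms, of m "x - d"] norm_app_yE[OF assms, of n "x - d"] by linarith
      finally show ?thesis by (simp add: dist_norm)
    qed
    then show "\<exists>N. \<forall>m\<ge>N. \<forall>n\<ge>N. dist (app (yE m t) x) (app (yE n t) x) < e" by blast
  qed
  then show ?thesis
    unfolding sg_def using Cauchy_convergent convergent_LIMSEQ_iff by blast
qed

lemma norm_sg: "0 \<le> t \<Longrightarrow> norm (sg t x) \<le> norm x"
  by (rule LIMSEQ_le_const2[OF tendsto_norm[OF yE_tendsto]]) (auto simp: norm_app_yE)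

lemma sg_add: "0 \<le> t \<Longrightarrow> sg t (x + y) = sg t x + sg t y"
  by (rule LIMSEQ_unique[OF yE_tendsto]) (auto simp: app.add_right intro: tendsto_add yE_tendsto)

lemma sg_scale: "0 \<le> t \<Longrightarrow> sg t (c *\<^sub>R x) = c *\<^sub>R sg t x"
  by (rule LIMSEQ_unique[OF yE_tendsto]) (auto simp: app.scaleR_right intro: tendsto_scaleR yE_tendsto)

lemma bounded_linear_sg: "0 \<le> t \<Longrightarrow> bounded_linear (sg t)"
  by (rule bounded_linear_intro[of _ 1]) (auto simp: sg_add sg_scale norm_sg)

lemma sg_diff: "0 \<le> t \<Longrightarrow> sg t (x - y) = sg t x - sg t y"
  by (rule linear_diff[OF bounded_linear.linear[OF bounded_linear_sg]])

lemma sg_zero [simp]: "sg 0 x = x"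
  using yE_tendsto[of 0 x] by (simp add: yE_def LIMSEQ_const_iff)

lemma sg_semigroup:
  assumes "0 \<le> s" "0 \<le> t"
  shows "sg (s + t) x = sg s (sg t x)"
proof (rule LIMSEQ_unique[OF yE_tendsto])
  show "0 \<le> s + t" using assms by simp
  have eq: "app (yE n (s + t)) x = app (yE n s) (app (yE n t) x - sg t x) + app (yE n s) (sg t x)" for n
  proof -
    have "yE n (s + t) = yE n s * yE n t"
      unfolding yE_def scaleR_add_left by (rule exp_add_commuting) simp
    then show ?thesis by (simp add: app_times app.diff_right)
  qed
  have "(\<lambda>n. app (yE n t) x - sg t x) \<longlonglongrightarrow> 0"
    using yE_tendsto[OF assms(2)] by (simp add: LIM_zero)
  then have "(\<lambda>n. norm (app (yE n t) x - sg t x)) \<longlonglongrightarrow> 0" by (simp add: tendsto_norm_zero_iff)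
  then have "(\<lambda>n. app (yE n s) (app (yE n t) x - sg t x)) \<longlonglongrightarrow> 0"
    by (rule Lim_null_comparison[rotated]) (simp add: norm_app_yE assms)
  from tendsto_add[OF this yE_tendsto[OF assms(1), of "sg t x"]]
  show "(\<lambda>n. app (yE n (s + t)) x) \<longlonglongrightarrow> sg s (sg t x)" by (simp add: eq)
qed

lemma sg_yE:
  assumes "x \<in> D" "0 \<le> t"
  shows "norm (app (yE n t) x - sg t x) \<le> t * norm (app (yA n) x - A x)"
proof (rule LIMSEQ_le)
  show "(\<lambda>m. norm (app (yE n t) x - app (yE m t) x)) \<longlonglongrightarrow> norm (app (yE n t) x - sg t x)"
    by (intro tendsto_intros yE_tendsto assms)
  show "(\<lambda>m. t * norm (app (yA n) x - app (yA m) x)) \<longlonglongrightarrow> t * norm (app (yA n) x - A x)"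
    by (intro tendsto_intros yA_tendsto assms)
qed (use yE_diff[OF assms(2)] in blast)

text \<open>On the domain the error bound \<open>sg_yE\<close> grows linearly in t and is thus
  uniform on bounded intervals; density and contractivity reach every x.\<close>

lemma sg_uniform:
  assumes "0 < e"
  shows "\<forall>\<^sub>F n in sequentially. \<forall>t\<in>{0..T}. norm (app (yE n t) x - sg t x) < e"
proof -
  obtain d where d: "d \<in> D" "norm (x - d) < e / 3" using approx_D[of "e/3"] assms by auto
  have "(\<lambda>n. (\<bar>T\<bar> + 1) * norm (app (yA n) d - A d)) \<longlonglongrightarrow> (\<bar>T\<bar> + 1) * norm (A d - A d)"
    by (intro tendsto_intros yA_tendsto d)
  from order_tendstoD(2)[OF this, of "e / 3"]
  have "\<forall>\<^sub>F n in sequentially. (\<bar>T\<bar> + 1) * norm (app (yA n) d - A d) < e / 3"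
    using assms by simp
  then show ?thesis
  proof eventually_elim
    case (elim n)
    show ?case
    proof
    fix t assume "t \<in> {0..T}"
    then have t: "0 \<le> t" "t \<le> \<bar>T\<bar> + 1" by auto
    have "norm (app (yE n t) d - sg t d) \<le> (\<bar>T\<bar> + 1) * norm (app (yA n) d - A d)"
      using sg_yE[OF d(1) t(1), of n] mult_right_mono[OF t(2) norm_ge_zero] by (rule order.trans)
    then have 1: "norm (app (yE n t) d - sg t d) < e / 3" using elim by simp
    have "app (yE n t) x - sg t x = app (yE n t) (x - d) + (app (yE n t) d - sg t d) - sg t (x - d)"
      using t by (simp add: app.diff_right sg_diff)
    also have "norm \<dots> \<le> norm (app (yE n t) (x - d)) + norm (app (yE n t) d - sg t d) + norm (sg t (x - d))"
      by (intro order.trans[OF norm_triangle_ineq4] add_mono norm_triangle_ineq) simp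
    also have "\<dots> < e"
      using 1 d(2) norm_app_yE[OF t(1), of n "x - d"] norm_sg[OF t(1), of "x - d"] by linarith
    finally show "norm (app (yE n t) x - sg t x) < e" .
    qed
  qed
qed

text \<open>The derivatives of the approximating orbits converge uniformly on [0, T], so the limit
  may be differentiated termwise.\<close>

lemma sg_deriv:
  assumes "x \<in> D" and True: "t \<in> {0..T}"
  shows "((\<lambda>t. sg t x) has_vector_derivative sg t (A x)) (at t within {0..T})"
proof -
  have "\<exists>g. \<forall>t\<in>{0..T}. (\<lambda>n. app (yE n t) x) \<longlonglongrightarrow> g t \<and> (g has_derivative (\<lambda>h. h *\<^sub>R sg t (A x))) (at t within {0..T})"
  proof (rule has_derivative_sequence[where f' = "\<lambda>n t h. h *\<^sub>R app (yE n t) (app (yA n) x)" and ?x0.0 = t and l = "sg t x"])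
    show "((\<lambda>t. app (yE n t) x) has_derivative (\<lambda>h. h *\<^sub>R app (yE n t) (app (yA n) x))) (at t within {0..T})" for n t
      using yE_deriv[unfolded has_vector_derivative_def] .
    fix e :: real assume "0 < e"
    then have e: "0 < e / 2" by simp
    have "(\<lambda>n. norm (app (yA n) x - A x)) \<longlonglongrightarrow> norm (A x - A x)"
      by (intro tendsto_intros yA_tendsto assms)
    then have "\<forall>\<^sub>F n in sequentially. norm (app (yA n) x - A x) < e / 2"
      using e by (intro order_tendstoD(2)) auto
    with sg_uniform[OF e, of T "A x"]
    show "\<forall>\<^sub>F n in sequentially. \<forall>t\<in>{0..T}. \<forall>h. norm (h *\<^sub>R app (yE n t) (app (yA n) x) - h *\<^sub>R sg t (A x)) \<le> e * norm h"
    proof (eventually_elim, intro ballI allI)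
      fix n t and h :: real
      assume elim: "\<forall>t\<in>{0..T}. norm (app (yE n t) (A x) - sg t (A x)) < e / 2"
        "norm (app (yA n) x - A x) < e / 2" and "t \<in> {0..T}"
      then have t: "0 \<le> t" and u: "norm (app (yE n t) (A x) - sg t (A x)) < e / 2" by auto
      have "app (yE n t) (app (yA n) x) - sg t (A x) =
          app (yE n t) (app (yA n) x - A x) + (app (yE n t) (A x) - sg t (A x))"
        by (simp add: app.diff_right)
      also have "norm \<dots> \<le> e"
        using elim(2) u norm_app_yE[OF t, of n "app (yA n) x - A x"]
          norm_triangle_ineq[of "app (yE n t) (app (yA n) x - A x)" "app (yE n t) (A x) - sg t (A x)"]
        by linarith
      finally show "norm (h *\<^sub>R app (yE n t) (app (yA n) x) - h *\<^sub>R sg t (A x)) \<le> e * norm h"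
        unfolding scaleR_diff_right[symmetric] norm_scaleR by (simp add: mult.commute[of e] mult_left_mono)
    qed
  next
    show "(\<lambda>n. app (yE n t) x) \<longlonglongrightarrow> sg t x" using assms(2) by (intro yE_tendsto) auto
  qed (use True in auto)
  then obtain g where g: "\<And>t. t \<in> {0..T} \<Longrightarrow> (\<lambda>n. app (yE n t) x) \<longlonglongrightarrow> g t"
    "\<And>t. t \<in> {0..T} \<Longrightarrow> (g has_derivative (\<lambda>h. h *\<^sub>R sg t (A x))) (at t within {0..T})" by blast
  have "g t = sg t x" if "t \<in> {0..T}" for t
    using LIMSEQ_unique[OF g(1)[OF that] yE_tendsto] that by auto
  then show ?thesis
    unfolding has_vector_derivative_def by (intro has_derivative_transform[OF True _ g(2)[OF True]]) auto
qed

lemma continuous_on_sg: "continuous_on {0..T} (\<lambda>t. sg t x)"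
proof (rule uniform_limit_theorem[of _ "\<lambda>n t. app (yE n t) x" sequentially])
  show "\<forall>\<^sub>F n in sequentially. continuous_on {0..T} (\<lambda>t. app (yE n t) x)"
    by (intro always_eventually allI)
      (auto simp: continuous_on_eq_continuous_within intro: has_vector_derivative_continuous[OF yE_deriv])
  show "uniform_limit {0..T} (\<lambda>n t. app (yE n t) x) (\<lambda>t. sg t x) sequentially"
    by (rule uniform_limitI) (use sg_uniform in \<open>simp add: dist_norm\<close>)
qed simp

text \<open>Joint continuity is what makes Duhamel integrands measurable. The maximum with 0 gives a
  total function of time, since the limit is controlled for nonnegative times only.\<close>

lemma continuous_on_sg2: "continuous_on UNIV (\<lambda>(t, x). sg (max 0 t) x)"
  unfolding continuous_on_sequentially
proof (intro allI ballI impI)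
  fix X a assume "(\<forall>n. X n \<in> UNIV) \<and> X \<longlonglongrightarrow> (a :: real \<times> 'a)"
  then have "X \<longlonglongrightarrow> a" by simp
  obtain t x where a: "a = (t, x)" by (cases a)
  have 1: "(\<lambda>n. fst (X n)) \<longlonglongrightarrow> t" and 2: "(\<lambda>n. snd (X n)) \<longlonglongrightarrow> x"
    using tendsto_fst[OF \<open>X \<longlonglongrightarrow> a\<close>] tendsto_snd[OF \<open>X \<longlonglongrightarrow> a\<close>] a by auto
  define T where "T = max 0 t + 1"
  have 3: "(\<lambda>n. max 0 (fst (X n))) \<longlonglongrightarrow> max 0 t" by (intro tendsto_intros 1)
  have "\<forall>\<^sub>F n in sequentially. max 0 (fst (X n)) < T"
    using 3 by (rule order_tendstoD(2)) (simp add: T_def)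
  then have "\<forall>\<^sub>F n in sequentially. max 0 (fst (X n)) \<in> {0..T}" by eventually_elim simp
  then have "(\<lambda>n. sg (max 0 (fst (X n))) x) \<longlonglongrightarrow> sg (max 0 t) x"
    by (rule continuous_on_tendsto_compose[OF continuous_on_sg[of T x] 3, rotated]) (simp add: T_def)
  moreover have "(\<lambda>n. sg (max 0 (fst (X n))) (snd (X n) - x)) \<longlonglongrightarrow> 0"
  proof (rule Lim_null_comparison)
    show "(\<lambda>n. norm (snd (X n) - x)) \<longlonglongrightarrow> 0" using 2 by (simp add: LIM_zero tendsto_norm_zero)
  qed (simp add: norm_sg)
  ultimately have "(\<lambda>n. sg (max 0 (fst (X n))) (snd (X n) - x) + sg (max 0 (fst (X n))) x) \<longlonglongrightarrow> 0 + sg (max 0 t) x"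
    by (intro tendsto_add)
  then show "((\<lambda>(t, x). sg (max 0 t) x) \<circ> X) \<longlonglongrightarrow> (\<lambda>(t, x). sg (max 0 t) x) a"
    by (simp add: a sg_diff o_def case_prod_beta)
qed

section \<open>Identification of the generator and weak differentiability\<close>

lemma sg_res:
  assumes "0 \<le> t" "0 < l"
  shows "sg t (res l x) = res l (sg t x)"
proof (rule LIMSEQ_unique[OF yE_tendsto[OF assms(1)]])
  have R: "app (bop (res l)) x = res l x" for x
    using app_bop[OF bounded_linear_res[OF assms(2)]] by simp
  have "yC n * bop (res l) = bop (res l) * yC n" for n
    using assms by (intro bop_eqI)
     (simp add: app_times app_yC R res_commute[of l "yl n"] linear_cmul[OF bounded_linear.linear[OF bounded_linear_res]])
  then have "yE n t * bop (res l) = bop (res l) * yE n t" for n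
    unfolding yE_def by (intro exp_commute) (simp add: yA_def algebra_simps)
  then have "app (yE n t) (res l x) = res l (app (yE n t) x)" for n
    by (metis app_times R)
  then show "(\<lambda>n. app (yE n t) (res l x)) \<longlonglongrightarrow> res l (sg t x)"
    using bounded_linear.tendsto[OF bounded_linear_res[OF assms(2)] yE_tendsto[OF assms(1)]] by simp
qed

text \<open>A point of the domain is a value of the resolvent, and the resolvent commutes with the
  semigroup.\<close>

lemma sg_D:
  assumes "0 \<le> t" "x \<in> D"
  shows sg_in: "sg t x \<in> D" and A_sg: "A (sg t x) = sg t (A x)"
proof -
  have "res 1 (x - A x) = x" using assms by (intro res_unique) auto
  then have *: "sg t x = res 1 (sg t (x - A x))" using sg_res[OF assms(1), of 1 "x - A x"] by simp
  then show "sg t x \<in> D" using res_in[of 1] by simp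
  have "A (sg t x) = sg t x - sg t (x - A x)"
    by (subst (1 2) *) (simp add: A_res)
  then show "A (sg t x) = sg t (A x)" using assms by (simp add: sg_diff)
qed

lemma sg_right_deriv:
  assumes "x \<in> D"
  shows "((\<lambda>t. (1 / t) *\<^sub>R (sg t x - x)) \<longlongrightarrow> A x) (at_right 0)"
proof -
  have "((\<lambda>t. sg t x) has_vector_derivative A x) (at 0 within {0..1})"
    using sg_deriv[OF assms, of 0 1] by simp
  then have "((\<lambda>t. norm (sg t x - x - t *\<^sub>R A x) / \<bar>t\<bar>) \<longlongrightarrow> 0) (at_right 0)"
    by (simp add: has_vector_derivative_def has_derivative_iff_norm at_within_Icc_at_right)
  moreover have "\<forall>\<^sub>F t in at_right 0. norm (sg t x - x - t *\<^sub>R A x) / \<bar>t\<bar> = norm ((1 / t) *\<^sub>R (sg t x - x) - A x)"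
  proof (rule eventually_at_right_less[THEN eventually_mono])
    fix t :: real assume t: "0 < t"
    have "(1 / t) *\<^sub>R (sg t x - x) - A x = (1 / t) *\<^sub>R (sg t x - x - t *\<^sub>R A x)"
      using t by (simp add: scaleR_diff_right)
    then show "norm (sg t x - x - t *\<^sub>R A x) / \<bar>t\<bar> = norm ((1 / t) *\<^sub>R (sg t x - x) - A x)"
      by simp
  qed
  ultimately have "((\<lambda>t. norm ((1 / t) *\<^sub>R (sg t x - x) - A x)) \<longlongrightarrow> 0) (at_right 0)"
    by (rule Lim_transform_eventually)
  then show ?thesis
    by (simp add: tendsto_norm_zero_iff LIM_zero_iff)
qed

text \<open>Suppose the orbit of x has right derivative y at 0, and let z in D solve z - A z = x -
  y. Then the orbit of x - z has right derivative x - z at 0, a growth that a contraction semigroup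
  allows only if x = z.\<close>

lemma sg_generator:
  "D = {x. \<exists>y. ((\<lambda>t. (1 / t) *\<^sub>R (sg t x - x)) \<longlongrightarrow> y) (at_right 0)}"
proof (intro equalityI subsetI)
  fix x assume "x \<in> {x. \<exists>y. ((\<lambda>t. (1 / t) *\<^sub>R (sg t x - x)) \<longlongrightarrow> y) (at_right 0)}"
  then obtain y where y: "((\<lambda>t. (1 / t) *\<^sub>R (sg t x - x)) \<longlongrightarrow> y) (at_right 0)" by blast
  define z where "z = res 1 (x - y)"
  have z: "z \<in> D" "z - A z = x - y" using res[of 1 "x - y"] by (auto simp: z_def)
  have lim: "((\<lambda>t. (1 / t) *\<^sub>R (sg t x - x) - (1 / t) *\<^sub>R (sg t z - z)) \<longlongrightarrow> y - A z) (at_right 0)"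
    by (intro tendsto_diff y sg_right_deriv z)
  have ev: "\<forall>\<^sub>F t in at_right 0. (1 / t) *\<^sub>R (sg t x - x) - (1 / t) *\<^sub>R (sg t z - z) = (1 / t) *\<^sub>R (sg t (x - z) - (x - z))"
    by (rule eventually_at_right_less[THEN eventually_mono]) (simp add: sg_diff algebra_simps)
  have "y - A z = x - z" using z(2) by (simp add: algebra_simps)
  with Lim_transform_eventually[OF lim ev] have "((\<lambda>t. (1 / t) *\<^sub>R (sg t (x - z) - (x - z))) \<longlongrightarrow> x - z) (at_right 0)"
    by (simp only:)
  then have "((\<lambda>t. inner ((1 / t) *\<^sub>R (sg t (x - z) - (x - z))) (x - z)) \<longlongrightarrow> inner (x - z) (x - z)) (at_right 0)"
    by (intro tendsto_intros)
  moreover have "\<forall>\<^sub>F t in at_right 0. inner ((1 / t) *\<^sub>R (sg t (x - z) - (x - z))) (x - z) \<le> 0"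
  proof (rule eventually_at_right_less[THEN eventually_mono])
    fix t :: real assume "0 < t"
    have "inner (sg t (x - z)) (x - z) \<le> norm (sg t (x - z)) * norm (x - z)" by (rule norm_cauchy_schwarz)
    also have "\<dots> \<le> norm (x - z) * norm (x - z)" using \<open>0 < t\<close> by (intro mult_right_mono norm_sg) auto
    also have "\<dots> = inner (x - z) (x - z)" by (simp add: power2_norm_eq_inner[symmetric] power2_eq_square)
    finally show "inner ((1 / t) *\<^sub>R (sg t (x - z) - (x - z))) (x - z) \<le> 0"
      using \<open>0 < t\<close> by (simp add: inner_diff_left[of "sg t (x - z)"] mult_le_0_iff divide_le_0_iff)
  qed
  ultimately have "inner (x - z) (x - z) \<le> 0"
    by (rule tendsto_upperbound) simp
  then have "x - z = 0" by (rule inner_self_le_zero)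
  then have "x = z" by simp
  then show "x \<in> D" using z by simp
qed (use sg_right_deriv in blast)

text \<open>The hypothesis says that y is in the domain of the adjoint of A, with value z. The orbit
  of a general x need not be differentiable, but its pairing with y is: approximate x within the
  domain and differentiate the limit termwise.\<close>

lemma sg_weak_deriv:
  assumes yz: "\<And>x. x \<in> D \<Longrightarrow> inner (A x) y = inner x z" and "t \<in> {0..T}"
  shows "((\<lambda>t. inner (sg t x) y) has_real_derivative inner (sg t x) z) (at t within {0..T})"
proof -
  define X where "X n = app (yC n) x" for n
  have X: "X n \<in> D" "X \<longlonglongrightarrow> x" for n
  proof -
    show "X n \<in> D" unfolding X_def app_yC by (rule subspace_scale[OF subspace_D res_in[OF yl_pos]])
    have "X = (\<lambda>n. app (yC n) x)" by (auto simp: X_def)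
    then show "X \<longlonglongrightarrow> x" using app_yC_tendsto[of x] by simp
  qed
  have "\<exists>g. \<forall>t\<in>{0..T}. (\<lambda>n. inner (sg t (X n)) y) \<longlonglongrightarrow> g t \<and> (g has_derivative (\<lambda>h. h * inner (sg t x) z)) (at t within {0..T})"
  proof (rule has_derivative_sequence[where f' = "\<lambda>n t h. h * inner (sg t (X n)) z" and ?x0.0 = t and l = "inner (sg t x) y"])
    fix n t assume t: "t \<in> {0..T}"
    have "((\<lambda>t. inner (sg t (X n)) y) has_vector_derivative inner (sg t (A (X n))) y) (at t within {0..T})"
      using t by (intro bounded_linear.has_vector_derivative[OF bounded_linear_inner_left] sg_deriv X) auto
    moreover have "inner (sg t (A (X n))) y = inner (sg t (X n)) z"
      using t A_sg[of t "X n"] yz[OF sg_in[of t "X n"]] X(1)[of n] by simp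
    ultimately show "((\<lambda>t. inner (sg t (X n)) y) has_derivative (\<lambda>h. h * inner (sg t (X n)) z)) (at t within {0..T})"
      by (simp add: has_vector_derivative_def)
  next
    fix e :: real assume "0 < e"
    have "(\<lambda>n. norm (X n - x) * norm z) \<longlonglongrightarrow> norm (x - x) * norm z" by (intro tendsto_intros X)
    then have "\<forall>\<^sub>F n in sequentially. norm (X n - x) * norm z < e"
      using \<open>0 < e\<close> by (intro order_tendstoD(2)) auto
    then show "\<forall>\<^sub>F n in sequentially. \<forall>t\<in>{0..T}. \<forall>h. norm (h * inner (sg t (X n)) z - h * inner (sg t x) z) \<le> e * norm h"
    proof (eventually_elim, intro ballI allI)
      fix n t and h :: real
      assume elim: "norm (X n - x) * norm z < e" "t \<in> {0..T}"
      have "\<bar>inner (sg t (X n)) z - inner (sg t x) z\<bar> = \<bar>inner (sg t (X n - x)) z\<bar>"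
        using elim by (simp add: sg_diff inner_diff_left)
      also have "\<dots> \<le> norm (sg t (X n - x)) * norm z" by (rule Cauchy_Schwarz_ineq2)
      also have "\<dots> \<le> norm (X n - x) * norm z" using elim by (intro mult_right_mono norm_sg) auto
      finally have "\<bar>inner (sg t (X n)) z - inner (sg t x) z\<bar> \<le> e" using elim by simp
      then show "norm (h * inner (sg t (X n)) z - h * inner (sg t x) z) \<le> e * norm h"
        unfolding right_diff_distrib[symmetric] real_norm_def abs_mult by (simp add: mult.commute[of e] mult_left_mono)
    qed
  next
    show "(\<lambda>n. inner (sg t (X n)) y) \<longlonglongrightarrow> inner (sg t x) y"
      using assms(2) by (intro tendsto_intros bounded_linear.tendsto[OF bounded_linear_sg] X) auto
  qed (use assms in auto)
  then obtain g where g: "\<And>t. t \<in> {0..T} \<Longrightarrow> (\<lambda>n. inner (sg t (X n)) y) \<longlonglongrightarrow> g t"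
    "\<And>t. t \<in> {0..T} \<Longrightarrow> (g has_derivative (\<lambda>h. h * inner (sg t x) z)) (at t within {0..T})" by blast
  have "g t = inner (sg t x) y" if "t \<in> {0..T}" for t
    by (rule LIMSEQ_unique[OF g(1)[OF that]], intro tendsto_intros bounded_linear.tendsto[OF bounded_linear_sg] X)
      (use that in auto)
  then have "((\<lambda>t. inner (sg t x) y) has_derivative (\<lambda>h. h * inner (sg t x) z)) (at t within {0..T})"
    by (intro has_derivative_transform[OF assms(2) _ g(2)[OF assms(2)]]) auto
  then show ?thesis by (simp add: has_field_derivative_def mult.commute[of _ "inner (sg t x) z"])
qed

text \<open>A vector orthogonal to the range of A defines a conserved quantity. This yields
  invariance of closed subspaces and, for the zero operator, that the semigroup is the
  identity.\<close>

lemma sg_invariant: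
  assumes y: "\<And>x. x \<in> D \<Longrightarrow> inner (A x) y = 0" and "0 \<le> t"
  shows "inner (sg t x) y = inner x y"
proof -
  have "((\<lambda>t. inner (sg t x) y) has_derivative (\<lambda>h. 0)) (at s within {0..t})" if "s \<in> {0..t}" for s
    using sg_weak_deriv[of y 0 s t x] y that by (simp add: has_field_derivative_def lambda_zero)
  from Derivative.has_derivative_zero_unique[OF _ this, of t 0] assms(2) show ?thesis by simp
qed

end

section \<open>Uniqueness of the semigroup with a given generator\<close>

text \<open>The argument is the one for Baire's theorem: if no bound exists, every ball contains a
  smaller ball on which some \<open>T n\<close> is large.\<close>

lemma uniform_boundedness:
  fixes X :: "'a::banach set" and T :: "nat \<Rightarrow> 'a \<Rightarrow> 'b::real_normed_vector"
  assumes X: "subspace X" "closed X"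
    and add: "\<And>n x y. x \<in> X \<Longrightarrow> y \<in> X \<Longrightarrow> T n (x + y) = T n x + T n y"
    and scale: "\<And>n c x. x \<in> X \<Longrightarrow> T n (c *\<^sub>R x) = c *\<^sub>R T n x"
    and bdd: "\<And>n. \<exists>C. \<forall>x\<in>X. norm (T n x) \<le> C * norm x"
    and pointwise: "\<And>x. x \<in> X \<Longrightarrow> \<exists>C. \<forall>n. norm (T n x) \<le> C"
  shows "\<exists>M. \<forall>n. \<forall>x\<in>X. norm (T n x) \<le> M * norm x"
proof (rule ccontr)
  assume unb: "\<not> ?thesis"
  have diff: "T n (x - y) = T n x - T n y" if "x \<in> X" "y \<in> X" for n x y
    using add[of x "- y" n] scale[of y n "- 1"] subspace_neg[OF X(1) that(2)] that by simp
  have step: "\<exists>b. (fst b \<in> X \<and> 0 < snd b) \<and> snd b \<le> snd a / 2 \<and> cball (fst b) (snd b) \<subseteq> cball (fst a) (snd a) \<and>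
      (\<exists>n. \<forall>y\<in>cball (fst b) (snd b) \<inter> X. real k < norm (T n y))"
    if "fst a \<in> X \<and> 0 < snd a" for a :: "'a \<times> real" and k
  proof -
    obtain c r where a: "a = (c, r)" by (cases a)
    with that have c: "c \<in> X" "0 < r" by auto
    obtain n u where u: "u \<in> X" "2 * (real k + 1) / r * norm u < norm (T n u)"
      using unb by (meson not_le)
    have "u \<noteq> 0"
      using u scale[of u n 0] by auto
    \<comment> \<open>Scaled to length r/2, u gives |T n v| > k + 1. Since 2 T n v is the difference
      of the values at c + v and c - v, one of these two points inherits the bound.\<close>
    define v where "v = (r / 2 / norm u) *\<^sub>R u"
    have v: "v \<in> X" "norm v = r / 2"
      using u \<open>u \<noteq> 0\<close> c by (auto simp: v_def intro: subspace_scale[OF X(1)])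
    have "real k + 1 < norm (T n v)"
      using u c \<open>u \<noteq> 0\<close> by (simp add: v_def scale field_simps)
    moreover have "2 *\<^sub>R T n v = T n (c + v) - T n (c - v)"
      using c v by (simp add: add diff scaleR_2)
    then have "2 * norm (T n v) \<le> norm (T n (c + v)) + norm (T n (c - v))"
      by (metis norm_scaleR norm_triangle_ineq4 abs_numeral)
    ultimately have "real k + 1 < norm (T n (c + v)) \<or> real k + 1 < norm (T n (c - v))" by linarith
    then obtain w where w: "w = c + v \<or> w = c - v" "real k + 1 < norm (T n w)" by blast
    have wX: "w \<in> X" using w c v X(1) by (auto intro: subspace_add subspace_diff)
    have wc: "dist c w = r / 2" using w v by (auto simp: dist_norm)
    obtain C where C: "\<And>x. x \<in> X \<Longrightarrow> norm (T n x) \<le> C * norm x" using bdd[of n] by blast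
    \<comment> \<open>The first bound keeps the new ball inside the old one and halves the radius;
      by the second, T n varies by at most 1 on it, so that of k + 1 at least k remains.\<close>
    define r' where "r' = min (r / 2) (1 / (\<bar>C\<bar> + 1))"
    have r': "0 < r'" "r' \<le> r / 2" "r' \<le> 1 / (\<bar>C\<bar> + 1)" using c by (auto simp: r'_def)
    have "real k < norm (T n y)" if "y \<in> cball w r'" "y \<in> X" for y
    proof -
      have "norm (T n w - T n y) \<le> C * norm (w - y)"
        using that wX by (subst diff[symmetric]) (auto intro!: C subspace_diff[OF X(1)])
      also have "\<dots> \<le> (\<bar>C\<bar> + 1) * r'"
        using that by (intro mult_mono) (auto simp: dist_norm)
      also have "\<dots> \<le> (\<bar>C\<bar> + 1) * (1 / (\<bar>C\<bar> + 1))"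
        using r' by (intro mult_left_mono) auto
      also have "\<dots> = 1" by simp
      finally show ?thesis using w(2) norm_triangle_ineq2[of "T n w" "T n y"] by linarith
    qed
    moreover have "cball w r' \<subseteq> cball c r"
    proof
      fix y assume "y \<in> cball w r'"
      then show "y \<in> cball c r" using wc r' dist_triangle[of c y w] by simp
    qed
    ultimately show ?thesis
      using wX r' unfolding a by (intro exI[of _ "(w, r')"]) (auto intro!: exI[of _ n])
  qed
  have "\<exists>f. \<forall>k. (fst (f k) \<in> X \<and> 0 < snd (f k)) \<and>
      (snd (f (Suc k)) \<le> snd (f k) / 2 \<and> cball (fst (f (Suc k))) (snd (f (Suc k))) \<subseteq> cball (fst (f k)) (snd (f k)) \<and>
      (\<exists>n. \<forall>y\<in>cball (fst (f (Suc k))) (snd (f (Suc k))) \<inter> X. real k < norm (T n y)))"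
    using subspace_0[OF X(1)] by (intro dependent_nat_choice[where P = "\<lambda>_ a. fst a \<in> X \<and> 0 < snd a"] exI[of _ "(0, 1)"] step) auto
  then obtain f where f: "\<And>k. fst (f k) \<in> X" "\<And>k. 0 < snd (f k)" "\<And>k. snd (f (Suc k)) \<le> snd (f k) / 2"
    "\<And>k. cball (fst (f (Suc k))) (snd (f (Suc k))) \<subseteq> cball (fst (f k)) (snd (f k))"
    "\<And>k. \<exists>n. \<forall>y\<in>cball (fst (f (Suc k))) (snd (f (Suc k))) \<inter> X. real k < norm (T n y)"
    by blast
  define S where "S k = cball (fst (f k)) (snd (f k)) \<inter> X" for k
  have dec: "decseq S" using f(4) by (intro decseq_SucI) (auto simp: S_def)
  have rad: "snd (f k) \<le> snd (f 0) * (1/2)^k" for k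
  proof (induction k)
    case (Suc k)
    then show ?case using f(3)[of k] by simp
  qed simp
  have "\<exists>x. \<forall>k. x \<in> S k"
  proof (rule decreasing_closed_nest)
    show "closed (S k)" for k using X by (auto simp: S_def)
    show "S k \<noteq> {}" for k 
    proof -
      have "fst (f k) \<in> S k" using f(1,2)[of k] by (simp add: S_def less_imp_le)
      then show ?thesis by blast
    qed
    show "S m \<subseteq> S k" if "k \<le> m" for k m using dec that by (auto simp: decseq_def)
    fix e :: real assume "0 < e"
    have "(\<lambda>k. snd (f 0) * (1/2)^k) \<longlonglongrightarrow> snd (f 0) * 0"
      by (intro tendsto_intros LIMSEQ_realpow_zero) auto
    from order_tendstoD(2)[OF this, of "e / 2"] obtain k where k: "snd (f 0) * (1/2)^k < e / 2"
      using \<open>0 < e\<close> by (auto simp: eventually_sequentially)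
    have "dist x y < e" if "x \<in> S k" "y \<in> S k" for x y
      using that dist_triangle2[of x y "fst (f k)"] rad[of k] k by (auto simp: S_def dist_commute)
    then show "\<exists>n. \<forall>x\<in>S n. \<forall>y\<in>S n. dist x y < e" by blast
  next
    fix x assume "\<And>k. x \<in> S k"
    then show ?thesis by blast
  qed
  then obtain x where x: "\<And>k. x \<in> S k" by blast
  then have "x \<in> X" by (auto simp: S_def)
  from pointwise[OF this] obtain C where C: "\<And>n. norm (T n x) \<le> C" by blast
  obtain k where k: "C < real k" using reals_Archimedean2 by blast
  obtain n where "\<forall>y\<in>S (Suc k). real k < norm (T n y)"
    using f(5)[of k] unfolding S_def by blast
  then have "real k < norm (T n x)" using x by blast
  then show False using C[of n] k by simp
qed

context
  fixes X :: "'a::banach set" and S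
  assumes X: "subspace X" "closed X" and S: "c0_semigroup X S"
begin

section \<open>Orbits of an arbitrary C0-semigroup\<close>

lemma c0_semigroupD:
  assumes "0 \<le> t" "x \<in> X"
  shows c0_in: "S t x \<in> X"
    and c0_add: "y \<in> X \<Longrightarrow> S t (x + y) = S t x + S t y"
    and c0_scale: "S t (c *\<^sub>R x) = c *\<^sub>R S t x"
    and c0_zero: "S 0 x = x"
    and c0_semigroup_add: "0 \<le> s \<Longrightarrow> S (s + t) x = S s (S t x)"
    and c0_lim: "((\<lambda>t. S t x) \<longlongrightarrow> x) (at_right 0)"
  using S assms unfolding c0_semigroup_def by blast+

lemma c0_diff: "0 \<le> t \<Longrightarrow> x \<in> X \<Longrightarrow> y \<in> X \<Longrightarrow> S t (x - y) = S t x - S t y"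
  using c0_add[of t x "- y"] c0_scale[of t y "- 1"] subspace_neg[OF X(1), of y] by simp

lemma c0_bounded:
  assumes "0 \<le> t"
  obtains C where "0 < C" "\<And>x. x \<in> X \<Longrightarrow> norm (S t x) \<le> C * norm x"
proof -
  have "\<forall>t\<ge>0. \<exists>C. \<forall>x\<in>X. norm (S t x) \<le> C * norm x"
    using S by (simp add: c0_semigroup_def)
  with assms obtain C where C: "\<And>x. x \<in> X \<Longrightarrow> norm (S t x) \<le> C * norm x"
    by metis
  have "norm (S t x) \<le> (\<bar>C\<bar> + 1) * norm x" if "x \<in> X" for x
  proof -
    have "C * norm x \<le> (\<bar>C\<bar> + 1) * norm x" by (rule mult_right_mono) auto
    then show ?thesis using C[OF that] by linarith
  qed
  then show ?thesis using that[of "\<bar>C\<bar> + 1"] by simp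
qed

lemma c0_near_zero:
  assumes "x \<in> X" "0 < e"
  obtains b where "0 < b" "\<And>t. 0 \<le> t \<Longrightarrow> t < b \<Longrightarrow> norm (S t x - x) < e"
proof -
  have "\<forall>\<^sub>F t in at_right 0. dist (S t x) x < e"
    using c0_lim[of 0 x] assms by (intro tendstoD) auto
  then obtain b where b: "0 < b" "\<And>t. 0 < t \<Longrightarrow> t < b \<Longrightarrow> dist (S t x) x < e"
    unfolding eventually_at_right_field by auto
  have "norm (S t x - x) < e" if "0 \<le> t" "t < b" for t
    using b(2)[of t] that assms c0_zero[of 0 x] by (cases "t = 0") (auto simp: dist_norm)
  then show ?thesis using that b by blast
qed

text \<open>Otherwise there are times t n tending to 0 at which the operator norm exceeds n. Strong
  continuity at 0 makes every orbit bounded along these times, contradicting uniform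
  boundedness.\<close>

lemma c0_locally_bounded: "\<exists>\<delta>>0. \<exists>M. \<forall>t\<in>{0..\<delta>}. \<forall>x\<in>X. norm (S t x) \<le> M * norm x"
proof (rule ccontr)
  assume *: "\<not> ?thesis"
  have "\<exists>t x. 0 \<le> t \<and> t \<le> 1 / real (Suc n) \<and> x \<in> X \<and> real n * norm x < norm (S t x)" for n
  proof -
    have "\<not> (\<forall>t\<in>{0..1 / real (Suc n)}. \<forall>x\<in>X. norm (S t x) \<le> real n * norm x)"
      using * by (metis of_nat_0_less_iff zero_less_Suc zero_less_divide_1_iff)
    then show ?thesis by (auto simp: not_le)
  qed
  then obtain t x where tx: "\<And>n. 0 \<le> t n" "\<And>n. t n \<le> 1 / real (Suc n)" "\<And>n. x n \<in> X"
    "\<And>n. real n * norm (x n) < norm (S (t n) (x n))"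
    by metis
  have t0: "t \<longlonglongrightarrow> 0"
    by (rule real_tendsto_sandwich[OF _ _ tendsto_const LIMSEQ_Suc[OF lim_1_over_n]]) (use tx in auto)
  have "\<exists>M. \<forall>n. \<forall>x\<in>X. norm (S (t n) x) \<le> M * norm x"
  proof (rule uniform_boundedness[OF X])
    fix y assume y: "y \<in> X"
    have "(\<lambda>n. S (t n) y) \<longlonglongrightarrow> y"
    proof (rule LIMSEQ_I)
      fix e :: real assume "0 < e"
      obtain b where b: "0 < b" "\<And>t. 0 \<le> t \<Longrightarrow> t < b \<Longrightarrow> norm (S t y - y) < e"
        using c0_near_zero[OF y \<open>0 < e\<close>] by blast
      have "\<forall>\<^sub>F n in sequentially. t n < b" using t0 b(1) by (rule order_tendstoD)
      then show "\<exists>N. \<forall>n\<ge>N. norm (S (t n) y - y) < e"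
        using b(2) tx(1) unfolding eventually_sequentially by blast
    qed
    then show "\<exists>C. \<forall>n. norm (S (t n) y) \<le> C"
      using convergent_imp_Bseq by (metis BseqE convergent_def)
  next
    fix n show "\<exists>C. \<forall>x\<in>X. norm (S (t n) x) \<le> C * norm x"
      using c0_bounded[OF tx(1)] by metis
  qed (use c0_add c0_scale tx in auto)
  then obtain M where M: "\<And>n x. x \<in> X \<Longrightarrow> norm (S (t n) x) \<le> M * norm x" by blast
  obtain n where n: "M < real n" using reals_Archimedean2 by blast
  have "real n * norm (x n) < M * norm (x n)" using tx(3,4)[of n] M by (meson less_le_trans)
  then show False using n by (meson mult_right_mono norm_ge_zero not_less order_less_imp_le)
qed

lemma c0_continuous_on:
  assumes x: "x \<in> X"
  shows "continuous_on {0..} (\<lambda>t. S t x)"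
  unfolding continuous_on_iff
proof (intro ballI allI impI)
  fix t e :: real assume t: "t \<in> {0..}" and "0 < e"
  obtain \<delta> M where \<delta>: "0 < \<delta>" and M: "\<And>s y. 0 \<le> s \<Longrightarrow> s \<le> \<delta> \<Longrightarrow> y \<in> X \<Longrightarrow> norm (S s y) \<le> M * norm y"
    using c0_locally_bounded by (metis atLeastAtMost_iff)
  \<comment> \<open>Right continuity at t needs a bound for S t only, but left continuity needs one
    for all S s with s slightly below t. Each such s is t0 plus a step of length at most \<delta>,
    so local boundedness at 0 provides it.\<close>
  define t0 where "t0 = max 0 (t - \<delta>)"
  have "0 \<le> t0" by (simp add: t0_def)
  then obtain C where C: "0 < C" "\<And>x. x \<in> X \<Longrightarrow> norm (S t0 x) \<le> C * norm x"
    using c0_bounded by metis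
  define K where "K = (\<bar>M\<bar> + 1) * C"
  have "0 < K" using C by (simp add: K_def)
  have K: "norm (S s y) \<le> K * norm y" if "t0 \<le> s" "s \<le> t" "y \<in> X" for s y
  proof -
    have s: "0 \<le> s - t0" "s - t0 \<le> \<delta>" using that by (auto simp: t0_def)
    have "S s y = S (s - t0) (S t0 y)"
      using c0_semigroup_add[OF \<open>0 \<le> t0\<close> that(3) s(1)] by simp
    also have "norm \<dots> \<le> M * norm (S t0 y)" using \<open>0 \<le> t0\<close> that by (intro M s c0_in)
    also have "\<dots> \<le> (\<bar>M\<bar> + 1) * (C * norm y)"
      using C that by (intro mult_mono) auto
    finally show ?thesis by (simp add: K_def mult.assoc)
  qed
  obtain b where b: "0 < b" "\<And>t. 0 \<le> t \<Longrightarrow> t < b \<Longrightarrow> norm (S t x - x) < e / K"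
    using c0_near_zero[OF x, of "e / K"] \<open>0 < e\<close> \<open>0 < K\<close> by auto
  have "dist (S s x) (S t x) < e" if s: "s \<in> {0..}" "dist s t < min b \<delta>" for s
  proof (cases "t \<le> s")
    case True
    have "S s x - S t x = S t (S (s - t) x - x)"
      using c0_semigroup_add[of "s - t" x t] True t x c0_in[of "s - t" x] by (simp add: c0_diff)
    then have "dist (S s x) (S t x) \<le> K * norm (S (s - t) x - x)"
      using K[of t "S (s - t) x - x"] t True x by (simp add: dist_norm t0_def c0_in subspace_diff[OF X(1)] \<delta> less_imp_le)
    also have "\<dots> < K * (e / K)"
      using b(2)[of "s - t"] s True \<open>0 < K\<close> by (intro mult_strict_left_mono) (auto simp: dist_real_def)
    finally show ?thesis using \<open>0 < K\<close> by simp
  next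
    case False
    then have s': "t0 \<le> s" "s \<le> t" using s by (auto simp: t0_def dist_real_def)
    have "S t x - S s x = S s (S (t - s) x - x)"
      using c0_semigroup_add[of "t - s" x s] False s x c0_in[of "t - s" x] by (simp add: c0_diff)
    then have "dist (S t x) (S s x) \<le> K * norm (S (t - s) x - x)"
      using K[OF s', of "S (t - s) x - x"] s' x by (simp add: dist_norm c0_in subspace_diff[OF X(1)])
    also have "\<dots> < K * (e / K)"
      using b(2)[of "t - s"] s s' \<open>0 < K\<close> by (intro mult_strict_left_mono) (auto simp: dist_real_def)
    finally show ?thesis using \<open>0 < K\<close> by (simp add: dist_commute)
  qed
  moreover have "0 < min b \<delta>" using b \<delta> by simp
  ultimately show "\<exists>d>0. \<forall>s\<in>{0..}. dist s t < d \<longrightarrow> dist (S s x) (S t x) < e" by blast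
qed

text \<open>The vector S (t + h) x is both S t (S h x) and S h (S t x). Dividing increments by h,
  the first form shows that the limit exists and the second that S t x lies in the domain.\<close>

lemma generator_right_deriv:
  assumes gen: "generated_by X S D A" and "x \<in> D" "0 \<le> t"
  shows "S t x \<in> D" "A x \<in> X" "A (S t x) = S t (A x)"
    "((\<lambda>h. (1 / h) *\<^sub>R (S (t + h) x - S t x)) \<longlongrightarrow> A (S t x)) (at_right 0)"
proof -
  have x: "x \<in> X" and lim: "((\<lambda>h. (1 / h) *\<^sub>R (S h x - x)) \<longlongrightarrow> A x) (at_right 0)"
    using gen assms(2) by (auto simp: generated_by_def)
  obtain y where "y \<in> X" "((\<lambda>h. (1 / h) *\<^sub>R (S h x - x)) \<longlongrightarrow> y) (at_right 0)"
    using gen assms(2) by (auto simp: generated_by_def)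
  then show Ax: "A x \<in> X"
    using tendsto_unique[OF trivial_limit_at_right_real lim] by metis
  obtain C where C: "0 < C" "\<And>x. x \<in> X \<Longrightarrow> norm (S t x) \<le> C * norm x"
    using c0_bounded[OF assms(3)] by metis
  have eq: "(1 / h) *\<^sub>R (S (t + h) x - S t x) - S t (A x) = S t ((1 / h) *\<^sub>R (S h x - x) - A x)"
    "S (t + h) x = S h (S t x)" "(1 / h) *\<^sub>R (S h x - x) - A x \<in> X" if "0 < h" for h
  proof -
    have h: "S h x \<in> X" "S h x - x \<in> X" "(1 / h) *\<^sub>R (S h x - x) \<in> X"
      using that x X(1) by (auto intro!: c0_in subspace_diff subspace_scale)
    show "(1 / h) *\<^sub>R (S (t + h) x - S t x) - S t (A x) = S t ((1 / h) *\<^sub>R (S h x - x) - A x)"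
      using h Ax x assms(3) that c0_semigroup_add[of h x t] by (simp add: c0_diff c0_scale)
    show "S (t + h) x = S h (S t x)"
      using c0_semigroup_add[of t x h] assms(3) that x by (simp add: add.commute)
    show "(1 / h) *\<^sub>R (S h x - x) - A x \<in> X" using h Ax by (intro subspace_diff[OF X(1)])
  qed
  have "((\<lambda>h. (1 / h) *\<^sub>R (S (t + h) x - S t x) - S t (A x)) \<longlongrightarrow> 0) (at_right 0)"
  proof (rule Lim_null_comparison)
    have "((\<lambda>h. norm ((1 / h) *\<^sub>R (S h x - x) - A x)) \<longlongrightarrow> norm (A x - A x)) (at_right 0)"
      by (intro tendsto_intros lim)
    then have "((\<lambda>h. C * norm ((1 / h) *\<^sub>R (S h x - x) - A x)) \<longlongrightarrow> C * norm (A x - A x)) (at_right 0)"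
      by (rule tendsto_mult_left)
    then show "((\<lambda>h. C * norm ((1 / h) *\<^sub>R (S h x - x) - A x)) \<longlongrightarrow> 0) (at_right 0)" by simp
    show "\<forall>\<^sub>F h in at_right 0. norm ((1 / h) *\<^sub>R (S (t + h) x - S t x) - S t (A x)) \<le> C * norm ((1 / h) *\<^sub>R (S h x - x) - A x)"
      by (rule eventually_at_right_less[THEN eventually_mono]) (simp only: eq(1) C(2)[OF eq(3)])
  qed
  then have lim': "((\<lambda>h. (1 / h) *\<^sub>R (S (t + h) x - S t x)) \<longlongrightarrow> S t (A x)) (at_right 0)"
    by (rule LIM_zero_cancel)
  have "\<forall>\<^sub>F h in at_right 0. (1 / h) *\<^sub>R (S (t + h) x - S t x) = (1 / h) *\<^sub>R (S h (S t x) - S t x)"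
    by (rule eventually_at_right_less[THEN eventually_mono]) (simp only: eq(2))
  with lim' have lim'': "((\<lambda>h. (1 / h) *\<^sub>R (S h (S t x) - S t x)) \<longlongrightarrow> S t (A x)) (at_right 0)"
    by (rule Lim_transform_eventually)
  then show D: "S t x \<in> D"
    using gen c0_in[OF assms(3)] x Ax unfolding generated_by_def by blast
  then have "((\<lambda>h. (1 / h) *\<^sub>R (S h (S t x) - S t x)) \<longlongrightarrow> A (S t x)) (at_right 0)"
    using gen by (auto simp: generated_by_def)
  then show "A (S t x) = S t (A x)"
    using tendsto_unique[OF trivial_limit_at_right_real _ lim''] by metis
  then show "((\<lambda>h. (1 / h) *\<^sub>R (S (t + h) x - S t x)) \<longlongrightarrow> A (S t x)) (at_right 0)"
    using lim' by simp
qed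

end

text \<open>Only one-sided information is at hand, so a supremum argument replaces the mean value
  theorem: the bound f s \<le> f 0 + e s holds on a largest initial interval, and the hypothesis
  would extend it beyond any right end below T.\<close>

lemma nonincreasing_if_right_deriv_nonpos:
  fixes f :: "real \<Rightarrow> real"
  assumes "0 \<le> T" and cont: "continuous_on {0..T} f"
    and right: "\<And>t e. 0 \<le> t \<Longrightarrow> t < T \<Longrightarrow> 0 < e \<Longrightarrow> \<forall>\<^sub>F h in at_right 0. f (t + h) - f t \<le> e * h"
  shows "f T \<le> f 0"
proof (rule field_le_epsilon)
  fix e' :: real assume "0 < e'"
  define e where "e = e' / (T + 1)"
  have "0 < e" using \<open>0 < e'\<close> assms(1) by (simp add: e_def)
  define E where "E = {t \<in> {0..T}. f t - e * t \<le> f 0}"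
  define B where "B = {t \<in> {0..T}. {0..t} \<subseteq> E}"
  have clE: "closed E"
  proof -
    have "closed ({0..T} \<inter> (\<lambda>t. f t - e * t) -` {..f 0})"
      by (intro continuous_closed_preimage continuous_intros cont)
    then show ?thesis by (simp add: E_def vimage_def Int_def)
  qed
  have B0: "0 \<in> B" using assms(1) by (simp add: B_def E_def)
  have bdd: "bdd_above B" by (auto simp: B_def)
  define c where "c = Sup B"
  have c: "0 \<le> c"
    using cSup_upper[OF B0 bdd] by (simp add: c_def)
  have "c \<le> T"
    unfolding c_def using B0 by (intro cSup_least) (auto simp: B_def)
  note c = c this
  have below: "s \<in> E" if "0 \<le> s" "s < c" for s
  proof -
    have "\<exists>t\<in>B. s < t" using that less_cSup_iff[OF _ bdd, of s] B0 by (auto simp: c_def)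
    then show ?thesis using that by (auto simp: B_def)
  qed
  have "{0..c} \<subseteq> E"
  proof (cases "c = 0")
    case False
    then have "closure {0..<c} \<subseteq> E" using below clE by (intro closure_minimal) auto
    then show ?thesis using False c by simp
  qed (use B0 in \<open>auto simp: B_def\<close>)
  have "c = T"
  proof (rule ccontr)
    assume "c \<noteq> T"
    then have "c < T" using c by simp
    obtain b where b: "0 < b" "\<And>h. 0 < h \<Longrightarrow> h < b \<Longrightarrow> f (c + h) - f c \<le> e * h"
      using right[OF c(1) \<open>c < T\<close> \<open>0 < e\<close>] unfolding eventually_at_right_field by auto
    define s where "s = min T (c + b / 2)"
    have s: "c < s" "s \<le> T" "s < c + b" using b \<open>c < T\<close> by (auto simp: s_def)
    have "u \<in> E" if "u \<in> {0..s}" for u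
    proof (cases "u \<le> c")
      case False
      have "f (c + (u - c)) - f c \<le> e * (u - c)" using b(2)[of "u - c"] that False s by auto
      moreover have "f c - e * c \<le> f 0" using \<open>{0..c} \<subseteq> E\<close> c by (auto simp: E_def)
      ultimately show ?thesis using that s by (auto simp: E_def algebra_simps)
    qed (use that \<open>{0..c} \<subseteq> E\<close> in auto)
    then have "s \<in> B" using s c by (auto simp: B_def)
    then show False using cSup_upper[OF _ bdd, of s] s by (simp add: c_def)
  qed
  then have "f T - e * T \<le> f 0" using \<open>{0..c} \<subseteq> E\<close> c by (auto simp: E_def)
  moreover have "e * T \<le> e'" using assms(1) \<open>0 < e'\<close> by (simp add: e_def field_simps)
  ultimately show "f T \<le> f 0 + e'" by simp
qed

text \<open>The squared distance of two orbits that start at a point of the domain has a nonpositive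
  right derivative.\<close>

theorem semigroup_unique:
  fixes X :: "'a::{real_inner, banach} set"
  assumes X: "subspace X" "closed X"
    and S: "c0_semigroup X S" "generated_by X S D A"
    and S': "c0_semigroup X S'" "generated_by X S' D A"
    and lin: "\<And>x y. x \<in> D \<Longrightarrow> y \<in> D \<Longrightarrow> x - y \<in> D \<and> A (x - y) = A x - A y"
    and diss: "\<And>x. x \<in> D \<Longrightarrow> inner (A x) x \<le> 0"
    and dense: "X \<subseteq> closure D"
    and "0 \<le> t" "x \<in> X"
  shows "S t x = S' t x"
proof -
  have on_D: "S t x = S' t x" if x: "x \<in> D" for x
  proof -
    have xX: "x \<in> X" using x S(2) by (auto simp: generated_by_def)
    define w where "w t = S t x - S' t x" for t
    have cont: "continuous_on {0..} w"
      unfolding w_def by (intro continuous_intros c0_continuous_on[OF X S(1) xX] c0_continuous_on[OF X S'(1) xX])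
    have "inner (w t) (w t) \<le> inner (w 0) (w 0)"
    proof (rule nonincreasing_if_right_deriv_nonpos[where f = "\<lambda>t. inner (w t) (w t)"])
      show "continuous_on {0..t} (\<lambda>t. inner (w t) (w t))"
        using cont by (intro continuous_intros) (auto intro: continuous_on_subset)
      fix s e :: real assume s: "0 \<le> s" "s < t" and "0 < e"
      note G = generator_right_deriv[OF X S x s(1)] and G' = generator_right_deriv[OF X S' x s(1)]
      have wD: "w s \<in> D" "A (w s) = A (S s x) - A (S' s x)"
        using lin[OF G(1) G'(1)] by (auto simp: w_def)
      have lim: "((\<lambda>h. (1 / h) *\<^sub>R (w (s + h) - w s)) \<longlongrightarrow> A (w s)) (at_right 0)"
        using tendsto_diff[OF G(4) G'(4)] unfolding wD(2) by (simp add: w_def algebra_simps)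
      have "((\<lambda>h. h *\<^sub>R (1 / h) *\<^sub>R (w (s + h) - w s)) \<longlongrightarrow> 0 *\<^sub>R A (w s)) (at_right 0)"
        by (intro tendsto_intros lim)
      moreover have "\<forall>\<^sub>F h in at_right 0. h *\<^sub>R (1 / h) *\<^sub>R (w (s + h) - w s) = w (s + h) - w s"
        by (rule eventually_at_right_less[THEN eventually_mono]) simp
      ultimately have "((\<lambda>h. w (s + h) - w s) \<longlongrightarrow> 0) (at_right 0)"
        using Lim_transform_eventually by fastforce
      \<comment> \<open>The difference of the squared norms at s + h and s is the inner product of w
        (s + h) - w s and w (s + h) + w s. This prepares the limit of the second factor.\<close>
      then have "((\<lambda>h. (w (s + h) - w s) + 2 *\<^sub>R w s) \<longlongrightarrow> 0 + 2 *\<^sub>R w s) (at_right 0)"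
        by (intro tendsto_intros)
      then have lim2: "((\<lambda>h. w (s + h) + w s) \<longlongrightarrow> 2 *\<^sub>R w s) (at_right 0)"
        by (simp add: scaleR_2)
      have "((\<lambda>h. inner ((1 / h) *\<^sub>R (w (s + h) - w s)) (w (s + h) + w s)) \<longlongrightarrow> inner (A (w s)) (2 *\<^sub>R w s)) (at_right 0)"
        by (intro tendsto_inner lim lim2)
      moreover have "inner (A (w s)) (2 *\<^sub>R w s) < e" using diss[OF wD(1)] \<open>0 < e\<close> by simp
      ultimately have "\<forall>\<^sub>F h in at_right 0. inner ((1 / h) *\<^sub>R (w (s + h) - w s)) (w (s + h) + w s) < e"
        by (rule order_tendstoD)
      with eventually_at_right_less[of "0::real"]
      show "\<forall>\<^sub>F h in at_right 0. inner (w (s + h)) (w (s + h)) - inner (w s) (w s) \<le> e * h"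
      proof eventually_elim
        case (elim h)
        then have "inner (w (s + h) - w s) (w (s + h) + w s) < e * h"
          by (simp only: inner_scaleR_left) (simp add: field_simps)
        then show ?case
          by (simp add: inner_diff_left inner_add_right inner_commute[of "w s" "w (s + h)"])
      qed
    qed fact
    also have "w 0 = 0" using c0_zero[OF X S(1) _ xX, of 0] c0_zero[OF X S'(1) _ xX, of 0] by (simp add: w_def)
    finally have "w t = 0" by (intro inner_self_le_zero) simp
    then show ?thesis by (simp add: w_def)
  qed
  obtain C where C: "0 < C" "\<And>x. x \<in> X \<Longrightarrow> norm (S t x) \<le> C * norm x"
    using c0_bounded[OF X S(1) \<open>0 \<le> t\<close>] by metis
  obtain C' where C': "0 < C'" "\<And>x. x \<in> X \<Longrightarrow> norm (S' t x) \<le> C' * norm x"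
    using c0_bounded[OF X S'(1) \<open>0 \<le> t\<close>] by metis
  have "x \<in> closure D" using dense \<open>x \<in> X\<close> by blast
  then obtain d where d: "\<And>n. d n \<in> D" "d \<longlonglongrightarrow> x" by (metis closure_sequential)
  have dX: "d n \<in> X" for n using d(1) S(2) by (auto simp: generated_by_def)
  have "norm (S t x - S' t x) \<le> (C + C') * norm (x - d n)" for n
  proof -
    have "S t x - S' t x = S t (x - d n) - S' t (x - d n)"
      using on_D[OF d(1)] c0_diff[OF X S(1) \<open>0 \<le> t\<close> \<open>x \<in> X\<close> dX] c0_diff[OF X S'(1) \<open>0 \<le> t\<close> \<open>x \<in> X\<close> dX] by simp
    also have "norm \<dots> \<le> C * norm (x - d n) + C' * norm (x - d n)"
      using C(2)[of "x - d n"] C'(2)[of "x - d n"] subspace_diff[OF X(1) \<open>x \<in> X\<close> dX]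
      by (intro order.trans[OF norm_triangle_ineq4] add_mono) auto
    finally show ?thesis by (simp add: algebra_simps)
  qed
  moreover have "(\<lambda>n. (C + C') * norm (x - d n)) \<longlonglongrightarrow> (C + C') * norm (x - x)"
    by (intro tendsto_intros d)
  ultimately have "norm (S t x - S' t x) \<le> (C + C') * norm (x - x)"
    by (intro LIMSEQ_le_const) auto
  then show ?thesis by simp
qed

section \<open>Mild solutions\<close>

text \<open>Moves an integral over a varying interval to a fixed one, where dominated convergence
  and Fubini's theorem apply.\<close>

lemma lebesgue_on_Icc_subset:
  fixes f :: "real \<Rightarrow> 'b::{banach, second_countable_topology}"
  assumes "{a..b} \<subseteq> {c..d}"
  shows "integrable (lebesgue_on {a..b}) f \<longleftrightarrow> integrable (lebesgue_on {c..d}) (\<lambda>s. indicator {a..b} s *\<^sub>R f s)"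
    and "(LINT s|lebesgue_on {a..b}. f s) = (LINT s|lebesgue_on {c..d}. indicator {a..b} s *\<^sub>R f s)"
proof -
  have "indicator {c..d} s * indicator {a..b} s = (indicator {a..b} s :: real)" for s
    using subsetD[OF assms, of s] by (auto simp: indicator_def)
  then have "(\<lambda>s. indicat_real {c..d} s *\<^sub>R indicat_real {a..b} s *\<^sub>R f s) = (\<lambda>s. indicator {a..b} s *\<^sub>R f s)"
    by (simp only: scaleR_scaleR)
  then show "integrable (lebesgue_on {a..b}) f \<longleftrightarrow> integrable (lebesgue_on {c..d}) (\<lambda>s. indicator {a..b} s *\<^sub>R f s)"
    and "(LINT s|lebesgue_on {a..b}. f s) = (LINT s|lebesgue_on {c..d}. indicator {a..b} s *\<^sub>R f s)"
    by (simp_all add: integrable_restrict_space integral_restrict_space del: scaleR_scaleR)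
qed

lemma measurable_ident_lebesgue_on [measurable]: "(\<lambda>x. x) \<in> borel_measurable (lebesgue_on S)"
  for S :: "real set"
  by (intro measurable_restrict_space1 measurable_completion) simp

lemma sigma_finite_lebesgue_on_Icc: "sigma_finite_measure (lebesgue_on {a..b::real})"
  by (intro finite_measure.axioms(1) finite_measure_lebesgue_on) auto

lemma AE_lebesgue_on_neq: "AE s in lebesgue_on S. s \<noteq> (c::real)" if "S \<in> sets lebesgue"
  using that AE_completion[OF AE_lborel_singleton[of c]]
  by (auto simp: AE_restrict_space_iff elim: eventually_mono)

section \<open>The Duhamel integral\<close>

locale separable_dissipative = maximal_dissipative D A
  for D :: "'a::{real_inner, banach, perfect_space, second_countable_topology} set" and A
begin

lemma sg_measurable [measurable (raw)]:
  assumes [measurable]: "\<tau> \<in> borel_measurable M" "F \<in> borel_measurable M"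
  shows "(\<lambda>s. sg (max 0 (\<tau> s)) (F s)) \<in> borel_measurable M"
proof -
  have "(\<lambda>(t, x). sg (max 0 t) x) \<in> borel_measurable (borel \<Otimes>\<^sub>M borel)"
    unfolding borel_prod by (rule borel_measurable_continuous_onI[OF continuous_on_sg2])
  moreover have "(\<lambda>s. (\<tau> s, F s)) \<in> M \<rightarrow>\<^sub>M borel \<Otimes>\<^sub>M borel" by measurable
  ultimately have "(\<lambda>s. case (\<tau> s, F s) of (t, x) \<Rightarrow> sg (max 0 t) x) \<in> borel_measurable M"
    by (rule measurable_compose[rotated])
  then show ?thesis by simp
qed

definition duhamel :: "(real \<Rightarrow> 'a) \<Rightarrow> real \<Rightarrow> 'a"
  where "duhamel F t = (LINT s|lebesgue_on {0..t}. sg (t - s) (F s))"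

context
  fixes F :: "real \<Rightarrow> 'a" and T :: real
  assumes F: "integrable (lebesgue_on {0..T}) F"
begin

lemma F_measurable [measurable]: "F \<in> borel_measurable (lebesgue_on {0..T})"
  using F by simp

lemma
  assumes "t \<le> T"
  shows duhamel_integrable: "integrable (lebesgue_on {0..t}) (\<lambda>s. sg (t - s) (F s))"
    and duhamel_eq: "duhamel F t = (LINT s|lebesgue_on {0..T}. indicator {0..t} s *\<^sub>R sg (max 0 (t - s)) (F s))"
proof -
  have sub: "{0..t} \<subseteq> {0..T}" using assms by auto
  have "integrable (lebesgue_on {0..T}) (\<lambda>s. indicator {0..t} s *\<^sub>R sg (max 0 (t - s)) (F s))"
    by (rule Bochner_Integration.integrable_bound[OF F]) (measurable, auto simp: norm_sg indicator_def)
  then have "integrable (lebesgue_on {0..t}) (\<lambda>s. sg (max 0 (t - s)) (F s))"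
    using lebesgue_on_Icc_subset(1)[OF sub] by blast
  then show "integrable (lebesgue_on {0..t}) (\<lambda>s. sg (t - s) (F s))"
    by (rule Bochner_Integration.integrable_cong[THEN iffD1, rotated -1]) auto
  have "duhamel F t = (LINT s|lebesgue_on {0..t}. sg (max 0 (t - s)) (F s))"
    unfolding duhamel_def by (intro Bochner_Integration.integral_cong) auto
  then show "duhamel F t = (LINT s|lebesgue_on {0..T}. indicator {0..t} s *\<^sub>R sg (max 0 (t - s)) (F s))"
    using lebesgue_on_Icc_subset(2)[OF sub] by simp
qed

text \<open>Dominated convergence with the majorant |F|. The integrands converge at every s except s
  = t, where the indicator jumps.\<close>

lemma duhamel_continuous: "continuous_on {0..T} (duhamel F)"
  unfolding continuous_on_sequentially
proof (intro allI ballI impI)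
  fix X t assume t: "t \<in> {0..T}" and "(\<forall>n. X n \<in> {0..T}) \<and> X \<longlonglongrightarrow> t"
  then have X: "\<And>n. X n \<in> {0..T}" "X \<longlonglongrightarrow> t" by auto
  have "(\<lambda>n. LINT s|lebesgue_on {0..T}. indicator {0..X n} s *\<^sub>R sg (max 0 (X n - s)) (F s)) \<longlonglongrightarrow>
      (LINT s|lebesgue_on {0..T}. indicator {0..t} s *\<^sub>R sg (max 0 (t - s)) (F s))"
  proof (rule integral_dominated_convergence[where w = "\<lambda>s. norm (F s)"])
    show "integrable (lebesgue_on {0..T}) (\<lambda>s. norm (F s))" using F by simp
    have "AE s in lebesgue_on {0..T}. s \<noteq> t" by (rule AE_lebesgue_on_neq) simp
    then show "AE s in lebesgue_on {0..T}. (\<lambda>n. indicator {0..X n} s *\<^sub>R sg (max 0 (X n - s)) (F s)) \<longlonglongrightarrow>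
        indicator {0..t} s *\<^sub>R sg (max 0 (t - s)) (F s)"
    proof eventually_elim
      case (elim s)
      have "(\<lambda>n. indicator {0..X n} s :: real) \<longlonglongrightarrow> indicator {0..t} s"
      proof (cases "s < t")
        case True
        then have "\<forall>\<^sub>F n in sequentially. s < X n" using X(2) by (intro order_tendstoD)
        then have "\<forall>\<^sub>F n in sequentially. indicator {0..X n} s = (indicator {0..t} s :: real)"
          by eventually_elim (use True in \<open>auto simp: indicator_def\<close>)
        then show ?thesis by (rule tendsto_eventually)
      next
        case False
        then have "t < s" using elim by simp
        then have "\<forall>\<^sub>F n in sequentially. X n < s" using X(2) by (intro order_tendstoD)
        then have "\<forall>\<^sub>F n in sequentially. indicator {0..X n} s = (indicator {0..t} s :: real)"
          by eventually_elim (use \<open>t < s\<close> in \<open>auto simp: indicator_def\<close>)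
        then show ?thesis by (rule tendsto_eventually)
      qed
      moreover have "(\<lambda>n. sg (max 0 (X n - s)) (F s)) \<longlonglongrightarrow> sg (max 0 (t - s)) (F s)"
      proof -
        have "(\<lambda>n. (X n - s, F s)) \<longlonglongrightarrow> (t - s, F s)" by (intro tendsto_intros X)
        from continuous_on_tendsto_compose[OF continuous_on_sg2 this] show ?thesis by simp
      qed
      ultimately show ?case by (rule tendsto_scaleR)
    qed
    show "AE s in lebesgue_on {0..T}. norm (indicator {0..X n} s *\<^sub>R sg (max 0 (X n - s)) (F s)) \<le> norm (F s)" for n
      by (auto simp: indicator_def norm_sg)
  qed measurable
  then show "(duhamel F \<circ> X) \<longlonglongrightarrow> duhamel F t"
    using X t by (simp add: o_def duhamel_eq)
qed

end

section \<open>Integration by parts for mild solutions\<close>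

context
  fixes \<phi> \<phi>' :: "real \<Rightarrow> real" and T :: real and y z :: 'a
  assumes \<phi>: "\<And>t. (\<phi> has_real_derivative \<phi>' t) (at t)" "continuous_on UNIV \<phi>'" "\<phi> 0 = 0" "\<phi> T = 0"
    and yz: "\<And>x. x \<in> D \<Longrightarrow> inner (A x) y = inner x z"
begin

text \<open>The integrand is the derivative of \<phi>(t) times the pairing of the orbit with y; the
  upper boundary term vanishes with \<phi> T, the lower one is at time s.\<close>

lemma sg_parts:
  assumes "0 \<le> s" "s \<le> T"
  shows "(LINT t|lebesgue_on {s..T}. \<phi>' t * inner (sg (t - s) v) y + \<phi> t * inner (sg (t - s) v) z) = - \<phi> s * inner v y"
proof -
  let ?f = "\<lambda>t. \<phi>' t * inner (sg (t - s) v) y + \<phi> t * inner (sg (t - s) v) z"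
  have c\<phi>: "continuous_on S \<phi>" for S
    using \<phi>(1) by (meson DERIV_isCont continuous_at_imp_continuous_on)
  have c\<phi>': "continuous_on S \<phi>'" for S using \<phi>(2) continuous_on_subset by blast
  have csg: "continuous_on {s..T} (\<lambda>t. sg (t - s) v)"
    by (rule continuous_on_compose2[OF continuous_on_sg[of "T - s" v]]) (auto intro: continuous_intros)
  have "((\<lambda>t. \<phi> t * inner (sg (t - s) v) y) has_vector_derivative ?f t) (at t within {s..T})" if t: "t \<in> {s..T}" for t
  proof -
    have "((\<lambda>t. inner (sg t v) y) has_real_derivative inner (sg (t - s) v) z) (at (t - s) within {0..T - s})"
      using t by (intro sg_weak_deriv yz) auto
    moreover have "(\<lambda>t. t - s) ` {s..T} = {0..T - s}"
      by (auto simp: image_iff intro!: bexI[of _ "_ + s"])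
    moreover have "((\<lambda>t. t - s) has_real_derivative 1) (at t within {s..T})"
      by (auto intro!: derivative_eq_intros)
    ultimately have "((\<lambda>t. inner (sg t v) y) \<circ> (\<lambda>t. t - s) has_real_derivative inner (sg (t - s) v) z * 1) (at t within {s..T})"
      by (intro DERIV_image_chain) simp_all
    then have "((\<lambda>t. \<phi> t * inner (sg (t - s) v) y) has_real_derivative ?f t) (at t within {s..T})"
      using has_field_derivative_at_within[OF \<phi>(1)]
      by (auto intro!: derivative_eq_intros simp: o_def algebra_simps)
    then show ?thesis by (simp add: has_real_derivative_iff_has_vector_derivative)
  qed
  from fundamental_theorem_of_calculus[OF assms(2) this]
  have "(?f has_integral - \<phi> s * inner v y) {s..T}" using \<phi>(4) by simp
  moreover have "integrable (lebesgue_on {s..T}) ?f"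
    by (intro continuous_imp_integrable_real continuous_intros c\<phi> c\<phi>' csg)
  ultimately show ?thesis
    by (simp add: lebesgue_integral_eq_integral integral_unique)
qed

lemma duhamel_parts:
  assumes F: "integrable (lebesgue_on {0..T}) F" and "0 \<le> T"
  shows "(LINT t|lebesgue_on {0..T}. \<phi>' t * inner (duhamel F t) y + \<phi> t * inner (duhamel F t) z) =
    - (LINT t|lebesgue_on {0..T}. \<phi> t * inner (F t) y)"
proof -
  let ?M = "lebesgue_on {0..T}"
  interpret finite_measure ?M by (rule finite_measure_lebesgue_on) auto
  interpret pair_sigma_finite ?M ?M
    by (intro pair_sigma_finite.intro sigma_finite_lebesgue_on_Icc)
  have [measurable]: "F \<in> borel_measurable ?M" using F by simp
  have c\<phi>: "continuous_on S \<phi>" for S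
    using \<phi>(1) by (meson DERIV_isCont continuous_at_imp_continuous_on)
  have c\<phi>': "continuous_on S \<phi>'" for S using \<phi>(2) continuous_on_subset by blast
  have [measurable]: "\<phi> \<in> borel_measurable borel" "\<phi>' \<in> borel_measurable borel"
    using c\<phi> c\<phi>' by (auto intro: borel_measurable_continuous_onI)
  define k where "k t s = \<phi>' t * inner (sg (max 0 (t - s)) (F s)) y + \<phi> t * inner (sg (max 0 (t - s)) (F s)) z" for t s
  \<comment> \<open>Extended by zero off the triangle s \<le> t, the kernel lives on a square. After
    exchanging the integrals, the inner one is that of \<open>sg_parts\<close>.\<close>
  define h where "h t s = indicator {0..t} s * k t s" for t s
  obtain K where K: "\<And>t. t \<in> {0..T} \<Longrightarrow> \<bar>\<phi>' t\<bar> * norm y + \<bar>\<phi> t\<bar> * norm z \<le> K"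
  proof -
    have "compact ((\<lambda>t. \<bar>\<phi>' t\<bar> * norm y + \<bar>\<phi> t\<bar> * norm z) ` {0..T})"
      by (intro compact_continuous_image continuous_intros c\<phi> c\<phi>') auto
    then have "bdd_above ((\<lambda>t. \<bar>\<phi>' t\<bar> * norm y + \<bar>\<phi> t\<bar> * norm z) ` {0..T})"
      by (intro bounded_imp_bdd_above compact_imp_bounded)
    then obtain K where "\<forall>t\<in>{0..T}. \<bar>\<phi>' t\<bar> * norm y + \<bar>\<phi> t\<bar> * norm z \<le> K"
      by (auto simp: bdd_above_def)
    then show ?thesis using that by blast
  qed
  have k_le: "\<bar>k t s\<bar> \<le> K * norm (F s)" if "t \<in> {0..T}" for t s
  proof -
    have "\<bar>inner (sg (max 0 (t - s)) (F s)) u\<bar> \<le> norm (F s) * norm u" for u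
      by (intro order.trans[OF Cauchy_Schwarz_ineq2] mult_right_mono norm_sg) auto
    then have "\<bar>k t s\<bar> \<le> \<bar>\<phi>' t\<bar> * (norm (F s) * norm y) + \<bar>\<phi> t\<bar> * (norm (F s) * norm z)"
      unfolding k_def by (intro order.trans[OF abs_triangle_ineq] add_mono) (auto simp: abs_mult intro: mult_left_mono)
    also have "\<dots> = (\<bar>\<phi>' t\<bar> * norm y + \<bar>\<phi> t\<bar> * norm z) * norm (F s)" by (simp add: algebra_simps)
    also have "\<dots> \<le> K * norm (F s)" by (intro mult_right_mono K that) simp
    finally show ?thesis .
  qed
  have h_le: "norm (h t s) \<le> K * norm (F s)" if "t \<in> {0..T}" for t s
    using k_le[OF that, of s] by (auto simp: h_def indicator_def)
  have h_meas: "(\<lambda>(t, s). h t s) \<in> borel_measurable (?M \<Otimes>\<^sub>M ?M)"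
  proof -
    have "(\<lambda>p. if 0 \<le> snd p \<and> snd p \<le> fst p then k (fst p) (snd p) else 0) \<in> borel_measurable (?M \<Otimes>\<^sub>M ?M)"
      unfolding k_def by measurable
    moreover have "(\<lambda>(t, s). h t s) = (\<lambda>p. if 0 \<le> snd p \<and> snd p \<le> fst p then k (fst p) (snd p) else 0)"
      by (auto simp: h_def indicator_def)
    ultimately show ?thesis by simp
  qed
  have h_int1: "integrable ?M (h t)" if "t \<in> {0..T}" for t
  proof (rule Bochner_Integration.integrable_bound)
    show "integrable ?M (\<lambda>s. K * norm (F s))" using F by simp
    show "h t \<in> borel_measurable ?M" unfolding h_def k_def by measurable
    show "AE s in ?M. norm (h t s) \<le> norm (K * norm (F s))"
      using h_le[OF that] by (auto intro: order.trans[OF _ abs_ge_self])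
  qed
  have h_int: "integrable (?M \<Otimes>\<^sub>M ?M) (\<lambda>(t, s). h t s)"
  proof (rule Fubini_integrable[OF h_meas])
    show "integrable ?M (\<lambda>t. LINT s|?M. norm (case (t, s) of (t, s) \<Rightarrow> h t s))"
    proof (rule integrable_const_bound)
      show "(\<lambda>t. LINT s|?M. norm (case (t, s) of (t, s) \<Rightarrow> h t s)) \<in> borel_measurable ?M"
        using h_meas by measurable
      show "AE t in ?M. norm (LINT s|?M. norm (case (t, s) of (t, s) \<Rightarrow> h t s)) \<le> (LINT s|?M. K * norm (F s))"
      proof (rule AE_I2)
        fix t assume "t \<in> space ?M"
        then have t: "t \<in> {0..T}" by simp
        have "(LINT s|?M. norm (h t s)) \<le> (LINT s|?M. K * norm (F s))"
          using F h_int1[OF t] h_le[OF t] by (intro integral_mono) auto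
        then show "norm (LINT s|?M. norm (case (t, s) of (t, s) \<Rightarrow> h t s)) \<le> (LINT s|?M. K * norm (F s))"
          by (simp add: integral_nonneg)
      qed
    qed
    show "AE t in ?M. integrable ?M (\<lambda>s. case (t, s) of (t, s) \<Rightarrow> h t s)"
      using h_int1 by (intro AE_I2) simp
  qed
  have "(LINT t|?M. \<phi>' t * inner (duhamel F t) y + \<phi> t * inner (duhamel F t) z) = (LINT t|?M. LINT s|?M. h t s)"
  proof (rule Bochner_Integration.integral_cong)
    fix t assume "t \<in> space ?M"
    then have t: "t \<le> T" "t \<in> {0..T}" by auto
    have int: "integrable ?M (\<lambda>s. indicator {0..t} s *\<^sub>R sg (max 0 (t - s)) (F s))"
      by (rule Bochner_Integration.integrable_bound[OF F]) (measurable, auto simp: norm_sg indicator_def)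
    have "inner (duhamel F t) u = (LINT s|?M. indicator {0..t} s * inner (sg (max 0 (t - s)) (F s)) u)" for u
      unfolding duhamel_eq[OF F t(1)] using int by (subst integral_inner_left[symmetric]) auto
    moreover have "integrable ?M (\<lambda>s. indicator {0..t} s * inner (sg (max 0 (t - s)) (F s)) u)" for u
      using integrable_inner_left[OF int, of u] by simp
    ultimately have "\<phi>' t * inner (duhamel F t) y + \<phi> t * inner (duhamel F t) z =
       (LINT s|?M. \<phi>' t * (indicator {0..t} s * inner (sg (max 0 (t - s)) (F s)) y) +
         \<phi> t * (indicator {0..t} s * inner (sg (max 0 (t - s)) (F s)) z))"
      by simp
    also have "\<dots> = (LINT s|?M. h t s)"
      by (intro Bochner_Integration.integral_cong) (auto simp: h_def k_def algebra_simps)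
    finally show "\<phi>' t * inner (duhamel F t) y + \<phi> t * inner (duhamel F t) z = (LINT s|?M. h t s)" .
  qed simp
  also have "\<dots> = (LINT s|?M. LINT t|?M. h t s)"
    by (rule Fubini_integral[OF h_int, symmetric])
  also have "\<dots> = (LINT s|?M. - (\<phi> s * inner (F s) y))"
  proof (rule Bochner_Integration.integral_cong)
    fix s assume "s \<in> space ?M"
    then have s: "0 \<le> s" "s \<le> T" by auto
    then have sub: "{s..T} \<subseteq> {0..T}" by auto
    have "(LINT t|?M. h t s) = (LINT t|?M. indicator {s..T} t *\<^sub>R k t s)"
      using s by (intro Bochner_Integration.integral_cong) (auto simp: h_def indicator_def)
    also have "\<dots> = (LINT t|lebesgue_on {s..T}. k t s)"
      by (rule lebesgue_on_Icc_subset(2)[OF sub, symmetric])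
    also have "\<dots> = (LINT t|lebesgue_on {s..T}. \<phi>' t * inner (sg (t - s) (F s)) y + \<phi> t * inner (sg (t - s) (F s)) z)"
      by (intro Bochner_Integration.integral_cong) (auto simp: k_def)
    also have "\<dots> = - (\<phi> s * inner (F s) y)" using sg_parts[OF s] by simp
    finally show "(LINT t|?M. h t s) = - (\<phi> s * inner (F s) y)" .
  qed simp
  finally show ?thesis by simp
qed

lemma mild_parts:
  assumes F: "integrable (lebesgue_on {0..T}) F" and "0 \<le> T"
  shows "(LINT t|lebesgue_on {0..T}. \<phi>' t * inner (sg t x + duhamel F t) y) =
    - (LINT t|lebesgue_on {0..T}. \<phi> t * (inner (sg t x + duhamel F t) z + inner (F t) y))"
proof -
  let ?M = "lebesgue_on {0..T}"
  have c\<phi>: "continuous_on S \<phi>" for S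
    using \<phi>(1) by (meson DERIV_isCont continuous_at_imp_continuous_on)
  have c\<phi>': "continuous_on S \<phi>'" for S using \<phi>(2) continuous_on_subset by blast
  have int: "integrable ?M (\<lambda>t. \<phi>' t * inner (sg t x) w)" "integrable ?M (\<lambda>t. \<phi> t * inner (sg t x) w)"
    "integrable ?M (\<lambda>t. \<phi>' t * inner (duhamel F t) w)" "integrable ?M (\<lambda>t. \<phi> t * inner (duhamel F t) w)" for w
    by (intro continuous_imp_integrable_real continuous_intros c\<phi> c\<phi>' continuous_on_sg duhamel_continuous[OF F])+
  have int2: "integrable ?M (\<lambda>t. \<phi> t * inner (F t) y)"
  proof -
    have "\<exists>K. \<forall>t\<in>{0..T}. \<bar>\<phi> t\<bar> \<le> K"
      using compact_imp_bounded[OF compact_continuous_image[OF c\<phi>[of "{0..T}"]]] by (auto simp: bounded_iff)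
    then obtain K where K: "\<And>t. t \<in> {0..T} \<Longrightarrow> \<bar>\<phi> t\<bar> \<le> K" by blast
    show ?thesis
    proof (rule Bochner_Integration.integrable_bound)
      show "integrable ?M (\<lambda>t. K * inner (F t) y)" using F by simp
      show "(\<lambda>t. \<phi> t * inner (F t) y) \<in> borel_measurable ?M"
        using F borel_measurable_continuous_onI[OF c\<phi>] by (intro borel_measurable_times) (auto intro: measurable_compose)
      show "AE t in ?M. norm (\<phi> t * inner (F t) y) \<le> norm (K * inner (F t) y)"
        using K by (intro AE_I2) (auto simp: abs_mult intro!: mult_right_mono intro: order.trans[OF _ abs_ge_self])
    qed
  qed
  have "(LINT t|?M. \<phi>' t * inner (sg t x) y + \<phi> t * inner (sg t x) z) = 0"
    using sg_parts[of 0 x] \<phi>(3) assms by simp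
  with duhamel_parts[OF F \<open>0 \<le> T\<close>] int int2 show ?thesis
    by (simp add: inner_add_left distrib_left)
qed

end

end

section \<open>Dissipative operators on a closed subspace\<close>

text \<open>The operator acts on a closed subspace X of the type and P is the orthogonal projection
  onto X. The sublocale below extends A by composition with P, so that the construction on whole
  types applies.\<close>

locale projected_dissipative =
  fixes P :: "'a::{real_inner, banach, perfect_space, second_countable_topology} \<Rightarrow> 'a"
    and X D :: "'a set" and A :: "'a \<Rightarrow> 'a"
  assumes P: "bounded_linear P" and P_sym: "inner (P x) y = inner x (P y)"
    and P_in: "P x \<in> X" and P_id: "x \<in> X \<Longrightarrow> P x = x"
    and D_sub: "D \<subseteq> X" and A_in: "x \<in> D \<Longrightarrow> A x \<in> X"
    and D: "subspace D"
    and A_plus: "x \<in> D \<Longrightarrow> y \<in> D \<Longrightarrow> A (x + y) = A x + A y"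
    and A_scaleR: "x \<in> D \<Longrightarrow> A (c *\<^sub>R x) = c *\<^sub>R A x"
    and A_dissipative: "x \<in> D \<Longrightarrow> inner (A x) x \<le> 0"
    and A_range: "0 < l \<Longrightarrow> y \<in> X \<Longrightarrow> \<exists>x\<in>D. l *\<^sub>R x - A x = y"
begin

sublocale P: bounded_linear P by (rule P)

lemma X_subspace: "subspace X"
proof (rule subspaceI)
  fix x y :: 'a and c :: real
  show "0 \<in> X" using P_in[of 0] by (simp add: P.zero)
  show "x + y \<in> X" if "x \<in> X" "y \<in> X" using P_in[of "x + y"] that by (simp add: P.add P_id)
  show "c *\<^sub>R x \<in> X" if "x \<in> X" using P_in[of "c *\<^sub>R x"] that by (simp add: P.scaleR P_id)
qed

lemma X_closed: "closed X"
proof -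
  have "x \<in> X \<longleftrightarrow> P x = x" for x using P_in[of x] P_id[of x] by auto
  then have "X = {x. P x = x}" by auto
  moreover have "closed {x. P x = x}"
    by (intro closed_Collect_eq continuous_intros P.continuous_on)
  ultimately show ?thesis by simp
qed

sublocale separable_dissipative "{x. P x \<in> D}" "\<lambda>x. A (P x)"
proof
  show "subspace {x. P x \<in> D}"
    using D by (auto simp: subspace_def P.add P.scaleR P.zero)
  fix x y :: 'a and c l :: real
  show "A (P (x + y)) = A (P x) + A (P y)" if "x \<in> {x. P x \<in> D}" "y \<in> {x. P x \<in> D}"
    using that by (simp add: P.add A_plus)
  show "A (P (c *\<^sub>R x)) = c *\<^sub>R A (P x)" if "x \<in> {x. P x \<in> D}"
    using that by (simp add: P.scaleR A_scaleR)
  show "inner (A (P x)) x \<le> 0" if "x \<in> {x. P x \<in> D}"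
  proof -
    have "inner (A (P x)) x = inner (P (A (P x))) x" using that by (simp add: P_id A_in)
    also have "\<dots> \<le> 0" using that by (simp add: P_sym A_dissipative)
    finally show ?thesis .
  qed
  show "\<exists>x\<in>{x. P x \<in> D}. l *\<^sub>R x - A (P x) = y" if l: "0 < l"
  proof -
    obtain x where x: "x \<in> D" "l *\<^sub>R x - A x = P y" using A_range[OF l P_in] by blast
    \<comment> \<open>The extended operator vanishes on the orthogonal complement of X, so there the
      resolvent equation is solved by division by l.\<close>
    have Px: "P (x + (1 / l) *\<^sub>R (y - P y)) = x"
      using x D_sub P_in by (simp add: P.add P.scaleR P.diff P_id subset_iff)
    have "l *\<^sub>R (x + (1 / l) *\<^sub>R (y - P y)) - A x = y"
      using x l by (simp add: scaleR_add_right algebra_simps)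
    then show ?thesis using x Px by (intro bexI[of _ "x + (1 / l) *\<^sub>R (y - P y)"]) auto
  qed
qed

text \<open>The part of the orbit orthogonal to X is orthogonal to the range of the extended
  operator. Its pairing with the orbit is therefore conserved, and it is zero at the start.\<close>

lemma sg_in_X:
  assumes "0 \<le> t" "x \<in> X"
  shows "sg t x \<in> X"
proof -
  define y where "y = sg t x - P (sg t x)"
  have orth: "inner (P v) y = 0" for v
    using P_in by (simp add: y_def P_sym P.diff P_id)
  have "inner (A (P v)) y = 0" if "v \<in> {x. P x \<in> D}" for v
    using orth[of "A (P v)"] that by (simp add: P_id A_in)
  then have "inner (sg t x) y = inner x y"
    using assms(1) by (intro sg_invariant) auto
  also have "\<dots> = 0" using orth[of x] assms by (simp add: P_id)
  finally have "inner y y = 0" using orth[of "sg t x"] by (simp add: y_def inner_diff_left)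
  then have "sg t x = P (sg t x)" by (simp add: y_def)
  then show ?thesis using P_in[of "sg t x"] by simp
qed

lemma sg_c0_semigroup: "c0_semigroup X sg"
proof -
  have "((\<lambda>t. sg t x) \<longlongrightarrow> x) (at_right 0)" for x
  proof -
    have "((\<lambda>t. sg t x) \<longlongrightarrow> sg 0 x) (at 0 within {0..1})"
      using continuous_on_sg[of 1 x] unfolding continuous_on_def by (rule bspec) simp
    then show ?thesis by (simp add: at_within_Icc_at_right)
  qed
  moreover have "\<exists>C. \<forall>x\<in>X. norm (sg t x) \<le> C * norm x" if "0 \<le> t" for t
    using norm_sg[OF that] by (intro exI[of _ 1]) simp
  ultimately show ?thesis
    unfolding c0_semigroup_def by (simp add: sg_in_X sg_add sg_scale sg_semigroup)
qed

lemma sg_generated_by: "generated_by X sg D A"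
  unfolding generated_by_def
proof
  have right: "((\<lambda>t. (1 / t) *\<^sub>R (sg t x - x)) \<longlongrightarrow> A x) (at_right 0)" if "x \<in> D" for x
    using sg_right_deriv[of x] that D_sub by (auto simp: P_id subset_iff)
  then show "\<forall>x\<in>D. ((\<lambda>t. (1 / t) *\<^sub>R (sg t x - x)) \<longlongrightarrow> A x) (at_right 0)" by blast
  show "D = {x \<in> X. \<exists>y\<in>X. ((\<lambda>t. (1 / t) *\<^sub>R (sg t x - x)) \<longlongrightarrow> y) (at_right 0)}"
  proof (intro equalityI subsetI)
    fix x assume "x \<in> D"
    then show "x \<in> {x \<in> X. \<exists>y\<in>X. ((\<lambda>t. (1 / t) *\<^sub>R (sg t x - x)) \<longlongrightarrow> y) (at_right 0)}"
      using right A_in D_sub by blast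
  next
    fix x assume "x \<in> {x \<in> X. \<exists>y\<in>X. ((\<lambda>t. (1 / t) *\<^sub>R (sg t x - x)) \<longlongrightarrow> y) (at_right 0)}"
    then obtain y where "x \<in> X" "((\<lambda>t. (1 / t) *\<^sub>R (sg t x - x)) \<longlongrightarrow> y) (at_right 0)" by blast
    moreover from this(2) have "x \<in> {x. P x \<in> D}" by (subst sg_generator) blast
    ultimately show "x \<in> D" by (simp add: P_id)
  qed
qed

lemma X_closure_D: "X \<subseteq> closure D"
proof
  fix x assume x: "x \<in> X"
  have "x \<in> closure {x. P x \<in> D}" using closure_D by simp
  then obtain d where d: "\<And>n. P (d n) \<in> D" "d \<longlonglongrightarrow> x" unfolding closure_sequential by auto
  have "(\<lambda>n. P (d n)) \<longlonglongrightarrow> P x" by (rule P.tendsto[OF d(2)])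
  then show "x \<in> closure D"
    using d(1) P_id[OF x] unfolding closure_sequential by (intro exI[of _ "\<lambda>n. P (d n)"]) simp
qed

lemma sg_unique:
  assumes "c0_semigroup X S" "generated_by X S D A" "0 \<le> t" "x \<in> X"
  shows "S t x = sg t x"
proof (rule semigroup_unique[OF X_subspace X_closed assms(1,2) sg_c0_semigroup sg_generated_by _ A_dissipative X_closure_D assms(3,4)])
  fix x y assume xy: "x \<in> D" "y \<in> D"
  then have "- y \<in> D" "A (- y) = - A y" using subspace_neg[OF D] A_scaleR[of y "- 1"] by auto
  then show "x - y \<in> D \<and> A (x - y) = A x - A y"
    using A_plus[of x "- y"] subspace_diff[OF D] xy by simp
qed

context
  fixes F :: "real \<Rightarrow> 'a" and T :: real and x :: 'a
  assumes F: "integrable (lebesgue_on {0..T}) F" "AE t in lebesgue_on {0..T}. F t \<in> X" and x: "x \<in> X"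
begin

lemma AE_F_subinterval: "t \<le> T \<Longrightarrow> AE s in lebesgue_on {0..t}. F s \<in> X \<and> s \<le> t"
  using F(2) by (auto simp: AE_restrict_space_iff elim!: eventually_mono)

lemma mild_solution_iff:
  "semigroup_mild_solution T X D A F x u \<longleftrightarrow> (\<forall>t\<in>{0..T}. u t = sg t x + duhamel F t)"
proof
  assume "semigroup_mild_solution T X D A F x u"
  then obtain S where S: "c0_semigroup X S" "generated_by X S D A"
    and u: "\<And>t. t \<in> {0..T} \<Longrightarrow> integrable (lebesgue_on {0..t}) (\<lambda>s. S (t - s) (F s))"
      "\<And>t. t \<in> {0..T} \<Longrightarrow> u t = S t x + (LINT s|lebesgue_on {0..t}. S (t - s) (F s))"
    unfolding semigroup_mild_solution_def by blast
  show "\<forall>t\<in>{0..T}. u t = sg t x + duhamel F t"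
  proof
    fix t assume t: "t \<in> {0..T}"
    have "(LINT s|lebesgue_on {0..t}. S (t - s) (F s)) = (LINT s|lebesgue_on {0..t}. sg (t - s) (F s))"
    proof (rule integral_cong_AE)
      show "AE s in lebesgue_on {0..t}. S (t - s) (F s) = sg (t - s) (F s)"
      proof -
        have "AE s in lebesgue_on {0..t}. F s \<in> X \<and> s \<le> t" using t by (intro AE_F_subinterval) simp
        then show ?thesis by eventually_elim (simp add: sg_unique[OF S])
      qed
    qed (use u(1)[OF t] duhamel_integrable[OF F(1), of t] t in auto)
    then show "u t = sg t x + duhamel F t"
      using u(2)[OF t] sg_unique[OF S, of t x] x t by (simp add: duhamel_def)
  qed
next
  assume "\<forall>t\<in>{0..T}. u t = sg t x + duhamel F t"
  then show "semigroup_mild_solution T X D A F x u"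
    unfolding semigroup_mild_solution_def
    using sg_c0_semigroup sg_generated_by duhamel_integrable[OF F(1)]
    by (intro exI[of _ sg]) (simp add: duhamel_def)
qed

lemma mild_continuous: "continuous_on {0..T} (\<lambda>t. sg t x + duhamel F t)"
  by (intro continuous_intros continuous_on_sg duhamel_continuous[OF F(1)])

lemma mild_in_X:
  assumes "t \<in> {0..T}"
  shows "sg t x + duhamel F t \<in> X"
proof -
  have t: "t \<le> T" using assms by simp
  have "P (duhamel F t) = (LINT s|lebesgue_on {0..t}. P (sg (t - s) (F s)))"
    unfolding duhamel_def by (rule integral_bounded_linear[OF P duhamel_integrable[OF F(1) t], symmetric])
  also have "\<dots> = duhamel F t"
    unfolding duhamel_def
  proof (rule integral_cong_AE)
    show "AE s in lebesgue_on {0..t}. P (sg (t - s) (F s)) = sg (t - s) (F s)"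
      using AE_F_subinterval[OF t] by eventually_elim (simp add: P_id sg_in_X)
    note int = duhamel_integrable[OF F(1) t]
    show "(\<lambda>s. sg (t - s) (F s)) \<in> borel_measurable (lebesgue_on {0..t})"
      using int by (rule borel_measurable_integrable)
    show "(\<lambda>s. P (sg (t - s) (F s))) \<in> borel_measurable (lebesgue_on {0..t})"
      using integrable_bounded_linear[OF P int] by (rule borel_measurable_integrable)
  qed
  finally have "duhamel F t \<in> X" using P_in[of "duhamel F t"] by simp
  then show ?thesis using sg_in_X[OF _ x] assms by (intro subspace_add[OF X_subspace]) auto
qed

end

end

section \<open>Test functions and weak derivatives\<close>

lemma power_div_fact_le_exp:
  fixes x :: real
  assumes "0 \<le> x"
  shows "x ^ n / fact n \<le> exp x"
proof -
  have "(\<Sum>k\<in>{n}. x ^ k /\<^sub>R fact k) \<le> (\<Sum>k. x ^ k /\<^sub>R fact k)"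
    using assms by (intro sum_le_suminf summable_exp_generic) auto
  then show ?thesis by (simp add: exp_def divide_inverse mult.commute)
qed

lemma DERIV_zero_if_quadratic_bound:
  fixes f :: "real \<Rightarrow> real"
  assumes "\<And>x. \<bar>f x - f x0\<bar> \<le> K * (x - x0)\<^sup>2"
  shows "(f has_real_derivative 0) (at x0)"
  unfolding has_field_derivative_iff
proof (rule Lim_null_comparison)
  show "\<forall>\<^sub>F x in at x0. norm ((f x - f x0) / (x - x0)) \<le> K * \<bar>x - x0\<bar>"
  proof (rule always_eventually, rule allI)
    fix x
    show "norm ((f x - f x0) / (x - x0)) \<le> K * \<bar>x - x0\<bar>"
    proof (cases "x = x0")
      case False
      then show ?thesis using assms[of x]
        by (simp add: divide_le_eq power2_eq_square mult.assoc abs_mult_self)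
    qed simp
  qed
  have "((\<lambda>x. K * \<bar>x - x0\<bar>) \<longlongrightarrow> K * \<bar>x0 - x0\<bar>) (at x0)" by (intro tendsto_intros)
  then show "((\<lambda>x. K * \<bar>x - x0\<bar>) \<longlongrightarrow> 0) (at x0)" by simp
qed

text \<open>With the factors \<open>poly p x / ((x - c) (d - x)) ^ k\<close> the class of bump functions is closed
  under differentiation.\<close>

definition bump :: "real \<Rightarrow> real \<Rightarrow> real \<Rightarrow> real poly \<Rightarrow> nat \<Rightarrow> real \<Rightarrow> real"
  where "bump s c d p k x =
    (if c < x \<and> x < d then poly p x / ((x - c) * (d - x)) ^ k * exp (- s / ((x - c) * (d - x))) else 0)"

text \<open>Quotient and chain rule over the common denominator \<open>Q ^ (k + 2)\<close>. For k =
  0 the truncated exponent k - 1 is multiplied by zero.\<close>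

lemma bump_deriv_aux:
  fixes Q :: real
  assumes "Q \<noteq> 0"
  shows "(P' * Q ^ k - P * (real k * Q ^ (k - 1) * R)) / (Q ^ k * Q ^ k) * e + P / Q ^ k * (e * (s * R / (Q * Q)))
    = (P' * Q\<^sup>2 - real k * (P * Q * R) + s * (P * R)) / Q ^ (k + 2) * e"
  using assms by (cases k) (simp_all add: field_simps power2_eq_square)

lemma bump_deriv:
  assumes "0 < s"
  shows "\<exists>p'. \<forall>x. (bump s c d p k has_real_derivative bump s c d p' (k + 2) x) (at x)"
proof -
  define q where "q = [:- (c * d), c + d, - 1:]"
  define p' where "p' = pderiv p * q\<^sup>2 - smult (real k) (p * q * pderiv q) + smult s (p * pderiv q)"
  have q: "poly q x = (x - c) * (d - x)" for x by (simp add: q_def algebra_simps)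
  have dq: "(poly q has_real_derivative poly (pderiv q) x) (at x)" for x by (rule poly_DERIV)
  have "(bump s c d p k has_real_derivative bump s c d p' (k + 2) x) (at x)" for x
  proof (cases "c < x \<and> x < d")
    case True
    define f where "f x = poly p x / poly q x ^ k * exp (- s / poly q x)" for x
    have qx: "poly q x \<noteq> 0" using True by (simp add: q)
    have der: "(f has_real_derivative
       ((poly (pderiv p) x * poly q x ^ k - poly p x * (real k * poly q x ^ (k - 1) * poly (pderiv q) x)) / (poly q x ^ k * poly q x ^ k)) *
         exp (- s / poly q x) +
       poly p x / poly q x ^ k * (exp (- s / poly q x) * (s * poly (pderiv q) x / (poly q x * poly q x)))) (at x)"
    proof -
      have "((\<lambda>x. poly p x / poly q x ^ k) has_real_derivative
        (poly (pderiv p) x * poly q x ^ k - poly p x * (real k * (poly (pderiv q) x * poly q x ^ (k - Suc 0)))) /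
          (poly q x ^ k * poly q x ^ k)) (at x)"
        using qx by (intro DERIV_divide poly_DERIV DERIV_power) auto
      moreover have "((\<lambda>x. exp (- s / poly q x)) has_real_derivative
        exp (- s / poly q x) * ((0 * poly q x - (- s) * poly (pderiv q) x) / (poly q x * poly q x))) (at x)"
        using qx by (intro DERIV_fun_exp DERIV_divide poly_DERIV DERIV_const)
      ultimately show ?thesis
        unfolding f_def by (rule DERIV_cong[OF DERIV_mult]) (simp add: mult_ac)
    qed
    have "poly p' x / poly q x ^ (k + 2) * exp (- s / poly q x) = bump s c d p' (k + 2) x"
      using True by (simp add: bump_def q)
    moreover have "poly p' x = poly (pderiv p) x * (poly q x)\<^sup>2 - real k * (poly p x * poly q x * poly (pderiv q) x)
        + s * (poly p x * poly (pderiv q) x)"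
      by (simp add: p'_def)
    ultimately have "(f has_real_derivative bump s c d p' (k + 2) x) (at x)"
      using der unfolding bump_deriv_aux[OF qx] by simp
    moreover have "\<forall>\<^sub>F y in nhds x. bump s c d p k y = f y"
    proof -
      have "open {c<..<d}" "x \<in> {c<..<d}" using True by auto
      then show ?thesis
        unfolding eventually_nhds by (intro exI[of _ "{c<..<d}"]) (auto simp: bump_def f_def q)
    qed
    ultimately show ?thesis using DERIV_cong_ev by blast
  next
    case False
    obtain M where M: "\<And>y. y \<in> {c..d} \<Longrightarrow> \<bar>poly p y\<bar> \<le> M"
    proof -
      have "bounded (poly p ` {c..d})"
        by (intro compact_imp_bounded compact_continuous_image continuous_intros) auto
      then have "\<exists>M. \<forall>y\<in>{c..d}. \<bar>poly p y\<bar> \<le> M" by (auto simp: bounded_iff)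
      then show ?thesis using that by blast
    qed
    have bx: "bump s c d p k x = 0" using False by (auto simp: bump_def)
    \<comment> \<open>One term of the exponential series, of order k + 2 in s / r, absorbs the pole
      \<open>r ^ k\<close> and leaves a factor \<open>r\<^sup>2\<close>. The bump thus vanishes
      quadratically at the ends of its interval.\<close>
    define K where "K = \<bar>M\<bar> * (fact (k + 2) / s ^ (k + 2)) * (d - c)\<^sup>2"
    have "\<bar>bump s c d p k y - bump s c d p k x\<bar> \<le> K * (y - x)\<^sup>2" for y
    proof (cases "c < y \<and> y < d")
      case True
      define r where "r = (y - c) * (d - y)"
      have r: "0 < r" using True by (simp add: r_def)
      have "inverse (exp (s / r)) \<le> inverse ((s / r) ^ (k + 2) / fact (k + 2))"
        using r assms by (intro le_imp_inverse_le power_div_fact_le_exp) simp_all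
      then have "exp (- (s / r)) \<le> fact (k + 2) / (s / r) ^ (k + 2)"
        by (simp only: exp_minus inverse_divide)
      also have "\<dots> = fact (k + 2) / s ^ (k + 2) * r ^ k * r\<^sup>2"
        using r by (simp add: power_divide power_add power2_eq_square)
      finally have "exp (- s / r) / r ^ k \<le> fact (k + 2) / s ^ (k + 2) * r\<^sup>2"
        using r by (simp add: field_simps)
      moreover have "\<bar>bump s c d p k y\<bar> = \<bar>poly p y\<bar> * (exp (- s / r) / r ^ k)"
        using True r by (simp add: bump_def r_def[symmetric] abs_mult)
      ultimately have "\<bar>bump s c d p k y\<bar> \<le> \<bar>M\<bar> * (fact (k + 2) / s ^ (k + 2) * r\<^sup>2)"
        using M[of y] True r assms by (simp only:) (intro mult_mono, auto)
      also have "\<dots> \<le> \<bar>M\<bar> * (fact (k + 2) / s ^ (k + 2) * ((d - c)\<^sup>2 * (y - x)\<^sup>2))"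
      proof -
        \<comment> \<open>As x is outside the interval and y inside, one of the distances of y to
          the two ends is at most |y - x|; the other is at most d - c.\<close>
        have "r \<le> (d - c) * \<bar>y - x\<bar>"
        proof (cases "x \<le> c")
          case True
          have "r \<le> (y - c) * (d - c)" using \<open>c < y \<and> y < d\<close> unfolding r_def by (intro mult_left_mono) auto
          also have "\<dots> \<le> \<bar>y - x\<bar> * (d - c)" using True \<open>c < y \<and> y < d\<close> by (intro mult_right_mono) auto
          finally show ?thesis by (simp add: mult.commute)
        next
          case F: False
          then have "d \<le> x" using False by auto
          have "r \<le> (d - c) * (d - y)" using \<open>c < y \<and> y < d\<close> unfolding r_def by (intro mult_right_mono) auto
          also have "\<dots> \<le> (d - c) * \<bar>y - x\<bar>" using \<open>d \<le> x\<close> \<open>c < y \<and> y < d\<close> by (intro mult_left_mono) auto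
          finally show ?thesis .
        qed
        then have "r\<^sup>2 \<le> ((d - c) * \<bar>y - x\<bar>)\<^sup>2" using r by (intro power_mono) auto
        then have "r\<^sup>2 \<le> (d - c)\<^sup>2 * (y - x)\<^sup>2" by (simp add: power_mult_distrib)
        then show ?thesis using assms by (intro mult_left_mono) auto
      qed
      finally show ?thesis by (simp only: bx diff_zero K_def mult.assoc)
    next
      case F: False
      then show ?thesis using False assms by (auto simp: bump_def K_def)
    qed
    then have "(bump s c d p k has_real_derivative 0) (at x)" by (rule DERIV_zero_if_quadratic_bound)
    moreover have "bump s c d p' (k + 2) x = 0" using False by (auto simp: bump_def)
    ultimately show ?thesis by simp
  qed
  then show ?thesis by blast
qed

lemma test_function_bump:
  assumes "0 < s" "a < c" "d < b"
  shows "test_function a b (bump s c d p k)"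
proof -
  have "\<exists>p' k'. (deriv ^^ n) (bump s c d p k) = bump s c d p' k'" for n
  proof (induction n)
    case (Suc n)
    then obtain p' k' where "(deriv ^^ n) (bump s c d p k) = bump s c d p' k'" by blast
    moreover obtain p'' where "\<forall>x. (bump s c d p' k' has_real_derivative bump s c d p'' (k' + 2) x) (at x)"
      using bump_deriv[OF assms(1)] by blast
    then have "deriv (bump s c d p' k') = bump s c d p'' (k' + 2)"
      by (intro ext DERIV_imp_deriv) blast
    ultimately have "(deriv ^^ Suc n) (bump s c d p k) = bump s c d p'' (k' + 2)" by simp
    then show ?case by blast
  qed auto
  moreover have "bump s c d p k differentiable_on UNIV" for p k
  proof -
    obtain p' where "\<forall>x. (bump s c d p k has_real_derivative bump s c d p' (k + 2) x) (at x)"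
      using bump_deriv[OF assms(1)] by blast
    then show ?thesis
      by (auto simp: differentiable_on_def real_differentiable_def intro: has_field_derivative_at_within)
  qed
  ultimately have "(deriv ^^ n) (bump s c d p k) differentiable_on UNIV" for n by metis
  moreover have "\<exists>c d'. a < c \<and> d' < b \<and> (\<forall>x. bump s c' d p k x \<noteq> 0 \<longrightarrow> x \<in> {c..d'})" if "c' = c" for c'
    using assms that by (intro exI[of _ c] exI[of _ d]) (auto simp: bump_def)
  ultimately show ?thesis unfolding test_function_def by blast
qed

section \<open>Calculus of test functions\<close>

context
  fixes a b :: real and \<phi> :: "real \<Rightarrow> real"
  assumes \<phi>: "test_function a b \<phi>"
begin

lemma test_function_DERIV: "(\<phi> has_real_derivative deriv \<phi> x) (at x)"
proof -
  have "(deriv ^^ 0) \<phi> differentiable_on UNIV" using \<phi> unfolding test_function_def by blast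
  then show ?thesis
    using DERIV_deriv_iff_real_differentiable by (auto simp: differentiable_on_def)
qed

lemma test_function_deriv: "test_function a b (deriv \<phi>)"
proof -
  obtain c d where cd: "a < c" "d < b" "\<forall>x. \<phi> x \<noteq> 0 \<longrightarrow> x \<in> {c..d}" using \<phi> unfolding test_function_def by blast
  have "x \<in> {c..d}" if "deriv \<phi> x \<noteq> 0" for x
  proof (rule ccontr)
    assume x: "x \<notin> {c..d}"
    have "open (- {c..d})" by auto
    then have "\<forall>\<^sub>F y in nhds x. \<phi> y = 0"
      unfolding eventually_nhds using x cd(3) by (intro exI[of _ "- {c..d}"]) auto
    then have "(\<phi> has_real_derivative 0) (at x) \<longleftrightarrow> ((\<lambda>_. 0) has_real_derivative 0) (at x)"
      by (intro DERIV_cong_ev) auto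
    then have "(\<phi> has_real_derivative 0) (at x)" by simp
    then show False using that by (auto dest: DERIV_imp_deriv)
  qed
  moreover have "(deriv ^^ k) (deriv \<phi>) differentiable_on UNIV" for k
  proof -
    have "(deriv ^^ Suc k) \<phi> differentiable_on UNIV" using \<phi> unfolding test_function_def by blast
    then show ?thesis by (simp only: funpow_Suc_right o_def)
  qed
  ultimately show ?thesis using cd(1,2) unfolding test_function_def by blast
qed

lemma test_function_zero: "x \<le> a \<or> b \<le> x \<Longrightarrow> \<phi> x = 0"
  using \<phi> unfolding test_function_def by force

end

lemma test_function_continuous: "test_function a b \<phi> \<Longrightarrow> continuous_on S \<phi>"
  using test_function_DERIV by (meson DERIV_isCont continuous_at_imp_continuous_on)

lemma test_function_deriv_continuous: "test_function a b \<phi> \<Longrightarrow> continuous_on S (deriv \<phi>)"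
  by (rule test_function_continuous[OF test_function_deriv])

lemma test_function_bounded:
  assumes "test_function a b \<phi>"
  shows "\<exists>K. \<forall>x. \<bar>\<phi> x\<bar> \<le> K"
proof -
  have "bounded (\<phi> ` {a..b})"
    by (intro compact_imp_bounded compact_continuous_image test_function_continuous[OF assms]) auto
  then have "\<exists>K. \<forall>x\<in>{a..b}. \<bar>\<phi> x\<bar> \<le> K" by (auto simp: bounded_iff)
  then obtain K where K: "\<And>x. x \<in> {a..b} \<Longrightarrow> \<bar>\<phi> x\<bar> \<le> K" by blast
  have "\<bar>\<phi> x\<bar> \<le> \<bar>K\<bar>" for x
    using K[of x] test_function_zero[OF assms, of x] by (cases "x \<in> {a..b}") auto
  then show ?thesis by blast
qed

lemma deriv_funpow_linear:
  fixes f g :: "real \<Rightarrow> real"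
  assumes "\<And>k. (deriv ^^ k) f differentiable_on UNIV" "\<And>k. (deriv ^^ k) g differentiable_on UNIV"
  shows "(deriv ^^ k) (\<lambda>x. f x + c * g x) = (\<lambda>x. (deriv ^^ k) f x + c * (deriv ^^ k) g x)"
proof (induction k)
  case (Suc k)
  have "((deriv ^^ k) f has_real_derivative (deriv ^^ Suc k) f x) (at x)"
    "((deriv ^^ k) g has_real_derivative (deriv ^^ Suc k) g x) (at x)" for x
    using assms[of k] DERIV_deriv_iff_real_differentiable by (auto simp: differentiable_on_def)
  then have "((\<lambda>x. (deriv ^^ k) f x + c * (deriv ^^ k) g x) has_real_derivative (deriv ^^ Suc k) f x + c * (deriv ^^ Suc k) g x) (at x)" for x
    by (intro DERIV_add DERIV_cmult)
  then have "deriv (\<lambda>x. (deriv ^^ k) f x + c * (deriv ^^ k) g x) = (\<lambda>x. (deriv ^^ Suc k) f x + c * (deriv ^^ Suc k) g x)"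
    by (intro ext DERIV_imp_deriv)
  then show ?case using Suc by simp
qed simp

lemma test_function_linear:
  assumes \<phi>: "test_function a b \<phi>" and \<psi>: "test_function a b \<psi>"
  shows "test_function a b (\<lambda>x. \<phi> x + c * \<psi> x)"
    and deriv_test_function_linear: "deriv (\<lambda>x. \<phi> x + c * \<psi> x) = (\<lambda>x. deriv \<phi> x + c * deriv \<psi> x)"
proof -
  have diff: "(deriv ^^ k) \<phi> differentiable_on UNIV" "(deriv ^^ k) \<psi> differentiable_on UNIV" for k
    using assms unfolding test_function_def by blast+
  obtain c1 d1 c2 d2 where cd: "a < c1" "d1 < b" "\<forall>x. \<phi> x \<noteq> 0 \<longrightarrow> x \<in> {c1..d1}"
    "a < c2" "d2 < b" "\<forall>x. \<psi> x \<noteq> 0 \<longrightarrow> x \<in> {c2..d2}"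
    using assms unfolding test_function_def by blast
  have "(deriv ^^ k) (\<lambda>x. \<phi> x + c * \<psi> x) differentiable_on UNIV" for k
    unfolding deriv_funpow_linear[OF diff]
    using diff[of k] by (intro derivative_intros) 
  moreover have "\<forall>x. \<phi> x + c * \<psi> x \<noteq> 0 \<longrightarrow> x \<in> {min c1 c2..max d1 d2}"
  proof (intro allI impI)
    fix x assume "\<phi> x + c * \<psi> x \<noteq> 0"
    then have "x \<in> {c1..d1} \<or> x \<in> {c2..d2}" using cd(3,6) by force
    then show "x \<in> {min c1 c2..max d1 d2}" by auto
  qed
  moreover have "a < min c1 c2" "max d1 d2 < b" using cd by auto
  ultimately show "test_function a b (\<lambda>x. \<phi> x + c * \<psi> x)"
    unfolding test_function_def by blast
  show "deriv (\<lambda>x. \<phi> x + c * \<psi> x) = (\<lambda>x. deriv \<phi> x + c * deriv \<psi> x)"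
    using deriv_funpow_linear[OF diff, of 1 c] by simp
qed

text \<open>The primitive from a vanishes to the left of the support by normalization and to the
  right of it because the total integral is zero.\<close>

lemma test_function_antiderivative:
  assumes \<phi>: "test_function a b \<phi>" and "a \<le> b" and int: "(LINT x|lebesgue_on {a..b}. \<phi> x) = 0"
  shows "\<exists>\<Phi>. test_function a b \<Phi> \<and> deriv \<Phi> = \<phi>"
proof -
  obtain c d where cd: "a < c" "d < b" "\<forall>x. \<phi> x \<noteq> 0 \<longrightarrow> x \<in> {c..d}" using \<phi> unfolding test_function_def by blast
  have "isCont \<phi> x" for x using test_function_DERIV[OF \<phi>] by (rule DERIV_isCont)
  then obtain F where "\<And>x. (F has_vector_derivative \<phi> x) (at x)"
    using einterval_antiderivative[of "-\<infinity>" "\<infinity>" \<phi>] by auto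
  then have F: "(F has_real_derivative \<phi> x) (at x)" for x
    by (simp add: has_real_derivative_iff_has_vector_derivative)
  define \<Phi> where "\<Phi> x = F x - F a" for x
  have D: "(\<Phi> has_real_derivative \<phi> x) (at x)" for x
    unfolding \<Phi>_def using F by (auto intro!: derivative_eq_intros)
  then have deriv: "deriv \<Phi> = \<phi>" by (auto intro: DERIV_imp_deriv)
  have left: "\<Phi> x = 0" if "x < c" for x
  proof -
    have "(\<Phi> has_real_derivative 0) (at y within {..<c})" if "y \<in> {..<c}" for y
    proof -
      have "\<phi> y = 0" using cd(3) that by force
      then show ?thesis using has_field_derivative_at_within[OF D, of y "{..<c}"] by simp
    qed
    from has_field_derivative_zero_constant[OF convex_real_interval(4) this]
    obtain k where "\<forall>y\<in>{..<c}. \<Phi> y = k" by blast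
    then show ?thesis using that cd(1) by (metis \<Phi>_def diff_self lessThan_iff)
  qed
  have "(\<phi> has_integral \<Phi> b - \<Phi> a) {a..b}"
    using D \<open>a \<le> b\<close> by (intro fundamental_theorem_of_calculus)
     (auto simp: has_real_derivative_iff_has_vector_derivative[symmetric] intro: has_field_derivative_at_within)
  moreover have "integrable (lebesgue_on {a..b}) \<phi>"
    by (intro continuous_imp_integrable_real test_function_continuous[OF \<phi>])
  ultimately have "\<Phi> b = 0"
    using int by (simp add: lebesgue_integral_eq_integral integral_unique \<Phi>_def)
  have right: "\<Phi> x = 0" if "d < x" for x
  proof -
    have "(\<Phi> has_real_derivative 0) (at y within {d<..})" if "y \<in> {d<..}" for y
    proof -
      have "\<phi> y = 0" using cd(3) that by force
      then show ?thesis using has_field_derivative_at_within[OF D, of y "{d<..}"] by simp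
    qed
    from has_field_derivative_zero_constant[OF convex_real_interval(3) this]
    obtain k where "\<forall>y\<in>{d<..}. \<Phi> y = k" by blast
    then show ?thesis using that cd(2) \<open>\<Phi> b = 0\<close> by (metis greaterThan_iff)
  qed
  have "(deriv ^^ k) \<Phi> differentiable_on UNIV" for k
  proof (cases k)
    case 0
    then show ?thesis using D
      by (auto simp: differentiable_on_def real_differentiable_def intro: has_field_derivative_at_within)
  next
    case (Suc j)
    then show ?thesis
      using \<phi> deriv unfolding test_function_def by (simp add: funpow_Suc_right del: funpow.simps)
  qed
  moreover have "\<forall>x. \<Phi> x \<noteq> 0 \<longrightarrow> x \<in> {c..d}" using left right by (meson atLeastAtMost_iff not_less)
  ultimately have "test_function a b \<Phi>" using cd(1,2) unfolding test_function_def by blast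
  then show ?thesis using deriv by blast
qed

lemma integrable_continuous_scaleR:
  fixes u :: "real \<Rightarrow> 'x::{banach, second_countable_topology}"
  assumes "continuous_on {a..b} \<phi>" "integrable (lebesgue_on {a..b}) u"
  shows "integrable (lebesgue_on {a..b}) (\<lambda>t. \<phi> t *\<^sub>R u t)"
proof -
  have "\<exists>K. \<forall>t\<in>{a..b}. \<bar>\<phi> t\<bar> \<le> K"
    using compact_imp_bounded[OF compact_continuous_image[OF assms(1)]] by (auto simp: bounded_iff)
  then obtain K where K: "\<And>t. t \<in> {a..b} \<Longrightarrow> \<bar>\<phi> t\<bar> \<le> K" by blast
  show ?thesis
  proof (rule Bochner_Integration.integrable_bound)
    show "integrable (lebesgue_on {a..b}) (\<lambda>t. K *\<^sub>R u t)" using assms(2) by simp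
    show "(\<lambda>t. \<phi> t *\<^sub>R u t) \<in> borel_measurable (lebesgue_on {a..b})"
      by (intro borel_measurable_scaleR continuous_imp_measurable_on_sets_lebesgue[OF assms(1)]
          borel_measurable_integrable[OF assms(2)]) simp
    show "AE t in lebesgue_on {a..b}. norm (\<phi> t *\<^sub>R u t) \<le> norm (K *\<^sub>R u t)"
      using K by (intro AE_I2) (auto intro!: mult_right_mono intro: order.trans[OF _ abs_ge_self])
  qed
qed

lemmas test_function_integrable =
  integrable_continuous_scaleR[OF test_function_continuous]
  integrable_continuous_scaleR[OF test_function_deriv_continuous]

text \<open>Letting s tend to 0 sends the exponential to 1 pointwise inside. The ends are pulled in
  by 1/(n+1) so that each approximant is a test function on (c, d) itself.\<close>

lemma bump_tendsto_indicator:
  fixes c d x :: real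
  shows "(\<lambda>n. bump (1 / real (Suc n)) (c + 1 / real (Suc n)) (d - 1 / real (Suc n)) [:1:] 0 x) \<longlonglongrightarrow> indicator {c<..<d} x"
proof (cases "c < x \<and> x < d")
  case True
  let ?e = "\<lambda>n. 1 / real (Suc n)"
  have e: "?e \<longlonglongrightarrow> 0" by (intro LIMSEQ_Suc lim_1_over_n)
  have "(\<lambda>n. exp (- ?e n / ((x - (c + ?e n)) * (d - ?e n - x)))) \<longlonglongrightarrow> exp (- 0 / ((x - (c + 0)) * (d - 0 - x)))"
    using True by (intro tendsto_intros e) auto
  moreover have "\<forall>\<^sub>F n in sequentially. ?e n < x - c" "\<forall>\<^sub>F n in sequentially. ?e n < d - x"
    using True order_tendstoD(2)[OF e, of "x - c"] order_tendstoD(2)[OF e, of "d - x"] by simp_all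
  then have "\<forall>\<^sub>F n in sequentially. exp (- ?e n / ((x - (c + ?e n)) * (d - ?e n - x))) = bump (?e n) (c + ?e n) (d - ?e n) [:1:] 0 x"
    by eventually_elim (simp add: bump_def)
  ultimately have "(\<lambda>n. bump (?e n) (c + ?e n) (d - ?e n) [:1:] 0 x) \<longlonglongrightarrow> exp (- 0 / ((x - (c + 0)) * (d - 0 - x)))"
    by (rule Lim_transform_eventually)
  then show ?thesis using True by simp
next
  case False
  have "bump (1 / real (Suc n)) (c + 1 / real (Suc n)) (d - 1 / real (Suc n)) [:1:] 0 x = 0" for n
  proof -
    have "0 < 1 / real (Suc n)" by simp
    then show ?thesis using False unfolding bump_def by (smt (verit))
  qed
  then show ?thesis using False by simp
qed

lemma abs_bump_le: "0 < s \<Longrightarrow> \<bar>bump s c d [:1:] 0 x\<bar> \<le> 1"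
  by (auto simp: bump_def divide_le_0_iff)

text \<open>The integrals of \<open>v\<close> vanish over open intervals, hence over Borel sets by Dynkin's
  \<open>\<pi>\<close>-\<open>\<lambda>\<close> theorem.\<close>

theorem fundamental_lemma:
  fixes v :: "real \<Rightarrow> 'x::{banach, second_countable_topology}"
  assumes v: "integrable (lebesgue_on {a..b}) v"
    and zero: "\<And>\<phi>. test_function a b \<phi> \<Longrightarrow> (LINT t|lebesgue_on {a..b}. \<phi> t *\<^sub>R v t) = 0"
  shows "AE t in lebesgue_on {a..b}. v t = 0"
proof -
  let ?M = "lebesgue_on {a..b}"
  have [measurable]: "v \<in> borel_measurable ?M" using v by simp
  have sets: "A \<in> sets borel \<Longrightarrow> A \<inter> {a..b} \<in> sets ?M" for A
    by (simp add: sets_restrict_space_iff)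
  define I where "I A = (LINT t|?M. indicator A t *\<^sub>R v t)" for A
  have meas: "indicat_real A \<in> borel_measurable ?M" if "A \<in> sets borel" for A
    using that by (intro measurable_restrict_space1 measurable_completion) simp
  have int: "integrable ?M (\<lambda>t. indicator A t *\<^sub>R v t)" if "A \<in> sets borel" for A
  proof (rule Bochner_Integration.integrable_bound[OF v])
    show "(\<lambda>t. indicat_real A t *\<^sub>R v t) \<in> borel_measurable ?M"
      by (intro borel_measurable_scaleR meas that) simp
  qed (auto simp: indicator_def)
  have inner: "I {c<..<d} = 0" if "a \<le> c" "d \<le> b" for c d
  proof -
    let ?e = "\<lambda>n. 1 / real (Suc n)"
    let ?\<phi> = "\<lambda>n. bump (?e n) (c + ?e n) (d - ?e n) [:1:] 0"
    have tf: "test_function a b (?\<phi> n)" for n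
    proof -
      have "0 < ?e n" by simp
      then show ?thesis using that by (intro test_function_bump) linarith+
    qed
    have "(\<lambda>n. LINT t|?M. ?\<phi> n t *\<^sub>R v t) \<longlonglongrightarrow> I {c<..<d}"
      unfolding I_def
    proof (rule integral_dominated_convergence)
      show "(\<lambda>t. indicat_real {c<..<d} t *\<^sub>R v t) \<in> borel_measurable ?M"
        using int[of "{c<..<d}"] by simp
      show "(\<lambda>t. ?\<phi> n t *\<^sub>R v t) \<in> borel_measurable ?M" for n
        using test_function_integrable(1)[OF tf v] by simp
      show "integrable ?M (\<lambda>t. norm (v t))" using v by simp
      show "AE t in ?M. (\<lambda>n. ?\<phi> n t *\<^sub>R v t) \<longlonglongrightarrow> indicat_real {c<..<d} t *\<^sub>R v t"
        by (intro AE_I2 tendsto_scaleR bump_tendsto_indicator tendsto_const)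
      show "AE t in ?M. norm (?\<phi> n t *\<^sub>R v t) \<le> norm (v t)" for n
        using abs_bump_le[of "?e n"] by (intro AE_I2) (simp add: mult_left_le_one_le)
    qed
    then show ?thesis using zero[OF tf] by (simp add: LIMSEQ_const_iff)
  qed
  \<comment> \<open>The end points of [a, b] form a null set, so every set may be cut down to the
    open interval, on which the test functions live.\<close>
  have AE_I: "I A = I B" if "A \<in> sets borel" "B \<in> sets borel" "A \<inter> {a<..<b} = B \<inter> {a<..<b}" for A B
    unfolding I_def
  proof (rule integral_cong_AE)
    have "AE t in ?M. t \<noteq> a" "AE t in ?M. t \<noteq> b" by (auto intro: AE_lebesgue_on_neq)
    moreover have "AE t in ?M. t \<in> {a..b}" using AE_space[of ?M] by simp
    ultimately show "AE t in ?M. indicat_real A t *\<^sub>R v t = indicat_real B t *\<^sub>R v t"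
    proof eventually_elim
      case (elim t)
      then have "t \<in> {a<..<b}" by auto
      then have "t \<in> A \<longleftrightarrow> t \<in> B" using that(3) by blast
      then show ?case by (simp add: indicator_def)
    qed
  qed (use int that in auto)
  have interval: "I {c<..<d} = 0" for c d
  proof -
    have "I {c<..<d} = I {max a c<..<min b d}" by (rule AE_I) auto
    then show ?thesis by (simp add: inner)
  qed
  have univ: "I (UNIV :: real set) = 0"
    using AE_I[of UNIV "{a<..<b}"] interval by auto
  have borel: "I A = 0" if "A \<in> sets borel" for A
  proof -
    let ?G = "range (\<lambda>(c, d). {c<..<d::real})"
    have sets_borel: "sets borel = sigma_sets UNIV ?G"
      by (subst borel_eq_box) (simp add: box_real split_def)
    have "Int_stable ?G"
    proof (rule Int_stableI)
      fix A B assume "A \<in> ?G" "B \<in> ?G"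
      then obtain c d c' d' where "A = {c<..<d}" "B = {c'<..<d'}" by auto
      then have "A \<inter> B = (\<lambda>(c, d). {c<..<d}) (max c c', min d d')" by auto
      then show "A \<inter> B \<in> ?G" by (metis rangeI)
    qed
 moreover have "?G \<subseteq> Pow UNIV" by simp
    moreover have "A \<in> sigma_sets UNIV ?G" using that sets_borel by simp
    ultimately show ?thesis
    proof (induction rule: sigma_sets_induct_disjoint)
      case (basic A)
      then show ?case using interval by auto
    next
      case (compl A)
      then have A: "A \<in> sets borel"
        using sets_borel by simp
      have "I (UNIV - A) = (LINT t|?M. indicat_real UNIV t *\<^sub>R v t - indicator A t *\<^sub>R v t)"
        unfolding I_def by (intro Bochner_Integration.integral_cong) (auto simp: indicator_def)
      also have "\<dots> = I UNIV - I A"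
        unfolding I_def using int[OF A] int[of UNIV] by (intro Bochner_Integration.integral_diff) auto
      finally show ?case using univ compl by simp
    next
      case (union A)
      then have A: "A i \<in> sets borel" for i
        using sets_borel by auto
      have U: "(\<Union>i. A i) \<in> sets borel" using A by auto
      have "I (\<Union>i. A i) = I ((\<Union>i. A i) \<inter> {a..b})"
        using A by (intro AE_I) auto
      also have "\<dots> = (LINT t:(\<Union>i. A i \<inter> {a..b})|?M. v t)"
        by (simp add: I_def set_lebesgue_integral_def)
      also have "\<dots> = (\<Sum>i. LINT t:(A i \<inter> {a..b})|?M. v t)"
      proof (rule lebesgue_integral_countable_add)
        show "A i \<inter> {a..b} \<in> sets ?M" for i using sets[OF A] .
        show "i \<noteq> j \<Longrightarrow> (A i \<inter> {a..b}) \<inter> (A j \<inter> {a..b}) = {}" for i j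
          using union(1) by (auto simp: disjoint_family_on_def)
        show "set_integrable ?M (\<Union>i. A i \<inter> {a..b}) v"
          unfolding set_integrable_def using A by (intro int) auto
      qed
      also have "(\<lambda>i. LINT t:(A i \<inter> {a..b})|?M. v t) = (\<lambda>i. 0)"
      proof
        fix i
        have "(LINT t:(A i \<inter> {a..b})|?M. v t) = I (A i \<inter> {a..b})" by (simp add: I_def set_lebesgue_integral_def)
        also have "\<dots> = I (A i)" using A by (intro AE_I) auto
        finally show "(LINT t:(A i \<inter> {a..b})|?M. v t) = 0" using union(3) by simp
      qed
      finally show ?case by simp
    qed (auto simp: I_def)
  qed
  show ?thesis
  proof (rule sigma_finite_measure.density_zero[OF sigma_finite_lebesgue_on_Icc v])
    fix A assume A: "A \<in> sets ?M"
    then have "A \<in> sets lebesgue" by (simp add: sets_restrict_space_iff)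
    \<comment> \<open>A Lebesgue set differs from a Borel set by a null set, so the Borel case
      suffices.\<close>
    then obtain S N N' where S: "A = S \<union> N" "S \<in> sets lborel" "N \<subseteq> N'" "N' \<in> null_sets lborel"
      by (rule sets_completionE) 
    have "AE t in lborel. t \<notin> N'" using S(4) by (rule AE_not_in)
    then have "AE t in lebesgue. t \<notin> N'" by (rule AE_completion)
    then have "AE t in ?M. t \<notin> N'" by (auto simp: AE_restrict_space_iff elim: eventually_mono)
    then have "AE t in ?M. indicat_real A t *\<^sub>R v t = indicat_real S t *\<^sub>R v t"
      by eventually_elim (use S in \<open>auto simp: indicator_def\<close>)
    then have "(LINT t|?M. indicat_real A t *\<^sub>R v t) = I S"
      unfolding I_def using int[of S] S A
      by (intro integral_cong_AE) (auto intro!: borel_measurable_scaleR borel_measurable_indicator)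
    then show "set_lebesgue_integral ?M A v = 0"
      using borel[of S] S by (simp add: set_lebesgue_integral_def)
  qed
qed

text \<open>The du Bois-Reymond argument. Subtracting from a test function \<phi> a multiple of a
  fixed bump \<psi> of nonzero integral leaves integral zero, hence the derivative of a test
  function, against which u integrates to zero.\<close>

lemma constant_if_weak_derivative_zero:
  fixes u :: "real \<Rightarrow> 'x::{banach, second_countable_topology}"
  assumes "a < b" and u: "integrable (lebesgue_on {a..b}) u"
    and zero: "\<And>\<phi>. test_function a b \<phi> \<Longrightarrow> (LINT t|lebesgue_on {a..b}. deriv \<phi> t *\<^sub>R u t) = 0"
  shows "\<exists>c. AE t in lebesgue_on {a..b}. u t = c"
proof -
  let ?M = "lebesgue_on {a..b}"
  define c where "c = (2 * a + b) / 3"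
  define d where "d = (a + 2 * b) / 3"
  have cd: "a < c" "c < d" "d < b" using \<open>a < b\<close> by (auto simp: c_def d_def field_simps)
  define \<psi> where "\<psi> = bump 1 c d [:1:] 0"
  have \<psi>: "test_function a b \<psi>" unfolding \<psi>_def using cd by (intro test_function_bump) auto
  have int: "integrable ?M \<phi>" if "test_function a b \<phi>" for \<phi>
    by (intro continuous_imp_integrable_real test_function_continuous[OF that])
  define m where "m = (LINT t|?M. \<psi> t)"
  have "m \<noteq> 0"
  proof
    assume "m = 0"
    moreover have "0 \<le> \<psi> t" for t by (simp add: \<psi>_def bump_def)
    ultimately have "AE t in ?M. \<psi> t = 0"
      using integral_nonneg_eq_0_iff_AE[OF int[OF \<psi>]] by (simp add: m_def)
    moreover have "AE t in ?M. t \<in> {a..b}" using AE_space[of ?M] by simp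
    ultimately have "AE t in ?M. t \<notin> {c<..<d}"
      by eventually_elim (auto simp: \<psi>_def bump_def)
    then have "AE t in lebesgue. t \<in> {a..b} \<longrightarrow> t \<notin> {c<..<d}" by (simp add: AE_restrict_space_iff)
    then have "AE t in lebesgue. t \<notin> {c<..<d}" by eventually_elim (use cd in auto)
    then have "emeasure lebesgue {c<..<d} = 0"
      by (subst (asm) AE_iff_measurable[of "{c<..<d}"]) auto
    then show False using cd by simp
  qed
  \<comment> \<open>The mean of u with weight \<psi>/m, the only candidate for the constant.\<close>
  define w where "w = (1 / m) *\<^sub>R (LINT t|?M. \<psi> t *\<^sub>R u t)"
  have "AE t in ?M. u t - w = 0"
  proof (rule fundamental_lemma)
    have fin: "finite_measure ?M" by (rule finite_measure_lebesgue_on) auto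
    then show "integrable ?M (\<lambda>t. u t - w)" using u finite_measure.integrable_const[OF fin] by auto
    fix \<phi> assume \<phi>: "test_function a b \<phi>"
    define n where "n = (LINT t|?M. \<phi> t)"
    have tf: "test_function a b (\<lambda>t. \<phi> t + (- n / m) * \<psi> t)" by (rule test_function_linear[OF \<phi> \<psi>])
    have "(LINT t|?M. \<phi> t + (- n / m) * \<psi> t) = n + (- n / m) * m"
      unfolding n_def m_def using int[OF \<phi>] int[OF \<psi>] by simp
    also have "\<dots> = 0" using \<open>m \<noteq> 0\<close> by simp
    finally obtain \<Phi> where \<Phi>: "test_function a b \<Phi>" "deriv \<Phi> = (\<lambda>t. \<phi> t + (- n / m) * \<psi> t)"
      using test_function_antiderivative[OF tf] \<open>a < b\<close> by auto
    have "0 = (LINT t|?M. deriv \<Phi> t *\<^sub>R u t)" using zero[OF \<Phi>(1)] by simp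
    also have "\<dots> = (LINT t|?M. \<phi> t *\<^sub>R u t + (- n / m) *\<^sub>R (\<psi> t *\<^sub>R u t))"
      by (simp only: \<Phi>(2) scaleR_add_left scaleR_scaleR)
    also have "\<dots> = (LINT t|?M. \<phi> t *\<^sub>R u t) + (- n / m) *\<^sub>R (LINT t|?M. \<psi> t *\<^sub>R u t)"
      by (subst Bochner_Integration.integral_add)
        (intro integrable_scaleR_right test_function_integrable(1)[OF \<phi> u] test_function_integrable(1)[OF \<psi> u]
          | simp only: integral_scaleR_right)+
    also have "\<dots> = (LINT t|?M. \<phi> t *\<^sub>R u t) - n *\<^sub>R w" by (simp add: w_def)
    also have "n *\<^sub>R w = (LINT t|?M. \<phi> t *\<^sub>R w)" using int[OF \<phi>] by (simp add: n_def)
    also have "(LINT t|?M. \<phi> t *\<^sub>R u t) - (LINT t|?M. \<phi> t *\<^sub>R w) = (LINT t|?M. \<phi> t *\<^sub>R (u t - w))"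
      using test_function_integrable(1)[OF \<phi> u] int[OF \<phi>] by (simp add: scaleR_diff_right)
    finally show "(LINT t|?M. \<phi> t *\<^sub>R (u t - w)) = 0" by simp
  qed
  then show ?thesis by (intro exI[of _ w]) simp
qed

lemma weak_derivative_unique:
  assumes "weak_derivative a b u v" "weak_derivative a b u v'"
    and int: "integrable (lebesgue_on {a..b}) v" "integrable (lebesgue_on {a..b}) v'"
  shows "AE t in lebesgue_on {a..b}. v t = v' t"
proof -
  have "AE t in lebesgue_on {a..b}. v t - v' t = 0"
  proof (rule fundamental_lemma)
    fix \<phi> assume \<phi>: "test_function a b \<phi>"
    have "- (LINT t|lebesgue_on {a..b}. \<phi> t *\<^sub>R v t) = - (LINT t|lebesgue_on {a..b}. \<phi> t *\<^sub>R v' t)"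
      using assms(1,2) \<phi> unfolding weak_derivative_def by (blast intro: trans sym)
    then show "(LINT t|lebesgue_on {a..b}. \<phi> t *\<^sub>R (v t - v' t)) = 0"
      using test_function_integrable(1)[OF \<phi> int(1)] test_function_integrable(1)[OF \<phi> int(2)]
      by (simp add: scaleR_diff_right)
  qed (use int in auto)
  then show ?thesis by eventually_elim simp
qed

text \<open>The semigroup of the zero operator is the identity and its Duhamel integral is the
  ordinary primitive. Continuity and integration by parts of primitives thus become special cases of
  the results on mild solutions.\<close>

interpretation trivial: separable_dissipative UNIV "\<lambda>_. 0 :: real"
proof
  show "\<exists>x\<in>UNIV. l *\<^sub>R x - 0 = y" if "0 < l" for l y :: real
    using that by (intro bexI[of _ "y / l"]) auto
qed auto

lemma trivial_sg: "0 \<le> t \<Longrightarrow> trivial.sg t x = x"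
  using trivial.sg_invariant[of 1 t x] by simp

definition primitive :: "(real \<Rightarrow> real) \<Rightarrow> real \<Rightarrow> real"
  where "primitive v x = (LINT s|lebesgue_on {0..x}. v s)"

lemma primitive_duhamel: "primitive v = trivial.duhamel v"
  unfolding primitive_def trivial.duhamel_def fun_eq_iff
  by (intro allI Bochner_Integration.integral_cong) (auto simp: trivial_sg)

lemma continuous_on_primitive: "integrable (lebesgue_on {0..l}) v \<Longrightarrow> continuous_on {0..l} (primitive v)"
  unfolding primitive_duhamel by (rule trivial.duhamel_continuous)

lemma weak_derivative_primitive:
  assumes "integrable (lebesgue_on {0..l}) v" "0 \<le> l"
  shows "weak_derivative 0 l (primitive v) v"
  unfolding weak_derivative_def
proof (intro allI impI)
  fix \<phi> assume \<phi>: "test_function 0 l \<phi>"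
  have eq: "trivial.sg t 0 + trivial.duhamel v t = primitive v t" if "t \<in> {0..l}" for t
    using that by (simp add: primitive_duhamel trivial_sg)
  have "(LINT t|lebesgue_on {0..l}. deriv \<phi> t *\<^sub>R primitive v t) =
      (LINT t|lebesgue_on {0..l}. deriv \<phi> t * inner (trivial.sg t 0 + trivial.duhamel v t) 1)"
    by (intro Bochner_Integration.integral_cong) (simp_all add: eq)
  also have "\<dots> = - (LINT t|lebesgue_on {0..l}. \<phi> t * (inner (trivial.sg t 0 + trivial.duhamel v t) 0 + inner (v t) 1))"
    using assms test_function_zero[OF \<phi>]
    by (intro trivial.mild_parts test_function_DERIV[OF \<phi>] test_function_deriv_continuous[OF \<phi>]) auto
  finally show "(LINT t|lebesgue_on {0..l}. deriv \<phi> t *\<^sub>R primitive v t) = - (LINT t|lebesgue_on {0..l}. \<phi> t *\<^sub>R v t)"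
    by simp
qed

text \<open>Both u and the primitive of v have the weak derivative v, so their difference is
  constant almost everywhere.\<close>

lemma weak_derivative_imp_primitive:
  fixes u v :: "real \<Rightarrow> real"
  assumes "0 < l" "integrable (lebesgue_on {0..l}) u" "integrable (lebesgue_on {0..l}) v"
    and "weak_derivative 0 l u v"
  shows "\<exists>c. AE t in lebesgue_on {0..l}. u t = c + primitive v t"
proof -
  have int: "integrable (lebesgue_on {0..l}) (primitive v)"
    by (intro continuous_imp_integrable_real continuous_on_primitive assms)
  have "\<exists>c. AE t in lebesgue_on {0..l}. u t - primitive v t = c"
  proof (rule constant_if_weak_derivative_zero)
    fix \<phi> assume \<phi>: "test_function 0 l \<phi>"
    have "weak_derivative 0 l (primitive v) v" using assms by (intro weak_derivative_primitive) auto
    then show "(LINT t|lebesgue_on {0..l}. deriv \<phi> t *\<^sub>R (u t - primitive v t)) = 0"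
      using assms(4) \<phi> test_function_integrable(2)[OF \<phi> assms(2)] test_function_integrable(2)[OF \<phi> int]
      unfolding weak_derivative_def by (simp add: right_diff_distrib)
  qed (use assms int in auto)
  then show ?thesis by (auto simp: diff_eq_eq)
qed

section \<open>Square integrable functions on an interval\<close>

lemma Icc_sets_lebesgue: "{a..b::real} \<in> sets lebesgue"
  by (rule sets_completionI_sets) simp

lemma abs_l2_eqI:
  "sq_integrable lebesgue f \<Longrightarrow> sq_integrable lebesgue g \<Longrightarrow> AE x in lebesgue. f x = g x \<Longrightarrow> abs_l2 f = abs_l2 g"
  by (rule Quotient3_rel_abs[OF Quotient3_l2]) simp

lemma rep_l2_add: "AE x in lebesgue. rep_l2 (p + q) x = rep_l2 p x + rep_l2 q x"
proof -
  have "p + q = abs_l2 (\<lambda>x. rep_l2 p x + rep_l2 q x)"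
    using plus_l2.abs_eq[of "rep_l2 p" "rep_l2 q"] by (simp add: abs_rep_l2 sq_integrable_rep_l2)
  then show ?thesis using rep_abs_l2[OF sq_integrable_add[OF sq_integrable_rep_l2 sq_integrable_rep_l2]] by simp
qed

lemma rep_l2_scale: "AE x in lebesgue. rep_l2 (c *\<^sub>R p) x = c * rep_l2 p x"
proof -
  have "c *\<^sub>R p = abs_l2 (\<lambda>x. c * rep_l2 p x)"
    using scaleR_l2.abs_eq[of "rep_l2 p" c] by (simp add: abs_rep_l2 sq_integrable_rep_l2)
  then show ?thesis using rep_abs_l2[OF sq_integrable_scale[OF sq_integrable_rep_l2]] by simp
qed

lemma inner_l2_rep: "inner p q = (LINT x|lebesgue. rep_l2 p x * rep_l2 q x)"
  using inner_l2.abs_eq[of "rep_l2 p" "rep_l2 q"] by (simp add: abs_rep_l2 sq_integrable_rep_l2)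

lemma rep_l2_measurable [measurable]: "rep_l2 p \<in> borel_measurable lebesgue"
  using sq_integrable_rep_l2[of p] by (simp add: sq_integrable_def)

lemma rep_l2_measurable_on [measurable]: "rep_l2 p \<in> borel_measurable (lebesgue_on S)"
  by (rule measurable_restrict_space1[OF rep_l2_measurable])

lemma AE_lebesgue_onI: "S \<in> sets lebesgue \<Longrightarrow> AE x in lebesgue. P x \<Longrightarrow> AE x in lebesgue_on S. P x"
  by (auto simp: AE_restrict_space_iff elim: eventually_mono)

lemma sq_integrable_on_rep_l2: "sq_integrable (lebesgue_on {0..l}) (rep_l2 p)"
  unfolding sq_integrable_def
proof
  have "integrable lebesgue (\<lambda>x. indicator {0..l} x *\<^sub>R (norm (rep_l2 p x))\<^sup>2)"
    using sq_integrable_rep_l2[of p] by (intro integrable_mult_indicator) (auto simp: sq_integrable_def)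
  then show "integrable (lebesgue_on {0..l}) (\<lambda>x. (norm (rep_l2 p x))\<^sup>2)"
    by (simp add: integrable_restrict_space)
qed simp

lemma sq_integrable_imp_integrable_on:
  fixes f :: "real \<Rightarrow> 'x::{banach, second_countable_topology}"
  assumes "sq_integrable (lebesgue_on {a..b}) f"
  shows "integrable (lebesgue_on {a..b}) f"
proof (rule Bochner_Integration.integrable_bound)
  have "finite_measure (lebesgue_on {a..b})" by (rule finite_measure_lebesgue_on) auto
  then show "integrable (lebesgue_on {a..b}) (\<lambda>x. 1 + (norm (f x))\<^sup>2)"
    using assms finite_measure.integrable_const by (auto simp: sq_integrable_def)
  show "f \<in> borel_measurable (lebesgue_on {a..b})" using assms by (simp add: sq_integrable_def)
  have "t \<le> 1 + t\<^sup>2" for t :: real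
    using zero_le_power2[of "t - 1/2"] by (simp add: power2_eq_square algebra_simps)
  then show "AE x in lebesgue_on {a..b}. norm (f x) \<le> norm (1 + (norm (f x))\<^sup>2)" by simp
qed

lemma integrable_on_rep_l2: "integrable (lebesgue_on {0..l}) (rep_l2 p)"
  by (rule sq_integrable_imp_integrable_on[OF sq_integrable_on_rep_l2])

lemma sq_integrable_continuous:
  fixes f :: "real \<Rightarrow> real"
  assumes "continuous_on {a..b} f"
  shows "sq_integrable (lebesgue_on {a..b}) f"
  unfolding sq_integrable_def
  using assms by (auto intro!: continuous_imp_integrable_real continuous_intros continuous_imp_measurable_on_sets_lebesgue)

definition restr :: "real \<Rightarrow> (real \<Rightarrow> real) \<Rightarrow> l2"
  where "restr l f = abs_l2 (\<lambda>x. if x \<in> {0..l} then f x else 0)"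

lemma sq_integrable_restr:
  fixes l :: real
  assumes "sq_integrable (lebesgue_on {0..l}) f"
  shows "sq_integrable lebesgue (\<lambda>x. if x \<in> {0..l} then f x else 0)"
  unfolding sq_integrable_def
proof
  have "(\<lambda>x. indicator {0..l} x *\<^sub>R f x) = (\<lambda>x. if x \<in> {0..l} then f x else 0)"
    by (auto simp: indicator_def)
  moreover have "f \<in> borel_measurable (lebesgue_on {0..l})" using assms by (simp add: sq_integrable_def)
  ultimately show "(\<lambda>x. if x \<in> {0..l} then f x else 0) \<in> borel_measurable lebesgue"
    using borel_measurable_restrict_space_iff[of "{0..l}" lebesgue f] Icc_sets_lebesgue[of 0 l] by simp
  have "integrable lebesgue (\<lambda>x. indicator {0..l} x *\<^sub>R (norm (f x))\<^sup>2)"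
    using assms integrable_restrict_space[of "{0..l}" lebesgue "\<lambda>x. (norm (f x))\<^sup>2"] Icc_sets_lebesgue[of 0 l]
    by (simp add: sq_integrable_def)
  moreover have "(\<lambda>x. indicator {0..l} x *\<^sub>R (norm (f x))\<^sup>2) = (\<lambda>x. (norm (if x \<in> {0..l} then f x else 0))\<^sup>2)"
    by (auto simp: indicator_def)
  ultimately show "integrable lebesgue (\<lambda>x. (norm (if x \<in> {0..l} then f x else 0))\<^sup>2)" by simp
qed

lemma rep_restr:
  assumes "sq_integrable (lebesgue_on {0..l}) f"
  shows "AE x in lebesgue. rep_l2 (restr l f) x = (if x \<in> {0..l} then f x else 0)"
  unfolding restr_def by (rule rep_abs_l2[OF sq_integrable_restr[OF assms]])

lemma rep_restr_on:
  assumes "sq_integrable (lebesgue_on {0..l}) f"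
  shows "AE x in lebesgue_on {0..l}. rep_l2 (restr l f) x = f x"
  using rep_restr[OF assms] by (auto simp: AE_restrict_space_iff elim!: eventually_mono split: if_splits)

lemma restr_cong:
  assumes "sq_integrable (lebesgue_on {0..l}) f" "sq_integrable (lebesgue_on {0..l}) g"
    and "AE x in lebesgue_on {0..l}. f x = g x"
  shows "restr l f = restr l g"
  unfolding restr_def
  using assms(3) by (intro abs_l2_eqI sq_integrable_restr assms) (auto simp: AE_restrict_space_iff elim!: eventually_mono)

lemma restr_add:
  assumes "sq_integrable (lebesgue_on {0..l}) f" "sq_integrable (lebesgue_on {0..l}) g"
  shows "restr l (\<lambda>x. f x + g x) = restr l f + restr l g"
proof -
  have "restr l f + restr l g = abs_l2 (\<lambda>x. (if x \<in> {0..l} then f x else 0) + (if x \<in> {0..l} then g x else 0))"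
    unfolding restr_def using sq_integrable_restr[OF assms(1)] sq_integrable_restr[OF assms(2)]
    by (intro plus_l2.abs_eq) auto
  also have "(\<lambda>x. (if x \<in> {0..l} then f x else 0) + (if x \<in> {0..l} then g x else 0)) = (\<lambda>x. if x \<in> {0..l} then f x + g x else 0)"
    by auto
  finally show ?thesis by (simp add: restr_def)
qed

lemma restr_scale:
  assumes "sq_integrable (lebesgue_on {0..l}) f"
  shows "restr l (\<lambda>x. c * f x) = c *\<^sub>R restr l f"
proof -
  have "c *\<^sub>R restr l f = abs_l2 (\<lambda>x. c * (if x \<in> {0..l} then f x else 0))"
    unfolding restr_def using sq_integrable_restr[OF assms(1)] by (intro scaleR_l2.abs_eq) auto
  also have "(\<lambda>x. c * (if x \<in> {0..l} then f x else 0)) = (\<lambda>x. if x \<in> {0..l} then c * f x else 0)"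
    by auto
  finally show ?thesis by (simp add: restr_def)
qed

lemma inner_restr:
  assumes "sq_integrable (lebesgue_on {0..l}) f"
  shows "inner (restr l f) p = (LINT x|lebesgue_on {0..l}. f x * rep_l2 p x)"
proof -
  have "inner (restr l f) p = (LINT x|lebesgue. indicator {0..l} x *\<^sub>R (f x * rep_l2 p x))"
    unfolding inner_l2_rep
  proof (rule integral_cong_AE)
    have "(\<lambda>x. f x * rep_l2 p x) \<in> borel_measurable (lebesgue_on {0..l})"
      using assms by (auto simp: sq_integrable_def)
    then show "(\<lambda>x. indicat_real {0..l} x *\<^sub>R (f x * rep_l2 p x)) \<in> borel_measurable lebesgue"
      by (simp add: borel_measurable_restrict_space_iff)
    show "AE x in lebesgue. rep_l2 (restr l f) x * rep_l2 p x = indicat_real {0..l} x *\<^sub>R (f x * rep_l2 p x)"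
      using rep_restr[OF assms] by eventually_elim (auto simp: indicator_def)
  qed simp
  then show ?thesis by (simp add: integral_restrict_space)
qed

lemma inner_restr_restr:
  assumes "sq_integrable (lebesgue_on {0..l}) f" "sq_integrable (lebesgue_on {0..l}) g"
  shows "inner (restr l f) (restr l g) = (LINT x|lebesgue_on {0..l}. f x * g x)"
  unfolding inner_restr[OF assms(1)]
proof (rule integral_cong_AE)
  show "AE x in lebesgue_on {0..l}. f x * rep_l2 (restr l g) x = f x * g x"
    using rep_restr_on[OF assms(2)] by eventually_elim simp
qed (use assms in \<open>auto simp: sq_integrable_def\<close>)

lemma norm_restr_le:
  assumes f: "sq_integrable (lebesgue_on {0..l}) f" and g: "sq_integrable (lebesgue_on {0..l}) g"
    and "AE x in lebesgue_on {0..l}. \<bar>f x\<bar> \<le> M * \<bar>g x\<bar>" "0 \<le> M"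
  shows "norm (restr l f) \<le> M * norm (restr l g)"
proof -
  have "(norm (restr l f))\<^sup>2 = (LINT x|lebesgue_on {0..l}. (f x)\<^sup>2)"
    by (simp only: power2_norm_eq_inner inner_restr_restr[OF f f]) (simp add: power2_eq_square)
  also have "\<dots> \<le> (LINT x|lebesgue_on {0..l}. M\<^sup>2 * (g x)\<^sup>2)"
  proof (rule integral_mono_AE)
    show "AE x in lebesgue_on {0..l}. (f x)\<^sup>2 \<le> M\<^sup>2 * (g x)\<^sup>2"
      using assms(3)
    proof eventually_elim
      case (elim x)
      then have "\<bar>f x\<bar>\<^sup>2 \<le> (M * \<bar>g x\<bar>)\<^sup>2" by (intro power_mono) auto
      then show ?case by (simp add: power_mult_distrib)
    qed
  qed (use f g in \<open>auto simp: sq_integrable_def\<close>)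
  also have "\<dots> = M\<^sup>2 * (LINT x|lebesgue_on {0..l}. (g x)\<^sup>2)" by simp
  also have "(LINT x|lebesgue_on {0..l}. (g x)\<^sup>2) = (norm (restr l g))\<^sup>2"
    by (simp only: power2_norm_eq_inner inner_restr_restr[OF g g]) (simp add: power2_eq_square)
  also have "M\<^sup>2 * (norm (restr l g))\<^sup>2 = (M * norm (restr l g))\<^sup>2" by (simp add: power_mult_distrib)
  finally show ?thesis using assms(4) by (rule power2_le_imp_le[OF _ mult_nonneg_nonneg]) simp
qed

text \<open>Pairing with this indicator function integrates from 0 to l, see
  \<open>inner_unit\<close>; primitives become inner products and are estimated by
  Cauchy-Schwarz.\<close>

definition unit :: "real \<Rightarrow> l2" where "unit l = restr l (\<lambda>_. 1)"

lemma sq_integrable_one: "sq_integrable (lebesgue_on {a..b}) (\<lambda>_. 1 :: real)" for a b :: real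
  by (rule sq_integrable_continuous) (rule continuous_on_const)

lemma inner_unit: "inner (unit x) p = primitive (rep_l2 p) x"
  by (simp add: unit_def inner_restr sq_integrable_one primitive_def)

lemma norm_unit: "0 \<le> l \<Longrightarrow> norm (unit l) = sqrt l"
  by (simp add: norm_eq_sqrt_inner unit_def inner_restr_restr sq_integrable_one measure_restrict_space)

lemma abs_inner_unit_le: "0 \<le> x \<Longrightarrow> x \<le> l \<Longrightarrow> \<bar>inner (unit x) k\<bar> \<le> sqrt l * norm k"
  by (intro order.trans[OF Cauchy_Schwarz_ineq2] mult_right_mono) (auto simp: norm_unit)

definition supported :: "real \<Rightarrow> l2 \<Rightarrow> bool"
  where "supported l p \<longleftrightarrow> (AE x in lebesgue. x \<notin> {0..l} \<longrightarrow> rep_l2 p x = 0)"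

lemma supported_restr: "sq_integrable (lebesgue_on {0..l}) f \<Longrightarrow> supported l (restr l f)"
  using rep_restr[of l f] by (auto simp: supported_def elim!: eventually_mono)

lemma restr_rep: "supported l p \<Longrightarrow> restr l (rep_l2 p) = p"
  using abs_l2_eqI[OF sq_integrable_restr[OF sq_integrable_on_rep_l2[of l p]] sq_integrable_rep_l2[of p]]
  by (auto simp: supported_def restr_def abs_rep_l2 elim!: eventually_mono)

lemma supported_eqI:
  assumes "supported l p" "supported l q" "AE x in lebesgue_on {0..l}. rep_l2 p x = rep_l2 q x"
  shows "p = q"
  using restr_cong[OF sq_integrable_on_rep_l2 sq_integrable_on_rep_l2 assms(3)] restr_rep assms(1,2) by metis

text \<open>The Volterra operator of integration from the left end of an edge.\<close>

definition integ :: "real \<Rightarrow> l2 \<Rightarrow> l2"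
  where "integ l k = restr l (\<lambda>x. inner (unit x) k)"

lemma continuous_on_inner_unit: "continuous_on {0..l} (\<lambda>x. inner (unit x) k)"
  unfolding inner_unit using continuous_on_primitive[OF integrable_on_rep_l2] by simp

lemma sq_integrable_inner_unit: "sq_integrable (lebesgue_on {0..l}) (\<lambda>x. inner (unit x) k)"
  by (rule sq_integrable_continuous[OF continuous_on_inner_unit])

lemma norm_integ: "0 \<le> l \<Longrightarrow> norm (integ l k) \<le> norm k * l"
proof -
  assume l: "0 \<le> l"
  have "norm (integ l k) \<le> (sqrt l * norm k) * norm (unit l)"
    unfolding integ_def unit_def[of l] using l
    by (intro norm_restr_le sq_integrable_inner_unit sq_integrable_one AE_I2) (auto intro: abs_inner_unit_le)
  also have "\<dots> = norm k * l" using l by (simp add: norm_unit mult.commute mult.left_commute)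
  finally show ?thesis .
qed

lemma bounded_linear_integ:
  assumes "0 \<le> l"
  shows "bounded_linear (integ l)"
proof (rule bounded_linear_intro)
  show "integ l (k + k') = integ l k + integ l k'" for k k'
    unfolding integ_def inner_add_right by (rule restr_add[OF sq_integrable_inner_unit sq_integrable_inner_unit])
  show "integ l (c *\<^sub>R k) = c *\<^sub>R integ l k" for c k
    unfolding integ_def inner_scaleR_right by (rule restr_scale[OF sq_integrable_inner_unit])
  show "norm (integ l k) \<le> norm k * l" for k by (rule norm_integ[OF assms])
qed

lemma sq_integrable_mult_bounded:
  fixes c f :: "real \<Rightarrow> real"
  assumes "c \<in> borel_measurable M" "AE x in M. \<bar>c x\<bar> \<le> K" "sq_integrable M f"
  shows "sq_integrable M (\<lambda>x. c x * f x)"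
  unfolding sq_integrable_def
proof
  show "(\<lambda>x. c x * f x) \<in> borel_measurable M" using assms by (auto simp: sq_integrable_def)
  show "integrable M (\<lambda>x. (norm (c x * f x))\<^sup>2)"
  proof (rule Bochner_Integration.integrable_bound)
    show "integrable M (\<lambda>x. K\<^sup>2 * (norm (f x))\<^sup>2)" using assms by (auto simp: sq_integrable_def)
    show "(\<lambda>x. (norm (c x * f x))\<^sup>2) \<in> borel_measurable M" using assms by (auto simp: sq_integrable_def)
    show "AE x in M. norm ((norm (c x * f x))\<^sup>2) \<le> norm (K\<^sup>2 * (norm (f x))\<^sup>2)"
      using assms(2)
    proof eventually_elim
      case (elim x)
      then have "\<bar>c x\<bar>\<^sup>2 \<le> K\<^sup>2" by (intro power_mono) auto
      then show ?case by (simp add: power_mult_distrib mult_right_mono)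
    qed
  qed
qed

section \<open>Bounded coefficients\<close>

definition coefficient :: "('v, 'e::finite) network \<Rightarrow> ('e \<Rightarrow> real \<Rightarrow> real) \<Rightarrow> real \<Rightarrow> real \<Rightarrow> bool"
  where "coefficient G c m M \<longleftrightarrow> (\<forall>e. c e \<in> borel_measurable (lebesgue_on {0..edge_length G e}) \<and>
    (AE x in lebesgue_on {0..edge_length G e}. m \<le> c e x \<and> c e x \<le> M))"

lemma mult_restr: "mult G c p $ e = restr (edge_length G e) (\<lambda>x. c e x * rep_l2 (p $ e) x)"
  by (simp add: mult_def restr_def)

lemma L2E_supported: "p \<in> L2E G \<longleftrightarrow> (\<forall>e. supported (edge_length G e) (p $ e))"
  by (simp add: L2E_def supported_def)

context
  fixes G :: "('v, 'e::finite) network" and c m M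
  assumes c: "coefficient G c m M"
begin

lemma coefficient_abs: "AE x in lebesgue_on {0..edge_length G e}. \<bar>c e x\<bar> \<le> max \<bar>m\<bar> \<bar>M\<bar>"
proof -
  have "AE x in lebesgue_on {0..edge_length G e}. m \<le> c e x \<and> c e x \<le> M" using c by (simp add: coefficient_def)
  then show ?thesis by eventually_elim auto
qed

lemma coefficient_measurable: "c e \<in> borel_measurable (lebesgue_on {0..edge_length G e})"
  using c by (simp add: coefficient_def)

lemma sq_integrable_coefficient:
  "sq_integrable (lebesgue_on {0..edge_length G e}) f \<Longrightarrow> sq_integrable (lebesgue_on {0..edge_length G e}) (\<lambda>x. c e x * f x)"
  by (rule sq_integrable_mult_bounded[OF coefficient_measurable coefficient_abs])

lemma mult_in: "mult G c p \<in> L2E G"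
  by (simp add: L2E_supported mult_restr supported_restr sq_integrable_coefficient sq_integrable_on_rep_l2)

lemma mult_add: "mult G c (p + q) = mult G c p + mult G c q"
proof (rule vec_eq_iff[THEN iffD2], rule allI)
  fix e
  let ?l = "edge_length G e"
  have "AE x in lebesgue_on {0..?l}. rep_l2 (p $ e + q $ e) x = rep_l2 (p $ e) x + rep_l2 (q $ e) x"
    by (intro AE_lebesgue_onI rep_l2_add) simp
  then have "AE x in lebesgue_on {0..?l}. c e x * rep_l2 (p $ e + q $ e) x = c e x * rep_l2 (p $ e) x + c e x * rep_l2 (q $ e) x"
    by eventually_elim (simp add: distrib_left)
  then show "mult G c (p + q) $ e = (mult G c p + mult G c q) $ e"
    unfolding vector_add_component mult_restr
    by (subst restr_add[symmetric])
      (intro restr_cong sq_integrable_add sq_integrable_coefficient sq_integrable_on_rep_l2, assumption?)+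
qed

lemma mult_scale: "mult G c (k *\<^sub>R p) = k *\<^sub>R mult G c p"
proof (rule vec_eq_iff[THEN iffD2], rule allI)
  fix e
  let ?l = "edge_length G e"
  have "AE x in lebesgue_on {0..?l}. rep_l2 (k *\<^sub>R p $ e) x = k * rep_l2 (p $ e) x"
    by (intro AE_lebesgue_onI rep_l2_scale) simp
  then have "AE x in lebesgue_on {0..?l}. c e x * rep_l2 (k *\<^sub>R p $ e) x = k * (c e x * rep_l2 (p $ e) x)"
    by eventually_elim simp
  then show "mult G c (k *\<^sub>R p) $ e = (k *\<^sub>R mult G c p) $ e"
    unfolding vector_scaleR_component mult_restr
    by (subst restr_scale[symmetric])
      (intro restr_cong sq_integrable_scale sq_integrable_coefficient sq_integrable_on_rep_l2, assumption?)+
qed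

text \<open>Cutting off is an orthogonal projection: the squared norm of the restriction is its
  pairing with p.\<close>

lemma norm_restr_rep_le: "norm (restr l (rep_l2 p)) \<le> norm p"
proof -
  have "(norm (restr l (rep_l2 p)))\<^sup>2 = inner (restr l (rep_l2 p)) p"
    unfolding power2_norm_eq_inner by (subst inner_restr_restr) (simp_all add: inner_restr sq_integrable_on_rep_l2)
  also have "\<dots> \<le> norm (restr l (rep_l2 p)) * norm p" by (rule norm_cauchy_schwarz)
  finally show ?thesis by (cases "norm (restr l (rep_l2 p)) = 0") (auto simp: power2_eq_square)
qed

lemma norm_mult_le: "norm (mult G c p) \<le> max \<bar>m\<bar> \<bar>M\<bar> * norm p"
proof -
  have "norm (mult G c p $ e) \<le> max \<bar>m\<bar> \<bar>M\<bar> * norm (p $ e)" for e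
  proof -
    have "norm (mult G c p $ e) \<le> max \<bar>m\<bar> \<bar>M\<bar> * norm (restr (edge_length G e) (rep_l2 (p $ e)))"
      unfolding mult_restr using coefficient_abs[of e]
      by (intro norm_restr_le sq_integrable_coefficient sq_integrable_on_rep_l2)
        (auto simp: abs_mult mult_right_mono elim!: eventually_mono)
    also have "\<dots> \<le> max \<bar>m\<bar> \<bar>M\<bar> * norm (p $ e)" by (intro mult_left_mono norm_restr_rep_le) auto
    finally show ?thesis .
  qed
  then have "norm (mult G c p) \<le> L2_set (\<lambda>e. max \<bar>m\<bar> \<bar>M\<bar> * norm (p $ e)) UNIV"
    unfolding norm_vec_def by (intro L2_set_mono) auto
  also have "\<dots> = max \<bar>m\<bar> \<bar>M\<bar> * norm p"
    unfolding norm_vec_def by (intro L2_set_right_distrib[symmetric]) auto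
  finally show ?thesis .
qed

lemma bounded_linear_mult: "bounded_linear (mult G c)"
  by (rule bounded_linear_intro[of _ "max \<bar>m\<bar> \<bar>M\<bar>"])
    (auto simp: mult_add mult_scale norm_mult_le mult.commute[of "norm _"])

lemma inner_mult_nth:
  "inner (mult G c p $ e) (q $ e) = (LINT x|lebesgue_on {0..edge_length G e}. c e x * (rep_l2 (p $ e) x * rep_l2 (q $ e) x))"
  unfolding mult_restr by (simp add: inner_restr sq_integrable_coefficient sq_integrable_on_rep_l2 mult.assoc)

lemma mult_sym: "inner (mult G c p) q = inner p (mult G c q)"
  unfolding inner_vec_def by (intro sum.cong refl, subst (2) inner_commute) (simp add: inner_mult_nth mult_ac)

lemma mult_lower:
  assumes "p \<in> L2E G"
  shows "m * (norm p)\<^sup>2 \<le> inner (mult G c p) p"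
proof -
  have "m * inner (p $ e) (p $ e) \<le> inner (mult G c p $ e) (p $ e)" for e
  proof -
    let ?M = "lebesgue_on {0..edge_length G e}"
    have "p $ e = restr (edge_length G e) (rep_l2 (p $ e))" using assms by (simp add: L2E_supported restr_rep)
    then have "inner (p $ e) (p $ e) = (LINT x|?M. rep_l2 (p $ e) x * rep_l2 (p $ e) x)"
      using inner_restr_restr[OF sq_integrable_on_rep_l2 sq_integrable_on_rep_l2] by metis
    then have "m * inner (p $ e) (p $ e) = (LINT x|?M. m * (rep_l2 (p $ e) x * rep_l2 (p $ e) x))" by simp
    also have "\<dots> \<le> (LINT x|?M. c e x * (rep_l2 (p $ e) x * rep_l2 (p $ e) x))"
    proof (rule integral_mono_AE)
      have "sq_integrable ?M (rep_l2 (p $ e))" by (rule sq_integrable_on_rep_l2)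
      from sq_integrable_mult[OF sq_integrable_coefficient[OF this] this] sq_integrable_mult[OF this this]
      show "integrable ?M (\<lambda>x. m * (rep_l2 (p $ e) x * rep_l2 (p $ e) x))"
        "integrable ?M (\<lambda>x. c e x * (rep_l2 (p $ e) x * rep_l2 (p $ e) x))"
        by (simp_all add: mult.assoc)
      have "AE x in ?M. m \<le> c e x \<and> c e x \<le> M" using c by (simp add: coefficient_def)
      then show "AE x in ?M. m * (rep_l2 (p $ e) x * rep_l2 (p $ e) x) \<le> c e x * (rep_l2 (p $ e) x * rep_l2 (p $ e) x)"
        by eventually_elim (auto intro: mult_right_mono)
    qed
    finally show ?thesis by (simp add: inner_mult_nth)
  qed
  then show ?thesis
    unfolding power2_norm_eq_inner inner_vec_def sum_distrib_left by (rule sum_mono)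
qed

end

lemma mult_inverse:
  assumes c: "coefficient G c m M" and c': "coefficient G c' m' M'" and "p \<in> L2E G"
    and inv: "\<And>e. AE x in lebesgue_on {0..edge_length G e}. c' e x * c e x = 1"
  shows "mult G c' (mult G c p) = p"
proof (rule vec_eq_iff[THEN iffD2], rule allI)
  fix e
  let ?l = "edge_length G e"
  have "AE x in lebesgue_on {0..?l}. rep_l2 (mult G c p $ e) x = c e x * rep_l2 (p $ e) x"
    unfolding mult_restr by (intro rep_restr_on sq_integrable_coefficient[OF c] sq_integrable_on_rep_l2)
  with inv[of e] have "AE x in lebesgue_on {0..?l}. c' e x * rep_l2 (mult G c p $ e) x = rep_l2 (p $ e) x"
    by eventually_elim (simp add: mult.assoc[symmetric])
  then have "mult G c' (mult G c p) $ e = restr ?l (rep_l2 (p $ e))"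
    unfolding mult_restr[of G c' "mult G c p"]
    by (intro restr_cong sq_integrable_coefficient[OF c'] sq_integrable_on_rep_l2)
  then show "mult G c' (mult G c p) $ e = p $ e" using assms(3) by (simp add: restr_rep L2E_supported)
qed

lemma coefficient_one: "coefficient G (\<lambda>_ _. 1) 1 1"
  by (simp add: coefficient_def)

text \<open>Multiplication by 1 cuts off outside the edges, hence this is the orthogonal projection
  onto \<open>L2E G\<close>; boundedness and symmetry come from the general facts on
  \<open>mult\<close>.\<close>

abbreviation proj :: "('v, 'e::finite) network \<Rightarrow> 'e l2e \<Rightarrow> 'e l2e"
  where "proj G \<equiv> mult G (\<lambda>_ _. 1)"

lemma proj_id: "p \<in> L2E G \<Longrightarrow> proj G p = p"
  by (simp add: vec_eq_iff mult_restr restr_rep L2E_supported)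

lemma L2E_iff: "p \<in> L2E G \<longleftrightarrow> proj G p = p"
  using proj_id mult_in[OF coefficient_one] by metis

lemma subspace_L2E: "subspace (L2E G)"
proof (rule subspaceI)
  interpret bounded_linear "proj G" by (rule bounded_linear_mult[OF coefficient_one])
  show "0 \<in> L2E G" "x \<in> L2E G \<Longrightarrow> y \<in> L2E G \<Longrightarrow> x + y \<in> L2E G" "x \<in> L2E G \<Longrightarrow> k *\<^sub>R x \<in> L2E G" for x y k
    by (simp_all add: L2E_iff zero add scaleR)
qed

lemma closed_L2E: "closed (L2E G)"
proof -
  have "L2E G = {p. proj G p = p}" using L2E_iff by blast
  then show ?thesis
    by (simp add: closed_Collect_eq linear_continuous_on[OF bounded_linear_mult[OF coefficient_one]])
qed

section \<open>Sobolev spaces on the network\<close>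

lemma continuous_AE_eq:
  fixes f g :: "real \<Rightarrow> real"
  assumes "a < b" and f: "continuous_on {a..b} f" and g: "continuous_on {a..b} g"
    and AE: "AE x in lebesgue_on {a..b}. f x = g x" and x: "x \<in> {a..b}"
  shows "f x = g x"
proof -
  have cont: "continuous_on {a..b} (\<lambda>x. \<bar>f x - g x\<bar>)" by (intro continuous_intros f g)
  have int: "integrable (lebesgue_on {a..b}) (\<lambda>x. \<bar>f x - g x\<bar>)" by (rule continuous_imp_integrable_real[OF cont])
  have "(LINT x|lebesgue_on {a..b}. \<bar>f x - g x\<bar>) = 0"
    using AE by (intro integral_eq_zero_AE) (auto elim: eventually_mono)
  then have "integral {a..b} (\<lambda>x. \<bar>f x - g x\<bar>) = 0"
    using lebesgue_integral_eq_integral[OF int] by simp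
  then have "\<bar>f x - g x\<bar> = 0"
    using integral_eq_0_iff[OF cont \<open>a < b\<close>] x by auto
  then show ?thesis by simp
qed

lemma integral_deriv_test_function:
  assumes \<phi>: "test_function a b \<phi>" and "a \<le> b"
  shows "(LINT t|lebesgue_on {a..b}. deriv \<phi> t) = 0"
proof -
  have "(deriv \<phi> has_integral \<phi> b - \<phi> a) {a..b}"
    using \<open>a \<le> b\<close> test_function_DERIV[OF \<phi>] by (intro fundamental_theorem_of_calculus)
     (auto simp: has_real_derivative_iff_has_vector_derivative[symmetric] intro: has_field_derivative_at_within)
  moreover have "integrable (lebesgue_on {a..b}) (deriv \<phi>)"
    by (intro continuous_imp_integrable_real test_function_deriv_continuous[OF \<phi>])
  ultimately show ?thesis
    using test_function_zero[OF \<phi>] by (simp add: lebesgue_integral_eq_integral integral_unique)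
qed

text \<open>\<open>h1_rel G q k y\<close>: the function \<open>q\<close> is in \<open>H\<^sup>1\<close> with edgewise derivative \<open>k\<close> and vertex
  values \<open>y\<close>. The conditions are linear and continuous in \<open>(q, k, y)\<close>.\<close>

definition h1_rel :: "('v::finite, 'e::finite) network \<Rightarrow> 'e l2e \<Rightarrow> 'e l2e \<Rightarrow> real ^ 'v \<Rightarrow> bool"
  where "h1_rel G q k y \<longleftrightarrow> q \<in> L2E G \<and> k \<in> L2E G \<and> (\<forall>e.
    q $ e = y $ source G e *\<^sub>R unit (edge_length G e) + integ (edge_length G e) (k $ e) \<and>
    y $ target G e = y $ source G e + inner (unit (edge_length G e)) (k $ e))"

lemma edge_deriv_unique:
  assumes "is_edge_deriv G q k" "is_edge_deriv G q k'"
  shows "k = k'"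
proof (rule vec_eq_iff[THEN iffD2], rule allI)
  fix e
  have "AE x in lebesgue_on {0..edge_length G e}. rep_l2 (k $ e) x = rep_l2 (k' $ e) x"
    using assms by (intro weak_derivative_unique[of 0 _ "rep_l2 (q $ e)"] integrable_on_rep_l2) (auto simp: is_edge_deriv_def)
  then show "k $ e = k' $ e"
    using assms by (intro supported_eqI) (auto simp: is_edge_deriv_def L2E_supported)
qed

lemma op_K_eq: "is_edge_deriv G q k \<Longrightarrow> op_K G q = k"
  unfolding op_K_def using edge_deriv_unique by blast

locale fin_network =
  fixes G :: "('v::finite, 'e::finite) network"
  assumes network: "is_network G"
begin

abbreviation len where "len \<equiv> edge_length G"

lemma len_pos [simp]: "0 < len e" and len_nonneg [simp]: "0 \<le> len e"
  using network by (auto simp: is_network_def intro: less_imp_le)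

lemma len_nonzero [simp]: "len e \<noteq> 0"
  using len_pos[of e] by linarith

text \<open>Needed for the uniqueness of traces: the value at an isolated vertex would be arbitrary.
  By connectedness v is the source of a given edge, or the path from v to it starts with an edge at
  v.\<close>

lemma incident: "\<exists>e. source G e = v \<or> target G e = v"
proof -
  obtain e :: 'e where True by blast
  have "(v, source G e) \<in> (adjacency G \<union> (adjacency G)\<inverse>)\<^sup>*" using network by (simp add: is_network_def)
  then show ?thesis
    by (cases rule: converse_rtranclE) (auto simp: adjacency_def)
qed

lemma inner_unit_unit: "inner (unit (len e)) (unit (len e)) = len e"
  using norm_unit[OF len_nonneg, of e] by (simp add: norm_eq_sqrt_inner)

lemma h1_rel_rep:
  assumes "h1_rel G q k y"
  shows "AE x in lebesgue_on {0..len e}. rep_l2 (q $ e) x = y $ source G e + primitive (rep_l2 (k $ e)) x"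
proof -
  have "q $ e = restr (len e) (\<lambda>x. y $ source G e * 1 + inner (unit x) (k $ e))"
    unfolding restr_add[OF sq_integrable_scale[OF sq_integrable_one] sq_integrable_inner_unit] restr_scale[OF sq_integrable_one]
    using assms by (simp add: h1_rel_def unit_def[symmetric] integ_def[symmetric])
  then show ?thesis
    using rep_restr_on[OF sq_integrable_add[OF sq_integrable_scale[OF sq_integrable_one] sq_integrable_inner_unit],
      of "len e" "y $ source G e" "k $ e"]
    by (simp add: inner_unit)
qed

lemma h1_rel_edge_deriv:
  assumes "h1_rel G q k y"
  shows "is_edge_deriv G q k"
  unfolding is_edge_deriv_def weak_derivative_def
proof (intro conjI allI impI)
  show "k \<in> L2E G" using assms by (simp add: h1_rel_def)
  fix e \<phi> assume \<phi>: "test_function 0 (len e) \<phi>"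
  let ?M = "lebesgue_on {0..len e}" and ?V = "primitive (rep_l2 (k $ e))" and ?c = "y $ source G e"
  have V: "integrable ?M ?V"
    by (intro continuous_imp_integrable_real continuous_on_primitive integrable_on_rep_l2)
  have \<phi>': "integrable ?M (deriv \<phi>)"
    by (intro continuous_imp_integrable_real test_function_deriv_continuous[OF \<phi>])
  have "(LINT t|?M. deriv \<phi> t *\<^sub>R rep_l2 (q $ e) t) = (LINT t|?M. ?c * deriv \<phi> t + deriv \<phi> t * ?V t)"
  proof (rule integral_cong_AE)
    show "AE t in ?M. deriv \<phi> t *\<^sub>R rep_l2 (q $ e) t = ?c * deriv \<phi> t + deriv \<phi> t * ?V t"
      using h1_rel_rep[OF assms, of e] by eventually_elim (simp add: algebra_simps)
    show "(\<lambda>t. deriv \<phi> t *\<^sub>R rep_l2 (q $ e) t) \<in> borel_measurable ?M"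
      by (rule borel_measurable_integrable[OF test_function_integrable(2)[OF \<phi> integrable_on_rep_l2]])
    show "(\<lambda>t. ?c * deriv \<phi> t + deriv \<phi> t * ?V t) \<in> borel_measurable ?M"
      using V \<phi>' by (intro borel_measurable_add borel_measurable_times) auto
  qed
  also have "\<dots> = (LINT t|?M. ?c * deriv \<phi> t) + (LINT t|?M. deriv \<phi> t * ?V t)"
    using test_function_integrable(2)[OF \<phi> V] \<phi>' by (intro Bochner_Integration.integral_add) auto
  also have "\<dots> = - (LINT t|?M. \<phi> t *\<^sub>R rep_l2 (k $ e) t)"
    using weak_derivative_primitive[OF integrable_on_rep_l2, of "len e" "k $ e"] \<phi> integral_deriv_test_function[OF \<phi>]
    by (simp add: weak_derivative_def)
  finally show "(LINT t|?M. deriv \<phi> t *\<^sub>R rep_l2 (q $ e) t) = - (LINT t|?M. \<phi> t *\<^sub>R rep_l2 (k $ e) t)" .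
qed

lemma primitive_zero [simp]: "primitive v 0 = 0"
proof -
  have "AE s in lebesgue_on {0..0::real}. False"
    using AE_lebesgue_on_neq[OF Icc_sets_lebesgue[of 0 0], of 0] AE_space[of "lebesgue_on {0..0::real}"]
    by eventually_elim simp
  then show ?thesis unfolding primitive_def by (intro integral_eq_zero_AE) (auto elim: eventually_mono)
qed

lemma h1_rel_trace:
  assumes "h1_rel G q k y"
  shows "is_trace G q y"
  unfolding is_trace_def
proof (intro exI[of _ "\<lambda>e x. y $ source G e + primitive (rep_l2 (k $ e)) x"] allI conjI)
  fix e
  show "continuous_on {0..len e} (\<lambda>x. y $ source G e + primitive (rep_l2 (k $ e)) x)"
    by (intro continuous_intros continuous_on_primitive integrable_on_rep_l2)
  show "AE x in lebesgue_on {0..len e}. y $ source G e + primitive (rep_l2 (k $ e)) x = rep_l2 (q $ e) x"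
    using h1_rel_rep[OF assms, of e] by eventually_elim simp
  show "y $ source G e + primitive (rep_l2 (k $ e)) 0 = y $ source G e" by simp
  show "y $ source G e + primitive (rep_l2 (k $ e)) (len e) = y $ target G e"
    using assms by (simp add: h1_rel_def inner_unit)
qed

lemma trace_unique:
  assumes "is_trace G q y" "is_trace G q y'"
  shows "y = y'"
proof (rule vec_eq_iff[THEN iffD2], rule allI)
  fix v
  obtain f where f: "\<And>e. continuous_on {0..len e} (f e)" "\<And>e. AE x in lebesgue_on {0..len e}. f e x = rep_l2 (q $ e) x"
    "\<And>e. f e 0 = y $ source G e" "\<And>e. f e (len e) = y $ target G e"
    using assms(1) unfolding is_trace_def by blast
  obtain g where g: "\<And>e. continuous_on {0..len e} (g e)" "\<And>e. AE x in lebesgue_on {0..len e}. g e x = rep_l2 (q $ e) x"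
    "\<And>e. g e 0 = y' $ source G e" "\<And>e. g e (len e) = y' $ target G e"
    using assms(2) unfolding is_trace_def by blast
  have eq: "f e x = g e x" if "x \<in> {0..len e}" for e x
  proof (rule continuous_AE_eq[OF len_pos f(1) g(1) _ that])
    show "AE x in lebesgue_on {0..len e}. f e x = g e x"
      using f(2)[of e] g(2)[of e] by eventually_elim simp
  qed
  obtain e where e: "source G e = v \<or> target G e = v" using incident by blast
  then show "y $ v = y' $ v"
    using eq[of 0 e] eq[of "len e" e] f(3,4)[of e] g(3,4)[of e] by auto
qed

lemma vertex_trace_eq: "is_trace G q y \<Longrightarrow> vertex_trace G q = y"
  unfolding vertex_trace_def using trace_unique by blast

lemma h1_rel_H1:
  assumes "h1_rel G q k y"
  shows "q \<in> H1 G" "op_K G q = k" "vertex_trace G q = y"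
proof -
  show "q \<in> H1 G"
    using assms h1_rel_edge_deriv[OF assms] h1_rel_trace[OF assms] by (auto simp: H1_def h1_rel_def)
  show "op_K G q = k" by (rule op_K_eq[OF h1_rel_edge_deriv[OF assms]])
  show "vertex_trace G q = y" by (rule vertex_trace_eq[OF h1_rel_trace[OF assms]])
qed

text \<open>On each edge q is almost everywhere a constant plus the primitive of its weak
  derivative. This continuous function must coincide with the one in the definition of the trace,
  which fixes the constant and the value at the target.\<close>

lemma H1_h1_rel:
  assumes "q \<in> H1 G"
  shows "h1_rel G q (op_K G q) (vertex_trace G q)"
proof -
  obtain k y where k: "is_edge_deriv G q k" and y: "is_trace G q y" and q: "q \<in> L2E G"
    using assms by (auto simp: H1_def)
  obtain f where f: "\<And>e. continuous_on {0..len e} (f e)" "\<And>e. AE x in lebesgue_on {0..len e}. f e x = rep_l2 (q $ e) x"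
    "\<And>e. f e 0 = y $ source G e" "\<And>e. f e (len e) = y $ target G e"
    using y unfolding is_trace_def by blast
  have kL: "k \<in> L2E G" using k by (simp add: is_edge_deriv_def)
  have edge: "q $ e = y $ source G e *\<^sub>R unit (len e) + integ (len e) (k $ e) \<and>
    y $ target G e = y $ source G e + inner (unit (len e)) (k $ e)" for e
  proof -
    have "weak_derivative 0 (len e) (rep_l2 (q $ e)) (rep_l2 (k $ e))" using k by (simp add: is_edge_deriv_def)
    from weak_derivative_imp_primitive[OF len_pos integrable_on_rep_l2 integrable_on_rep_l2 this]
    obtain c where c: "AE x in lebesgue_on {0..len e}. rep_l2 (q $ e) x = c + primitive (rep_l2 (k $ e)) x" by blast
    have eq: "f e x = c + primitive (rep_l2 (k $ e)) x" if "x \<in> {0..len e}" for x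
    proof (rule continuous_AE_eq[OF len_pos f(1) _ _ that])
      show "continuous_on {0..len e} (\<lambda>x. c + primitive (rep_l2 (k $ e)) x)"
        by (intro continuous_intros continuous_on_primitive integrable_on_rep_l2)
      show "AE x in lebesgue_on {0..len e}. f e x = c + primitive (rep_l2 (k $ e)) x"
        using f(2)[of e] c by eventually_elim simp
    qed
    have c_eq: "c = y $ source G e" using eq[of 0] f(3)[of e] by simp
    have tgt: "y $ target G e = y $ source G e + inner (unit (len e)) (k $ e)"
      using eq[of "len e"] f(4)[of e] c_eq by (simp add: inner_unit)
    have "q $ e = restr (len e) (rep_l2 (q $ e))" using q by (simp add: L2E_supported restr_rep)
    also have "\<dots> = restr (len e) (\<lambda>x. c * 1 + inner (unit x) (k $ e))"
      using c by (intro restr_cong sq_integrable_add sq_integrable_scale sq_integrable_one sq_integrable_inner_unit sq_integrable_on_rep_l2)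
        (simp add: inner_unit)
    also have "\<dots> = c *\<^sub>R unit (len e) + integ (len e) (k $ e)"
      unfolding restr_add[OF sq_integrable_scale[OF sq_integrable_one] sq_integrable_inner_unit] restr_scale[OF sq_integrable_one]
      by (simp add: unit_def integ_def)
    finally show ?thesis using tgt c_eq by simp
  qed
  then have rel: "h1_rel G q k y" using q kL by (simp add: h1_rel_def)
  then show ?thesis using h1_rel_H1[OF rel] by simp
qed

lemma h1_rel_add: "h1_rel G q k y \<Longrightarrow> h1_rel G q' k' y' \<Longrightarrow> h1_rel G (q + q') (k + k') (y + y')"
  using subspace_add[OF subspace_L2E]
  by (auto simp: h1_rel_def scaleR_add_left inner_add_right linear_add[OF bounded_linear.linear[OF bounded_linear_integ]])

lemma h1_rel_scale: "h1_rel G q k y \<Longrightarrow> h1_rel G (c *\<^sub>R q) (c *\<^sub>R k) (c *\<^sub>R y)"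
  using subspace_scale[OF subspace_L2E]
  by (auto simp: h1_rel_def scaleR_add_right linear_cmul[OF bounded_linear.linear[OF bounded_linear_integ]] distrib_left)

lemma h1_rel_zero: "h1_rel G 0 0 0"
  using subspace_0[OF subspace_L2E]
  by (auto simp: h1_rel_def linear_0[OF bounded_linear.linear[OF bounded_linear_integ]])

lemma H1_add:
  assumes "q \<in> H1 G" "q' \<in> H1 G"
  shows "q + q' \<in> H1 G" "op_K G (q + q') = op_K G q + op_K G q'"
    "vertex_trace G (q + q') = vertex_trace G q + vertex_trace G q'"
  using h1_rel_H1[OF h1_rel_add[OF H1_h1_rel[OF assms(1)] H1_h1_rel[OF assms(2)]]] by auto

lemma H1_scale:
  assumes "q \<in> H1 G"
  shows "c *\<^sub>R q \<in> H1 G" "op_K G (c *\<^sub>R q) = c *\<^sub>R op_K G q"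
    "vertex_trace G (c *\<^sub>R q) = c *\<^sub>R vertex_trace G q"
  using h1_rel_H1[OF h1_rel_scale[OF H1_h1_rel[OF assms]]] by auto

lemma subspace_H1: "subspace (H1 G)"
  using H1_add(1) H1_scale(1) h1_rel_H1(1)[OF h1_rel_zero] by (simp add: subspace_def)

lemma subspace_H10: "subspace (H10 G)"
  using h1_rel_H1[OF h1_rel_zero] by (auto simp: subspace_def H10_def H1_add H1_scale)

lemma H10_H1: "q \<in> H10 G \<Longrightarrow> q \<in> H1 G"
  by (simp add: H10_def)

lemma H1_L2E: "q \<in> H1 G \<Longrightarrow> q \<in> L2E G" and op_K_L2E: "q \<in> H1 G \<Longrightarrow> op_K G q \<in> L2E G"
  using H1_h1_rel[of q] by (auto simp: h1_rel_def)

lemma op_B_add: "q \<in> H1 G \<Longrightarrow> q' \<in> H1 G \<Longrightarrow> op_B G (q + q') = op_B G q + op_B G q'"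
  and op_C_add: "q \<in> H1 G \<Longrightarrow> q' \<in> H1 G \<Longrightarrow> op_C G (q + q') = op_C G q + op_C G q'"
  by (simp_all add: op_B_def op_C_def H1_add vec_eq_iff)

lemma op_B_scale: "q \<in> H1 G \<Longrightarrow> op_B G (c *\<^sub>R q) = c *\<^sub>R op_B G q"
  and op_C_scale: "q \<in> H1 G \<Longrightarrow> op_C G (c *\<^sub>R q) = c *\<^sub>R op_C G q"
  by (simp_all add: op_B_def op_C_def H1_scale vec_eq_iff)

lemma H10_iff: "q \<in> H10 G \<longleftrightarrow> q \<in> H1 G \<and> op_B G q = 0"
  by (auto simp: H10_def op_B_def vec_eq_iff)

section \<open>Traces as bounded functionals and the graph of \<open>op_K\<close>\<close>

definition src_val :: "'e \<Rightarrow> 'e l2e \<times> 'e l2e \<Rightarrow> real"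
  where "src_val e z = inner (fst z $ e - integ (len e) (snd z $ e)) (unit (len e)) / len e"

text \<open>A bounded linear extension of the vertex trace to all pairs (q, k). At the source of an
  edge, q minus the primitive of k is the constant vertex value, recovered by pairing with
  \<open>unit\<close> and dividing by the length; a vertex that is no source is read from an edge
  ending there.\<close>

definition trc :: "'e l2e \<times> 'e l2e \<Rightarrow> real ^ 'v"
  where "trc z = (\<chi> v. if \<exists>e. source G e = v then src_val (SOME e. source G e = v) z
    else src_val (SOME e. target G e = v) z +
      inner (unit (len (SOME e. target G e = v))) (snd z $ (SOME e. target G e = v)))"

lemma bounded_linear_src_val: "bounded_linear (src_val e)"
  unfolding src_val_def divide_inverse
  by (intro bounded_linear_mult_const bounded_linear_compose[OF bounded_linear_inner_left]
      bounded_linear_sub bounded_linear_compose[OF bounded_linear_vec_nth] bounded_linear_fst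
      bounded_linear_compose[OF bounded_linear_integ] bounded_linear_snd len_nonneg)

lemma bounded_linear_trc: "bounded_linear trc"
proof -
  have snd: "bounded_linear (\<lambda>z :: 'e l2e \<times> 'e l2e. inner u (snd z $ e))" for u e
    by (intro bounded_linear_compose[OF bounded_linear_inner_right] bounded_linear_compose[OF bounded_linear_vec_nth]
        bounded_linear_snd)
  have comp: "bounded_linear (\<lambda>z. trc z $ v)" for v
    by (cases "\<exists>e. source G e = v") (simp_all add: trc_def bounded_linear_src_val bounded_linear_add snd)
  have eq: "trc = (\<lambda>z. \<Sum>v\<in>UNIV. trc z $ v *\<^sub>R axis v 1)"
    by (simp add: fun_eq_iff vec_eq_iff axis_def if_distrib cong: if_cong)
  show ?thesis
    by (subst eq) (intro bounded_linear_sum bounded_linear_scaleR_const comp)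
qed

lemma trc_eq:
  assumes "h1_rel G q k y"
  shows "trc (q, k) = y"
proof (rule vec_eq_iff[THEN iffD2], rule allI)
  have src: "src_val e (q, k) = y $ source G e" for e
    using assms inner_unit_unit[of e] len_pos[of e] by (simp add: h1_rel_def src_val_def)
  fix v
  show "trc (q, k) $ v = y $ v"
  proof (cases "\<exists>e. source G e = v")
    case True
    then show ?thesis using someI_ex[OF True] by (simp add: trc_def src)
  next
    case False
    then have "\<exists>e. target G e = v" using incident by blast
    define e where "e = (SOME e. target G e = v)"
    have "target G e = v" unfolding e_def by (rule someI_ex) fact
    moreover have "y $ target G e = y $ source G e + inner (unit (len e)) (k $ e)"
      using assms by (simp add: h1_rel_def)
    ultimately show ?thesis using False by (simp add: trc_def src e_def[symmetric])
  qed
qed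

lemma vertex_trace_trc: "q \<in> H1 G \<Longrightarrow> vertex_trace G q = trc (q, op_K G q)"
  using trc_eq[OF H1_h1_rel] by simp

text \<open>The space \<open>H10 G\<close> with its own norm, realized as a closed subspace of a
  product, which is the form that \<open>lax_milgram_symmetric\<close> requires.\<close>

definition graph10 :: "('e l2e \<times> 'e l2e) set"
  where "graph10 = (\<lambda>q. (q, op_K G q)) ` H10 G"

lemma graph10_iff: "z \<in> graph10 \<longleftrightarrow> h1_rel G (fst z) (snd z) (trc z) \<and> (\<forall>v\<in>boundary G. trc z $ v = 0)"
proof
  assume "z \<in> graph10"
  then obtain q where q: "q \<in> H10 G" "z = (q, op_K G q)" by (auto simp: graph10_def)
  then show "h1_rel G (fst z) (snd z) (trc z) \<and> (\<forall>v\<in>boundary G. trc z $ v = 0)"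
    using H1_h1_rel[of q] vertex_trace_trc[of q] by (auto simp: H10_def)
next
  assume *: "h1_rel G (fst z) (snd z) (trc z) \<and> (\<forall>v\<in>boundary G. trc z $ v = 0)"
  then have "fst z \<in> H10 G" "z = (fst z, op_K G (fst z))"
    using h1_rel_H1[of "fst z" "snd z" "trc z"] by (auto simp: H10_def prod_eq_iff)
  then show "z \<in> graph10" by (auto simp: graph10_def)
qed

lemma subspace_graph10: "subspace graph10"
proof (rule subspaceI)
  have "(0, op_K G 0) = (0 :: 'e l2e \<times> 'e l2e)" using h1_rel_H1(2)[OF h1_rel_zero] by (simp add: zero_prod_def)
  then show "0 \<in> graph10" using subspace_0[OF subspace_H10] unfolding graph10_def
    by (auto simp: image_iff intro!: bexI[of _ 0])
  fix x y and c :: real assume "x \<in> graph10" 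
  then show "c *\<^sub>R x \<in> graph10"
    using subspace_scale[OF subspace_H10] by (auto simp: graph10_def H1_scale H10_H1 image_iff)
  assume "y \<in> graph10"
  with \<open>x \<in> graph10\<close> show "x + y \<in> graph10"
    using subspace_add[OF subspace_H10] by (auto simp: graph10_def H1_add H10_H1 image_iff)
qed

lemma closed_graph10: "closed graph10"
proof -
  have trc: "continuous_on UNIV (\<lambda>z. trc z $ v)" for v
    by (intro continuous_intros linear_continuous_on bounded_linear_trc)
  have integ: "continuous_on UNIV (\<lambda>z :: 'e l2e \<times> 'e l2e. integ (len e) (snd z $ e))" for e
    by (intro continuous_on_compose2[OF linear_continuous_on[OF bounded_linear_integ[OF len_nonneg]]] continuous_intros) auto
  have L: "closed (fst -` L2E G :: ('e l2e \<times> 'e l2e) set)" "closed (snd -` L2E G :: ('e l2e \<times> 'e l2e) set)"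
    by (intro closed_vimage closed_L2E continuous_intros)+
  have "graph10 = (fst -` L2E G \<inter> snd -` L2E G) \<inter>
     (\<Inter>e. {z. fst z $ e = trc z $ source G e *\<^sub>R unit (len e) + integ (len e) (snd z $ e)} \<inter>
       {z. trc z $ target G e = trc z $ source G e + inner (unit (len e)) (snd z $ e)}) \<inter>
     (\<Inter>v\<in>boundary G. {z. trc z $ v = 0})"
    by (auto simp: graph10_iff h1_rel_def)
  also have "closed \<dots>"
    by (intro closed_Int closed_INT ballI L closed_Collect_eq trc integ continuous_intros)
  finally show ?thesis .
qed

section \<open>Poincare inequality, density and elliptic problems\<close>

lemma h1_rel_path:
  assumes "(u, v) \<in> (adjacency G \<union> (adjacency G)\<inverse>)\<^sup>*"
  shows "\<exists>C\<ge>0. \<forall>q k y. h1_rel G q k y \<longrightarrow> \<bar>y $ v - y $ u\<bar> \<le> C * norm k"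
  using assms
proof (induction rule: rtrancl_induct)
  case (step w v)
  then obtain C where C: "C \<ge> 0" "\<And>q k y. h1_rel G q k y \<Longrightarrow> \<bar>y $ w - y $ u\<bar> \<le> C * norm k" by blast
  obtain e where e: "(w = source G e \<and> v = target G e) \<or> (v = source G e \<and> w = target G e)"
    using step(2) by (auto simp: adjacency_def)
  have "\<bar>y $ v - y $ u\<bar> \<le> (C + sqrt (len e)) * norm k" if rel: "h1_rel G q k y" for q k y
  proof -
    have "\<bar>y $ v - y $ w\<bar> = \<bar>inner (unit (len e)) (k $ e)\<bar>" using e rel by (auto simp: h1_rel_def)
    also have "\<dots> \<le> sqrt (len e) * norm (k $ e)" by (intro abs_inner_unit_le) auto
    also have "\<dots> \<le> sqrt (len e) * norm k" by (intro mult_left_mono Finite_Cartesian_Product.norm_nth_le) auto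
    finally show ?thesis using C(2)[OF rel] by (simp add: distrib_right)
  qed
  then show ?case using C(1) by (intro exI[of _ "C + sqrt (len e)"]) auto
qed (auto intro: exI[of _ 0])

text \<open>Some boundary vertex carries the value 0, and by connectedness every other vertex value
  is controlled along a path by the derivative. Vertex values and derivative control q on each
  edge.\<close>

lemma poincare: "\<exists>C\<ge>0. \<forall>z\<in>graph10. norm (fst z) \<le> C * norm (snd z)"
proof -
  obtain u where u: "u \<in> boundary G" using network by (auto simp: is_network_def)
  have "\<exists>C\<ge>0. \<forall>q k y. h1_rel G q k y \<longrightarrow> \<bar>y $ v - y $ u\<bar> \<le> C * norm k" for v
    using network by (intro h1_rel_path) (simp add: is_network_def)
  then obtain C where C: "\<And>v. 0 \<le> C v" "\<And>v q k y. h1_rel G q k y \<Longrightarrow> \<bar>y $ v - y $ u\<bar> \<le> C v * norm k" by metis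
  define K where "K = (\<Sum>e\<in>UNIV. C (source G e) * sqrt (len e) + len e)"
  have "norm (fst z) \<le> K * norm (snd z)" if z: "z \<in> graph10" for z
  proof -
    obtain q k where qk: "z = (q, k)" by (cases z)
    define y where "y = trc z"
    have rel: "h1_rel G q k y" and "y $ u = 0" using z u by (auto simp: graph10_iff qk y_def)
    have e: "norm (q $ e) \<le> (C (source G e) * sqrt (len e) + len e) * norm k" for e
    proof -
      have "norm (q $ e) \<le> \<bar>y $ source G e\<bar> * sqrt (len e) + norm (k $ e) * len e"
        using rel norm_integ[of "len e" "k $ e"] norm_triangle_ineq[of "y $ source G e *\<^sub>R unit (len e)" "integ (len e) (k $ e)"]
        by (simp add: h1_rel_def norm_unit)
      also have "\<dots> \<le> (C (source G e) * norm k) * sqrt (len e) + norm k * len e"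
        using C(2)[OF rel, of "source G e"] \<open>y $ u = 0\<close>
        by (intro add_mono mult_right_mono Finite_Cartesian_Product.norm_nth_le) auto
      finally show ?thesis by (simp add: algebra_simps)
    qed
    have "norm q \<le> (\<Sum>e\<in>UNIV. norm (q $ e))"
      unfolding norm_vec_def by (rule L2_set_le_sum) simp
    also have "\<dots> \<le> (\<Sum>e\<in>UNIV. (C (source G e) * sqrt (len e) + len e) * norm k)" by (intro sum_mono e)
    finally show ?thesis by (simp add: qk K_def sum_distrib_right)
  qed
  moreover have "0 \<le> K" unfolding K_def using C(1) by (intro sum_nonneg) auto
  ultimately show ?thesis by blast
qed

text \<open>A test function inside one edge, extended by zero to the network, belongs to
  \<open>H10 G\<close>; the fundamental lemma applies edge by edge.\<close>

lemma H10_dense: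
  assumes "v \<in> L2E G" and orth: "\<And>q. q \<in> H10 G \<Longrightarrow> inner v q = 0"
  shows "v = 0"
proof (rule vec_eq_iff[THEN iffD2], rule allI)
  fix e
  let ?M = "lebesgue_on {0..len e}"
  have "AE x in ?M. rep_l2 (v $ e) x = 0"
  proof (rule fundamental_lemma[OF integrable_on_rep_l2])
    fix \<phi> assume \<phi>: "test_function 0 (len e) \<phi>"
    have sq: "sq_integrable ?M \<phi>" "sq_integrable ?M (deriv \<phi>)"
      by (intro sq_integrable_continuous test_function_continuous[OF \<phi>] test_function_deriv_continuous[OF \<phi>])+
    define q where "q = axis e (restr (len e) \<phi>)"
    define k where "k = axis e (restr (len e) (deriv \<phi>))"
    have prim: "inner (unit x) (restr (len e) (deriv \<phi>)) = \<phi> x" if x: "x \<in> {0..len e}" for x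
    proof -
      have "AE t in lebesgue_on {0..len e}. rep_l2 (restr (len e) (deriv \<phi>)) t = deriv \<phi> t"
        by (rule rep_restr_on[OF sq(2)])
      then have "AE t in lebesgue_on {0..x}. rep_l2 (restr (len e) (deriv \<phi>)) t = deriv \<phi> t"
        using x by (auto simp: AE_restrict_space_iff elim!: eventually_mono)
      then have "inner (unit x) (restr (len e) (deriv \<phi>)) = (LINT t|lebesgue_on {0..x}. deriv \<phi> t)"
        unfolding inner_unit primitive_def
        by (intro integral_cong_AE) (auto intro!: continuous_imp_measurable_on_sets_lebesgue test_function_deriv_continuous[OF \<phi>])
      also have "\<dots> = integral {0..x} (deriv \<phi>)"
        by (intro lebesgue_integral_eq_integral continuous_imp_integrable_real test_function_deriv_continuous[OF \<phi>]) simp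
      also have "(deriv \<phi> has_integral \<phi> x - \<phi> 0) {0..x}"
        using x test_function_DERIV[OF \<phi>] by (intro fundamental_theorem_of_calculus)
         (auto simp: has_real_derivative_iff_has_vector_derivative[symmetric] intro: has_field_derivative_at_within)
      then have "integral {0..x} (deriv \<phi>) = \<phi> x" using test_function_zero[OF \<phi>, of 0] by (simp add: integral_unique)
      finally show ?thesis .
    qed
    have zero: "restr l (\<lambda>_. 0) = 0" for l
      using restr_scale[OF sq_integrable_one, of l 0] by simp
    have sup: "supported l 0" for l
      using supported_restr[OF sq_integrable_scale[OF sq_integrable_one], of l 0] by (simp add: zero)
    have "h1_rel G q k 0"
      unfolding h1_rel_def
    proof (intro conjI allI)
      show "q \<in> L2E G" "k \<in> L2E G"
        using supported_restr[OF sq(1)] supported_restr[OF sq(2)] sup by (auto simp: L2E_supported q_def k_def axis_def)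
      fix e'
      have "integ (len e) (restr (len e) (deriv \<phi>)) = restr (len e) \<phi>"
        unfolding integ_def using prim by (intro restr_cong sq_integrable_inner_unit sq AE_I2) simp
      then show "q $ e' = 0 $ source G e' *\<^sub>R unit (len e') + integ (len e') (k $ e')"
        using linear_0[OF bounded_linear.linear[OF bounded_linear_integ[OF len_nonneg[of e']]]]
        by (auto simp: q_def k_def axis_def)
      show "(0 :: real ^ 'v) $ target G e' = 0 $ source G e' + inner (unit (len e')) (k $ e')"
        using prim[of "len e"] test_function_zero[OF \<phi>, of "len e"] by (auto simp: k_def axis_def)
    qed
    then have "q \<in> H10 G" using h1_rel_H1[of q k 0] by (simp add: H10_def)
    then have "inner v q = 0" by (rule orth)
    moreover have "inner v q = inner (v $ e) (restr (len e) \<phi>)"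
    proof -
      have "inner v q = (\<Sum>i\<in>UNIV. if i = e then inner (v $ e) (restr (len e) \<phi>) else 0)"
        unfolding inner_vec_def q_def by (intro sum.cong) (auto simp: axis_def)
      then show ?thesis by simp
    qed
    ultimately show "(LINT t|?M. \<phi> t *\<^sub>R rep_l2 (v $ e) t) = 0"
      using inner_restr[OF sq(1), of "v $ e"] by (simp add: inner_commute)
  qed
  then have "restr (len e) (rep_l2 (v $ e)) = restr (len e) (\<lambda>_. 0 * 1)"
    by (intro restr_cong sq_integrable_on_rep_l2 sq_integrable_scale sq_integrable_one) simp
  also have "\<dots> = 0" using restr_scale[OF sq_integrable_one, of "len e" 0] by simp
  finally show "v $ e = 0 $ e" using assms(1) by (simp add: restr_rep L2E_supported)
qed

lemma bounded_bilinear_plus: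
  assumes "bounded_bilinear f" "bounded_bilinear g"
  shows "bounded_bilinear (\<lambda>x y. f x y + g x y)"
proof -
  interpret f: bounded_bilinear f by fact
  interpret g: bounded_bilinear g by fact
  show ?thesis
  proof
    obtain K L where KL: "\<And>x y. norm (f x y) \<le> norm x * norm y * K" "\<And>x y. norm (g x y) \<le> norm x * norm y * L"
      using f.bounded g.bounded by blast
    have "norm (f x y + g x y) \<le> norm x * norm y * (K + L)" for x y
      using norm_triangle_ineq[of "f x y" "g x y"] KL[of x y] by (simp add: distrib_left)
    then show "\<exists>K. \<forall>x y. norm (f x y + g x y) \<le> norm x * norm y * K" by blast
  qed (simp_all add: f.add_left f.add_right g.add_left g.add_right f.scaleR_left f.scaleR_right
      g.scaleR_left g.scaleR_right scaleR_add_right)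
qed

lemma bounded_bilinear_weighted:
  assumes \<alpha>: "coefficient G \<alpha> m M" and \<beta>: "coefficient G \<beta> m' M'"
  shows "bounded_bilinear (\<lambda>z w. inner (mult G \<alpha> (fst z)) (fst w) + inner (mult G \<beta> (snd z)) (snd w))"
  by (intro bounded_bilinear_plus bounded_bilinear.comp[OF bounded_bilinear_inner] bounded_linear_fst bounded_linear_snd
      bounded_linear_compose[OF bounded_linear_mult[OF \<alpha>]] bounded_linear_compose[OF bounded_linear_mult[OF \<beta>]])

text \<open>Since \<alpha> may vanish, coercivity has to come from the derivative term, through the
  Poincare inequality.\<close>

theorem elliptic_solution:
  assumes \<alpha>: "coefficient G \<alpha> 0 M" and \<beta>: "coefficient G \<beta> m' M'" "0 < m'" and F: "bounded_linear F"
  shows "\<exists>p\<in>H10 G. \<forall>q\<in>H10 G. inner (mult G \<alpha> p) q + inner (mult G \<beta> (op_K G p)) (op_K G q) = F (q, op_K G q)"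
proof -
  let ?b = "\<lambda>z w. inner (mult G \<alpha> (fst z)) (fst w) + inner (mult G \<beta> (snd z)) (snd w)"
  obtain C where C: "0 \<le> C" "\<And>z. z \<in> graph10 \<Longrightarrow> norm (fst z) \<le> C * norm (snd z)" using poincare by blast
  have "\<exists>u\<in>graph10. \<forall>w\<in>graph10. ?b u w = F w"
  proof (rule lax_milgram_symmetric[OF subspace_graph10 closed_graph10 bounded_bilinear_weighted[OF \<alpha> \<beta>(1)] _ _ _ F])
    show "?b z w = ?b w z" for z w
      using mult_sym[OF \<alpha>, of "fst z" "fst w"] mult_sym[OF \<beta>(1), of "snd z" "snd w"]
      by (simp add: inner_commute[of _ "mult G _ _"])
    \<comment> \<open>With Poincare constant C the squared graph norm is at most C^2 + 1 times the
      squared norm of the derivative, and the weight \<beta> contributes m'.\<close>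
    show "0 < m' / (C\<^sup>2 + 1)" using \<beta>(2) by (simp add: add_nonneg_pos)
    fix z assume z: "z \<in> graph10"
    have L: "fst z \<in> L2E G" "snd z \<in> L2E G" using z by (auto simp: graph10_iff h1_rel_def)
    have "(norm (fst z))\<^sup>2 \<le> (C * norm (snd z))\<^sup>2" using C(2)[OF z] by (intro power_mono) auto
    then have "(norm z)\<^sup>2 \<le> (C\<^sup>2 + 1) * (norm (snd z))\<^sup>2"
      by (simp add: norm_prod_def case_prod_beta power_mult_distrib distrib_right)
    then have "m' / (C\<^sup>2 + 1) * (norm z)\<^sup>2 \<le> m' / (C\<^sup>2 + 1) * ((C\<^sup>2 + 1) * (norm (snd z))\<^sup>2)"
      using \<beta>(2) by (intro mult_left_mono) (auto simp: add_nonneg_pos)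
    also have "\<dots> = m' * (norm (snd z))\<^sup>2"
      using add_nonneg_pos[of "C\<^sup>2" 1] by simp
    also have "\<dots> \<le> inner (mult G \<beta> (snd z)) (snd z)" by (rule mult_lower[OF \<beta>(1) L(2)])
    also have "\<dots> \<le> ?b z z" using mult_lower[OF \<alpha> L(1)] by simp
    finally show "m' / (C\<^sup>2 + 1) * (norm z)\<^sup>2 \<le> ?b z z" .
  qed
  then show ?thesis by (auto simp: graph10_def)
qed

lemma elliptic_unique:
  assumes \<alpha>: "coefficient G \<alpha> 0 M" and \<beta>: "coefficient G \<beta> m' M'" "0 < m'" and p: "p \<in> H10 G"
    and zero: "inner (mult G \<alpha> p) p + inner (mult G \<beta> (op_K G p)) (op_K G p) = 0"
  shows "p = 0"
proof -
  have L: "p \<in> L2E G" "op_K G p \<in> L2E G" using p by (auto simp: H10_H1 H1_L2E op_K_L2E)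
  have "m' * (norm (op_K G p))\<^sup>2 \<le> 0"
    using mult_lower[OF \<alpha> L(1)] mult_lower[OF \<beta>(1) L(2)] zero by simp
  then have "op_K G p = 0" using \<beta>(2) by (simp add: mult_le_0_iff)
  moreover obtain C where "\<And>z. z \<in> graph10 \<Longrightarrow> norm (fst z) \<le> C * norm (snd z)" using poincare by blast
  ultimately have "norm p \<le> C * norm (0 :: 'e l2e)" using p by (force simp: graph10_def)
  then show ?thesis by simp
qed

end

section \<open>Function spaces in time\<close>

text \<open>Completeness of Lebesgue measure: every subset of the exceptional null set is
  measurable.\<close>

lemma borel_measurable_lebesgue_on_cong_AE:
  fixes f g :: "'a::euclidean_space \<Rightarrow> 'b::topological_space"
  assumes S: "S \<in> sets lebesgue" and f: "f \<in> borel_measurable (lebesgue_on S)"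
    and AE: "AE x in lebesgue_on S. f x = g x"
  shows "g \<in> borel_measurable (lebesgue_on S)"
proof (rule measurableI)
  obtain N where N: "N \<in> null_sets (lebesgue_on S)" "{x \<in> space (lebesgue_on S). f x \<noteq> g x} \<subseteq> N"
    using AE by (auto simp: eventually_ae_filter)
  have sub: "B \<in> sets (lebesgue_on S)" if "B \<subseteq> N" for B
  proof -
    have "N \<in> null_sets lebesgue" using N(1) S by (simp add: null_sets_restrict_space)
    then have "B \<in> null_sets lebesgue" using that null_sets_completion_subset by blast
    moreover have "B \<subseteq> S" using that sets.sets_into_space[of N "lebesgue_on S"] N(1) by (auto simp: null_sets_def)
    ultimately show ?thesis using S by (simp add: sets_restrict_space_iff null_sets_def)
  qed
  fix A :: "'b set" assume A: "A \<in> sets borel"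
  have "g -` A \<inter> space (lebesgue_on S) = (f -` A \<inter> space (lebesgue_on S) - N) \<union> (g -` A \<inter> N)"
    using N sets.sets_into_space[of N "lebesgue_on S"] by (auto simp: null_sets_def)
  also have "\<dots> \<in> sets (lebesgue_on S)"
    using measurable_sets[OF f A] N(1) sub[of "g -` A \<inter> N"] by (auto simp: null_sets_def)
  finally show "g -` A \<inter> space (lebesgue_on S) \<in> sets (lebesgue_on S)" .
qed simp

lemma sq_integrable_cong_AE:
  assumes f: "sq_integrable (lebesgue_on {a..b::real}) f" and AE: "AE x in lebesgue_on {a..b}. f x = g x"
  shows "sq_integrable (lebesgue_on {a..b}) g"
proof -
  have g: "g \<in> borel_measurable (lebesgue_on {a..b})"
    using f by (intro borel_measurable_lebesgue_on_cong_AE[OF Icc_sets_lebesgue _ AE]) (simp add: sq_integrable_def)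
  have "integrable (lebesgue_on {a..b}) (\<lambda>x. (norm (f x))\<^sup>2) \<longleftrightarrow> integrable (lebesgue_on {a..b}) (\<lambda>x. (norm (g x))\<^sup>2)"
    using f g AE by (intro integrable_cong_AE) (auto simp: sq_integrable_def elim: eventually_mono)
  then show ?thesis using f g by (simp add: sq_integrable_def)
qed

lemma sq_integrable_plus:
  fixes f g :: "'a \<Rightarrow> 'b::{banach, second_countable_topology}"
  assumes "sq_integrable M f" "sq_integrable M g"
  shows "sq_integrable M (\<lambda>x. f x + g x)"
  unfolding sq_integrable_def
proof
  have [measurable]: "f \<in> borel_measurable M" "g \<in> borel_measurable M" using assms by (auto simp: sq_integrable_def)
  show "(\<lambda>x. f x + g x) \<in> borel_measurable M" by simp
  show "integrable M (\<lambda>x. (norm (f x + g x))\<^sup>2)"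
  proof (rule Bochner_Integration.integrable_bound)
    show "integrable M (\<lambda>x. 2 * (norm (f x))\<^sup>2 + 2 * (norm (g x))\<^sup>2)" using assms by (auto simp: sq_integrable_def)
    have "(norm (u + v))\<^sup>2 \<le> 2 * (norm u)\<^sup>2 + 2 * (norm v)\<^sup>2" for u v :: 'b
    proof -
      have "(norm (u + v))\<^sup>2 \<le> (norm u + norm v)\<^sup>2" by (intro power_mono norm_triangle_ineq) simp
      also have "\<dots> \<le> 2 * (norm u)\<^sup>2 + 2 * (norm v)\<^sup>2"
        using zero_le_power2[of "norm u - norm v"] by (simp add: power2_eq_square algebra_simps)
      finally show ?thesis .
    qed
    then show "AE x in M. norm ((norm (f x + g x))\<^sup>2) \<le> norm (2 * (norm (f x))\<^sup>2 + 2 * (norm (g x))\<^sup>2)"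
      by (intro AE_I2) (simp add: order.trans[OF _ abs_ge_self])
  qed simp
qed

lemma sq_integrable_linear:
  fixes f :: "'a \<Rightarrow> 'b::{banach, second_countable_topology}" and L :: "'b \<Rightarrow> 'c::{banach, second_countable_topology}"
  assumes f: "sq_integrable M f" and L: "bounded_linear L"
  shows "sq_integrable M (\<lambda>x. L (f x))"
  unfolding sq_integrable_def
proof
  show m: "(\<lambda>x. L (f x)) \<in> borel_measurable M"
    using f measurable_compose[OF _ borel_measurable_continuous_onI[OF linear_continuous_on[OF L]]]
    by (auto simp: sq_integrable_def)
  obtain K where K: "\<And>x. norm (L x) \<le> norm x * K" using bounded_linear.bounded[OF L] by blast
  show "integrable M (\<lambda>x. (norm (L (f x)))\<^sup>2)"
  proof (rule Bochner_Integration.integrable_bound)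
    show "integrable M (\<lambda>x. K\<^sup>2 * (norm (f x))\<^sup>2)" using f by (auto simp: sq_integrable_def)
    have "(norm (L x))\<^sup>2 \<le> K\<^sup>2 * (norm x)\<^sup>2" for x
      using power_mono[OF K norm_ge_zero, of x 2] by (simp add: power_mult_distrib mult.commute)
    then show "AE x in M. norm ((norm (L (f x)))\<^sup>2) \<le> norm (K\<^sup>2 * (norm (f x))\<^sup>2)"
      by (intro AE_I2) simp
  qed (use m in simp)
qed

lemma sq_integrable_continuous_banach:
  fixes u :: "real \<Rightarrow> 'x::{banach, second_countable_topology}"
  assumes "continuous_on {a..b} u"
  shows "sq_integrable (lebesgue_on {a..b}) u"
  unfolding sq_integrable_def
proof
  show "u \<in> borel_measurable (lebesgue_on {a..b})"
    by (intro continuous_imp_measurable_on_sets_lebesgue assms) simp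
  show "integrable (lebesgue_on {a..b}) (\<lambda>x. (norm (u x))\<^sup>2)"
    by (intro continuous_imp_integrable_real continuous_intros assms)
qed

lemma sq_integrable_Pair:
  fixes f :: "'a \<Rightarrow> 'b::{banach, second_countable_topology}" and g :: "'a \<Rightarrow> 'c::{banach, second_countable_topology}"
  assumes "sq_integrable M f" "sq_integrable M g"
  shows "sq_integrable M (\<lambda>x. (f x, g x))"
proof -
  have "bounded_linear (\<lambda>u :: 'b. (u, 0 :: 'c))" "bounded_linear (\<lambda>v :: 'c. (0 :: 'b, v))"
    by (intro bounded_linear_Pair bounded_linear_ident bounded_linear_zero)+
  from sq_integrable_plus[OF sq_integrable_linear[OF assms(1) this(1)] sq_integrable_linear[OF assms(2) this(2)]]
  show ?thesis by simp
qed

lemma weak_derivative_linear: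
  assumes L: "bounded_linear L" and u: "integrable (lebesgue_on {a..b}) u" and v: "integrable (lebesgue_on {a..b}) v"
    and "weak_derivative a b u v"
  shows "weak_derivative a b (\<lambda>t. L (u t)) (\<lambda>t. L (v t))"
  unfolding weak_derivative_def
proof (intro allI impI)
  interpret bounded_linear L by fact
  fix \<phi> assume \<phi>: "test_function a b \<phi>"
  have "(LINT t|lebesgue_on {a..b}. deriv \<phi> t *\<^sub>R L (u t)) = L (LINT t|lebesgue_on {a..b}. deriv \<phi> t *\<^sub>R u t)"
    using integral_bounded_linear[OF L test_function_integrable(2)[OF \<phi> u]] by (simp add: scaleR)
  also have "\<dots> = L (- (LINT t|lebesgue_on {a..b}. \<phi> t *\<^sub>R v t))"
    using assms(4) \<phi> by (simp add: weak_derivative_def)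
  also have "\<dots> = - (LINT t|lebesgue_on {a..b}. \<phi> t *\<^sub>R L (v t))"
    using integral_bounded_linear[OF L test_function_integrable(1)[OF \<phi> v]] by (simp add: scaleR neg)
  finally show "(LINT t|lebesgue_on {a..b}. deriv \<phi> t *\<^sub>R L (u t)) = - (LINT t|lebesgue_on {a..b}. \<phi> t *\<^sub>R L (v t))" .
qed

lemma H1_time_integrable: "u \<in> H1_time T X \<Longrightarrow> integrable (lebesgue_on {0..T}) u"
  by (intro sq_integrable_imp_integrable_on sq_integrable_continuous_banach) (simp add: H1_time_def C_time_def)

lemma L2_time_integrable: "v \<in> L2_time T X \<Longrightarrow> integrable (lebesgue_on {0..T}) v"
  by (intro sq_integrable_imp_integrable_on) (simp add: L2_time_def)

lemma H1_time_linear: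
  assumes L: "bounded_linear L" and X: "\<And>x. x \<in> X \<Longrightarrow> L x \<in> Y" and u: "u \<in> H1_time T X"
  shows "(\<lambda>t. L (u t)) \<in> H1_time T Y"
proof -
  obtain v where v: "v \<in> L2_time T X" "weak_derivative 0 T u v" using u by (auto simp: H1_time_def)
  have "(\<lambda>t. L (v t)) \<in> L2_time T Y"
    using v(1) X sq_integrable_linear[OF _ L] by (auto simp: L2_time_def elim: eventually_mono)
  moreover have "weak_derivative 0 T (\<lambda>t. L (u t)) (\<lambda>t. L (v t))"
    by (intro weak_derivative_linear[OF L H1_time_integrable[OF u] L2_time_integrable[OF v(1)] v(2)])
  moreover have "(\<lambda>t. L (u t)) \<in> C_time T Y"
    using u X by (auto simp: H1_time_def C_time_def intro: continuous_on_compose2[OF linear_continuous_on[OF L, of UNIV]])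
  ultimately show ?thesis by (auto simp: H1_time_def)
qed

lemma weak_derivative_cong:
  assumes "\<And>t. t \<in> {a..b} \<Longrightarrow> u t = u' t"
  shows "weak_derivative a b u v = weak_derivative a b u' v"
proof -
  have "(LINT t|lebesgue_on {a..b}. deriv \<phi> t *\<^sub>R u t) = (LINT t|lebesgue_on {a..b}. deriv \<phi> t *\<^sub>R u' t)" for \<phi>
    using assms by (intro Bochner_Integration.integral_cong) auto
  then show ?thesis by (simp add: weak_derivative_def)
qed

lemma time_deriv_cong: "(\<And>t. t \<in> {0..T} \<Longrightarrow> u t = u' t) \<Longrightarrow> time_deriv T u = time_deriv T u'"
  unfolding time_deriv_def using weak_derivative_cong[of 0 T u u'] by simp

text \<open>The representative is chosen among functions without restriction on their values.
  Uniqueness of weak derivatives puts it into X almost everywhere.\<close>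

lemma
  assumes u: "u \<in> H1_time T X"
  shows time_deriv_L2: "time_deriv T u \<in> L2_time T X"
    and weak_derivative_time_deriv: "weak_derivative 0 T u (time_deriv T u)"
proof -
  obtain v where v: "v \<in> L2_time T X" "weak_derivative 0 T u v" using u by (auto simp: H1_time_def)
  then have "v \<in> L2_time T UNIV \<and> weak_derivative 0 T u v" by (simp add: L2_time_def)
  then have w: "time_deriv T u \<in> L2_time T UNIV \<and> weak_derivative 0 T u (time_deriv T u)"
    unfolding time_deriv_def by (rule someI[of "\<lambda>v. v \<in> L2_time T UNIV \<and> weak_derivative 0 T u v"])
  then show "weak_derivative 0 T u (time_deriv T u)" by simp
  have "AE t in lebesgue_on {0..T}. time_deriv T u t = v t"
    using w v by (intro weak_derivative_unique[of 0 T u] L2_time_integrable) auto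
  moreover have "AE t in lebesgue_on {0..T}. v t \<in> X" using v by (simp add: L2_time_def)
  ultimately have "AE t in lebesgue_on {0..T}. time_deriv T u t \<in> X" by eventually_elim simp
  then show "time_deriv T u \<in> L2_time T X" using w by (simp add: L2_time_def)
qed

lemma weak_derivative_inner:
  assumes u: "u \<in> H1_time T X" and \<phi>: "test_function 0 T \<phi>" and L: "bounded_linear (L :: _ \<Rightarrow> real)"
  shows "(LINT t|lebesgue_on {0..T}. deriv \<phi> t * L (u t)) = - (LINT t|lebesgue_on {0..T}. \<phi> t * L (time_deriv T u t))"
proof -
  have "weak_derivative 0 T (\<lambda>t. L (u t)) (\<lambda>t. L (time_deriv T u t))"
    by (intro weak_derivative_linear[OF L] H1_time_integrable[OF u] L2_time_integrable[OF time_deriv_L2[OF u]]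
        weak_derivative_time_deriv[OF u])
  then show ?thesis using \<phi> by (simp add: weak_derivative_def)
qed

context fin_network
begin

lemma h1_norm_eq: "h1_norm G q = norm (q, op_K G q)"
  by (simp add: h1_norm_def norm_prod_def)

text \<open>Strong measurability is inherited from u: J maps its approximating simple functions to
  simple functions, and boundedness of J turns pointwise convergence into convergence in the dual
  norm. The dual norm of J x is continuous in x, hence measurable along u.\<close>

lemma L2_time_dual_linear:
  fixes J :: "'x::{banach, second_countable_topology} \<Rightarrow> 'e functional"
  assumes V: "V = H1 G \<or> V = H10 G"
    and add: "\<And>x q q'. q \<in> V \<Longrightarrow> q' \<in> V \<Longrightarrow> J x (q + q') = J x q + J x q'"
    and scale: "\<And>x c q. q \<in> V \<Longrightarrow> J x (c *\<^sub>R q) = c * J x q"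
    and J_diff: "\<And>x y q. J (x - y) q = J x q - J y q"
    and bound: "\<And>x q. q \<in> V \<Longrightarrow> \<bar>J x q\<bar> \<le> C * norm x * h1_norm G q" and "0 \<le> C"
    and u: "sq_integrable (lebesgue_on {0..T}) u"
  shows "(\<lambda>t. J (u t)) \<in> L2_time_dual G T V"
proof -
  let ?M = "lebesgue_on {0..T}" and ?B = "{q \<in> V. h1_norm G q \<le> 1}"
  have sub: "subspace V" using V subspace_H1 subspace_H10 by blast
  have V0: "0 \<in> ?B"
    using subspace_0[OF sub] h1_rel_H1(2)[OF h1_rel_zero] by (simp add: h1_norm_def)
  have le: "\<bar>J x q\<bar> \<le> C * norm x" if "q \<in> ?B" for x q
  proof -
    have "\<bar>J x q\<bar> \<le> C * norm x * h1_norm G q" using bound that by blast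
    also have "\<dots> \<le> C * norm x * 1" using that \<open>0 \<le> C\<close> by (intro mult_left_mono) auto
    finally show ?thesis by simp
  qed
  have bdd: "bdd_above ((\<lambda>q. \<bar>J x q\<bar>) ` ?B)" for x
    using le by (intro bdd_aboveI2)
  have upper: "\<bar>J x q\<bar> \<le> dual_norm G V (J x)" if "q \<in> ?B" for x q
    unfolding dual_norm_def using bdd that by (intro cSUP_upper)
  have dn_le: "dual_norm G V (J x) \<le> C * norm x" for x
    unfolding dual_norm_def using V0 le by (intro cSUP_least) auto
  have dn_nonneg: "0 \<le> dual_norm G V (J x)" for x
    using upper[OF V0, of x] by linarith
  have tri: "dual_norm G V (J x) \<le> dual_norm G V (J y) + C * norm (x - y)" for x y
    unfolding dual_norm_def[of G V "J x"]
  proof (rule cSUP_least)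
    fix q assume q: "q \<in> ?B"
    have "\<bar>J x q\<bar> \<le> \<bar>J y q\<bar> + \<bar>J (x - y) q\<bar>" by (simp add: J_diff)
    also have "\<dots> \<le> dual_norm G V (J y) + C * norm (x - y)" by (intro add_mono upper le q)
    finally show "\<bar>J x q\<bar> \<le> dual_norm G V (J y) + C * norm (x - y)" .
  qed (use V0 in blast)
  \<comment> \<open>By \<open>tri\<close> this function is Lipschitz with constant C.\<close>
  have "continuous_on UNIV (\<lambda>x. dual_norm G V (J x))"
  proof (rule continuous_on_sequentiallyI)
    fix X a assume "X \<longlonglongrightarrow> (a :: 'x)"
    have "(\<lambda>n. dual_norm G V (J (X n)) - dual_norm G V (J a)) \<longlonglongrightarrow> 0"
    proof (rule Lim_null_comparison)
      have "(\<lambda>n. C * norm (X n - a)) \<longlonglongrightarrow> C * norm (a - a)" by (intro tendsto_intros \<open>X \<longlonglongrightarrow> a\<close>)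
      then show "(\<lambda>n. C * norm (X n - a)) \<longlonglongrightarrow> 0" by simp
      have "norm (dual_norm G V (J (X n)) - dual_norm G V (J a)) \<le> C * norm (X n - a)" for n
        using tri[of "X n" a] tri[of a "X n"] by (simp add: norm_minus_commute abs_le_iff)
      then show "\<forall>\<^sub>F n in sequentially. norm (dual_norm G V (J (X n)) - dual_norm G V (J a)) \<le> C * norm (X n - a)"
        by simp
    qed
    then show "(\<lambda>n. dual_norm G V (J (X n))) \<longlonglongrightarrow> dual_norm G V (J a)" by (rule LIM_zero_cancel)
  qed
  then have meas: "(\<lambda>x. dual_norm G V (J x)) \<in> borel_measurable borel" by (rule borel_measurable_continuous_onI)
  have u_meas [measurable]: "u \<in> borel_measurable ?M" using u by (simp add: sq_integrable_def)
  have dual: "J x \<in> dual G V" for x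
    using add scale bound unfolding dual_def by blast
  obtain s where s: "\<And>n. simple_function ?M (s n)" "\<And>t. t \<in> space ?M \<Longrightarrow> (\<lambda>n. s n t) \<longlonglongrightarrow> u t"
    using borel_measurable_implies_sequence_metric[OF u_meas, of 0] by blast
  have "\<exists>s. (\<forall>n. simple_function ?M (s n) \<and> (\<forall>t\<in>{0..T}. s n t \<in> dual G V)) \<and>
      (AE t in ?M. (\<lambda>n. dual_norm G V (\<lambda>q. s n t q - J (u t) q)) \<longlonglongrightarrow> 0)"
  proof (intro exI[of _ "\<lambda>n t. J (s n t)"] conjI allI ballI)
    show "simple_function ?M (\<lambda>t. J (s n t))" for n using s(1) by (rule simple_function_compose1)
    show "AE t in ?M. (\<lambda>n. dual_norm G V (\<lambda>q. J (s n t) q - J (u t) q)) \<longlonglongrightarrow> 0"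
    proof (rule AE_I2)
      fix t assume t: "t \<in> space ?M"
      show "(\<lambda>n. dual_norm G V (\<lambda>q. J (s n t) q - J (u t) q)) \<longlonglongrightarrow> 0"
      proof (rule Lim_null_comparison)
        have "(\<lambda>n. C * norm (s n t - u t)) \<longlonglongrightarrow> C * norm (u t - u t)" by (intro tendsto_intros s(2)[OF t])
        then show "(\<lambda>n. C * norm (s n t - u t)) \<longlonglongrightarrow> 0" by simp
        have "(\<lambda>q. J (s n t) q - J (u t) q) = J (s n t - u t)" for n by (simp add: J_diff fun_eq_iff)
        then show "\<forall>\<^sub>F n in sequentially. norm (dual_norm G V (\<lambda>q. J (s n t) q - J (u t) q)) \<le> C * norm (s n t - u t)"
          using dn_le dn_nonneg by simp
      qed
    qed
  qed (rule dual)
  moreover have "integrable ?M (\<lambda>t. (dual_norm G V (J (u t)))\<^sup>2)"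
  proof (rule Bochner_Integration.integrable_bound)
    show "integrable ?M (\<lambda>t. C\<^sup>2 * (norm (u t))\<^sup>2)" using u by (auto simp: sq_integrable_def)
    show "(\<lambda>t. (dual_norm G V (J (u t)))\<^sup>2) \<in> borel_measurable ?M"
      using measurable_compose[OF u_meas meas] by simp
    have "(dual_norm G V (J x))\<^sup>2 \<le> C\<^sup>2 * (norm x)\<^sup>2" for x
      using power_mono[OF dn_le dn_nonneg, of x 2] by (simp add: power_mult_distrib)
    then show "AE t in ?M. norm ((dual_norm G V (J (u t)))\<^sup>2) \<le> norm (C\<^sup>2 * (norm (u t))\<^sup>2)"
      by (intro AE_I2) simp
  qed
  ultimately show ?thesis using dual unfolding L2_time_dual_def by simp
qed

end

section \<open>The generator and the stationary corrector\<close>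

text \<open>The operator algebra \<open>bop\<close> asks for a space other than {0}, in the form of
  this class.\<close>

instance l2 :: perfect_space
proof
  fix x :: l2
  have "unit 1 \<noteq> 0" using norm_unit[of 1] by auto
  show "\<not> open {x}"
  proof
    assume "open {x}"
    then obtain e where e: "0 < e" "\<And>y. dist y x < e \<Longrightarrow> y = x" by (auto simp: open_dist)
    have "x + (e / 2) *\<^sub>R unit 1 = x"
      using e(1) norm_unit[of 1] by (intro e(2)) (simp add: dist_norm)
    then show False using \<open>unit 1 \<noteq> 0\<close> e(1) by simp
  qed
qed

instance prod :: (perfect_space, topological_space) perfect_space
proof
  fix x :: "'a \<times> 'b"
  show "\<not> open {x}"
  proof
    assume "open {x}"
    then have "open (fst ` {x})" by (rule open_image_fst)
    then show False using not_open_singleton[of "fst x"] by simp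
  qed
qed

lemma mult_affine:
  assumes c: "coefficient G c m M" and c': "coefficient G c' m' M'"
    and eq: "\<And>e x. c' e x = s + t * c e x" and p: "p \<in> L2E G"
  shows "mult G c' p = s *\<^sub>R p + t *\<^sub>R mult G c p"
proof (rule vec_eq_iff[THEN iffD2], rule allI)
  fix e
  let ?r = "rep_l2 (p $ e)"
  have sq: "sq_integrable (lebesgue_on {0..edge_length G e}) ?r" by (rule sq_integrable_on_rep_l2)
  have "mult G c' p $ e = restr (edge_length G e) (\<lambda>x. s * ?r x + t * (c e x * ?r x))"
    by (simp add: mult_restr eq distrib_right mult.assoc)
  also have "\<dots> = s *\<^sub>R restr (edge_length G e) ?r + t *\<^sub>R mult G c p $ e"
    using sq sq_integrable_coefficient[OF c sq]
    by (simp add: restr_add restr_scale sq_integrable_scale mult_restr)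
  finally show "mult G c' p $ e = (s *\<^sub>R p + t *\<^sub>R mult G c p) $ e"
    using p by (simp add: restr_rep L2E_supported)
qed

locale telegraph = fin_network G
  for G :: "('v::finite, 'e::finite) network" +
  fixes a d :: "'e \<Rightarrow> real \<Rightarrow> real" and a_max d_min d_max \<epsilon> :: real and Bm :: "real ^ 'v \<Rightarrow> 'e l2e"
  assumes a: "coefficient G a 0 a_max" and d: "coefficient G d d_min d_max" and d_min: "0 < d_min"
    and Bm: "is_right_inverse G Bm" and \<epsilon>: "0 < \<epsilon>"
begin

text \<open>An edge has positive measure, so the bounds on d hold at some point of it.\<close>

lemma d_max: "0 < d_max"
proof (rule ccontr)
  assume *: "\<not> 0 < d_max"
  obtain e :: 'e where True by blast
  have "AE x in lebesgue_on {0..len e}. d_min \<le> d e x \<and> d e x \<le> d_max" using d by (simp add: coefficient_def)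
  then have "AE x in lebesgue_on {0..len e}. False" by eventually_elim (use * d_min in linarith)
  then have "emeasure (lebesgue_on {0..len e}) {0..len e} = 0"
    by (subst (asm) AE_iff_measurable[of "{0..len e}"]) auto
  then show False using len_pos[of e] by (simp add: emeasure_restrict_space)
qed

lemma coefficient_affine_inverse:
  assumes "0 \<le> s" "0 < t"
  shows "coefficient G (\<lambda>e x. 1 / (s + t * d e x)) (1 / (s + t * d_max)) (1 / (s + t * d_min))"
  unfolding coefficient_def
proof (intro allI conjI)
  fix e
  have [measurable]: "d e \<in> borel_measurable (lebesgue_on {0..len e})" using d by (simp add: coefficient_def)
  show "(\<lambda>x. 1 / (s + t * d e x)) \<in> borel_measurable (lebesgue_on {0..len e})" by measurable
  have "AE x in lebesgue_on {0..len e}. d_min \<le> d e x \<and> d e x \<le> d_max" using d by (simp add: coefficient_def)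
  then show "AE x in lebesgue_on {0..len e}. 1 / (s + t * d_max) \<le> 1 / (s + t * d e x) \<and> 1 / (s + t * d e x) \<le> 1 / (s + t * d_min)"
  proof eventually_elim
    case (elim x)
    have "0 < s + t * d_min" using assms d_min by (simp add: add_nonneg_pos)
    moreover have "s + t * d_min \<le> s + t * d e x" "s + t * d e x \<le> s + t * d_max" using elim assms by auto
    ultimately show ?case by (auto intro!: divide_left_mono mult_pos_pos)
  qed
qed

lemma coefficient_weaken:
  assumes "coefficient G c m M" "m' \<le> m"
  shows "coefficient G c m' M"
  unfolding coefficient_def
proof (intro allI conjI)
  fix e
  show "c e \<in> borel_measurable (lebesgue_on {0..len e})" using assms by (simp add: coefficient_def)
  have "AE x in lebesgue_on {0..len e}. m \<le> c e x \<and> c e x \<le> M" using assms by (simp add: coefficient_def)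
  then show "AE x in lebesgue_on {0..len e}. m' \<le> c e x \<and> c e x \<le> M"
    by eventually_elim (use assms(2) in auto)
qed

lemma coefficient_affine:
  assumes "coefficient G c m M" "0 \<le> t"
  shows "coefficient G (\<lambda>e x. s + t * c e x) (s + t * m) (s + t * M)"
  unfolding coefficient_def
proof (intro allI conjI)
  fix e
  have [measurable]: "c e \<in> borel_measurable (lebesgue_on {0..len e})" using assms by (simp add: coefficient_def)
  show "(\<lambda>x. s + t * c e x) \<in> borel_measurable (lebesgue_on {0..len e})" by measurable
  have "AE x in lebesgue_on {0..len e}. m \<le> c e x \<and> c e x \<le> M" using assms by (simp add: coefficient_def)
  then show "AE x in lebesgue_on {0..len e}. s + t * m \<le> s + t * c e x \<and> s + t * c e x \<le> s + t * M"
    by eventually_elim (use assms(2) in \<open>auto intro: mult_left_mono\<close>)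
qed

lemma mult_affine_inverse:
  assumes "0 \<le> s" "0 < t" "p \<in> L2E G"
  shows "s *\<^sub>R mult G (\<lambda>e x. 1 / (s + t * d e x)) p + t *\<^sub>R mult G d (mult G (\<lambda>e x. 1 / (s + t * d e x)) p) = p"
    and "mult G (\<lambda>e x. 1 / (s + t * d e x)) (s *\<^sub>R p + t *\<^sub>R mult G d p) = p"
proof -
  note inv = coefficient_affine_inverse[OF assms(1,2)] and aff = coefficient_affine[OF d, of t s]
  have t: "0 \<le> t" using assms by simp
  have ae: "AE x in lebesgue_on {0..len e}. (s + t * d e x) * (1 / (s + t * d e x)) = 1" for e
  proof -
    have "AE x in lebesgue_on {0..len e}. d_min \<le> d e x \<and> d e x \<le> d_max" using d by (simp add: coefficient_def)
    then show ?thesis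
    proof eventually_elim
      case (elim x)
      then have "0 < d e x" using d_min by linarith
      then have "0 < s + t * d e x" using assms by (simp add: add_nonneg_pos)
      then show ?case by simp
    qed
  qed
  have "mult G (\<lambda>e x. s + t * d e x) (mult G (\<lambda>e x. 1 / (s + t * d e x)) p) = p"
    by (rule mult_inverse[OF inv aff[OF t] assms(3) ae])
  then show "s *\<^sub>R mult G (\<lambda>e x. 1 / (s + t * d e x)) p + t *\<^sub>R mult G d (mult G (\<lambda>e x. 1 / (s + t * d e x)) p) = p"
    by (simp add: mult_affine[OF d aff[OF t] refl mult_in[OF inv]])
  have "mult G (\<lambda>e x. 1 / (s + t * d e x)) (mult G (\<lambda>e x. s + t * d e x) p) = p"
    using ae by (intro mult_inverse[OF aff[OF t] inv assms(3)]) (simp add: mult.commute)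
  then show "mult G (\<lambda>e x. 1 / (s + t * d e x)) (s *\<^sub>R p + t *\<^sub>R mult G d p) = p"
    by (simp add: mult_affine[OF d aff[OF t] refl assms(3)])
qed

lemma mult_a_in: "mult G a p \<in> L2E G" and mult_d_in: "mult G d p \<in> L2E G"
  by (rule mult_in[OF a], rule mult_in[OF d])

section \<open>The adjoint of \<open>op_K\<close> and the generator\<close>

definition dom_K_adj :: "'e l2e set"
  where "dom_K_adj = {m \<in> L2E G. \<exists>m'\<in>L2E G. \<forall>q\<in>H10 G. inner m' q = K_adj G m q}"

lemma dom_A_eq: "dom_A G = H10 G \<times> dom_K_adj"
  by (simp add: dom_A_def dom_K_adj_def)

text \<open>Density of \<open>H10 G\<close> in \<open>L2E G\<close> makes the definite description
  in \<open>K_adj_L2\<close> unique.\<close>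

lemma K_adj_L2_eqI:
  assumes "m' \<in> L2E G" "\<And>q. q \<in> H10 G \<Longrightarrow> inner m' q = K_adj G m q"
  shows "K_adj_L2 G m = m'"
  unfolding K_adj_L2_def
proof (rule the_equality)
  fix n assume n: "n \<in> L2E G \<and> (\<forall>q\<in>H10 G. inner n q = K_adj G m q)"
  have "n - m' = 0"
    using n assms by (intro H10_dense subspace_diff[OF subspace_L2E]) (auto simp: inner_diff_left)
  then show "n = m'" by simp
qed (use assms in blast)

lemma
  assumes "m \<in> dom_K_adj"
  shows K_adj_L2_in: "K_adj_L2 G m \<in> L2E G"
    and inner_K_adj_L2: "q \<in> H10 G \<Longrightarrow> inner (K_adj_L2 G m) q = inner (op_K G q) m"
proof -
  obtain m' where "m' \<in> L2E G" "\<And>q. q \<in> H10 G \<Longrightarrow> inner m' q = K_adj G m q"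
    using assms by (auto simp: dom_K_adj_def)
  with K_adj_L2_eqI[OF this] show "K_adj_L2 G m \<in> L2E G" "q \<in> H10 G \<Longrightarrow> inner (K_adj_L2 G m) q = inner (op_K G q) m"
    by (auto simp: K_adj_def)
qed

lemma dom_K_adjI:
  assumes "m \<in> L2E G" "m' \<in> L2E G" "\<And>q. q \<in> H10 G \<Longrightarrow> inner m' q = inner (op_K G q) m"
  shows "m \<in> dom_K_adj" "K_adj_L2 G m = m'"
  using assms K_adj_L2_eqI[of m' m] by (auto simp: dom_K_adj_def K_adj_def)

lemma dom_K_adj_add:
  assumes "m \<in> dom_K_adj" "n \<in> dom_K_adj"
  shows "m + n \<in> dom_K_adj" "K_adj_L2 G (m + n) = K_adj_L2 G m + K_adj_L2 G n"
proof -
  have L: "m + n \<in> L2E G" "K_adj_L2 G m + K_adj_L2 G n \<in> L2E G"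
    using assms K_adj_L2_in by (auto simp: dom_K_adj_def intro!: subspace_add[OF subspace_L2E])
  have "inner (K_adj_L2 G m + K_adj_L2 G n) q = inner (op_K G q) (m + n)" if "q \<in> H10 G" for q
    using assms that by (simp add: inner_K_adj_L2 inner_add_left inner_add_right)
  from dom_K_adjI[OF L this] show "m + n \<in> dom_K_adj" "K_adj_L2 G (m + n) = K_adj_L2 G m + K_adj_L2 G n" by auto
qed

lemma dom_K_adj_scale:
  assumes "m \<in> dom_K_adj"
  shows "c *\<^sub>R m \<in> dom_K_adj" "K_adj_L2 G (c *\<^sub>R m) = c *\<^sub>R K_adj_L2 G m"
proof -
  have L: "c *\<^sub>R m \<in> L2E G" "c *\<^sub>R K_adj_L2 G m \<in> L2E G"
    using assms K_adj_L2_in by (auto simp: dom_K_adj_def intro!: subspace_scale[OF subspace_L2E])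
  have "inner (c *\<^sub>R K_adj_L2 G m) q = inner (op_K G q) (c *\<^sub>R m)" if "q \<in> H10 G" for q
    using assms that by (simp add: inner_K_adj_L2)
  from dom_K_adjI[OF L this] show "c *\<^sub>R m \<in> dom_K_adj" "K_adj_L2 G (c *\<^sub>R m) = c *\<^sub>R K_adj_L2 G m" by auto
qed

lemma subspace_dom_K_adj: "subspace dom_K_adj"
proof (rule subspaceI)
  have "inner 0 q = inner (op_K G q) 0" for q by simp
  then show "0 \<in> dom_K_adj" using dom_K_adjI(1)[of 0 0] subspace_0[OF subspace_L2E[of G]] by simp
qed (simp_all add: dom_K_adj_add dom_K_adj_scale)

definition gen :: "'e l2e \<times> 'e l2e \<Rightarrow> 'e l2e \<times> 'e l2e"
  where "gen x = (1 / sqrt \<epsilon>) *\<^sub>R op_A G a d \<epsilon> x"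

lemma gen_eq:
  "gen (p, m) = (- mult G a p + (1 / sqrt \<epsilon>) *\<^sub>R K_adj_L2 G m,
     - ((1 / sqrt \<epsilon>) *\<^sub>R op_K G p) - (1 / \<epsilon>) *\<^sub>R mult G d m)"
  using \<epsilon> by (simp add: gen_def op_A_def scaleR_diff_right scaleR_add_right real_sqrt_mult[symmetric])

lemma inner_gen:
  assumes "(p, m) \<in> dom_A G" "q \<in> H10 G"
  shows "inner (gen (p, m)) (q, 0) = inner (p, m) (- mult G a q, (1 / sqrt \<epsilon>) *\<^sub>R op_K G q)"
proof -
  have "inner (K_adj_L2 G m) q = inner m (op_K G q)"
    using assms by (simp add: dom_A_eq inner_K_adj_L2 inner_commute[of m])
  then show ?thesis
    by (simp add: gen_eq inner_add_left inner_diff_left mult_sym[OF a])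
qed

definition P :: "'e l2e \<times> 'e l2e \<Rightarrow> 'e l2e \<times> 'e l2e"
  where "P x = (proj G (fst x), proj G (snd x))"

sublocale projected_dissipative P "L2E G \<times> L2E G" "dom_A G" gen
proof (rule projected_dissipative.intro)
  show "bounded_linear P"
    unfolding P_def
    by (intro bounded_linear_Pair bounded_linear_compose[OF bounded_linear_mult[OF coefficient_one]]
        bounded_linear_fst bounded_linear_snd)
  show "inner (P x) y = inner x (P y)" for x y
    by (simp add: P_def inner_prod_def mult_sym[OF coefficient_one])
  show "P x \<in> L2E G \<times> L2E G" for x by (simp add: P_def mult_in[OF coefficient_one])
  show "P x = x" if "x \<in> L2E G \<times> L2E G" for x using that by (auto simp: P_def proj_id)
  show "dom_A G \<subseteq> L2E G \<times> L2E G" by (auto simp: dom_A_eq H10_H1 H1_L2E dom_K_adj_def)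
  show "gen x \<in> L2E G \<times> L2E G" if "x \<in> dom_A G" for x
    using that by (auto simp: gen_eq dom_A_eq H10_H1 op_K_L2E K_adj_L2_in mult_a_in mult_d_in
        intro!: subspace_add[OF subspace_L2E] subspace_diff[OF subspace_L2E] subspace_scale[OF subspace_L2E]
          subspace_neg[OF subspace_L2E])
  show "subspace (dom_A G)"
    unfolding dom_A_eq by (intro subspace_Times subspace_H10 subspace_dom_K_adj)
  show "gen (x + y) = gen x + gen y" if "x \<in> dom_A G" "y \<in> dom_A G" for x y
    using that by (cases x; cases y) (simp add: gen_eq dom_A_eq H10_H1 H1_add dom_K_adj_add mult_add[OF a] mult_add[OF d]
        scaleR_add_right)
  show "gen (c *\<^sub>R x) = c *\<^sub>R gen x" if "x \<in> dom_A G" for x c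
    using that by (cases x) (simp add: gen_eq dom_A_eq H10_H1 H1_scale dom_K_adj_scale mult_scale[OF a] mult_scale[OF d]
        scaleR_add_right scaleR_diff_right mult.commute)
  show "inner (gen x) x \<le> 0" if x: "x \<in> dom_A G" for x
  proof -
    obtain p m where pm: "x = (p, m)" "p \<in> H10 G" "m \<in> dom_K_adj" using x by (auto simp: dom_A_eq)
    have L: "p \<in> L2E G" "m \<in> L2E G" using pm by (auto simp: H10_H1 H1_L2E dom_K_adj_def)
    \<comment> \<open>The contributions of \<open>op_K\<close> and \<open>K_adj_L2\<close> are
      opposite and cancel; only the damping by a and d remains.\<close>
    have "inner (gen x) x = - inner (mult G a p) p - (1 / \<epsilon>) * inner (mult G d m) m"
      using pm by (simp add: gen_eq inner_add_left inner_diff_left inner_K_adj_L2)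
    moreover have "0 \<le> inner (mult G a p) p" using mult_lower[OF a L(1)] by simp
    moreover have "0 \<le> d_min * (norm m)\<^sup>2" using d_min by simp
    then have "0 \<le> (1 / \<epsilon>) * inner (mult G d m) m" using mult_lower[OF d L(2)] \<epsilon> by simp
    ultimately show ?thesis by linarith
  qed
  show "\<exists>x\<in>dom_A G. l *\<^sub>R x - gen x = y" if l: "0 < l" and y: "y \<in> L2E G \<times> L2E G" for l y
  proof -
    obtain f1 f2 where f: "y = (f1, f2)" "f1 \<in> L2E G" "f2 \<in> L2E G" using y by auto
    \<comment> \<open>Multiplication by \<beta> solves the second component of the resolvent
      equation for m. Inserted into the first, this leaves an elliptic problem for p with weight
      \<alpha> at p and weight \<gamma> = \<beta>/\<epsilon> at its derivative.\<close>
    define \<beta> where "\<beta> = (\<lambda>e x. 1 / (l + (1 / \<epsilon>) * d e x))"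
    define \<alpha> where "\<alpha> = (\<lambda>e x. l + 1 * a e x)"
    define \<gamma> where "\<gamma> = (\<lambda>e x. 0 + 1 / \<epsilon> * \<beta> e x)"
    let ?w = "1 / sqrt \<epsilon>"
    have \<epsilon>': "0 < 1 / \<epsilon>" using \<epsilon> by simp
    have w2: "?w * ?w = 1 / \<epsilon>" using \<epsilon> by (simp add: real_sqrt_mult[symmetric])
    note \<beta> = coefficient_affine_inverse[OF less_imp_le[OF l] \<epsilon>', folded \<beta>_def]
    have \<beta>_pos: "0 < 1 / \<epsilon> * (1 / (l + 1 / \<epsilon> * d_max))" using l \<epsilon> d_max by (simp add: add_pos_pos)
    have \<gamma>: "coefficient G \<gamma> (1 / \<epsilon> * (1 / (l + 1 / \<epsilon> * d_max))) (1 / \<epsilon> * (1 / (l + 1 / \<epsilon> * d_min)))"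
      using coefficient_affine[OF \<beta> less_imp_le[OF \<epsilon>'], of 0, folded \<gamma>_def] by simp
    have \<alpha>: "coefficient G \<alpha> 0 (l + 1 * a_max)"
      by (rule coefficient_weaken[OF coefficient_affine[OF a zero_le_one, of l, folded \<alpha>_def]]) (use l in simp)
    have "bounded_linear (\<lambda>z. inner f1 (fst z) + ?w * inner (mult G \<beta> f2) (snd z))"
      by (intro bounded_linear_add bounded_linear_compose[OF bounded_linear_inner_right]
          bounded_linear_compose[OF bounded_linear_mult_right] bounded_linear_fst bounded_linear_snd)
    from elliptic_solution[OF \<alpha> \<gamma> \<beta>_pos this]
    obtain p where p: "p \<in> H10 G" and weak: "\<And>q. q \<in> H10 G \<Longrightarrow>
       inner (mult G \<alpha> p) q + inner (mult G \<gamma> (op_K G p)) (op_K G q)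
         = inner f1 q + ?w * inner (mult G \<beta> f2) (op_K G q)" by auto
    have L: "p \<in> L2E G" "op_K G p \<in> L2E G" using p by (auto simp: H10_H1 H1_L2E op_K_L2E)
    have \<alpha>p: "mult G \<alpha> p = l *\<^sub>R p + mult G a p"
      using mult_affine[OF a \<alpha> _ L(1), of l 1] by (simp add: \<alpha>_def)
    have \<beta>p: "mult G \<gamma> (op_K G p) = (1 / \<epsilon>) *\<^sub>R mult G \<beta> (op_K G p)"
      using mult_affine[OF \<beta> \<gamma> _ L(2), of 0 "1 / \<epsilon>"] by (simp add: \<gamma>_def)
    define m where "m = mult G \<beta> (f2 - ?w *\<^sub>R op_K G p)"
    have m_eq: "m = mult G \<beta> f2 - ?w *\<^sub>R mult G \<beta> (op_K G p)"
      unfolding m_def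
      by (simp add: linear_diff[OF bounded_linear.linear[OF bounded_linear_mult[OF \<beta>]]] mult_scale[OF \<beta>])
    have mL: "m \<in> L2E G" unfolding m_def by (rule mult_in[OF \<beta>])
    \<comment> \<open>Read in terms of m, the weak equation for p exhibits an L2 representative of
      the adjoint applied to m: m lies in the domain, and the first component of the resolvent
      equation holds.\<close>
    have K: "inner (sqrt \<epsilon> *\<^sub>R (l *\<^sub>R p + mult G a p - f1)) q = inner (op_K G q) m" if q: "q \<in> H10 G" for q
    proof -
      have "inner (l *\<^sub>R p + mult G a p - f1) q = ?w * inner (mult G \<beta> f2) (op_K G q) - (1 / \<epsilon>) * inner (mult G \<beta> (op_K G p)) (op_K G q)"
        using weak[OF q] unfolding \<alpha>p \<beta>p by (simp add: inner_diff_left)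
      also have "\<dots> = ?w * inner m (op_K G q)"
        unfolding m_eq w2[symmetric] by (simp add: inner_diff_left right_diff_distrib)
      finally show ?thesis using \<epsilon> by (simp add: inner_commute)
    qed
    have mdom: "m \<in> dom_K_adj" and mK: "K_adj_L2 G m = sqrt \<epsilon> *\<^sub>R (l *\<^sub>R p + mult G a p - f1)"
      using dom_K_adjI[OF mL _ K] f L mult_a_in
      by (auto intro!: subspace_add[OF subspace_L2E] subspace_diff[OF subspace_L2E] subspace_scale[OF subspace_L2E])
    have second: "l *\<^sub>R m + (1 / \<epsilon>) *\<^sub>R mult G d m = f2 - ?w *\<^sub>R op_K G p"
      unfolding m_def
      by (rule mult_affine_inverse(1)[OF less_imp_le[OF l] \<epsilon>', folded \<beta>_def])
        (intro subspace_diff[OF subspace_L2E] subspace_scale[OF subspace_L2E] f L)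
    have "l *\<^sub>R (p, m) - gen (p, m) = y"
      unfolding gen_eq mK f(1) using \<epsilon> second by (simp add: algebra_simps)
    then show ?thesis using p mdom by (auto simp: dom_A_eq)
  qed
qed

end

context telegraph
begin

section \<open>Boundary liftings\<close>

definition bdl :: "'v \<Rightarrow> 'e l2e" where "bdl v = Bm (axis v 1)"

text \<open>Agrees with \<open>Bm\<close> on \<open>RD G\<close>, see \<open>Bm_lift\<close>, but is
  linear and bounded on the whole type.\<close>

definition lift :: "real ^ 'v \<Rightarrow> 'e l2e" where "lift y = (\<Sum>v\<in>boundary G. y $ v *\<^sub>R bdl v)"

definition K_lift :: "real ^ 'v \<Rightarrow> 'e l2e" where "K_lift y = (\<Sum>v\<in>boundary G. y $ v *\<^sub>R op_K G (bdl v))"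

lemma bounded_linear_lift: "bounded_linear lift" and bounded_linear_K_lift: "bounded_linear K_lift"
  unfolding lift_def K_lift_def
  by (intro bounded_linear_sum bounded_linear_scaleR_const bounded_linear_vec_nth)+

lemma subspace_RD: "subspace (RD G)"
  by (auto simp: RD_def subspace_def)

lemma axis_RD: "v \<in> boundary G \<Longrightarrow> axis v c \<in> RD G"
  by (auto simp: RD_def axis_def)

lemma bdl_H1: "v \<in> boundary G \<Longrightarrow> bdl v \<in> H1 G" and op_B_bdl: "v \<in> boundary G \<Longrightarrow> op_B G (bdl v) = axis v 1"
  using Bm axis_RD[of v 1] by (auto simp: bdl_def is_right_inverse_def)

text \<open>One induction carries all five claims, because additivity of \<open>Bm\<close> is known
  only for partial sums in \<open>RD G\<close> and additivity of the operators only for those in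
  \<open>H1 G\<close>.\<close>

lemma sum_bdl:
  assumes "S \<subseteq> boundary G"
  shows "(\<Sum>v\<in>S. y $ v *\<^sub>R bdl v) \<in> H1 G \<and>
    op_K G (\<Sum>v\<in>S. y $ v *\<^sub>R bdl v) = (\<Sum>v\<in>S. y $ v *\<^sub>R op_K G (bdl v)) \<and>
    op_B G (\<Sum>v\<in>S. y $ v *\<^sub>R bdl v) = (\<Sum>v\<in>S. y $ v *\<^sub>R axis v 1) \<and>
    (\<Sum>v\<in>S. y $ v *\<^sub>R axis v 1) \<in> RD G \<and>
    Bm (\<Sum>v\<in>S. y $ v *\<^sub>R axis v 1) = (\<Sum>v\<in>S. y $ v *\<^sub>R bdl v)"
  using finite_subset[OF assms finite] assms
proof (induction S)
  case empty
  have 0: "op_K G 0 = 0" "vertex_trace G 0 = 0" using h1_rel_H1[OF h1_rel_zero] by auto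
  have "\<forall>c. \<forall>y\<in>RD G. Bm (c *\<^sub>R y) = c *\<^sub>R Bm y" using Bm by (simp add: is_right_inverse_def)
  then have "Bm (0 *\<^sub>R 0) = 0 *\<^sub>R Bm 0" using subspace_0[OF subspace_RD] by blast
  then have "Bm 0 = 0" by simp
  then show ?case
    using subspace_0[OF subspace_H1] subspace_0[OF subspace_RD] by (simp add: 0 op_B_def vec_eq_iff)
next
  case (insert v S)
  let ?s = "\<Sum>v\<in>S. y $ v *\<^sub>R bdl v" and ?t = "\<Sum>v\<in>S. y $ v *\<^sub>R axis v 1 :: real ^ 'v"
  have v: "v \<in> boundary G" using insert by simp
  have IH: "?s \<in> H1 G" "op_K G ?s = (\<Sum>v\<in>S. y $ v *\<^sub>R op_K G (bdl v))" "op_B G ?s = ?t" "?t \<in> RD G" "Bm ?t = ?s"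
    using insert by auto
  have b: "y $ v *\<^sub>R bdl v \<in> H1 G" "y $ v *\<^sub>R axis v 1 \<in> RD G"
    using H1_scale(1)[OF bdl_H1[OF v]] subspace_scale[OF subspace_RD axis_RD[OF v]] by auto
  have "Bm (y $ v *\<^sub>R axis v 1) = y $ v *\<^sub>R bdl v"
    using Bm axis_RD[OF v, of 1] unfolding bdl_def is_right_inverse_def by blast
  moreover have "Bm (y $ v *\<^sub>R axis v 1 + ?t) = Bm (y $ v *\<^sub>R axis v 1) + Bm ?t"
    using Bm b(2) IH(4) unfolding is_right_inverse_def by blast
  ultimately show ?case
    using insert.hyps H1_add[OF b(1) IH(1)] IH op_B_add[OF b(1) IH(1)] subspace_add[OF subspace_RD b(2) IH(4)] v
    by (simp add: H1_scale(2) bdl_H1 op_B_scale op_B_bdl)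
qed

lemma RD_expand: "y \<in> RD G \<Longrightarrow> (\<Sum>v\<in>boundary G. y $ v *\<^sub>R axis v 1) = y"
proof (rule vec_eq_iff[THEN iffD2], rule allI)
  fix u assume y: "y \<in> RD G"
  have "(\<Sum>v\<in>boundary G. y $ v *\<^sub>R axis v 1) $ u = (\<Sum>v\<in>boundary G. if u = v then y $ v else 0)"
    unfolding sum_component by (intro sum.cong) (auto simp: axis_def)
  also have "\<dots> = y $ u" using y by (auto simp: RD_def sum.delta)
  finally show "(\<Sum>v\<in>boundary G. y $ v *\<^sub>R axis v 1) $ u = y $ u" .
qed

lemma lift_H1: "lift y \<in> H1 G" and op_K_lift: "op_K G (lift y) = K_lift y"
  and op_B_lift: "y \<in> RD G \<Longrightarrow> op_B G (lift y) = y" and Bm_lift: "y \<in> RD G \<Longrightarrow> Bm y = lift y"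
  using sum_bdl[of "boundary G" y] RD_expand[of y] by (auto simp: lift_def K_lift_def)

lemma op_B_RD: "op_B G q \<in> RD G"
  by (simp add: op_B_def RD_def)

text \<open>Subtracting from q the lifting of its boundary values leaves an element of
  \<open>H10 G\<close>, so the functional sees the boundary values only.\<close>

lemma functional_boundary:
  assumes add: "\<And>q q'. q \<in> H1 G \<Longrightarrow> q' \<in> H1 G \<Longrightarrow> \<Phi> (q + q') = \<Phi> q + (\<Phi> q' :: real)"
    and scale: "\<And>c q. q \<in> H1 G \<Longrightarrow> \<Phi> (c *\<^sub>R q) = c * \<Phi> q"
    and zero: "\<And>q. q \<in> H10 G \<Longrightarrow> \<Phi> q = 0" and q: "q \<in> H1 G"
  shows "\<Phi> q = inner (\<chi> v. if v \<in> boundary G then \<Phi> (bdl v) else 0) (op_B G q)"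
proof -
  have "\<Phi> (\<Sum>v\<in>S. y $ v *\<^sub>R bdl v) = (\<Sum>v\<in>S. y $ v * \<Phi> (bdl v))" if "S \<subseteq> boundary G" for S and y :: "real ^ 'v"
    using finite_subset[OF that finite] that
  proof (induction S)
    case empty
    then show ?case using scale[OF q, of 0] by simp
  next
    case (insert v S)
    then show ?case using sum_bdl[of S y] H1_scale(1)[OF bdl_H1] by (simp add: add scale bdl_H1)
  qed
  then have lift: "\<Phi> (lift y) = (\<Sum>v\<in>boundary G. y $ v * \<Phi> (bdl v))" for y by (simp add: lift_def)
  define q0 where "q0 = q + (- 1) *\<^sub>R lift (op_B G q)"
  have m: "(- 1) *\<^sub>R lift (op_B G q) \<in> H1 G" by (rule H1_scale(1)[OF lift_H1])
  have "q0 \<in> H1 G" unfolding q0_def by (rule H1_add(1)[OF q m])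
  moreover have "op_B G q0 = 0"
    unfolding q0_def op_B_add[OF q m] op_B_scale[OF lift_H1] by (simp add: op_B_lift op_B_RD)
  ultimately have "\<Phi> q0 = 0" using zero by (simp add: H10_iff)
  then have "\<Phi> q = (\<Sum>v\<in>boundary G. op_B G q $ v * \<Phi> (bdl v))"
    unfolding q0_def add[OF q m] scale[OF lift_H1] lift by simp
  also have "\<dots> = (\<Sum>v\<in>UNIV. if v \<in> boundary G then op_B G q $ v * \<Phi> (bdl v) else 0)"
    by (simp add: sum.If_cases)
  also have "\<dots> = inner (\<chi> v. if v \<in> boundary G then \<Phi> (bdl v) else 0) (op_B G q)"
    unfolding inner_vec_def by (intro sum.cong) auto
  finally show ?thesis .
qed

section \<open>The stationary corrector\<close>

definition dinv :: "'e \<Rightarrow> real \<Rightarrow> real" where "dinv e x = 1 / (0 + 1 * d e x)"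

lemma dinv: "coefficient G dinv (1 / d_max) (1 / d_min)"
  using coefficient_affine_inverse[of 0 1] by (simp add: dinv_def[abs_def])

lemma mult_d_dinv: "p \<in> L2E G \<Longrightarrow> mult G d (mult G dinv p) = p"
  and mult_dinv_d: "p \<in> L2E G \<Longrightarrow> mult G dinv (mult G d p) = p"
  using mult_affine_inverse[of 0 1 p] by (simp_all add: dinv_def[abs_def])

definition interior :: "real ^ 'v \<Rightarrow> real ^ 'v" where "interior r = (\<chi> v. if v \<in> boundary G then 0 else r $ v)"

text \<open>Rewrites point evaluation through \<open>trc\<close>, that is, as a bounded functional
  on pairs as demanded by \<open>elliptic_solution\<close>.\<close>

lemma inner_op_C: "q \<in> H1 G \<Longrightarrow> inner r (op_C G q) = inner (interior r) (trc (q, op_K G q))"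
  unfolding inner_vec_def interior_def op_C_def by (intro sum.cong) (auto simp: vertex_trace_trc)

text \<open>The corrector problem after eliminating its second unknown, which is minus
  \<open>dinv\<close> times the derivative of p. Tested on \<open>H10 G\<close>, where the
  multiplier drops out.\<close>

definition is_corr :: "real ^ 'v \<Rightarrow> 'e l2e \<Rightarrow> bool"
  where "is_corr r p \<longleftrightarrow> p \<in> H10 G \<and>
    (\<forall>q\<in>H10 G. inner (mult G a p) q + inner (mult G dinv (op_K G p)) (op_K G q) = - inner r (op_C G q))"

definition corr_P :: "real ^ 'v \<Rightarrow> 'e l2e" where "corr_P r = (SOME p. is_corr r p)"

lemma is_corr_unique:
  assumes "is_corr r p" "is_corr r p'"
  shows "p = p'"
proof -
  have H: "p \<in> H10 G" "p' \<in> H10 G" using assms by (auto simp: is_corr_def)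
  then have D: "p - p' \<in> H10 G" by (rule subspace_diff[OF subspace_H10])
  have K: "op_K G (p - p') = op_K G p - op_K G p'"
    using H1_add(2)[of p "- 1 *\<^sub>R p'"] H1_scale[of p' "- 1"] H by (simp add: H10_H1)
  have "p - p' = 0"
  proof (rule elliptic_unique[OF a dinv _ D])
    show "0 < 1 / d_max" using d_max by simp
    have "inner (mult G a (p - p')) (p - p') + inner (mult G dinv (op_K G (p - p'))) (op_K G (p - p')) =
      (inner (mult G a p) (p - p') + inner (mult G dinv (op_K G p)) (op_K G (p - p'))) -
      (inner (mult G a p') (p - p') + inner (mult G dinv (op_K G p')) (op_K G (p - p')))"
      unfolding K linear_diff[OF bounded_linear.linear[OF bounded_linear_mult[OF a]]]
        linear_diff[OF bounded_linear.linear[OF bounded_linear_mult[OF dinv]]]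
      by (simp only: inner_diff_left)
    also have "\<dots> = 0" using assms D by (simp add: is_corr_def)
    finally show "inner (mult G a (p - p')) (p - p') + inner (mult G dinv (op_K G (p - p'))) (op_K G (p - p')) = 0" .
  qed
  then show ?thesis by simp
qed

lemma is_corr: "is_corr r (corr_P r)"
proof -
  have "bounded_linear (\<lambda>z. - inner (interior r) (trc z))"
    by (intro bounded_linear_minus bounded_linear_compose[OF bounded_linear_inner_right] bounded_linear_trc)
  from elliptic_solution[OF a dinv _ this] d_max
  have "\<exists>p. is_corr r p" by (auto simp: is_corr_def inner_op_C H10_H1)
  then show ?thesis unfolding corr_P_def by (rule someI_ex)
qed

lemma corr_P_eqI: "is_corr r p \<Longrightarrow> corr_P r = p"
  using is_corr_unique is_corr by blast

lemma corr_P_H10: "corr_P r \<in> H10 G"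
  using is_corr by (simp add: is_corr_def)

lemma corr_P_add: "corr_P (r + r') = corr_P r + corr_P r'"
proof (rule corr_P_eqI)
  have H: "corr_P r \<in> H1 G" "corr_P r' \<in> H1 G" using corr_P_H10 H10_H1 by auto
  show "is_corr (r + r') (corr_P r + corr_P r')"
    using is_corr[of r] is_corr[of r'] subspace_add[OF subspace_H10]
    by (simp add: is_corr_def H1_add(2)[OF H] mult_add[OF a] mult_add[OF dinv] inner_add_left algebra_simps)
qed

lemma corr_P_scale: "corr_P (c *\<^sub>R r) = c *\<^sub>R corr_P r"
proof (rule corr_P_eqI)
  have H: "corr_P r \<in> H1 G" using corr_P_H10 H10_H1 by auto
  show "is_corr (c *\<^sub>R r) (c *\<^sub>R corr_P r)"
    using is_corr[of r] subspace_scale[OF subspace_H10]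
    by (simp add: is_corr_def H1_scale(2)[OF H] mult_scale[OF a] mult_scale[OF dinv] distrib_left[symmetric])
qed

text \<open>Linear maps on the finite-dimensional space of vertex vectors are bounded. Composed with
  r they therefore inherit its H1 regularity in time.\<close>

lemma bounded_linear_corr_P: "bounded_linear corr_P"
  and bounded_linear_K_corr_P: "bounded_linear (\<lambda>r. op_K G (corr_P r))"
  by (simp_all add: linear_conv_bounded_linear[symmetric] linear_iff corr_P_add corr_P_scale H1_add H1_scale corr_P_H10 H10_H1)

definition corr_M :: "real ^ 'v \<Rightarrow> 'e l2e" where "corr_M r = - mult G dinv (op_K G (corr_P r))"

lemma bounded_linear_corr_M: "bounded_linear corr_M"
  unfolding corr_M_def
  by (intro bounded_linear_minus bounded_linear_compose[OF bounded_linear_mult[OF dinv]] bounded_linear_K_corr_P)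

lemma corr_M_L2E: "corr_M r \<in> L2E G"
  unfolding corr_M_def by (intro subspace_neg[OF subspace_L2E] mult_in[OF dinv])

lemma corr_weak: "q \<in> H10 G \<Longrightarrow> inner (mult G a (corr_P r)) q - inner (op_K G q) (corr_M r) = - inner r (op_C G q)"
  using is_corr[of r] by (simp add: is_corr_def corr_M_def inner_commute[of "op_K G q"])

text \<open>Minus the defect of the first corrector equation, tested with the liftings of the
  boundary unit vectors; \<open>functional_boundary\<close> makes it the multiplier.\<close>

definition corr_L :: "real ^ 'v \<Rightarrow> real ^ 'v"
  where "corr_L r = (\<chi> v. if v \<in> boundary G then
    - (inner (mult G a (corr_P r)) (bdl v) - inner (op_K G (bdl v)) (corr_M r) + inner r (op_C G (bdl v))) else 0)"

lemma bounded_linear_corr_L: "bounded_linear corr_L"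
proof -
  have M: "corr_M (r + r') = corr_M r + corr_M r'" "corr_M (c *\<^sub>R r) = c *\<^sub>R corr_M r" for r r' c
    using bounded_linear.linear[OF bounded_linear_corr_M] unfolding linear_iff by blast+
  have "corr_L (r + r') $ v = (corr_L r + corr_L r') $ v" "corr_L (c *\<^sub>R r) $ v = (c *\<^sub>R corr_L r) $ v" for r r' c v
    by (simp_all add: corr_L_def M corr_P_add corr_P_scale mult_add[OF a] mult_scale[OF a] inner_add_left inner_add_right algebra_simps)
  then have "corr_L (r + r') = corr_L r + corr_L r'" "corr_L (c *\<^sub>R r) = c *\<^sub>R corr_L r" for r r' c
    unfolding vec_eq_iff by blast+
  then show ?thesis by (simp add: linear_conv_bounded_linear[symmetric] linear_iff)
qed

lemma corr_equation:
  assumes q: "q \<in> H1 G"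
  shows "inner (mult G a (corr_P r)) q - inner (op_K G q) (corr_M r) + inner (corr_L r) (op_B G q) = - inner r (op_C G q)"
proof -
  let ?\<Phi> = "\<lambda>q. inner (mult G a (corr_P r)) q - inner (op_K G q) (corr_M r) + inner r (op_C G q)"
  have "?\<Phi> q = inner (\<chi> v. if v \<in> boundary G then ?\<Phi> (bdl v) else 0) (op_B G q)"
  proof (rule functional_boundary[OF _ _ _ q])
    show "?\<Phi> (q + q') = ?\<Phi> q + ?\<Phi> q'" if "q \<in> H1 G" "q' \<in> H1 G" for q q'
      using that by (simp add: H1_add op_C_add inner_add_left inner_add_right)
    show "?\<Phi> (c *\<^sub>R q) = c * ?\<Phi> q" if "q \<in> H1 G" for c q
      using that by (simp add: H1_scale op_C_scale algebra_simps)
    show "?\<Phi> q = 0" if "q \<in> H10 G" for q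
      using corr_weak[OF that, of r] by simp
  qed
  also have "(\<chi> v. if v \<in> boundary G then ?\<Phi> (bdl v) else 0) = - corr_L r"
    by (simp add: corr_L_def vec_eq_iff)
  finally show ?thesis by simp
qed

lemma corrector_corr:
  assumes r: "r \<in> H1_time T X"
  shows "corrector G a d T r (\<lambda>t. corr_P (r t)) (\<lambda>t. corr_M (r t)) (\<lambda>t. corr_L (r t))"
  unfolding corrector_def
proof (intro conjI ballI)
  have "(\<lambda>t. (corr_P (r t), op_K G (corr_P (r t)))) \<in> H1_time T ((\<lambda>q. (q, op_K G q)) ` H10 G)"
    by (rule H1_time_linear[OF bounded_linear_Pair[OF bounded_linear_corr_P bounded_linear_K_corr_P] _ r])
      (simp add: corr_P_H10)
  then show "(\<lambda>t. corr_P (r t)) \<in> H1_time_H1 G T (H10 G)" by (simp add: H1_time_H1_def)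
  show "(\<lambda>t. corr_M (r t)) \<in> H1_time T (L2E G)"
    by (rule H1_time_linear[OF bounded_linear_corr_M corr_M_L2E r])
  show "(\<lambda>t. corr_L (r t)) \<in> H1_time T (RD G)"
    by (rule H1_time_linear[OF bounded_linear_corr_L _ r]) (simp add: corr_L_def RD_def)
  fix t
  show "emb (mult G a (corr_P (r t))) q - K_adj G (corr_M (r t)) q + B_adj G (corr_L (r t)) q = - C_adj G (r t) q"
    if "q \<in> H1 G" for q
    using corr_equation[OF that] by (simp add: emb_def K_adj_def B_adj_def C_adj_def)
  have "mult G d (corr_M (r t)) = - op_K G (corr_P (r t))"
    unfolding corr_M_def linear_neg[OF bounded_linear.linear[OF bounded_linear_mult[OF d]]]
    by (simp add: mult_d_dinv op_K_L2E H10_H1 corr_P_H10)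
  then show "op_K G (corr_P (r t)) + mult G d (corr_M (r t)) = 0" by simp
  show "op_B G (corr_P (r t)) = 0" using corr_P_H10 H10_iff by blast
qed

lemma corrector_unique:
  assumes "corrector G a d T r pb mb lb" and t: "t \<in> {0..T}"
  shows "pb t = corr_P (r t)" "mb t = corr_M (r t)"
proof -
  have "(\<lambda>t. (pb t, op_K G (pb t))) ` {0..T} \<subseteq> (\<lambda>q. (q, op_K G q)) ` H10 G"
    using assms(1) by (simp add: corrector_def H1_time_H1_def H1_time_def C_time_def)
  then have "(pb t, op_K G (pb t)) \<in> (\<lambda>q. (q, op_K G q)) ` H10 G" using t by blast
  then have pb: "pb t \<in> H10 G" by auto
  have mb: "mb t \<in> L2E G" using assms(1) t by (auto simp: corrector_def H1_time_def C_time_def)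
  have "mult G d (mb t) = - op_K G (pb t)"
    using assms by (simp add: corrector_def eq_neg_iff_add_eq_0 add.commute)
  then have "mb t = mult G dinv (- op_K G (pb t))" using mult_dinv_d[OF mb] by simp
  then have mb_eq: "mb t = - mult G dinv (op_K G (pb t))"
    by (simp add: linear_neg[OF bounded_linear.linear[OF bounded_linear_mult[OF dinv]]])
  have "inner (mult G a (pb t)) q + inner (mult G dinv (op_K G (pb t))) (op_K G q) = - inner (r t) (op_C G q)" if q: "q \<in> H10 G" for q
  proof -
    have "emb (mult G a (pb t)) q - K_adj G (mb t) q + B_adj G (lb t) q = - C_adj G (r t) q"
      using assms q by (simp add: corrector_def H10_H1)
    moreover have "op_B G q = 0" using q H10_iff by blast
    ultimately show ?thesis
      by (simp add: emb_def K_adj_def B_adj_def C_adj_def mb_eq inner_commute[of "op_K G q"])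
  qed
  then have "is_corr (r t) (pb t)" using pb by (simp add: is_corr_def)
  then show "pb t = corr_P (r t)" using corr_P_eqI by simp
  then show "mb t = corr_M (r t)" using mb_eq by (simp add: corr_M_def)
qed

end

section \<open>Existence and uniqueness of the mild solution\<close>

locale telegraph_data = telegraph G a d a_max d_min d_max \<epsilon> Bm
  for G :: "('v::finite, 'e::finite) network" and a d a_max d_min d_max \<epsilon> Bm +
  fixes T :: real and f g :: "real \<Rightarrow> 'e l2e" and h r :: "real \<Rightarrow> real ^ 'v" and p0 m0 :: "'e l2e"
  assumes T: "0 < T" and f: "f \<in> L2_time T (L2E G)" and g: "g \<in> L2_time T (L2E G)"
    and h: "h \<in> H1_time T (RD G)" and r: "r \<in> H1_time T (RN G)"
    and p0: "p0 \<in> L2E G" and m0: "m0 \<in> L2E G"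
begin

abbreviation MT where "MT \<equiv> lebesgue_on {0..T}"

definition pb :: "real \<Rightarrow> 'e l2e" where "pb t = corr_P (r t)"
definition mb :: "real \<Rightarrow> 'e l2e" where "mb t = corr_M (r t)"

definition F :: "real \<Rightarrow> 'e l2e \<times> 'e l2e"
  where "F t = ((1 / sqrt \<epsilon>) *\<^sub>R (g t - time_deriv T pb t - mult G a (Bm (h t)) - Bm (time_deriv T h t)),
    (1 / \<epsilon>) *\<^sub>R (f t - op_K G (Bm (h t))) - time_deriv T mb t)"

definition x0 :: "'e l2e \<times> 'e l2e"
  where "x0 = ((1 / sqrt \<epsilon>) *\<^sub>R (p0 - pb 0 - Bm (h 0)), m0 - mb 0)"

definition U :: "real \<Rightarrow> 'e l2e \<times> 'e l2e" where "U t = sg t x0 + duhamel F t"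

definition psol :: "real \<Rightarrow> 'e l2e" where "psol t = pb t + Bm (h t) + sqrt \<epsilon> *\<^sub>R fst (U t)"
definition msol :: "real \<Rightarrow> 'e l2e" where "msol t = mb t + snd (U t)"

lemma pb_H1_time: "pb \<in> H1_time T (L2E G)"
  unfolding pb_def[abs_def]
  by (rule H1_time_linear[OF bounded_linear_corr_P _ r]) (simp add: corr_P_H10 H10_H1 H1_L2E)

lemma mb_H1_time: "mb \<in> H1_time T (L2E G)"
  unfolding mb_def[abs_def] by (rule H1_time_linear[OF bounded_linear_corr_M corr_M_L2E r])

lemma h_RD: "t \<in> {0..T} \<Longrightarrow> h t \<in> RD G"
  using h by (auto simp: H1_time_def C_time_def)

lemma h_continuous: "continuous_on {0..T} h" and r_continuous: "continuous_on {0..T} r"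
  using h r by (auto simp: H1_time_def C_time_def)

lemma time_deriv_h: "sq_integrable MT (time_deriv T h)" "AE t in MT. time_deriv T h t \<in> RD G"
  using time_deriv_L2[OF h] by (auto simp: L2_time_def)

lemma lift_L2E: "lift y \<in> L2E G" and K_lift_L2E: "K_lift y \<in> L2E G"
  using H1_L2E[OF lift_H1] op_K_L2E[OF lift_H1] by (auto simp: op_K_lift)

text \<open>The inhomogeneity with \<open>lift\<close> in place of \<open>Bm\<close>. The two agree
  where h and its derivative lie in \<open>RD G\<close>; square integrability is visible only for
  this version, since nothing is known about \<open>Bm\<close> elsewhere.\<close>

definition F' :: "real \<Rightarrow> 'e l2e \<times> 'e l2e"
  where "F' t = ((1 / sqrt \<epsilon>) *\<^sub>R (g t - time_deriv T pb t - mult G a (lift (h t)) - lift (time_deriv T h t)),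
    (1 / \<epsilon>) *\<^sub>R (f t - K_lift (h t)) - time_deriv T mb t)"

lemma F_F': "AE t in MT. F t = F' t"
proof -
  have "AE t in MT. t \<in> {0..T}" using AE_space[of MT] by simp
  with time_deriv_h(2) show ?thesis
    by eventually_elim (simp add: F_def F'_def Bm_lift h_RD op_K_lift)
qed

lemma sq_integrable_lift_h:
  "sq_integrable MT (\<lambda>t. lift (h t))" "sq_integrable MT (\<lambda>t. K_lift (h t))" "sq_integrable MT (\<lambda>t. lift (time_deriv T h t))"
  by (intro sq_integrable_linear[OF _ bounded_linear_lift] sq_integrable_linear[OF _ bounded_linear_K_lift]
      sq_integrable_continuous_banach h_continuous time_deriv_h)+

lemma sq_integrable_minus_banach: "sq_integrable M u \<Longrightarrow> sq_integrable M v \<Longrightarrow> sq_integrable M (\<lambda>x. u x - v x)"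
  for u v :: "'z \<Rightarrow> 'y::{banach, second_countable_topology}"
  using sq_integrable_plus[of M u "\<lambda>x. - v x"] sq_integrable_linear[of M v uminus]
  by (simp add: bounded_linear_minus bounded_linear_ident)

lemma sq_integrable_F: "sq_integrable MT F"
proof (rule sq_integrable_cong_AE)
  have "sq_integrable MT g" "sq_integrable MT f" "sq_integrable MT (time_deriv T pb)" "sq_integrable MT (time_deriv T mb)"
    using f g time_deriv_L2[OF pb_H1_time] time_deriv_L2[OF mb_H1_time] by (auto simp: L2_time_def)
  then show "sq_integrable MT F'"
    unfolding F'_def[abs_def]
    by (intro sq_integrable_Pair sq_integrable_linear[OF _ bounded_linear_scaleR_right] sq_integrable_minus_banach
        sq_integrable_linear[OF _ bounded_linear_mult[OF a]] sq_integrable_lift_h)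
  show "AE t in MT. F' t = F t" using F_F' by eventually_elim simp
qed

lemma integrable_F: "integrable MT F"
  by (rule sq_integrable_imp_integrable_on[OF sq_integrable_F])

lemma F_in: "AE t in MT. F t \<in> L2E G \<times> L2E G"
proof -
  have "AE t in MT. g t \<in> L2E G" "AE t in MT. f t \<in> L2E G" "AE t in MT. time_deriv T pb t \<in> L2E G"
    "AE t in MT. time_deriv T mb t \<in> L2E G"
    using f g time_deriv_L2[OF pb_H1_time] time_deriv_L2[OF mb_H1_time] by (auto simp: L2_time_def)
  with F_F' show ?thesis
  proof eventually_elim
    case (elim t)
    then show ?case
      by (auto simp: F'_def mult_a_in lift_L2E K_lift_L2E intro!: subspace_diff[OF subspace_L2E] subspace_scale[OF subspace_L2E])
  qed
qed

lemma x0_in: "x0 \<in> L2E G \<times> L2E G"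
  using T h_RD[of 0] p0 m0 corr_M_L2E H1_L2E[OF H10_H1[OF corr_P_H10]]
  by (auto simp: x0_def pb_def mb_def Bm_lift lift_L2E intro!: subspace_diff[OF subspace_L2E] subspace_scale[OF subspace_L2E])

lemmas U_iff = mild_solution_iff[OF integrable_F F_in x0_in, folded U_def]

lemma U_continuous: "continuous_on {0..T} U"
  unfolding U_def[abs_def] by (rule mild_continuous[OF integrable_F F_in x0_in])

lemma U_in: "t \<in> {0..T} \<Longrightarrow> U t \<in> L2E G \<times> L2E G"
  unfolding U_def by (rule mild_in_X[OF integrable_F F_in x0_in])

lemma U_eq_iff: "((1 / sqrt \<epsilon>) *\<^sub>R (p - pb t - Bm (h t)), m - mb t) = U t \<longleftrightarrow> p = psol t \<and> m = msol t"
proof -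
  have "(1 / sqrt \<epsilon>) *\<^sub>R (p - pb t - Bm (h t)) = fst (U t) \<longleftrightarrow> p - pb t - Bm (h t) = sqrt \<epsilon> *\<^sub>R fst (U t)"
    using \<epsilon> by (auto simp: field_simps dest: arg_cong[where f = "\<lambda>x. sqrt \<epsilon> *\<^sub>R x"])
  then show ?thesis by (auto simp: prod_eq_iff psol_def msol_def algebra_simps)
qed

lemma mild_solution_pm_iff:
  "mild_solution_pm G a d \<epsilon> T Bm f g h r p0 m0 p m \<longleftrightarrow> (\<forall>t\<in>{0..T}. p t = psol t \<and> m t = msol t)"
proof
  assume "mild_solution_pm G a d \<epsilon> T Bm f g h r p0 m0 p m"
  then obtain pb' mb' lb' where c: "corrector G a d T r pb' mb' lb'" and
    s: "semigroup_mild_solution T (L2E G \<times> L2E G) (dom_A G) gen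
        (\<lambda>t. ((1 / sqrt \<epsilon>) *\<^sub>R (g t - time_deriv T pb' t - mult G a (Bm (h t)) - Bm (time_deriv T h t)),
               (1 / \<epsilon>) *\<^sub>R (f t - op_K G (Bm (h t))) - time_deriv T mb' t))
        ((1 / sqrt \<epsilon>) *\<^sub>R (p0 - pb' 0 - Bm (h 0)), m0 - mb' 0)
        (\<lambda>t. ((1 / sqrt \<epsilon>) *\<^sub>R (p t - pb' t - Bm (h t)), m t - mb' t))"
    unfolding mild_solution_pm_def gen_def[abs_def] by blast
  have eq: "pb' t = pb t" "mb' t = mb t" if "t \<in> {0..T}" for t
    using corrector_unique[OF c that] by (simp_all add: pb_def mb_def)
  \<comment> \<open>The representative chosen by \<open>time_deriv\<close> depends on the values on
    [0, T] only, so these are equalities of functions and not merely almost everywhere.\<close>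
  then have "time_deriv T pb' = time_deriv T pb" "time_deriv T mb' = time_deriv T mb"
    by (auto intro: time_deriv_cong)
  then have "semigroup_mild_solution T (L2E G \<times> L2E G) (dom_A G) gen F x0
      (\<lambda>t. ((1 / sqrt \<epsilon>) *\<^sub>R (p t - pb' t - Bm (h t)), m t - mb' t))"
    using s eq[of 0] T by (simp add: F_def[abs_def] x0_def)
  then have "\<forall>t\<in>{0..T}. ((1 / sqrt \<epsilon>) *\<^sub>R (p t - pb' t - Bm (h t)), m t - mb' t) = U t"
    by (simp only: U_iff)
  then show "\<forall>t\<in>{0..T}. p t = psol t \<and> m t = msol t"
    using eq U_eq_iff by auto
next
  assume "\<forall>t\<in>{0..T}. p t = psol t \<and> m t = msol t"
  then have "semigroup_mild_solution T (L2E G \<times> L2E G) (dom_A G) gen F x0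
      (\<lambda>t. ((1 / sqrt \<epsilon>) *\<^sub>R (p t - pb t - Bm (h t)), m t - mb t))"
    unfolding U_iff using U_eq_iff by blast
  then show "mild_solution_pm G a d \<epsilon> T Bm f g h r p0 m0 p m"
    unfolding mild_solution_pm_def
    using corrector_corr[OF r] by (intro exI[of _ pb] exI[of _ mb] exI[of _ "\<lambda>t. corr_L (r t)"])
      (simp add: F_def[abs_def] x0_def pb_def[abs_def] mb_def[abs_def] gen_def[abs_def])
qed

lemma psol_C_time: "psol \<in> C_time T (L2E G)" and msol_C_time: "msol \<in> C_time T (L2E G)"
proof -
  have c: "continuous_on {0..T} pb" "continuous_on {0..T} mb"
    using pb_H1_time mb_H1_time by (auto simp: H1_time_def C_time_def)
  have "continuous_on {0..T} (\<lambda>t. pb t + lift (h t) + sqrt \<epsilon> *\<^sub>R fst (U t))"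
    by (intro continuous_intros c U_continuous continuous_on_compose2[OF linear_continuous_on[OF bounded_linear_lift, of UNIV] h_continuous]) auto
  then have "continuous_on {0..T} psol"
    by (rule continuous_on_cong[THEN iffD1, rotated 2]) (simp_all add: psol_def Bm_lift h_RD)
  moreover have "psol t \<in> L2E G" if "t \<in> {0..T}" for t
    using U_in[OF that] that H1_L2E[OF H10_H1[OF corr_P_H10]]
    by (auto simp: psol_def Bm_lift h_RD lift_L2E pb_def intro!: subspace_add[OF subspace_L2E] subspace_scale[OF subspace_L2E])
  ultimately show "psol \<in> C_time T (L2E G)" by (auto simp: C_time_def)
  have "continuous_on {0..T} msol"
    unfolding msol_def[abs_def] by (intro continuous_intros c U_continuous)
  moreover have "msol t \<in> L2E G" if "t \<in> {0..T}" for t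
    using U_in[OF that] corr_M_L2E by (auto simp: msol_def mb_def intro!: subspace_add[OF subspace_L2E])
  ultimately show "msol \<in> C_time T (L2E G)" by (auto simp: C_time_def)
qed

lemma psol_continuous: "continuous_on {0..T} psol" and msol_continuous: "continuous_on {0..T} msol"
  using psol_C_time msol_C_time by (auto simp: C_time_def)

section \<open>The weak form of the first equation\<close>

definition J :: "'e l2e \<times> 'e l2e \<times> (real ^ 'v) \<Rightarrow> 'e functional"
  where "J x q = inner (fst x) q + inner (op_K G q) (fst (snd x)) - inner (snd (snd x)) (op_C G q)"

text \<open>Collects the data so that J (w t) is the first equation solved for the time derivative
  of p plus the boundary term of the multiplier. With values in a Banach space type, w fits
  \<open>L2_time_dual_linear\<close>.\<close>

definition w :: "real \<Rightarrow> 'e l2e \<times> 'e l2e \<times> (real ^ 'v)"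
  where "w t = (g t - mult G a (psol t), msol t, r t)"

lemma J_w: "J (w t) q = inner (g t) q - inner (mult G a (psol t)) q + inner (op_K G q) (msol t) - inner (r t) (op_C G q)"
  by (simp add: J_def w_def inner_diff_left)

lemma sq_integrable_w: "sq_integrable MT w"
proof -
  have "sq_integrable MT g" using g by (simp add: L2_time_def)
  moreover have "sq_integrable MT psol" "sq_integrable MT msol" "sq_integrable MT r"
    by (intro sq_integrable_continuous_banach psol_continuous msol_continuous r_continuous)+
  ultimately show ?thesis
    unfolding w_def[abs_def]
    by (intro sq_integrable_Pair sq_integrable_minus_banach sq_integrable_linear[OF _ bounded_linear_mult[OF a]])
qed

lemma bounded_linear_J: "bounded_linear (\<lambda>x. J x q)"
  unfolding J_def
  by (intro bounded_linear_add bounded_linear_sub bounded_linear_compose[OF bounded_linear_inner_left]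
      bounded_linear_compose[OF bounded_linear_inner_right] bounded_linear_fst bounded_linear_snd
      bounded_linear_compose[OF bounded_linear_fst] bounded_linear_compose[OF bounded_linear_snd])

lemma integrable_J_w: "integrable MT (\<lambda>t. J (w t) q)"
  by (rule integrable_bounded_linear[OF bounded_linear_J sq_integrable_imp_integrable_on[OF sq_integrable_w]])

lemma integrable_psol: "integrable MT (\<lambda>t. inner (psol t) q)"
  by (intro continuous_imp_integrable_real continuous_intros psol_continuous)

lemma J_add: "q \<in> H1 G \<Longrightarrow> q' \<in> H1 G \<Longrightarrow> J x (q + q') = J x q + J x q'"
  by (simp add: J_def H1_add op_C_add inner_add_left inner_add_right)

lemma J_scale: "q \<in> H1 G \<Longrightarrow> J x (c *\<^sub>R q) = c * J x q"
  by (simp add: J_def H1_scale op_C_scale algebra_simps)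

lemma J_w_L2_time_dual:
  assumes "V = H1 G \<or> V = H10 G"
  shows "(\<lambda>t. J (w t)) \<in> L2_time_dual G T V"
proof -
  obtain C where C: "\<And>z. norm (trc z) \<le> norm z * C" "0 < C"
    using bounded_linear.pos_bounded[OF bounded_linear_trc] by blast
  have V: "V \<subseteq> H1 G" using assms by (auto simp: H10_H1)
  show ?thesis
  \<comment> \<open>The two inner products contribute 1 each and the point evaluations contribute
    the bound C of \<open>trc\<close>.\<close>
  proof (rule L2_time_dual_linear[where J = J and C = "2 + C", OF assms _ _ _ _ _ sq_integrable_w])
    show "J x (q + q') = J x q + J x q'" if "q \<in> V" "q' \<in> V" for x q q' using that V by (auto intro: J_add)
    show "J x (c *\<^sub>R q) = c * J x q" if "q \<in> V" for x c q using that V by (auto intro: J_scale)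
    show "J (x - y) q = J x q - J y q" for x y q
      by (rule linear_diff[OF bounded_linear.linear[OF bounded_linear_J]])
    show "0 \<le> 2 + C" using C by simp
    fix x :: "'e l2e \<times> 'e l2e \<times> (real ^ 'v)" and q assume "q \<in> V"
    then have q: "q \<in> H1 G" using V by blast
    have n: "norm (fst x) \<le> norm x" "norm (fst (snd x)) \<le> norm x" "norm (snd (snd x)) \<le> norm x"
      using norm_fst_le[of "fst x" "snd x"] norm_snd_le[of "snd x" "fst x"] norm_fst_le[of "fst (snd x)" "snd (snd x)"]
        norm_snd_le[of "snd (snd x)" "fst (snd x)"] by simp_all
    have nq: "norm q \<le> h1_norm G q" "norm (op_K G q) \<le> h1_norm G q"
      unfolding h1_norm_eq using norm_fst_le[of q "op_K G q"] norm_snd_le[of "op_K G q" q] by auto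
    have "norm (op_C G q) \<le> norm (vertex_trace G q)"
      unfolding norm_vec_def by (intro L2_set_mono) (auto simp: op_C_def)
    also have "\<dots> \<le> C * h1_norm G q"
      unfolding vertex_trace_trc[OF q] h1_norm_eq using C(1) by (simp add: mult.commute)
    finally have nC: "norm (op_C G q) \<le> C * h1_norm G q" .
    have *: "\<bar>inner y z\<bar> \<le> A * B" if "norm y \<le> A" "norm z \<le> B" for A B and y z :: "'x::real_inner"
      using Cauchy_Schwarz_ineq2[of y z] mult_mono[OF that] order.trans[OF norm_ge_zero that(1)] by simp
    have "\<bar>J x q\<bar> \<le> \<bar>inner (fst x) q\<bar> + \<bar>inner (op_K G q) (fst (snd x))\<bar> + \<bar>inner (snd (snd x)) (op_C G q)\<bar>"
      unfolding J_def by linarith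
    also have "\<dots> \<le> norm x * h1_norm G q + h1_norm G q * norm x + norm x * (C * h1_norm G q)"
      by (intro add_mono * n nq nC)
    also have "\<dots> = (2 + C) * norm x * h1_norm G q" by (simp add: algebra_simps)
    finally show "\<bar>J x q\<bar> \<le> (2 + C) * norm x * h1_norm G q" .
  qed
qed

lemma emb_psol_L2_time_dual: "(\<lambda>t. emb (psol t)) \<in> L2_time_dual G T (H10 G)"
proof (rule L2_time_dual_linear)
  show "sq_integrable MT psol" by (intro sq_integrable_continuous_banach psol_continuous)
  show "\<bar>emb x q\<bar> \<le> 1 * norm x * h1_norm G q" for x q
  proof -
    have "\<bar>inner x q\<bar> \<le> norm x * norm q" by (rule Cauchy_Schwarz_ineq2)
    also have "\<dots> \<le> norm x * h1_norm G q"
      unfolding h1_norm_eq using norm_fst_le[of q "op_K G q"] by (intro mult_left_mono) auto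
    finally show ?thesis by (simp add: emb_def)
  qed
qed (auto simp: emb_def inner_add_right inner_diff_left)

text \<open>For \<open>q\<close> in \<open>H\<^sup>1\<^sub>0\<close> the vector \<open>(q, 0)\<close> lies in the domain of the adjoint of the generator.\<close>

lemma weak_H10:
  assumes \<phi>: "test_function 0 T \<phi>" and q: "q \<in> H10 G"
  shows "(LINT t|MT. deriv \<phi> t * inner (psol t) q) = - (LINT t|MT. \<phi> t * J (w t) q)"
proof -
  let ?z = "(- mult G a q, (1 / sqrt \<epsilon>) *\<^sub>R op_K G q)"
  have zX: "?z \<in> L2E G \<times> L2E G"
    using q by (auto simp: mult_a_in op_K_L2E H10_H1 intro!: subspace_neg[OF subspace_L2E] subspace_scale[OF subspace_L2E])
  \<comment> \<open>The adjoint relation is needed for the extended generator; it carries over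
    because the vector on the right lies in the range of P.\<close>
  have yz: "inner (gen (P x)) (q, 0) = inner x ?z" if "x \<in> {x. P x \<in> dom_A G}" for x
  proof -
    obtain p' m' where pm: "P x = (p', m')" by (cases "P x")
    have "inner (gen (P x)) (q, 0) = inner (P x) ?z"
      using that inner_gen[OF _ q, of p' m'] by (simp add: pm)
    also have "\<dots> = inner x ?z" using P_id[OF zX] by (simp add: P_sym)
    finally show ?thesis .
  qed
  have A: "(LINT t|MT. deriv \<phi> t * inner (U t) (q, 0)) = - (LINT t|MT. \<phi> t * (inner (U t) ?z + inner (F t) (q, 0)))"
    unfolding U_def using T test_function_zero[OF \<phi>]
    by (intro mild_parts[OF test_function_DERIV[OF \<phi>] test_function_deriv_continuous[OF \<phi>] _ _ yz integrable_F]) auto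
  have B: "(LINT t|MT. deriv \<phi> t * inner (pb t) q) = - (LINT t|MT. \<phi> t * inner (time_deriv T pb t) q)"
    by (rule weak_derivative_inner[OF pb_H1_time \<phi> bounded_linear_inner_left])
  have C: "(LINT t|MT. deriv \<phi> t * inner (lift (h t)) q) = - (LINT t|MT. \<phi> t * inner (lift (time_deriv T h t)) q)"
    by (rule weak_derivative_inner[OF h \<phi> bounded_linear_compose[OF bounded_linear_inner_left bounded_linear_lift]])
  have iU: "integrable MT U" by (intro sq_integrable_imp_integrable_on sq_integrable_continuous_banach U_continuous)
  have ipb: "integrable MT pb" by (rule H1_time_integrable[OF pb_H1_time])
  have ipb': "integrable MT (time_deriv T pb)" by (rule L2_time_integrable[OF time_deriv_L2[OF pb_H1_time]])
  have ih: "integrable MT (\<lambda>t. lift (h t))" "integrable MT (\<lambda>t. lift (time_deriv T h t))"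
    by (intro sq_integrable_imp_integrable_on sq_integrable_lift_h)+
  note tf1 = test_function_integrable(1)[OF \<phi>, where 'x = real, simplified]
    and tf2 = test_function_integrable(2)[OF \<phi>, where 'x = real, simplified]
  have i1: "integrable MT (\<lambda>t. deriv \<phi> t * inner (pb t) q)" "integrable MT (\<lambda>t. deriv \<phi> t * inner (lift (h t)) q)"
    "integrable MT (\<lambda>t. deriv \<phi> t * inner (U t) (q, 0))"
    by (intro tf2 integrable_inner_left ipb ih iU)+
  have i2: "integrable MT (\<lambda>t. \<phi> t * inner (time_deriv T pb t) q)" "integrable MT (\<lambda>t. \<phi> t * inner (lift (time_deriv T h t)) q)"
    "integrable MT (\<lambda>t. \<phi> t * (inner (U t) ?z + inner (F t) (q, 0)))"
    by (intro tf1 Bochner_Integration.integrable_add integrable_inner_left ipb' ih iU integrable_F)+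
  have "(LINT t|MT. deriv \<phi> t * inner (psol t) q) =
    (LINT t|MT. deriv \<phi> t * inner (pb t) q + deriv \<phi> t * inner (lift (h t)) q + sqrt \<epsilon> * (deriv \<phi> t * inner (U t) (q, 0)))"
    by (intro Bochner_Integration.integral_cong)
      (simp_all add: psol_def Bm_lift h_RD inner_add_left inner_prod_def algebra_simps)
  also have "\<dots> = (LINT t|MT. deriv \<phi> t * inner (pb t) q) + (LINT t|MT. deriv \<phi> t * inner (lift (h t)) q) +
      sqrt \<epsilon> * (LINT t|MT. deriv \<phi> t * inner (U t) (q, 0))"
    using i1 by simp
  also have "\<dots> = - ((LINT t|MT. \<phi> t * inner (time_deriv T pb t) q) + (LINT t|MT. \<phi> t * inner (lift (time_deriv T h t)) q) +
      sqrt \<epsilon> * (LINT t|MT. \<phi> t * (inner (U t) ?z + inner (F t) (q, 0))))"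
    unfolding A B C by simp
  also have "\<dots> = - (LINT t|MT. \<phi> t * inner (time_deriv T pb t) q + \<phi> t * inner (lift (time_deriv T h t)) q +
      sqrt \<epsilon> * (\<phi> t * (inner (U t) ?z + inner (F t) (q, 0))))"
    using i2 by simp
  also have "(LINT t|MT. \<phi> t * inner (time_deriv T pb t) q + \<phi> t * inner (lift (time_deriv T h t)) q +
      sqrt \<epsilon> * (\<phi> t * (inner (U t) ?z + inner (F t) (q, 0)))) = (LINT t|MT. \<phi> t * J (w t) q)"
  proof (rule integral_cong_AE)
    have "AE t in MT. t \<in> {0..T}" using AE_space[of MT] by simp
    with F_F' show "AE t in MT. \<phi> t * inner (time_deriv T pb t) q + \<phi> t * inner (lift (time_deriv T h t)) q +
      sqrt \<epsilon> * (\<phi> t * (inner (U t) ?z + inner (F t) (q, 0))) = \<phi> t * J (w t) q"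
    proof eventually_elim
      case (elim t)
      have u1: "sqrt \<epsilon> *\<^sub>R fst (U t) = psol t - pb t - lift (h t)" and u2: "snd (U t) = msol t - mb t"
        using elim by (simp_all add: psol_def msol_def Bm_lift h_RD)
      have "sqrt \<epsilon> * inner (U t) ?z = - inner (sqrt \<epsilon> *\<^sub>R fst (U t)) (mult G a q) + inner (snd (U t)) (op_K G q)"
        using \<epsilon> by (simp add: inner_prod_def right_diff_distrib)
      also have "\<dots> = - inner (mult G a (psol t)) q + inner (mult G a (pb t)) q + inner (mult G a (lift (h t))) q
          + inner (op_K G q) (msol t) - inner (op_K G q) (mb t)"
        unfolding u1 u2 by (simp add: inner_diff_left mult_sym[OF a] inner_commute[of "op_K G q"])
      \<comment> \<open>The stationary equation for \<open>pb\<close> and \<open>mb\<close>, tested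
        with q, trades their terms for the point evaluations in \<open>op_C\<close>.\<close>
      also have "\<dots> = - inner (mult G a (psol t)) q + inner (mult G a (lift (h t))) q + inner (op_K G q) (msol t) - inner (r t) (op_C G q)"
        using corr_weak[OF q, of "r t"] by (simp add: pb_def mb_def)
      finally have eU: "sqrt \<epsilon> * inner (U t) ?z = \<dots>" .
      have eF: "sqrt \<epsilon> * inner (F t) (q, 0) = inner (g t) q - inner (time_deriv T pb t) q - inner (mult G a (lift (h t))) q
          - inner (lift (time_deriv T h t)) q"
        using \<epsilon> elim(1) by (simp add: F'_def inner_diff_left)
      have "inner (time_deriv T pb t) q + inner (lift (time_deriv T h t)) q + (sqrt \<epsilon> * inner (U t) ?z + sqrt \<epsilon> * inner (F t) (q, 0)) = J (w t) q"
        unfolding eU eF J_w by simp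
      moreover have "x * \<alpha> + x * \<beta> + s * (x * (u + v)) = x * j" if "\<alpha> + \<beta> + (s * u + s * v) = j" for \<alpha> \<beta> s u v j x :: real
        unfolding that[symmetric] by (simp add: algebra_simps)
      ultimately show ?case by blast
    qed
    show "(\<lambda>t. \<phi> t * J (w t) q) \<in> borel_measurable MT"
      using tf1[OF integrable_J_w] by simp
    show "(\<lambda>t. \<phi> t * inner (time_deriv T pb t) q + \<phi> t * inner (lift (time_deriv T h t)) q +
      sqrt \<epsilon> * (\<phi> t * (inner (U t) ?z + inner (F t) (q, 0)))) \<in> borel_measurable MT"
      using i2 by (intro borel_measurable_add borel_measurable_times[OF borel_measurable_const]) (auto dest: borel_measurable_integrable)
  qed
  finally show ?thesis .
qed

section \<open>The multiplier and its primitive\<close>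

definition defect :: "(real \<Rightarrow> real) \<Rightarrow> 'e functional"
  where "defect \<phi> q = (LINT t|MT. deriv \<phi> t * inner (psol t) q) + (LINT t|MT. \<phi> t * J (w t) q)"

text \<open>By the first equation \<open>defect\<close> must be the pairing of the multiplier with
  the boundary values of q, and the lifting \<open>bdl v\<close> has the unit vector at v as
  boundary values.\<close>

definition lam :: "(real \<Rightarrow> real) \<Rightarrow> real ^ 'v"
  where "lam \<phi> = (\<chi> v. if v \<in> boundary G then defect \<phi> (bdl v) else 0)"

context
  fixes \<phi> assumes \<phi>: "test_function 0 T \<phi>"
begin

lemma integrable_test: "integrable MT u \<Longrightarrow> integrable MT (\<lambda>t. \<phi> t * (u t :: real))"
  and integrable_test_deriv: "integrable MT u \<Longrightarrow> integrable MT (\<lambda>t. deriv \<phi> t * (u t :: real))"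
  using test_function_integrable[OF \<phi>, where 'x = real] by simp_all

lemma defect_boundary:
  assumes "q \<in> H1 G"
  shows "defect \<phi> q = inner (lam \<phi>) (op_B G q)"
  unfolding lam_def
proof (rule functional_boundary[OF _ _ _ assms])
  note i = integrable_test[OF integrable_J_w] integrable_test_deriv[OF integrable_psol]
  show "defect \<phi> (q + q') = defect \<phi> q + defect \<phi> q'" if "q \<in> H1 G" "q' \<in> H1 G" for q q'
    using i that by (simp add: defect_def J_add inner_add_right distrib_left)
  show "defect \<phi> (c *\<^sub>R q) = c * defect \<phi> q" if "q \<in> H1 G" for c q
    using that by (simp add: defect_def J_scale distrib_left mult.left_commute[of _ c])
  show "defect \<phi> q = 0" if "q \<in> H10 G" for q
    using weak_H10[OF \<phi> that] by (simp add: defect_def)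
qed

end

lemma lam_equation:
  "dist_eq T (H1 G)
    (\<lambda>\<phi> q. dist_deriv (regular T (\<lambda>t. emb (psol t))) \<phi> q + B_adj G (lam \<phi>) q) (regular T (\<lambda>t. J (w t)))"
  unfolding dist_eq_def
proof (intro allI impI ballI)
  fix \<phi> q assume \<phi>: "test_function 0 T \<phi>" and q: "q \<in> H1 G"
  show "dist_deriv (regular T (\<lambda>t. emb (psol t))) \<phi> q + B_adj G (lam \<phi>) q = regular T (\<lambda>t. J (w t)) \<phi> q"
    using defect_boundary[OF \<phi> q] by (simp add: dist_deriv_def regular_def emb_def B_adj_def defect_def)
qed

text \<open>Serves both ways: with y = \<open>lam \<phi>\<close> it shows that the equation holds,
  and for any other multiplier it determines the boundary pairings.\<close>

lemma system_equation_iff: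
  assumes eq: "\<And>t. t \<in> {0..T} \<Longrightarrow> p t = psol t \<and> m t = msol t" and \<phi>: "test_function 0 T \<phi>" and q: "q \<in> H1 G"
  shows "dist_deriv (regular T (\<lambda>t. emb (p t))) \<phi> q + regular T (\<lambda>t q. emb (mult G a (p t)) q - K_adj G (m t) q) \<phi> q
     + B_adj G y q = regular T (\<lambda>t q. emb (g t) q - C_adj G (r t) q) \<phi> q \<longleftrightarrow> inner y (op_B G q) = inner (lam \<phi>) (op_B G q)"
proof -
  let ?S = "\<lambda>t. inner (mult G a (psol t)) q - inner (op_K G q) (msol t)"
  have iS: "integrable MT ?S"
    by (intro continuous_imp_integrable_real continuous_intros msol_continuous
        continuous_on_compose2[OF linear_continuous_on[OF bounded_linear_mult[OF a], of UNIV] psol_continuous]) auto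
  have 1: "dist_deriv (regular T (\<lambda>t. emb (p t))) \<phi> q = - (LINT t|MT. deriv \<phi> t * inner (psol t) q)"
    unfolding dist_deriv_def regular_def
    by (intro arg_cong[where f = uminus] Bochner_Integration.integral_cong) (simp_all add: emb_def eq)
  have 2: "regular T (\<lambda>t q. emb (mult G a (p t)) q - K_adj G (m t) q) \<phi> q = (LINT t|MT. \<phi> t * ?S t)"
    unfolding regular_def by (intro Bochner_Integration.integral_cong) (simp_all add: emb_def K_adj_def eq)
  have "regular T (\<lambda>t q. emb (g t) q - C_adj G (r t) q) \<phi> q = (LINT t|MT. \<phi> t * J (w t) q + \<phi> t * ?S t)"
    unfolding regular_def
    by (intro Bochner_Integration.integral_cong) (simp_all add: emb_def C_adj_def J_w algebra_simps)
  also have "\<dots> = (LINT t|MT. \<phi> t * J (w t) q) + (LINT t|MT. \<phi> t * ?S t)"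
    using integrable_test[OF \<phi> integrable_J_w] integrable_test[OF \<phi> iS] by simp
  finally have 3: "regular T (\<lambda>t q. emb (g t) q - C_adj G (r t) q) \<phi> q = \<dots>" .
  show ?thesis
    unfolding 1 2 3 using defect_boundary[OF \<phi> q] by (auto simp: B_adj_def defect_def)
qed

lemma lam_RD: "lam \<phi> \<in> RD G"
  by (simp add: lam_def RD_def)

lemma abs_integral_test_le:
  fixes \<phi> u :: "real \<Rightarrow> real"
  assumes "integrable MT u" "\<And>t. \<bar>\<phi> t\<bar> \<le> S" and i: "integrable MT (\<lambda>t. \<phi> t * u t)"
  shows "\<bar>LINT t|MT. \<phi> t * u t\<bar> \<le> S * (LINT t|MT. \<bar>u t\<bar>)"
proof -
  have "\<bar>LINT t|MT. \<phi> t * u t\<bar> \<le> (LINT t|MT. \<bar>\<phi> t * u t\<bar>)" by (rule integral_abs_bound)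
  also have "\<dots> \<le> (LINT t|MT. S * \<bar>u t\<bar>)"
    using assms(2)
    by (intro integral_mono integrable_abs i integrable_mult_right assms(1)) (auto simp: abs_mult intro: mult_right_mono)
  finally show ?thesis by simp
qed

lemma lam_distribution: "distribution T (RD G) lam"
  unfolding distribution_def
proof (intro conjI allI impI)
  show "lam \<phi> \<in> RD G" for \<phi> by (rule lam_RD)
  fix \<phi> \<psi> assume \<phi>: "test_function 0 T \<phi>" and \<psi>: "test_function 0 T \<psi>"
  have d: "deriv (\<lambda>t. \<phi> t + \<psi> t) = (\<lambda>t. deriv \<phi> t + deriv \<psi> t)"
    using deriv_test_function_linear[OF \<phi> \<psi>, of 1] by simp
  have "defect (\<lambda>t. \<phi> t + \<psi> t) q = defect \<phi> q + defect \<psi> q" for q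
    unfolding defect_def d
    using integrable_test[OF \<phi> integrable_J_w[of q]] integrable_test[OF \<psi> integrable_J_w[of q]]
      integrable_test_deriv[OF \<phi> integrable_psol[of q]] integrable_test_deriv[OF \<psi> integrable_psol[of q]]
    by (simp add: distrib_right)
  then show "lam (\<lambda>t. \<phi> t + \<psi> t) = lam \<phi> + lam \<psi>" by (simp add: lam_def vec_eq_iff)
next
  fix c \<phi> assume \<phi>: "test_function 0 T \<phi>"
  have "deriv (\<lambda>t. c * \<phi> t) = (\<lambda>t. c * deriv \<phi> t)"
    by (intro ext DERIV_imp_deriv DERIV_cmult test_function_DERIV[OF \<phi>])
  then have "defect (\<lambda>t. c * \<phi> t) q = c * defect \<phi> q" for q
    by (simp add: defect_def mult.assoc distrib_left)
  then show "lam (\<lambda>t. c * \<phi> t) = c *\<^sub>R lam \<phi>" by (simp add: lam_def vec_eq_iff)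
next
  \<comment> \<open>The defect involves only \<phi> and its first derivative, each integrated
    against a fixed integrable function. Hence the order is at most 1, with a constant independent
    of the support.\<close>
  define C where "C = (\<Sum>v\<in>UNIV. (LINT t|MT. \<bar>inner (psol t) (bdl v)\<bar>) + (LINT t|MT. \<bar>J (w t) (bdl v)\<bar>))"
  have "norm (lam \<phi>) \<le> C * (\<Sum>j\<le>1. SUP t. \<bar>(deriv ^^ j) \<phi> t\<bar>)" if \<phi>: "test_function 0 T \<phi>" for \<phi>
  proof -
    define S0 where "S0 = (SUP t. \<bar>\<phi> t\<bar>)"
    define S1 where "S1 = (SUP t. \<bar>deriv \<phi> t\<bar>)"
    have b: "bdd_above (range (\<lambda>t. \<bar>\<phi> t\<bar>))" "bdd_above (range (\<lambda>t. \<bar>deriv \<phi> t\<bar>))"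
      using test_function_bounded[OF \<phi>] test_function_bounded[OF test_function_deriv[OF \<phi>]]
      by (auto simp: bdd_above_def)
    have S: "\<bar>\<phi> t\<bar> \<le> S0" "\<bar>deriv \<phi> t\<bar> \<le> S1" for t
      unfolding S0_def S1_def by (intro cSUP_upper b UNIV_I)+
    have S_nonneg: "0 \<le> S0" "0 \<le> S1" using S[of 0] by linarith+
    have comp: "\<bar>lam \<phi> $ v\<bar> \<le> ((LINT t|MT. \<bar>inner (psol t) (bdl v)\<bar>) + (LINT t|MT. \<bar>J (w t) (bdl v)\<bar>)) * (S0 + S1)" for v
    proof -
      let ?A = "LINT t|MT. \<bar>inner (psol t) (bdl v)\<bar>" and ?B = "LINT t|MT. \<bar>J (w t) (bdl v)\<bar>"
      have AB: "0 \<le> ?A" "0 \<le> ?B" by (intro integral_nonneg_AE AE_I2 abs_ge_zero)+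
      have "\<bar>lam \<phi> $ v\<bar> \<le> \<bar>defect \<phi> (bdl v)\<bar>" by (simp add: lam_def)
      also have "\<dots> \<le> S1 * ?A + S0 * ?B"
        unfolding defect_def
        by (intro order.trans[OF abs_triangle_ineq] add_mono abs_integral_test_le S integrable_psol integrable_J_w
            integrable_test[OF \<phi>] integrable_test_deriv[OF \<phi>])
      also have "\<dots> \<le> (S0 + S1) * ?A + (S0 + S1) * ?B"
        using AB S_nonneg by (intro add_mono mult_right_mono) auto
      finally show ?thesis by (simp add: algebra_simps)
    qed
    have "norm (lam \<phi>) \<le> (\<Sum>v\<in>UNIV. \<bar>lam \<phi> $ v\<bar>)" by (rule norm_le_l1_cart)
    also have "\<dots> \<le> C * (S0 + S1)" unfolding C_def sum_distrib_right by (intro sum_mono comp)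
    finally show ?thesis by (simp add: S0_def S1_def)
  qed
  then show "\<exists>C k. \<forall>\<phi>. test_function 0 T \<phi> \<longrightarrow> (\<forall>t. \<phi> t \<noteq> 0 \<longrightarrow> t \<in> {c..d}) \<longrightarrow>
      norm (lam \<phi>) \<le> C * (\<Sum>j\<le>k. SUP t. \<bar>(deriv ^^ j) \<phi> t\<bar>)" for c d
    by blast
qed

lemma lam_primitive:
  "\<exists>\<Lambda>\<in>C_time T (RD G). \<forall>\<phi>. test_function 0 T \<phi> \<longrightarrow> lam \<phi> = - (LINT t|MT. deriv \<phi> t *\<^sub>R \<Lambda> t)"
proof -
  \<comment> \<open>Component v of the multiplier is J (w t) at \<open>bdl v\<close> minus the time
    derivative of the pairing of p with \<open>bdl v\<close>. Integrating in time leaves a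
    continuous function, although the derivative itself need not be a function.\<close>
  define \<Lambda> where "\<Lambda> t = (\<chi> v. if v \<in> boundary G then primitive (\<lambda>s. J (w s) (bdl v)) t - inner (psol t) (bdl v) else 0)" for t
  have "continuous_on {0..T} (\<lambda>t. \<Lambda> t $ v)" for v
    by (cases "v \<in> boundary G") (auto simp: \<Lambda>_def intro!: continuous_intros continuous_on_primitive integrable_J_w psol_continuous)
  then have cont: "continuous_on {0..T} \<Lambda>"
    by (subst continuous_on_componentwise) (auto simp: Basis_vec_def inner_axis)
  have "lam \<phi> = - (LINT t|MT. deriv \<phi> t *\<^sub>R \<Lambda> t)" if \<phi>: "test_function 0 T \<phi>" for \<phi>
  proof (rule vec_eq_iff[THEN iffD2], rule allI)
    fix v
    have int: "integrable MT (\<lambda>t. deriv \<phi> t *\<^sub>R \<Lambda> t)"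
      by (intro continuous_imp_integrable_real continuous_intros cont test_function_deriv_continuous[OF \<phi>])
    have comp: "(LINT t|MT. deriv \<phi> t *\<^sub>R \<Lambda> t) $ v = (LINT t|MT. deriv \<phi> t * \<Lambda> t $ v)"
      using integral_bounded_linear[OF bounded_linear_vec_nth[of v] int] by simp
    show "lam \<phi> $ v = (- (LINT t|MT. deriv \<phi> t *\<^sub>R \<Lambda> t)) $ v"
    proof (cases "v \<in> boundary G")
      case True
      let ?V = "primitive (\<lambda>s. J (w s) (bdl v))"
      have iV: "integrable MT ?V"
        by (intro continuous_imp_integrable_real continuous_on_primitive integrable_J_w)
      have "(LINT t|MT. deriv \<phi> t * \<Lambda> t $ v) = (LINT t|MT. deriv \<phi> t * ?V t - deriv \<phi> t * inner (psol t) (bdl v))"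
        using True by (simp add: \<Lambda>_def right_diff_distrib)
      also have "\<dots> = (LINT t|MT. deriv \<phi> t * ?V t) - (LINT t|MT. deriv \<phi> t * inner (psol t) (bdl v))"
        using integrable_test_deriv[OF \<phi> iV] integrable_test_deriv[OF \<phi> integrable_psol] by simp
      also have "(LINT t|MT. deriv \<phi> t * ?V t) = - (LINT t|MT. \<phi> t * J (w t) (bdl v))"
        using weak_derivative_primitive[OF integrable_J_w] T \<phi> by (simp add: weak_derivative_def)
      finally show ?thesis using True by (simp add: comp lam_def defect_def)
    next
      case False
      then have "(LINT t|MT. deriv \<phi> t * \<Lambda> t $ v) = 0" by (simp add: \<Lambda>_def)
      then show ?thesis using False by (simp add: comp lam_def)
    qed
  qed
  moreover have "\<Lambda> \<in> C_time T (RD G)" using cont by (auto simp: C_time_def RD_def \<Lambda>_def)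
  ultimately show ?thesis by blast
qed

lemma mild_solution_lam: "mild_solution G a d \<epsilon> T Bm f g h r p0 m0 psol msol lam"
  unfolding mild_solution_def dist_eq_def
proof (intro conjI allI impI ballI)
  show "mild_solution_pm G a d \<epsilon> T Bm f g h r p0 m0 psol msol" by (simp add: mild_solution_pm_iff)
  show "distribution T (RD G) lam" by (rule lam_distribution)
qed (simp add: system_equation_iff)

lemma mild_solution_unique:
  assumes "mild_solution G a d \<epsilon> T Bm f g h r p0 m0 p m lam'"
  shows "(\<forall>t\<in>{0..T}. p t = psol t \<and> m t = msol t) \<and> (\<forall>\<phi>. test_function 0 T \<phi> \<longrightarrow> lam' \<phi> = lam \<phi>)"
proof (intro conjI)
  show eq: "\<forall>t\<in>{0..T}. p t = psol t \<and> m t = msol t"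
    using assms mild_solution_pm_iff by (simp add: mild_solution_def)
  show "\<forall>\<phi>. test_function 0 T \<phi> \<longrightarrow> lam' \<phi> = lam \<phi>"
  proof (intro allI impI, rule vec_eq_iff[THEN iffD2], rule allI)
    fix \<phi> v assume \<phi>: "test_function 0 T \<phi>"
    have RD: "lam' \<phi> \<in> RD G" using assms \<phi> by (simp add: mild_solution_def distribution_def)
    show "lam' \<phi> $ v = lam \<phi> $ v"
    proof (cases "v \<in> boundary G")
      case True
      \<comment> \<open>Testing with the lifting of a unit vector isolates one component; off the
        boundary both multipliers vanish because they lie in \<open>RD G\<close>.\<close>
      have "inner (lam' \<phi>) (op_B G (bdl v)) = inner (lam \<phi>) (op_B G (bdl v))"
        using assms \<phi> bdl_H1[OF True] system_equation_iff[of p m \<phi> "bdl v" "lam' \<phi>"] eq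
        by (simp add: mild_solution_def dist_eq_def)
      then show ?thesis by (simp add: op_B_bdl[OF True] inner_axis)
    qed (use RD lam_RD in \<open>auto simp: RD_def\<close>)
  qed
qed

lemma emb_psol_H1_time_dual: "(\<lambda>t. emb (psol t)) \<in> H1_time_dual G T (H10 G)"
proof -
  have "dist_eq T (H10 G) (dist_deriv (regular T (\<lambda>t. emb (psol t)))) (regular T (\<lambda>t. J (w t)))"
    unfolding dist_eq_def using weak_H10 by (simp add: dist_deriv_def regular_def emb_def)
  then show ?thesis
    using emb_psol_L2_time_dual J_w_L2_time_dual[of "H10 G"] unfolding H1_time_dual_def by blast
qed

end

theorem lemma3p8:
  fixes G :: "('v::finite, 'e::finite) network"
    and a d :: "'e \<Rightarrow> real \<Rightarrow> real" and a_max d_min d_max :: real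
    and Bm :: "real ^ 'v \<Rightarrow> 'e l2e"
    and T \<epsilon> :: real
    and f g :: "real \<Rightarrow> 'e l2e" and h r :: "real \<Rightarrow> real ^ 'v"
    and p0 m0 :: "'e l2e"
  assumes "is_network G"
    and "\<And>e. a e \<in> borel_measurable (lebesgue_on {0..edge_length G e})"
    and "\<And>e. AE x in lebesgue_on {0..edge_length G e}. 0 \<le> a e x \<and> a e x \<le> a_max"
    and "\<And>e. d e \<in> borel_measurable (lebesgue_on {0..edge_length G e})"
    and "0 < d_min"
    and "\<And>e. AE x in lebesgue_on {0..edge_length G e}. d_min \<le> d e x \<and> d e x \<le> d_max"
    and "is_right_inverse G Bm"
    and "0 < T" and "0 < \<epsilon>"
    and "f \<in> L2_time T (L2E G)" and "g \<in> L2_time T (L2E G)"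
    and "h \<in> H1_time T (RD G)" and "r \<in> H1_time T (RN G)"
    and "p0 \<in> L2E G" and "m0 \<in> L2E G"
  shows "\<exists>p m lam.
    mild_solution G a d \<epsilon> T Bm f g h r p0 m0 p m lam \<and>
    (\<forall>p' m' lam'. mild_solution G a d \<epsilon> T Bm f g h r p0 m0 p' m' lam' \<longrightarrow>
       (\<forall>t\<in>{0..T}. p' t = p t \<and> m' t = m t) \<and>
       (\<forall>\<phi>. test_function 0 T \<phi> \<longrightarrow> lam' \<phi> = lam \<phi>)) \<and>
    p \<in> C_time T (L2E G) \<and> (\<lambda>t. emb (p t)) \<in> H1_time_dual G T (H10 G) \<and>
    m \<in> C_time T (L2E G) \<and>
    (\<exists>\<Lambda>\<in>C_time T (RD G). \<forall>\<phi>. test_function 0 T \<phi> \<longrightarrow>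
       lam \<phi> = - (LINT t|lebesgue_on {0..T}. deriv \<phi> t *\<^sub>R \<Lambda> t)) \<and>
    (\<exists>w\<in>L2_time_dual G T (H1 G). dist_eq T (H1 G)
       (\<lambda>\<phi> q. dist_deriv (regular T (\<lambda>t. emb (p t))) \<phi> q + B_adj G (lam \<phi>) q)
       (regular T w))"
proof -
  interpret telegraph_data G a d a_max d_min d_max \<epsilon> Bm T f g h r p0 m0
    by unfold_locales (use assms in \<open>auto simp: coefficient_def\<close>)
  have unique: "\<forall>p' m' lam'. mild_solution G a d \<epsilon> T Bm f g h r p0 m0 p' m' lam' \<longrightarrow>
      (\<forall>t\<in>{0..T}. p' t = psol t \<and> m' t = msol t) \<and> (\<forall>\<phi>. test_function 0 T \<phi> \<longrightarrow> lam' \<phi> = lam \<phi>)"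
    by (intro allI impI mild_solution_unique)
  have regular: "\<exists>w\<in>L2_time_dual G T (H1 G). dist_eq T (H1 G)
      (\<lambda>\<phi> q. dist_deriv (regular T (\<lambda>t. emb (psol t))) \<phi> q + B_adj G (lam \<phi>) q) (regular T w)"
    by (rule bexI[of _ "\<lambda>t. J (w t)"], rule lam_equation, rule J_w_L2_time_dual) simp
  show ?thesis
    by (rule exI[of _ psol], rule exI[of _ msol], rule exI[of _ lam])
      (intro conjI mild_solution_lam unique psol_C_time emb_psol_H1_time_dual msol_C_time lam_primitive regular)
qed

end
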